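(* Let $\mathrm{H}:=\mathrm{E\text{-}HA}^{\omega*}_{\mathrm{st}}+\mathrm{I}+\mathrm{NCR}+\mathrm{HAC}+\mathrm{HIP}_{\forall^{\mathrm{st}}}+\mathrm{HGMP}$. (1) For every formula $\Phi$ of $\mathrm{E\text{-}HA}^{\omega*}_{\mathrm{st}}$, $\mathrm{H}\vdash\Phi\leftrightarrow\Phi^D$. (2) Let $\Psi$ be a formula of $\mathrm{E\text{-}HA}^{\omega*}_{\mathrm{st}}$ such that for every formula $\Phi$ (with $\Phi^D\equiv\exists^{\mathrm{st}}\underline x\forall^{\mathrm{st}}\underline y\,\varphi_D(\underline x,\underline y)$): if $\mathrm{H}+\Psi\vdash\Phi$ then there are closed terms $\underline t$ of $\mathcal T^*$ with $\mathrm{E\text{-}HA}^{\omega*}\vdash\forall\underline y\,\varphi_D(\underline t,\underline y)$. Then $\mathrm{H}\vdash\Psi$.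
   Context: Finite types: $0$; $\sigma\to\tau$; $\sigma^*$ (finite sequences). $\mathcal T^*$ is Gödel's T extended with $\varepsilon_\sigma$ (empty sequence), $c$ (prepending), list recursors. $\mathrm{E\text{-}HA}^{\omega*}$: intuitionistic extensional arithmetic in all finite types over $\mathcal T^*$ (primitive equality at all types, function extensionality, induction for all formulas, axiom $\forall y^{\sigma^*}(y=\varepsilon\lor\exists a,x\,y=c(a,x))$). Definable: $|x|$, $(x)_i$, $\langle\dots\rangle$, concatenation $*$; $s\in t:\equiv\exists i<|t|(s=(t)_i)$; for $s:(\sigma\to\tau^* )^*$, $s[t]:=(s)_0(t)*\dots*(s)_{|s|-1}(t)$ (iterated for several arguments, componentwise for tuples). $\mathrm{E\text{-}HA}^{\omega*}_{\mathrm{st}}$: add predicates $\mathrm{st}^\sigma$, quantifiers $\forall^{\mathrm{st}},\exists^{\mathrm{st}}$ (formulas without these are internal; lower-case Greek = internal) with axioms $\forall^{\mathrm{st}}x\Phi\leftrightarrow\forall x(\mathrm{st}(x)\to\Phi)$, $\exists^{\mathrm{st}}x\Phi\leftrightarrow\exists x(\mathrm{st}(x)\land\Phi)$, $\mathrm{st}(x)\land x=y\to\mathrm{st}(y)$, $\mathrm{st}(t)$ for closed $t\in\mathcal T^*$, $\mathrm{st}(f)\land\mathrm{st}(x)\to\mathrm{st}(fx)$, external induction for all formulas; internal induction only for internal formulas. $\mathrm{I}$: $\forall^{\mathrm{st}}x^{\sigma^*}\exists y\forall x'\in x\varphi(x',y)\to\exists y\forall^{\mathrm{st}}x\varphi(x,y)$.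 $\mathrm{NCR}$: $\forall y\exists^{\mathrm{st}}x\Phi(x,y)\to\exists^{\mathrm{st}}x^{\sigma^*}\forall y\exists x'\in x\Phi(x',y)$. $\mathrm{HAC}$: $\forall^{\mathrm{st}}x\exists^{\mathrm{st}}y\Phi(x,y)\to\exists^{\mathrm{st}}F\forall^{\mathrm{st}}x\exists y\in F(x)\Phi(x,y)$. $\mathrm{HIP}_{\forall^{\mathrm{st}}}$: $(\forall^{\mathrm{st}}x\varphi(x)\to\exists^{\mathrm{st}}y\Psi(y))\to\exists^{\mathrm{st}}y(\forall^{\mathrm{st}}x\varphi(x)\to\exists y'\in y\Psi(y'))$. $\mathrm{HGMP}$: $(\forall^{\mathrm{st}}x\varphi(x)\to\psi)\to\exists^{\mathrm{st}}x(\forall x'\in x\varphi(x')\to\psi)$. D-interpretation $\Phi^D\equiv\exists^{\mathrm{st}}\underline x\forall^{\mathrm{st}}\underline y\varphi_D$ ($\varphi_D$ internal): $\varphi^D:\equiv\varphi$ (internal atomic); $\mathrm{st}(u)^D:\equiv\exists^{\mathrm{st}}x(u\in x)$; with $\Phi^D\equiv\exists^{\mathrm{st}}\underline x\forall^{\mathrm{st}}\underline y\varphi_D$, $\Psi^D\equiv\exists^{\mathrm{st}}\underline u\forall^{\mathrm{st}}\underline v\psi_D$: $(\Phi\land\Psi)^D:\equiv\exists^{\mathrm{st}}\underline x,\underline u\forall^{\mathrm{st}}\underline y,\underline v(\varphi_D\land\psi_D)$; $\lor$ likewise; $(\Phi\to\Psi)^D:\equiv\exists^{\mathrm{st}}\underline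 U,\underline Y\forall^{\mathrm{st}}\underline x,\underline v(\forall\underline y\in\underline Y[\underline x,\underline v]\varphi_D(\underline x,\underline y)\to\psi_D(\underline U[\underline x],\underline v))$; $(\forall z\Phi)^D:\equiv\exists^{\mathrm{st}}\underline x\forall^{\mathrm{st}}\underline y\forall z\varphi_D$; $(\exists z\Phi)^D:\equiv\exists^{\mathrm{st}}\underline x\forall^{\mathrm{st}}\underline y\exists z\forall\underline y'\in\underline y\varphi_D(\underline x,\underline y',z)$; $(\forall^{\mathrm{st}}z\Phi)^D:\equiv\exists^{\mathrm{st}}\underline X\forall^{\mathrm{st}}z,\underline y\varphi_D(\underline X[z],\underline y,z)$; $(\exists^{\mathrm{st}}z\Phi)^D:\equiv\exists^{\mathrm{st}}\underline x,z\forall^{\mathrm{st}}\underline y\exists z'\in z\forall\underline y'\in\underline y\varphi_D(\underline x,\underline y',z')$ (new variables of appropriate sequence types). *)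

theory Defs
  imports Main
begin

section \<open>Types, terms and formulas\<close>

text \<open>
  Terms and formulas are represented with de Bruijn indices. A context is the list of the types
  of the free variables: variable \<open>i\<close> has type \<open>\<Gamma> ! i\<close>. All types are inhabited by closed terms, so
  working in a nonempty context rather than with universal closures makes no difference.
  Goedel's T is presented with primitive lambda-abstraction (instead of combinators).
\<close>

datatype ty = Base | Arr ty ty (infixr "\<rightarrow>" 65) | Seq ty

datatype tm =
    Var nat
  | Lam ty tm
  | App tm tm (infixl "\<cdot>" 75)
  | Zero
  | Succ
  | NRec ty
  | Emp ty
  | Prep ty
  | LRec ty ty

inductive wt :: "ty list \<Rightarrow> tm \<Rightarrow> ty \<Rightarrow> bool" where
  "i < length \<Gamma> \<Longrightarrow> wt \<Gamma> (Var i) (\<Gamma> ! i)"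
| "wt (\<sigma> # \<Gamma>) t \<tau> \<Longrightarrow> wt \<Gamma> (Lam \<sigma> t) (\<sigma> \<rightarrow> \<tau>)"
| "wt \<Gamma> t (\<sigma> \<rightarrow> \<tau>) \<Longrightarrow> wt \<Gamma> u \<sigma> \<Longrightarrow> wt \<Gamma> (t \<cdot> u) \<tau>"
| "wt \<Gamma> Zero Base"
| "wt \<Gamma> Succ (Base \<rightarrow> Base)"
| "wt \<Gamma> (NRec \<sigma>) (Base \<rightarrow> \<sigma> \<rightarrow> (\<sigma> \<rightarrow> Base \<rightarrow> \<sigma>) \<rightarrow> \<sigma>)"
| "wt \<Gamma> (Emp \<sigma>) (Seq \<sigma>)"
| "wt \<Gamma> (Prep \<sigma>) (\<sigma> \<rightarrow> Seq \<sigma> \<rightarrow> Seq \<sigma>)"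
| "wt \<Gamma> (LRec \<sigma> \<rho>) (Seq \<sigma> \<rightarrow> \<rho> \<rightarrow> (\<rho> \<rightarrow> \<sigma> \<rightarrow> \<rho>) \<rightarrow> \<rho>)"

primrec ren :: "(nat \<Rightarrow> nat) \<Rightarrow> tm \<Rightarrow> tm" where
  "ren r (Var i) = Var (r i)"
| "ren r (Lam \<sigma> t) = Lam \<sigma> (ren (case_nat 0 (\<lambda>i. Suc (r i))) t)"
| "ren r (t \<cdot> u) = ren r t \<cdot> ren r u"
| "ren r Zero = Zero"
| "ren r Succ = Succ"
| "ren r (NRec \<sigma>) = NRec \<sigma>"
| "ren r (Emp \<sigma>) = Emp \<sigma>"
| "ren r (Prep \<sigma>) = Prep \<sigma>"
| "ren r (LRec \<sigma> \<rho>) = LRec \<sigma> \<rho>"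

definition lift :: "nat \<Rightarrow> tm \<Rightarrow> tm" where
  "lift k = ren (\<lambda>i. i + k)"

definition up :: "(nat \<Rightarrow> tm) \<Rightarrow> nat \<Rightarrow> tm" where
  "up e = case_nat (Var 0) (\<lambda>i. lift 1 (e i))"

primrec sub :: "(nat \<Rightarrow> tm) \<Rightarrow> tm \<Rightarrow> tm" where
  "sub e (Var i) = e i"
| "sub e (Lam \<sigma> t) = Lam \<sigma> (sub (up e) t)"
| "sub e (t \<cdot> u) = sub e t \<cdot> sub e u"
| "sub e Zero = Zero"
| "sub e Succ = Succ"
| "sub e (NRec \<sigma>) = NRec \<sigma>"
| "sub e (Emp \<sigma>) = Emp \<sigma>"
| "sub e (Prep \<sigma>) = Prep \<sigma>"
| "sub e (LRec \<sigma> \<rho>) = LRec \<sigma> \<rho>"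

datatype fm =
    Eq ty tm tm
  | Bot
  | St ty tm
  | And fm fm
  | Or fm fm
  | Imp fm fm
  | All ty fm
  | Ex ty fm
  | AllSt ty fm
  | ExSt ty fm

abbreviation Iff :: "fm \<Rightarrow> fm \<Rightarrow> fm" where
  "Iff \<Phi> \<Psi> \<equiv> And (Imp \<Phi> \<Psi>) (Imp \<Psi> \<Phi>)"

primrec wff :: "ty list \<Rightarrow> fm \<Rightarrow> bool" where
  "wff \<Gamma> (Eq \<sigma> s t) \<longleftrightarrow> wt \<Gamma> s \<sigma> \<and> wt \<Gamma> t \<sigma>"
| "wff \<Gamma> Bot \<longleftrightarrow> True"
| "wff \<Gamma> (St \<sigma> t) \<longleftrightarrow> wt \<Gamma> t \<sigma>"
| "wff \<Gamma> (And \<Phi> \<Psi>) \<longleftrightarrow> wff \<Gamma> \<Phi> \<and> wff \<Gamma> \<Psi>"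
| "wff \<Gamma> (Or \<Phi> \<Psi>) \<longleftrightarrow> wff \<Gamma> \<Phi> \<and> wff \<Gamma> \<Psi>"
| "wff \<Gamma> (Imp \<Phi> \<Psi>) \<longleftrightarrow> wff \<Gamma> \<Phi> \<and> wff \<Gamma> \<Psi>"
| "wff \<Gamma> (All \<sigma> \<Phi>) \<longleftrightarrow> wff (\<sigma> # \<Gamma>) \<Phi>"
| "wff \<Gamma> (Ex \<sigma> \<Phi>) \<longleftrightarrow> wff (\<sigma> # \<Gamma>) \<Phi>"
| "wff \<Gamma> (AllSt \<sigma> \<Phi>) \<longleftrightarrow> wff (\<sigma> # \<Gamma>) \<Phi>"
| "wff \<Gamma> (ExSt \<sigma> \<Phi>) \<longleftrightarrow> wff (\<sigma> # \<Gamma>) \<Phi>"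

primrec internal :: "fm \<Rightarrow> bool" where
  "internal (Eq \<sigma> s t) \<longleftrightarrow> True"
| "internal Bot \<longleftrightarrow> True"
| "internal (St \<sigma> t) \<longleftrightarrow> False"
| "internal (And \<Phi> \<Psi>) \<longleftrightarrow> internal \<Phi> \<and> internal \<Psi>"
| "internal (Or \<Phi> \<Psi>) \<longleftrightarrow> internal \<Phi> \<and> internal \<Psi>"
| "internal (Imp \<Phi> \<Psi>) \<longleftrightarrow> internal \<Phi> \<and> internal \<Psi>"
| "internal (All \<sigma> \<Phi>) \<longleftrightarrow> internal \<Phi>"
| "internal (Ex \<sigma> \<Phi>) \<longleftrightarrow> internal \<Phi>"
| "internal (AllSt \<sigma> \<Phi>) \<longleftrightarrow> False"
| "internal (ExSt \<sigma> \<Phi>) \<longleftrightarrow> False"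

primrec fsub :: "(nat \<Rightarrow> tm) \<Rightarrow> fm \<Rightarrow> fm" where
  "fsub e (Eq \<sigma> s t) = Eq \<sigma> (sub e s) (sub e t)"
| "fsub e Bot = Bot"
| "fsub e (St \<sigma> t) = St \<sigma> (sub e t)"
| "fsub e (And \<Phi> \<Psi>) = And (fsub e \<Phi>) (fsub e \<Psi>)"
| "fsub e (Or \<Phi> \<Psi>) = Or (fsub e \<Phi>) (fsub e \<Psi>)"
| "fsub e (Imp \<Phi> \<Psi>) = Imp (fsub e \<Phi>) (fsub e \<Psi>)"
| "fsub e (All \<sigma> \<Phi>) = All \<sigma> (fsub (up e) \<Phi>)"
| "fsub e (Ex \<sigma> \<Phi>) = Ex \<sigma> (fsub (up e) \<Phi>)"
| "fsub e (AllSt \<sigma> \<Phi>) = AllSt \<sigma> (fsub (up e) \<Phi>)"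
| "fsub e (ExSt \<sigma> \<Phi>) = ExSt \<sigma> (fsub (up e) \<Phi>)"

text \<open>
  \<open>inst k ts \<Phi>\<close> replaces the variables \<open>0, \<dots>, length ts - 1\<close> of \<open>\<Phi>\<close> by \<open>ts\<close>; the result is placed
  under \<open>k\<close> additional binders, so the remaining variables \<open>length ts + j\<close> become \<open>j + k\<close>.
\<close>

definition inst :: "nat \<Rightarrow> tm list \<Rightarrow> fm \<Rightarrow> fm" where
  "inst k ts = fsub (\<lambda>i. if i < length ts then ts ! i else Var (i - length ts + k))"

text \<open>Quantifier blocks, outermost variable first. Inside a block of length \<open>k\<close> the bound variables
  are, in order, \<open>vars k\<close>.\<close>

abbreviation Alls :: "ty list \<Rightarrow> fm \<Rightarrow> fm" where "Alls \<equiv> foldr All"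
abbreviation AllSts :: "ty list \<Rightarrow> fm \<Rightarrow> fm" where "AllSts \<equiv> foldr AllSt"
abbreviation ExSts :: "ty list \<Rightarrow> fm \<Rightarrow> fm" where "ExSts \<equiv> foldr ExSt"

definition vars :: "nat \<Rightarrow> tm list" where
  "vars k = map Var (rev [0..<k])"

definition closure :: "ty list \<Rightarrow> fm \<Rightarrow> fm" where
  "closure \<Gamma> \<Phi> = Alls (rev \<Gamma>) \<Phi>"


section \<open>Finite sequences\<close>

primrec dflt :: "ty \<Rightarrow> tm" where
  "dflt Base = Zero"
| "dflt (\<sigma> \<rightarrow> \<tau>) = Lam \<sigma> (dflt \<tau>)"
| "dflt (Seq \<sigma>) = Emp \<sigma>"

definition plus :: "tm \<Rightarrow> tm \<Rightarrow> tm" where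
  "plus s t = NRec Base \<cdot> s \<cdot> t \<cdot> Lam Base (Lam Base (Succ \<cdot> Var 1))"

definition Lt :: "tm \<Rightarrow> tm \<Rightarrow> fm" where
  "Lt s t = Ex Base (Eq Base (plus (lift 1 s) (Succ \<cdot> Var 0)) (lift 1 t))"

definition len :: "ty \<Rightarrow> tm \<Rightarrow> tm" where
  "len \<sigma> s = LRec \<sigma> Base \<cdot> s \<cdot> Zero \<cdot> Lam Base (Lam \<sigma> (Succ \<cdot> Var 1))"

text \<open>\<open>(s)\<^sub>i\<close>, by recursion on \<open>s\<close>: the entries of \<open>c(a, s)\<close> are \<open>a\<close> at 0 and \<open>(s)\<^sub>n\<close> at \<open>n + 1\<close>.
  Out of range it is the arbitrary closed term \<open>dflt \<sigma>\<close>.\<close>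

definition nth_tm :: "ty \<Rightarrow> tm \<Rightarrow> tm \<Rightarrow> tm" where
  "nth_tm \<sigma> s i =
     LRec \<sigma> (Base \<rightarrow> \<sigma>) \<cdot> s \<cdot> Lam Base (dflt \<sigma>)
       \<cdot> Lam (Base \<rightarrow> \<sigma>) (Lam \<sigma> (Lam Base (NRec \<sigma> \<cdot> Var 0 \<cdot> Var 1 \<cdot> Lam \<sigma> (Lam Base (Var 4 \<cdot> Var 0)))))
       \<cdot> i"

definition conc :: "ty \<Rightarrow> tm \<Rightarrow> tm \<Rightarrow> tm" where
  "conc \<sigma> s t = LRec \<sigma> (Seq \<sigma>) \<cdot> s \<cdot> t \<cdot> Lam (Seq \<sigma>) (Lam \<sigma> (Prep \<sigma> \<cdot> Var 0 \<cdot> Var 1))"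

definition In :: "ty \<Rightarrow> tm \<Rightarrow> tm \<Rightarrow> fm" where
  "In \<sigma> s t = Ex Base (And (Lt (Var 0) (len \<sigma> (lift 1 t)))
                        (Eq \<sigma> (lift 1 s) (nth_tm \<sigma> (lift 1 t) (Var 0))))"

definition BAll :: "ty \<Rightarrow> tm \<Rightarrow> fm \<Rightarrow> fm" where
  "BAll \<sigma> s \<Phi> = All \<sigma> (Imp (In \<sigma> (Var 0) (lift 1 s)) \<Phi>)"

definition BEx :: "ty \<Rightarrow> tm \<Rightarrow> fm \<Rightarrow> fm" where
  "BEx \<sigma> s \<Phi> = Ex \<sigma> (And (In \<sigma> (Var 0) (lift 1 s)) \<Phi>)"

text \<open>\<open>BAlls \<tau>s ss \<Phi>\<close> is the bounded quantification over a tuple of sequences \<open>ss\<close>.\<close>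

fun BAlls :: "ty list \<Rightarrow> tm list \<Rightarrow> fm \<Rightarrow> fm" where
  "BAlls (\<tau> # \<tau>s) (s # ss) \<Phi> = BAll \<tau> s (BAlls \<tau>s (map (lift 1) ss) \<Phi>)"
| "BAlls _ _ \<Phi> = \<Phi>"

text \<open>\<open>sapp \<rho> \<tau> s t\<close> is \<open>s[t]\<close> for \<open>s : (\<rho> \<rightarrow> \<tau>\<^sup>*)\<^sup>*\<close> and \<open>t : \<rho>\<close>, of type \<open>\<tau>\<^sup>*\<close>.\<close>

definition sapp :: "ty \<Rightarrow> ty \<Rightarrow> tm \<Rightarrow> tm \<Rightarrow> tm" where
  "sapp \<rho> \<tau> s t =
     LRec (\<rho> \<rightarrow> Seq \<tau>) (Seq \<tau>) \<cdot> s \<cdot> Emp \<tau>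
       \<cdot> Lam (Seq \<tau>) (Lam (\<rho> \<rightarrow> Seq \<tau>) (conc \<tau> (Var 0 \<cdot> lift 2 t) (Var 1)))"

text \<open>Iterated application: \<open>s : (fty \<rho>s \<tau>)\<^sup>*\<close> and \<open>ts : \<rho>s\<close> give \<open>s[ts] : \<tau>\<^sup>*\<close>.\<close>

primrec fty :: "ty list \<Rightarrow> ty \<Rightarrow> ty" where
  "fty [] \<tau> = \<tau>"
| "fty (\<rho> # \<rho>s) \<tau> = \<rho> \<rightarrow> Seq (fty \<rho>s \<tau>)"

fun sapps :: "ty list \<Rightarrow> ty \<Rightarrow> tm \<Rightarrow> tm list \<Rightarrow> tm" where
  "sapps (\<rho> # \<rho>s) \<tau> s (t # ts) = sapps \<rho>s \<tau> (sapp \<rho> (fty \<rho>s \<tau>) s t) ts"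
| "sapps _ _ s _ = s"


section \<open>Deduction and theories\<close>

text \<open>
  Intuitionistic natural deduction for the language \<open>L\<close> and the axioms \<open>A\<close> (both depending on the
  context). \<open>L\<close> keeps derivations in the internal theory inside the internal language.
\<close>

inductive prv :: "(ty list \<Rightarrow> fm set) \<Rightarrow> (ty list \<Rightarrow> fm set) \<Rightarrow> ty list \<Rightarrow> fm list \<Rightarrow> fm \<Rightarrow> bool"
  for L A where
  Ax: "\<Phi> \<in> A \<Gamma> \<Longrightarrow> prv L A \<Gamma> \<Delta> \<Phi>"
| Hyp: "\<Phi> \<in> set \<Delta> \<Longrightarrow> prv L A \<Gamma> \<Delta> \<Phi>"
| BotE: "prv L A \<Gamma> \<Delta> Bot \<Longrightarrow> \<Phi> \<in> L \<Gamma> \<Longrightarrow> prv L A \<Gamma> \<Delta> \<Phi>"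
| AndI: "prv L A \<Gamma> \<Delta> \<Phi> \<Longrightarrow> prv L A \<Gamma> \<Delta> \<Psi> \<Longrightarrow> prv L A \<Gamma> \<Delta> (And \<Phi> \<Psi>)"
| AndE1: "prv L A \<Gamma> \<Delta> (And \<Phi> \<Psi>) \<Longrightarrow> prv L A \<Gamma> \<Delta> \<Phi>"
| AndE2: "prv L A \<Gamma> \<Delta> (And \<Phi> \<Psi>) \<Longrightarrow> prv L A \<Gamma> \<Delta> \<Psi>"
| OrI1: "prv L A \<Gamma> \<Delta> \<Phi> \<Longrightarrow> \<Psi> \<in> L \<Gamma> \<Longrightarrow> prv L A \<Gamma> \<Delta> (Or \<Phi> \<Psi>)"
| OrI2: "prv L A \<Gamma> \<Delta> \<Psi> \<Longrightarrow> \<Phi> \<in> L \<Gamma> \<Longrightarrow> prv L A \<Gamma> \<Delta> (Or \<Phi> \<Psi>)"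
| OrE: "prv L A \<Gamma> \<Delta> (Or \<Phi> \<Psi>) \<Longrightarrow> prv L A \<Gamma> (\<Phi> # \<Delta>) \<Theta> \<Longrightarrow> prv L A \<Gamma> (\<Psi> # \<Delta>) \<Theta> \<Longrightarrow>
    prv L A \<Gamma> \<Delta> \<Theta>"
| ImpI: "prv L A \<Gamma> (\<Phi> # \<Delta>) \<Psi> \<Longrightarrow> \<Phi> \<in> L \<Gamma> \<Longrightarrow> prv L A \<Gamma> \<Delta> (Imp \<Phi> \<Psi>)"
| ImpE: "prv L A \<Gamma> \<Delta> (Imp \<Phi> \<Psi>) \<Longrightarrow> prv L A \<Gamma> \<Delta> \<Phi> \<Longrightarrow> prv L A \<Gamma> \<Delta> \<Psi>"
| AllI: "prv L A (\<sigma> # \<Gamma>) (map (inst 1 []) \<Delta>) \<Phi> \<Longrightarrow> prv L A \<Gamma> \<Delta> (All \<sigma> \<Phi>)"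
| AllE: "prv L A \<Gamma> \<Delta> (All \<sigma> \<Phi>) \<Longrightarrow> wt \<Gamma> t \<sigma> \<Longrightarrow> prv L A \<Gamma> \<Delta> (inst 0 [t] \<Phi>)"
| ExI: "prv L A \<Gamma> \<Delta> (inst 0 [t] \<Phi>) \<Longrightarrow> wt \<Gamma> t \<sigma> \<Longrightarrow> Ex \<sigma> \<Phi> \<in> L \<Gamma> \<Longrightarrow> prv L A \<Gamma> \<Delta> (Ex \<sigma> \<Phi>)"
| ExE: "prv L A \<Gamma> \<Delta> (Ex \<sigma> \<Phi>) \<Longrightarrow> prv L A (\<sigma> # \<Gamma>) (\<Phi> # map (inst 1 []) \<Delta>) (inst 1 [] \<Psi>) \<Longrightarrow>
    \<Psi> \<in> L \<Gamma> \<Longrightarrow> prv L A \<Gamma> \<Delta> \<Psi>"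

definition lang_int :: "ty list \<Rightarrow> fm set" where
  "lang_int \<Gamma> = {\<phi>. wff \<Gamma> \<phi> \<and> internal \<phi>}"

definition lang_st :: "ty list \<Rightarrow> fm set" where
  "lang_st \<Gamma> = {\<Phi>. wff \<Gamma> \<Phi>}"

inductive_set EHA :: "ty list \<Rightarrow> fm set" for \<Gamma> where
  eq_refl: "wt \<Gamma> t \<sigma> \<Longrightarrow> Eq \<sigma> t t \<in> EHA \<Gamma>"
| eq_repl: "wt \<Gamma> s \<sigma> \<Longrightarrow> wt \<Gamma> t \<sigma> \<Longrightarrow> \<phi> \<in> lang_int (\<sigma> # \<Gamma>) \<Longrightarrow>
    Imp (Eq \<sigma> s t) (Imp (inst 0 [s] \<phi>) (inst 0 [t] \<phi>)) \<in> EHA \<Gamma>"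
| ext: "wt \<Gamma> f (\<sigma> \<rightarrow> \<tau>) \<Longrightarrow> wt \<Gamma> g (\<sigma> \<rightarrow> \<tau>) \<Longrightarrow>
    Imp (All \<sigma> (Eq \<tau> (lift 1 f \<cdot> Var 0) (lift 1 g \<cdot> Var 0))) (Eq (\<sigma> \<rightarrow> \<tau>) f g) \<in> EHA \<Gamma>"
| beta: "wt (\<sigma> # \<Gamma>) t \<tau> \<Longrightarrow> wt \<Gamma> u \<sigma> \<Longrightarrow>
    Eq \<tau> (Lam \<sigma> t \<cdot> u) (sub (case_nat u Var) t) \<in> EHA \<Gamma>"
| Succ_neq_Zero: "wt \<Gamma> t Base \<Longrightarrow> Imp (Eq Base (Succ \<cdot> t) Zero) Bot \<in> EHA \<Gamma>"
| Succ_inj: "wt \<Gamma> s Base \<Longrightarrow> wt \<Gamma> t Base \<Longrightarrow> Imp (Eq Base (Succ \<cdot> s) (Succ \<cdot> t)) (Eq Base s t) \<in> EHA \<Gamma>"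
| NRec_Zero: "wt \<Gamma> y \<sigma> \<Longrightarrow> wt \<Gamma> z (\<sigma> \<rightarrow> Base \<rightarrow> \<sigma>) \<Longrightarrow>
    Eq \<sigma> (NRec \<sigma> \<cdot> Zero \<cdot> y \<cdot> z) y \<in> EHA \<Gamma>"
| NRec_Succ: "wt \<Gamma> x Base \<Longrightarrow> wt \<Gamma> y \<sigma> \<Longrightarrow> wt \<Gamma> z (\<sigma> \<rightarrow> Base \<rightarrow> \<sigma>) \<Longrightarrow>
    Eq \<sigma> (NRec \<sigma> \<cdot> (Succ \<cdot> x) \<cdot> y \<cdot> z) (z \<cdot> (NRec \<sigma> \<cdot> x \<cdot> y \<cdot> z) \<cdot> x) \<in> EHA \<Gamma>"
| LRec_Emp: "wt \<Gamma> y \<rho> \<Longrightarrow> wt \<Gamma> z (\<rho> \<rightarrow> \<sigma> \<rightarrow> \<rho>) \<Longrightarrow>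
    Eq \<rho> (LRec \<sigma> \<rho> \<cdot> Emp \<sigma> \<cdot> y \<cdot> z) y \<in> EHA \<Gamma>"
| LRec_Prep: "wt \<Gamma> a \<sigma> \<Longrightarrow> wt \<Gamma> x (Seq \<sigma>) \<Longrightarrow> wt \<Gamma> y \<rho> \<Longrightarrow> wt \<Gamma> z (\<rho> \<rightarrow> \<sigma> \<rightarrow> \<rho>) \<Longrightarrow>
    Eq \<rho> (LRec \<sigma> \<rho> \<cdot> (Prep \<sigma> \<cdot> a \<cdot> x) \<cdot> y \<cdot> z) (z \<cdot> (LRec \<sigma> \<rho> \<cdot> x \<cdot> y \<cdot> z) \<cdot> a) \<in> EHA \<Gamma>"
| seq_cases: "All (Seq \<sigma>) (Or (Eq (Seq \<sigma>) (Var 0) (Emp \<sigma>))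
      (Ex \<sigma> (Ex (Seq \<sigma>) (Eq (Seq \<sigma>) (Var 2) (Prep \<sigma> \<cdot> Var 1 \<cdot> Var 0))))) \<in> EHA \<Gamma>"
| ind: "\<phi> \<in> lang_int (Base # \<Gamma>) \<Longrightarrow>
    Imp (And (inst 0 [Zero] \<phi>) (All Base (Imp \<phi> (inst 1 [Succ \<cdot> Var 0] \<phi>)))) (All Base \<phi>) \<in> EHA \<Gamma>"

inductive_set EHA_st :: "ty list \<Rightarrow> fm set" for \<Gamma> where
  base: "\<phi> \<in> EHA \<Gamma> \<Longrightarrow> \<phi> \<in> EHA_st \<Gamma>"
| AllSt_def: "\<Phi> \<in> lang_st (\<sigma> # \<Gamma>) \<Longrightarrow>
    Iff (AllSt \<sigma> \<Phi>) (All \<sigma> (Imp (St \<sigma> (Var 0)) \<Phi>)) \<in> EHA_st \<Gamma>"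
| ExSt_def: "\<Phi> \<in> lang_st (\<sigma> # \<Gamma>) \<Longrightarrow>
    Iff (ExSt \<sigma> \<Phi>) (Ex \<sigma> (And (St \<sigma> (Var 0)) \<Phi>)) \<in> EHA_st \<Gamma>"
| st_eq: "wt \<Gamma> s \<sigma> \<Longrightarrow> wt \<Gamma> t \<sigma> \<Longrightarrow> Imp (And (St \<sigma> s) (Eq \<sigma> s t)) (St \<sigma> t) \<in> EHA_st \<Gamma>"
| st_closed: "wt [] t \<sigma> \<Longrightarrow> St \<sigma> t \<in> EHA_st \<Gamma>"
| st_app: "wt \<Gamma> f (\<sigma> \<rightarrow> \<tau>) \<Longrightarrow> wt \<Gamma> t \<sigma> \<Longrightarrow>
    Imp (And (St (\<sigma> \<rightarrow> \<tau>) f) (St \<sigma> t)) (St \<tau> (f \<cdot> t)) \<in> EHA_st \<Gamma>"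
| st_ind: "\<Phi> \<in> lang_st (Base # \<Gamma>) \<Longrightarrow>
    Imp (And (inst 0 [Zero] \<Phi>) (AllSt Base (Imp \<Phi> (inst 1 [Succ \<cdot> Var 0] \<Phi>)))) (AllSt Base \<Phi>)
      \<in> EHA_st \<Gamma>"

text \<open>In \<open>I\<close> and \<open>NCR\<close> the schematic formula has \<open>x\<close> as variable 0 and \<open>y\<close> as variable 1, in
  \<open>HAC\<close> it is the other way round; the remaining variables are parameters.\<close>

inductive_set H :: "ty list \<Rightarrow> fm set" for \<Gamma> where
  EHA_st: "\<Phi> \<in> EHA_st \<Gamma> \<Longrightarrow> \<Phi> \<in> H \<Gamma>"
| I: "\<phi> \<in> lang_int (\<sigma> # \<tau> # \<Gamma>) \<Longrightarrow>
    Imp (AllSt (Seq \<sigma>) (Ex \<tau> (BAll \<sigma> (Var 1) (inst 3 [Var 0, Var 1] \<phi>))))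
        (Ex \<tau> (AllSt \<sigma> \<phi>)) \<in> H \<Gamma>"
| NCR: "\<Phi> \<in> lang_st (\<sigma> # \<tau> # \<Gamma>) \<Longrightarrow>
    Imp (All \<tau> (ExSt \<sigma> \<Phi>))
        (ExSt (Seq \<sigma>) (All \<tau> (BEx \<sigma> (Var 1) (inst 3 [Var 0, Var 1] \<Phi>)))) \<in> H \<Gamma>"
| HAC: "\<Phi> \<in> lang_st (\<tau> # \<sigma> # \<Gamma>) \<Longrightarrow>
    Imp (AllSt \<sigma> (ExSt \<tau> \<Phi>))
        (ExSt (\<sigma> \<rightarrow> Seq \<tau>) (AllSt \<sigma> (BEx \<tau> (Var 1 \<cdot> Var 0) (inst 3 [Var 0, Var 1] \<Phi>)))) \<in> H \<Gamma>"
| HIP: "\<phi> \<in> lang_int (\<sigma> # \<Gamma>) \<Longrightarrow> \<Psi> \<in> lang_st (\<tau> # \<Gamma>) \<Longrightarrow>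
    Imp (Imp (AllSt \<sigma> \<phi>) (ExSt \<tau> \<Psi>))
        (ExSt (Seq \<tau>) (Imp (AllSt \<sigma> (inst 2 [Var 0] \<phi>)) (BEx \<tau> (Var 0) (inst 2 [Var 0] \<Psi>)))) \<in> H \<Gamma>"
| HGMP: "\<phi> \<in> lang_int (\<sigma> # \<Gamma>) \<Longrightarrow> \<psi> \<in> lang_int \<Gamma> \<Longrightarrow>
    Imp (Imp (AllSt \<sigma> \<phi>) \<psi>)
        (ExSt (Seq \<sigma>) (Imp (BAll \<sigma> (Var 0) (inst 2 [Var 0] \<phi>)) (inst 1 [] \<psi>))) \<in> H \<Gamma>"

text \<open>Adding \<open>\<Psi>\<close>, with free variables \<open>\<Gamma>\<^sub>0\<close>, as an axiom means adding its universal closure.\<close>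

definition adjoin :: "(ty list \<Rightarrow> fm set) \<Rightarrow> ty list \<Rightarrow> fm \<Rightarrow> ty list \<Rightarrow> fm set" where
  "adjoin A \<Gamma>\<^sub>0 \<Psi> = (\<lambda>\<Gamma>. insert (closure \<Gamma>\<^sub>0 \<Psi>) (A \<Gamma>))"


section \<open>The interpretation\<close>

text \<open>
  For \<open>\<Phi>\<^sup>D = \<exists>\<^sup>s\<^sup>t x \<forall>\<^sup>s\<^sup>t y. \<phi>\<^sub>D(x, y)\<close>, the variables \<open>y\<close> have the types \<open>Dy \<Phi>\<close>. The variables \<open>x\<close>
  always have sequence types, and \<open>Dx \<Phi>\<close> lists the element types: \<open>x\<close> has the types
  \<open>map Seq (Dx \<Phi>)\<close>.
\<close>

fun Dx :: "fm \<Rightarrow> ty list" and Dy :: "fm \<Rightarrow> ty list" where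
  "Dx (Eq \<sigma> s t) = []"
| "Dx Bot = []"
| "Dx (St \<sigma> t) = [\<sigma>]"
| "Dx (And \<Phi> \<Psi>) = Dx \<Phi> @ Dx \<Psi>"
| "Dx (Or \<Phi> \<Psi>) = Dx \<Phi> @ Dx \<Psi>"
| "Dx (Imp \<Phi> \<Psi>) = map (fty (map Seq (Dx \<Phi>))) (Dx \<Psi>)
                  @ map (fty (map Seq (Dx \<Phi>) @ Dy \<Psi>)) (Dy \<Phi>)"
| "Dx (All \<sigma> \<Phi>) = Dx \<Phi>"
| "Dx (Ex \<sigma> \<Phi>) = Dx \<Phi>"
| "Dx (AllSt \<sigma> \<Phi>) = map (fty [\<sigma>]) (Dx \<Phi>)"
| "Dx (ExSt \<sigma> \<Phi>) = Dx \<Phi> @ [\<sigma>]"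
| "Dy (Eq \<sigma> s t) = []"
| "Dy Bot = []"
| "Dy (St \<sigma> t) = []"
| "Dy (And \<Phi> \<Psi>) = Dy \<Phi> @ Dy \<Psi>"
| "Dy (Or \<Phi> \<Psi>) = Dy \<Phi> @ Dy \<Psi>"
| "Dy (Imp \<Phi> \<Psi>) = map Seq (Dx \<Phi>) @ Dy \<Psi>"
| "Dy (All \<sigma> \<Phi>) = Dy \<Phi>"
| "Dy (Ex \<sigma> \<Phi>) = map Seq (Dy \<Phi>)"
| "Dy (AllSt \<sigma> \<Phi>) = \<sigma> # Dy \<Phi>"
| "Dy (ExSt \<sigma> \<Phi>) = map Seq (Dy \<Phi>)"

text \<open>
  \<open>Dm \<Phi> e xs ys\<close> is \<open>\<phi>\<^sub>D(xs, ys)\<close> for arbitrary tuples of terms \<open>xs\<close> and \<open>ys\<close>, where the free variables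
  of \<open>\<Phi>\<close> are replaced according to \<open>e\<close>. Passing the terms as arguments avoids a separate
  substitution; everything is lifted when a quantifier is crossed.
\<close>

primrec Dm :: "fm \<Rightarrow> (nat \<Rightarrow> tm) \<Rightarrow> tm list \<Rightarrow> tm list \<Rightarrow> fm" where
  "Dm (Eq \<sigma> s t) e xs ys = Eq \<sigma> (sub e s) (sub e t)"
| "Dm Bot e xs ys = Bot"
| "Dm (St \<sigma> t) e xs ys = In \<sigma> (sub e t) (hd xs)"
| "Dm (And \<Phi> \<Psi>) e xus yvs =
    (let m = length (Dx \<Phi>); n = length (Dy \<Phi>) in
     And (Dm \<Phi> e (take m xus) (take n yvs)) (Dm \<Psi> e (drop m xus) (drop n yvs)))"
| "Dm (Or \<Phi> \<Psi>) e xus yvs =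
    (let m = length (Dx \<Phi>); n = length (Dy \<Phi>) in
     Or (Dm \<Phi> e (take m xus) (take n yvs)) (Dm \<Psi> e (drop m xus) (drop n yvs)))"
| "Dm (Imp \<Phi> \<Psi>) e UYs xvs =
    (let Us = take (length (Dx \<Psi>)) UYs; Ys = drop (length (Dx \<Psi>)) UYs;
         xs = take (length (Dx \<Phi>)) xvs; vs = drop (length (Dx \<Phi>)) xvs;
         k = length (Dy \<Phi>);
         Yxvs = map2 (\<lambda>\<rho> Y. sapps (map Seq (Dx \<Phi>) @ Dy \<Psi>) \<rho> Y (xs @ vs)) (Dy \<Phi>) Ys;
         Uxs = map2 (\<lambda>\<tau> U. sapps (map Seq (Dx \<Phi>)) \<tau> U xs) (Dx \<Psi>) Us
     in Imp (BAlls (Dy \<Phi>) Yxvs (Dm \<Phi> (\<lambda>i. lift k (e i)) (map (lift k) xs) (vars k)))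
            (Dm \<Psi> e Uxs vs))"
| "Dm (All \<sigma> \<Phi>) e xs ys = All \<sigma> (Dm \<Phi> (up e) (map (lift 1) xs) (map (lift 1) ys))"
| "Dm (Ex \<sigma> \<Phi>) e xs ys =
    (let k = length (Dy \<Phi>) in
     Ex \<sigma> (BAlls (Dy \<Phi>) (map (lift 1) ys)
       (Dm \<Phi> (\<lambda>i. lift k (up e i)) (map (lift (k + 1)) xs) (vars k))))"
| "Dm (AllSt \<sigma> \<Phi>) e Xs zys =
    (let z = hd zys; ys = tl zys in
     Dm \<Phi> (case_nat z e) (map2 (\<lambda>\<tau> X. sapp \<sigma> \<tau> X z) (Dx \<Phi>) Xs) ys)"
| "Dm (ExSt \<sigma> \<Phi>) e xzs ys =
    (let k = length (Dy \<Phi>); xs = butlast xzs; z = last xzs in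
     BEx \<sigma> z (BAlls (Dy \<Phi>) (map (lift 1) ys)
       (Dm \<Phi> (\<lambda>i. lift k (up e i)) (map (lift (k + 1)) xs) (vars k))))"

definition D :: "fm \<Rightarrow> fm" where
  "D \<Phi> = (let m = length (Dx \<Phi>); n = length (Dy \<Phi>) in
     ExSts (map Seq (Dx \<Phi>)) (AllSts (Dy \<Phi>)
       (Dm \<Phi> (\<lambda>i. Var (i + (m + n))) (map (lift n) (vars m)) (vars n))))"

text \<open>\<open>\<forall>y. \<phi>\<^sub>D(ts, y)\<close> for closed terms \<open>ts\<close>, which need not be lifted.\<close>

definition D_witnessed :: "fm \<Rightarrow> tm list \<Rightarrow> fm" where
  "D_witnessed \<Phi> ts = (let n = length (Dy \<Phi>) in
     Alls (Dy \<Phi>) (Dm \<Phi> (\<lambda>i. Var (i + n)) ts (vars n)))"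

end

theory Submission
  imports Defs "HOL-Library.Countable" "HOL-Library.Infinite_Set"
begin

text \<open>
  Derivability in \<open>H\<close> is replaced by truth in a Kripke model: the worlds are the prime theories
  extending \<open>H\<close>, with the terms available at a world as its domain, and \<open>H\<close> is complete for them. At a
  world the principles I, NCR, HAC, HIP and HGMP assert the existence of certain terms. They extend
  from single variables to tuples: where formulas are internal a tuple is coded by a single object,
  and where the witnesses are finite sequences one can iterate, because the predicates in question
  are preserved when a sequence of candidates is enlarged. Induction on \<open>\<Phi>\<close> then shows that \<open>\<Phi>\<close> is true
  at a world iff standard terms \<open>x\<close> of that world satisfy \<open>\<phi>\<^sub>D(x, y)\<close> for all standard \<open>y\<close> of all
  later worlds; each connective consumes the principles suited to it. For a disjunction, I provides
  one number that selects the disjunct simultaneously for all standard challenges.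

  For the second part take \<open>\<Phi> = \<Psi>\<close>: closed terms are standard, so the derivation of
  \<open>\<forall>y. \<psi>\<^sub>D(t, y)\<close> makes \<open>\<Psi>\<close> true at every world.
\<close>

section \<open>Substitution\<close>

text \<open>Deriving the equivalences inside the calculus would mean manipulating tuples of de
  Bruijn terms of varying types. At a world the same steps are statements about elements, handled
  with Isabelle's own quantifiers, and completeness returns a derivation. The price is that the
  principles are schemes over formulas: every predicate on worlds and tuples to which they are
  applied must be shown to be defined by a formula with parameters, internal where the scheme
  demands it. Two obstacles remain for tuples. There are no product types, so a code needs a common
  type for its components: any two types are retracts of a third, and a tuple becomes a sequence
  over such a type. And NCR, HAC and HIP return not a witness but a finite sequence of candidates.
  As every witness of the interpretation is itself a finite sequence, the candidates are flattened
  into one; this is harmless because the matrix uses witnesses only through their members, and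
  positively.\<close>

abbreviation scons :: "tm \<Rightarrow> (nat \<Rightarrow> tm) \<Rightarrow> nat \<Rightarrow> tm" (infixr "##" 65) where
  "x ## e \<equiv> case_nat x e"

lemma up_0 [simp]: "up e 0 = Var 0"
  and up_Suc [simp]: "up e (Suc i) = lift 1 (e i)"
  by (simp_all add: up_def)

lemma ren_ren: "ren r (ren s t) = ren (\<lambda>i. r (s i)) t"
proof (induction t arbitrary: r s)
  case (Lam \<sigma> t)
  have "(\<lambda>i. case_nat 0 (\<lambda>i. Suc (r i)) (case_nat 0 (\<lambda>i. Suc (s i)) i)) = case_nat 0 (\<lambda>i. Suc (r (s i)))"
    by (auto split: nat.split)
  then show ?case by (simp add: Lam)
qed simp_all

lemma sub_ren: "sub e (ren r t) = sub (\<lambda>i. e (r i)) t"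
proof (induction t arbitrary: e r)
  case (Lam \<sigma> t)
  have "(\<lambda>i. up e (case_nat 0 (\<lambda>i. Suc (r i)) i)) = up (\<lambda>i. e (r i))"
    by (auto simp: up_def split: nat.split)
  then show ?case by (simp add: Lam)
qed simp_all

lemma ren_sub: "ren r (sub e t) = sub (\<lambda>i. ren r (e i)) t"
proof (induction t arbitrary: e r)
  case (Lam \<sigma> t)
  have "(\<lambda>i. ren (case_nat 0 (\<lambda>i. Suc (r i))) (up e i)) = up (\<lambda>i. ren r (e i))"
    by (auto simp: up_def lift_def ren_ren split: nat.split)
  then show ?case by (simp add: Lam)
qed simp_all

lemma sub_lift [simp]: "sub e (lift k t) = sub (\<lambda>i. e (i + k)) t"
  by (simp add: lift_def sub_ren)

lemma lift_sub: "lift k (sub e t) = sub (\<lambda>i. lift k (e i)) t"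
  by (simp add: lift_def ren_sub)

lemma lift_lift [simp]: "lift k (lift l t) = lift (l + k) t"
  by (simp add: lift_def ren_ren add.assoc)

lemma lift_Var [simp]: "lift k (Var i) = Var (i + k)"
  by (simp add: lift_def)

lemma lift_App [simp]: "lift k (s \<cdot> t) = lift k s \<cdot> lift k t"
  by (simp add: lift_def)

lemma sub_sub: "sub e (sub f t) = sub (\<lambda>i. sub e (f i)) t"
proof (induction t arbitrary: e f)
  case (Lam \<sigma> t)
  have "(\<lambda>i. sub (up e) (up f i)) = up (\<lambda>i. sub e (f i))"
    by (auto simp: up_def lift_sub split: nat.split)
  then show ?case by (simp add: Lam)
qed simp_all

lemma up_Var [simp]: "up Var = Var"
  by (auto simp: up_def split: nat.split)

lemma sub_Var [simp]: "sub Var t = t"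
  by (induction t) simp_all

lemma lift_0 [simp]: "lift 0 t = t"
proof -
  have "lift 0 (sub Var t) = sub (\<lambda>i. lift 0 (Var i)) t" by (rule lift_sub)
  then show ?thesis by simp
qed

lemma lift_conv_sub: "lift k t = sub (\<lambda>i. Var (i + k)) t"
proof -
  have "lift k (sub Var t) = sub (\<lambda>i. lift k (Var i)) t" by (rule lift_sub)
  then show ?thesis by simp
qed

lemma up_comp: "(\<lambda>i. sub (up e) (up f i)) = up (\<lambda>i. sub e (f i))"
  by (auto simp: up_def lift_sub split: nat.split)

lemma fsub_fsub: "fsub e (fsub f \<Phi>) = fsub (\<lambda>i. sub e (f i)) \<Phi>"
  by (induction \<Phi> arbitrary: e f) (simp_all add: sub_sub up_comp)

lemma fsub_Var [simp]: "fsub Var \<Phi> = \<Phi>"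
  by (induction \<Phi>) simp_all

lemma internal_fsub [simp]: "internal (fsub e \<Phi>) = internal \<Phi>"
  by (induction \<Phi> arbitrary: e) simp_all

lemma internal_inst [simp]: "internal (inst k ts \<Phi>) = internal \<Phi>"
  by (simp add: inst_def)

lemma scons_up: "(\<lambda>i. sub (t ## f) (up e i)) = t ## (\<lambda>i. sub f (e i))"
  by (auto simp: up_def split: nat.split)

lemma inst_0_single: "inst 0 [t] \<Phi> = fsub (t ## Var) \<Phi>"
  unfolding inst_def by (rule arg_cong[where f="\<lambda>e. fsub e \<Phi>"]) (auto split: nat.split)

lemma inst_0_fsub_up: "inst 0 [t] (fsub (up e) \<Phi>) = fsub (t ## e) \<Phi>"
  by (simp add: inst_0_single fsub_fsub scons_up)

text \<open>Pure weakening by \<open>k\<close>; for \<open>k = 1\<close> it is what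
  \<open>AllI\<close> and \<open>ExE\<close> apply to the assumptions.\<close>

lemma inst_Nil: "inst k [] \<Phi> = fsub (\<lambda>i. Var (i + k)) \<Phi>"
  by (simp add: inst_def)

subsection \<open>Typing\<close>

inductive_cases wt_VarE: "wt \<Gamma> (Var i) \<tau>"
inductive_cases wt_LamE: "wt \<Gamma> (Lam \<sigma> t) \<tau>"
inductive_cases wt_AppE: "wt \<Gamma> (t \<cdot> u) \<tau>"
inductive_cases wt_ZeroE: "wt \<Gamma> Zero \<tau>"
inductive_cases wt_SuccE: "wt \<Gamma> Succ \<tau>"
inductive_cases wt_NRecE: "wt \<Gamma> (NRec \<sigma>) \<tau>"
inductive_cases wt_EmpE: "wt \<Gamma> (Emp \<sigma>) \<tau>"
inductive_cases wt_PrepE: "wt \<Gamma> (Prep \<sigma>) \<tau>"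
inductive_cases wt_LRecE: "wt \<Gamma> (LRec \<sigma> \<rho>) \<tau>"

lemma wt_Var_iff [simp]: "wt \<Gamma> (Var i) \<tau> \<longleftrightarrow> i < length \<Gamma> \<and> \<Gamma> ! i = \<tau>"
  by (auto intro: wt.intros elim: wt_VarE)
lemma wt_Lam_iff [simp]: "wt \<Gamma> (Lam \<sigma> t) \<rho> \<longleftrightarrow> (\<exists>\<tau>. \<rho> = \<sigma> \<rightarrow> \<tau> \<and> wt (\<sigma> # \<Gamma>) t \<tau>)"
  by (auto intro: wt.intros elim: wt_LamE)
lemma wt_App_iff: "wt \<Gamma> (t \<cdot> u) \<tau> \<longleftrightarrow> (\<exists>\<sigma>. wt \<Gamma> t (\<sigma> \<rightarrow> \<tau>) \<and> wt \<Gamma> u \<sigma>)"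
  by (auto intro: wt.intros elim: wt_AppE)
lemma wt_const_iff [simp]:
  "wt \<Gamma> Zero \<tau> \<longleftrightarrow> \<tau> = Base"
  "wt \<Gamma> Succ \<tau> \<longleftrightarrow> \<tau> = Base \<rightarrow> Base"
  "wt \<Gamma> (NRec \<sigma>) \<tau> \<longleftrightarrow> \<tau> = Base \<rightarrow> \<sigma> \<rightarrow> (\<sigma> \<rightarrow> Base \<rightarrow> \<sigma>) \<rightarrow> \<sigma>"
  "wt \<Gamma> (Emp \<sigma>) \<tau> \<longleftrightarrow> \<tau> = Seq \<sigma>"
  "wt \<Gamma> (Prep \<sigma>) \<tau> \<longleftrightarrow> \<tau> = \<sigma> \<rightarrow> Seq \<sigma> \<rightarrow> Seq \<sigma>"
  "wt \<Gamma> (LRec \<sigma> \<rho>) \<tau> \<longleftrightarrow> \<tau> = Seq \<sigma> \<rightarrow> \<rho> \<rightarrow> (\<rho> \<rightarrow> \<sigma> \<rightarrow> \<rho>) \<rightarrow> \<rho>"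
  by (auto intro: wt.intros elim: wt_ZeroE wt_SuccE wt_NRecE wt_EmpE wt_PrepE wt_LRecE)

text \<open>Only the indices below \<open>length \<Gamma>\<close> are constrained. An environment is
  a total function, and by \<open>fsub_cong\<close> its other values do not affect a formula typed
  in \<open>\<Gamma>\<close>.\<close>

definition wtenv :: "ty list \<Rightarrow> (nat \<Rightarrow> tm) \<Rightarrow> ty list \<Rightarrow> bool" where
  "wtenv \<Gamma>' e \<Gamma> \<longleftrightarrow> (\<forall>i < length \<Gamma>. wt \<Gamma>' (e i) (\<Gamma> ! i))"

lemma wt_ren: "wt \<Gamma> t \<tau> \<Longrightarrow> (\<And>i. i < length \<Gamma> \<Longrightarrow> r i < length \<Gamma>' \<and> \<Gamma>' ! r i = \<Gamma> ! i) \<Longrightarrow> wt \<Gamma>' (ren r t) \<tau>"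
proof (induction arbitrary: \<Gamma>' r rule: wt.induct)
  case (2 \<sigma> \<Gamma> t \<tau>)
  have "wt (\<sigma> # \<Gamma>') (ren (case_nat 0 (\<lambda>i. Suc (r i))) t) \<tau>"
    by (rule "2.IH") (auto simp: "2.prems" split: nat.split)
  then show ?case by simp
next
  case (3 \<Gamma> t \<sigma> \<tau> u)
  show ?case using wt.intros(3)[OF 3(3)[OF 3(5)] 3(4)[OF 3(5)]] by simp
qed auto

lemma wt_lift: "wt \<Gamma> t \<tau> \<Longrightarrow> length \<Delta> = k \<Longrightarrow> wt (\<Delta> @ \<Gamma>) (lift k t) \<tau>"
  unfolding lift_def by (erule wt_ren) (auto simp: nth_append)

lemma wtenv_up: "wtenv \<Gamma>' e \<Gamma> \<Longrightarrow> wtenv (\<sigma> # \<Gamma>') (up e) (\<sigma> # \<Gamma>)"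
  unfolding wtenv_def
proof (intro allI impI)
  fix i assume *: "\<forall>i<length \<Gamma>. wt \<Gamma>' (e i) (\<Gamma> ! i)" "i < length (\<sigma> # \<Gamma>)"
  show "wt (\<sigma> # \<Gamma>') (up e i) ((\<sigma> # \<Gamma>) ! i)"
    using * wt_lift[of \<Gamma>' _ _ "[\<sigma>]" "Suc 0"] by (cases i) auto
qed

lemma wt_sub: "wt \<Gamma> t \<tau> \<Longrightarrow> wtenv \<Gamma>' e \<Gamma> \<Longrightarrow> wt \<Gamma>' (sub e t) \<tau>"
proof (induction arbitrary: \<Gamma>' e rule: wt.induct)
  case (2 \<sigma> \<Gamma> t \<tau>)
  then show ?case using wtenv_up by simp
next
  case (3 \<Gamma> t \<sigma> \<tau> u)
  show ?case using wt.intros(3)[OF 3(3)[OF 3(5)] 3(4)[OF 3(5)]] by simp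
qed (auto simp: wtenv_def)

lemma wff_fsub: "wff \<Gamma> \<Phi> \<Longrightarrow> wtenv \<Gamma>' e \<Gamma> \<Longrightarrow> wff \<Gamma>' (fsub e \<Phi>)"
  by (induction \<Phi> arbitrary: \<Gamma> \<Gamma>' e) (auto intro: wt_sub wtenv_up)

lemma wtenv_scons: "wt \<Gamma>' t \<sigma> \<Longrightarrow> wtenv \<Gamma>' e \<Gamma> \<Longrightarrow> wtenv \<Gamma>' (t ## e) (\<sigma> # \<Gamma>)"
  by (auto simp: wtenv_def nth_Cons split: nat.split)

lemma wtenv_Var: "wtenv \<Gamma> Var \<Gamma>"
  by (simp add: wtenv_def)

lemma up_cong: "\<forall>i < length \<Gamma>. e i = f i \<Longrightarrow> \<forall>i < length (\<sigma> # \<Gamma>). up e i = up f i"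
  by (auto simp: up_def split: nat.split)

lemma sub_cong: "wt \<Gamma> t \<tau> \<Longrightarrow> \<forall>i < length \<Gamma>. e i = f i \<Longrightarrow> sub e t = sub f t"
proof (induction arbitrary: e f rule: wt.induct)
  case (2 \<sigma> \<Gamma> t \<tau>)
  show ?case using "2.IH"[OF up_cong[OF "2.prems"]] by simp
qed auto

lemma fsub_cong: "wff \<Gamma> \<Phi> \<Longrightarrow> \<forall>i < length \<Gamma>. e i = f i \<Longrightarrow> fsub e \<Phi> = fsub f \<Phi>"
proof (induction \<Phi> arbitrary: \<Gamma> e f)
  case (Eq \<sigma> s t)
  then show ?case using sub_cong[of \<Gamma> s \<sigma> e f] sub_cong[of \<Gamma> t \<sigma> e f] by simp
next
  case (St \<sigma> t)
  then show ?case using sub_cong[of \<Gamma> t \<sigma> e f] by simp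
next
  case (And a b)
  then show ?case using And.IH(1)[of \<Gamma> e f] And.IH(2)[of \<Gamma> e f] by simp
next
  case (Or a b)
  then show ?case using Or.IH(1)[of \<Gamma> e f] Or.IH(2)[of \<Gamma> e f] by simp
next
  case (Imp a b)
  then show ?case using Imp.IH(1)[of \<Gamma> e f] Imp.IH(2)[of \<Gamma> e f] by simp
next
  case (All \<sigma> a)
  show ?case using All.IH[OF _ up_cong[OF All.prems(2)]] All.prems(1) by simp
next
  case (Ex \<sigma> a)
  show ?case using Ex.IH[OF _ up_cong[OF Ex.prems(2)]] Ex.prems(1) by simp
next
  case (AllSt \<sigma> a)
  show ?case using AllSt.IH[OF _ up_cong[OF AllSt.prems(2)]] AllSt.prems(1) by simp
next
  case (ExSt \<sigma> a)
  show ?case using ExSt.IH[OF _ up_cong[OF ExSt.prems(2)]] ExSt.prems(1) by simp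
qed simp

lemma sub_closed: "wt [] t \<tau> \<Longrightarrow> sub e t = t"
  using sub_cong[of "[]" t \<tau> e Var] by simp

lemma wt_closed: "wt [] t \<tau> \<Longrightarrow> wt \<Gamma> t \<tau>"
  using wt_sub[of "[]" t \<tau> \<Gamma> Var] by (simp add: wtenv_def)

lemma wt_dflt: "wt \<Gamma> (dflt \<tau>) \<tau>"
  by (induction \<tau> arbitrary: \<Gamma>) auto

lemma sub_dflt [simp]: "sub e (dflt \<tau>) = dflt \<tau>"
  using sub_closed[OF wt_dflt] .

section \<open>Substitution in derivations\<close>

lemma prv_weaken: "prv L A \<Gamma> \<Delta> \<Phi> \<Longrightarrow> set \<Delta> \<subseteq> set \<Delta>' \<Longrightarrow> prv L A \<Gamma> \<Delta>' \<Phi>"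
proof (induction arbitrary: \<Delta>' rule: prv.induct)
  case (OrE \<Gamma> \<Delta> \<Phi> \<Psi> \<Theta>)
  show ?case by (rule prv.OrE[OF OrE.IH(1) OrE.IH(2) OrE.IH(3)]) (use OrE.prems in auto)
next
  case (ImpI \<Gamma> \<Phi> \<Delta> \<Psi>)
  show ?case by (rule prv.ImpI[OF ImpI.IH]) (use ImpI in auto)
next
  case (AllI \<sigma> \<Gamma> \<Delta> \<Phi>)
  show ?case by (rule prv.AllI[OF AllI.IH]) (use AllI.prems in auto)
next
  case (ExE \<Gamma> \<Delta> \<sigma> \<Phi> \<Psi>)
  show ?case by (rule prv.ExE[OF ExE.IH(1) ExE.IH(2)]) (use ExE in auto)
next
  case (AndE1 \<Gamma> \<Delta> \<Phi> \<Psi>)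
  show ?case using prv.AndE1[OF AndE1.IH[OF AndE1.prems]] .
next
  case (AndE2 \<Gamma> \<Delta> \<Phi> \<Psi>)
  show ?case using prv.AndE2[OF AndE2.IH[OF AndE2.prems]] .
next
  case (ImpE \<Gamma> \<Delta> \<Phi> \<Psi>)
  show ?case using prv.ImpE[OF ImpE.IH(1)[OF ImpE.prems] ImpE.IH(2)[OF ImpE.prems]] .
next
  case (AllE \<Gamma> \<Delta> \<sigma> \<Phi> t)
  show ?case using prv.AllE[OF AllE.IH[OF AllE.prems] AllE.hyps(2)] .
next
  case (ExI \<Gamma> \<Delta> t \<Phi> \<sigma>)
  show ?case using prv.ExI[OF ExI.IH[OF ExI.prems] ExI.hyps(2,3)] .
next
  case (AndI \<Gamma> \<Delta> \<Phi> \<Psi>)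
  show ?case by (rule prv.AndI[OF AndI.IH(1)[OF AndI.prems] AndI.IH(2)[OF AndI.prems]])
next
  case (BotE \<Gamma> \<Delta> \<Phi>)
  show ?case by (rule prv.BotE[OF BotE.IH[OF BotE.prems] BotE.hyps(2)])
next
  case (OrI1 \<Gamma> \<Delta> \<Phi> \<Psi>)
  show ?case by (rule prv.OrI1[OF OrI1.IH[OF OrI1.prems] OrI1.hyps(2)])
next
  case (OrI2 \<Gamma> \<Delta> \<Psi> \<Phi>)
  show ?case by (rule prv.OrI2[OF OrI2.IH[OF OrI2.prems] OrI2.hyps(2)])
qed (auto intro: prv.Ax prv.Hyp)

lemma fsub_inst_0: "fsub e (inst 0 [t] \<Phi>) = inst 0 [sub e t] (fsub (up e) \<Phi>)"
  by (simp add: inst_0_fsub_up) (auto simp: inst_0_single fsub_fsub intro!: arg_cong[where f="\<lambda>e. fsub e \<Phi>"] split: nat.split)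

lemma fsub_inst_1_Nil: "fsub (up e) (inst (Suc 0) [] \<Phi>) = inst (Suc 0) [] (fsub e \<Phi>)"
  by (simp add: inst_Nil fsub_fsub lift_conv_sub)

lemma fsub_inst_1: "fsub (up e) (inst (Suc 0) [t] \<Phi>) = inst (Suc 0) [sub (up e) t] (fsub (up e) \<Phi>)"
  unfolding inst_def fsub_fsub
  by (rule arg_cong[where f="\<lambda>e. fsub e \<Phi>"]) (auto simp: up_def lift_conv_sub fun_eq_iff sub_sub split: nat.split)

lemma fsub_inst_2: "fsub (up (up e)) (inst 2 [Var 0] \<Phi>) = inst 2 [Var 0] (fsub (up e) \<Phi>)"
  unfolding inst_def fsub_fsub
  by (rule arg_cong[where f="\<lambda>e. fsub e \<Phi>"]) (auto simp: up_def lift_conv_sub fun_eq_iff sub_sub numeral_2_eq_2 split: nat.split)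

lemma fsub_inst_3: "fsub (up (up (up e))) (inst 3 [Var 0, Var (Suc 0)] \<Phi>) = inst 3 [Var 0, Var (Suc 0)] (fsub (up (up e)) \<Phi>)"
  unfolding inst_def fsub_fsub
  by (rule arg_cong[where f="\<lambda>e. fsub e \<Phi>"])
    (auto simp: up_def lift_conv_sub fun_eq_iff sub_sub numeral_3_eq_3 less_Suc_eq split: nat.split)

text \<open>Each rule is stable under substitution; at a binder the environment is replaced by
  \<open>up e\<close>, which commutes with the weakening of the assumptions. The result serves to
  enlarge the context, to turn a variable into a bound one and to pass to the instance given by an
  environment.\<close>

lemma prv_fsub:
  assumes L: "\<And>\<Gamma> \<Gamma>' e \<Phi>. \<Phi> \<in> L \<Gamma> \<Longrightarrow> wtenv \<Gamma>' e \<Gamma> \<Longrightarrow> fsub e \<Phi> \<in> L \<Gamma>'"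
    and A: "\<And>\<Gamma> \<Gamma>' e \<Phi>. \<Phi> \<in> A \<Gamma> \<Longrightarrow> wtenv \<Gamma>' e \<Gamma> \<Longrightarrow> fsub e \<Phi> \<in> A \<Gamma>'"
  shows "prv L A \<Gamma> \<Delta> \<Phi> \<Longrightarrow> wtenv \<Gamma>' e \<Gamma> \<Longrightarrow> prv L A \<Gamma>' (map (fsub e) \<Delta>) (fsub e \<Phi>)"
proof (induction arbitrary: \<Gamma>' e rule: prv.induct)
  case (AllI \<sigma> \<Gamma> \<Delta> \<Phi>)
  have "prv L A (\<sigma> # \<Gamma>') (map (fsub (up e)) (map (inst 1 []) \<Delta>)) (fsub (up e) \<Phi>)"
    by (rule AllI.IH[OF wtenv_up[OF AllI.prems]])
  then show ?case by (simp add: comp_def fsub_inst_1_Nil prv.AllI)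
next
  case (AllE \<Gamma> \<Delta> \<sigma> \<Phi> t)
  show ?case using prv.AllE[OF AllE.IH[OF AllE.prems, simplified] wt_sub[OF AllE.hyps(2) AllE.prems]]
    by (simp add: fsub_inst_0)
next
  case (ExI \<Gamma> \<Delta> t \<Phi> \<sigma>)
  show ?case using prv.ExI[OF ExI.IH[OF ExI.prems, unfolded fsub_inst_0] wt_sub[OF ExI.hyps(2) ExI.prems]]
     L[OF ExI.hyps(3) ExI.prems] by simp
next
  case (ExE \<Gamma> \<Delta> \<sigma> \<Phi> \<Psi>)
  have "prv L A (\<sigma> # \<Gamma>') (map (fsub (up e)) (\<Phi> # map (inst 1 []) \<Delta>)) (fsub (up e) (inst 1 [] \<Psi>))"
    by (rule ExE.IH(2)[OF wtenv_up[OF ExE.prems]])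
  then show ?case using prv.ExE[OF ExE.IH(1)[OF ExE.prems, simplified]] L[OF ExE.hyps(3) ExE.prems]
    by (simp add: comp_def fsub_inst_1_Nil)
next
  case (ImpI \<Gamma> \<Phi> \<Delta> \<Psi>)
  show ?case using prv.ImpI[OF ImpI.IH[OF ImpI.prems, unfolded list.map] L[OF ImpI.hyps(2) ImpI.prems]] by simp
next
  case (OrE \<Gamma> \<Delta> \<Phi> \<Psi> \<Theta>)
  show ?case using prv.OrE[OF OrE.IH(1)[OF OrE.prems, simplified]] OrE.IH(2,3)[OF OrE.prems] by simp
next
  case (ImpE \<Gamma> \<Delta> \<Phi> \<Psi>)
  show ?case using prv.ImpE[OF ImpE.IH(1)[OF ImpE.prems, simplified] ImpE.IH(2)[OF ImpE.prems]] .
next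
  case (AndE1 \<Gamma> \<Delta> \<Phi> \<Psi>)
  show ?case using prv.AndE1[OF AndE1.IH[OF AndE1.prems, simplified]] .
next
  case (AndE2 \<Gamma> \<Delta> \<Phi> \<Psi>)
  show ?case using prv.AndE2[OF AndE2.IH[OF AndE2.prems, simplified]] .
next
  case (AndI \<Gamma> \<Delta> \<Phi> \<Psi>)
  show ?case using prv.AndI[OF AndI.IH(1)[OF AndI.prems] AndI.IH(2)[OF AndI.prems]] by simp
next
  case (BotE \<Gamma> \<Delta> \<Phi>)
  show ?case by (rule prv.BotE[OF BotE.IH[OF BotE.prems, simplified] L[OF BotE.hyps(2) BotE.prems]])
next
  case (OrI1 \<Gamma> \<Delta> \<Phi> \<Psi>)
  show ?case using prv.OrI1[OF OrI1.IH[OF OrI1.prems] L[OF OrI1.hyps(2) OrI1.prems]] by simp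
next
  case (OrI2 \<Gamma> \<Delta> \<Psi> \<Phi>)
  show ?case using prv.OrI2[OF OrI2.IH[OF OrI2.prems] L[OF OrI2.hyps(2) OrI2.prems]] by simp
next
  case (Ax \<Phi> \<Gamma> \<Delta>)
  show ?case using A[OF Ax.hyps Ax.prems] by (rule prv.Ax)
next
  case (Hyp \<Phi> \<Delta> \<Gamma>)
  then show ?case by (auto intro: prv.Hyp)
qed

lemma lang_int_fsub: "\<Phi> \<in> lang_int \<Gamma> \<Longrightarrow> wtenv \<Gamma>' e \<Gamma> \<Longrightarrow> fsub e \<Phi> \<in> lang_int \<Gamma>'"
  by (auto simp: lang_int_def intro: wff_fsub)

lemma lang_st_fsub: "\<Phi> \<in> lang_st \<Gamma> \<Longrightarrow> wtenv \<Gamma>' e \<Gamma> \<Longrightarrow> fsub e \<Phi> \<in> lang_st \<Gamma>'"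
  by (auto simp: lang_st_def intro: wff_fsub)

subsection \<open>Sequence terms\<close>

lemma sub_up_lift: "sub (up e) (lift 1 t) = lift 1 (sub e t)"
  by (simp add: lift_sub)

lemma up_numeral [simp]: "up e (numeral k) = lift 1 (e (pred_numeral k))"
  by (simp add: numeral_eq_Suc)

lemma sub_plus [simp]: "sub e (plus s t) = plus (sub e s) (sub e t)"
  by (simp add: plus_def)
lemma sub_len [simp]: "sub e (len \<sigma> s) = len \<sigma> (sub e s)"
  by (simp add: len_def)
lemma sub_nth_tm [simp]: "sub e (nth_tm \<sigma> s i) = nth_tm \<sigma> (sub e s) (sub e i)"
  by (simp add: nth_tm_def)
lemma sub_conc [simp]: "sub e (conc \<sigma> s t) = conc \<sigma> (sub e s) (sub e t)"
  by (simp add: conc_def)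
lemma sub_sapp [simp]: "sub e (sapp \<rho> \<tau> s t) = sapp \<rho> \<tau> (sub e s) (sub e t)"
  by (simp add: sapp_def lift_sub numeral_2_eq_2)

lemma lift_plus [simp]: "lift k (plus s t) = plus (lift k s) (lift k t)"
  and lift_len [simp]: "lift k (len \<sigma> s) = len \<sigma> (lift k s)"
  and lift_nth_tm [simp]: "lift k (nth_tm \<sigma> s i) = nth_tm \<sigma> (lift k s) (lift k i)"
  and lift_conc [simp]: "lift k (conc \<sigma> s t) = conc \<sigma> (lift k s) (lift k t)"
  and lift_sapp [simp]: "lift k (sapp \<rho> \<tau> s t) = sapp \<rho> \<tau> (lift k s) (lift k t)"
  by (simp_all add: lift_conv_sub)

lemma fsub_Lt [simp]: "fsub e (Lt s t) = Lt (sub e s) (sub e t)"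
  by (simp add: Lt_def lift_sub)
lemma fsub_In [simp]: "fsub e (In \<sigma> s t) = In \<sigma> (sub e s) (sub e t)"
  by (simp add: In_def lift_sub)
lemma fsub_BAll [simp]: "fsub e (BAll \<sigma> s \<Phi>) = BAll \<sigma> (sub e s) (fsub (up e) \<Phi>)"
  by (simp add: BAll_def lift_sub)
lemma fsub_BEx [simp]: "fsub e (BEx \<sigma> s \<Phi>) = BEx \<sigma> (sub e s) (fsub (up e) \<Phi>)"
  by (simp add: BEx_def lift_sub)

lemma internal_Lt [simp]: "internal (Lt s t)" by (simp add: Lt_def)
lemma internal_In [simp]: "internal (In \<sigma> s t)" by (simp add: In_def)
lemma internal_BAll [simp]: "internal (BAll \<sigma> s \<Phi>) = internal \<Phi>" by (simp add: BAll_def)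
lemma internal_BEx [simp]: "internal (BEx \<sigma> s \<Phi>) = internal \<Phi>" by (simp add: BEx_def)

lemma wt_App: "wt \<Gamma> t (\<sigma> \<rightarrow> \<tau>) \<Longrightarrow> wt \<Gamma> u \<sigma> \<Longrightarrow> wt \<Gamma> (t \<cdot> u) \<tau>"
  by (rule wt.intros(3))

lemma wt_lift_Cons: "wt \<Gamma> t \<tau> \<Longrightarrow> wt (\<sigma> # \<Gamma>) (lift (Suc 0) t) \<tau>"
  using wt_lift[of \<Gamma> t \<tau> "[\<sigma>]" "Suc 0"] by simp

lemma wt_plus: "wt \<Gamma> s Base \<Longrightarrow> wt \<Gamma> t Base \<Longrightarrow> wt \<Gamma> (plus s t) Base"
  by (simp add: plus_def wt_App_iff)
lemma wt_len: "wt \<Gamma> s (Seq \<sigma>) \<Longrightarrow> wt \<Gamma> (len \<sigma> s) Base"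
  by (simp add: len_def wt_App_iff)
lemma wt_nth_tm: "wt \<Gamma> s (Seq \<sigma>) \<Longrightarrow> wt \<Gamma> i Base \<Longrightarrow> wt \<Gamma> (nth_tm \<sigma> s i) \<sigma>"
  by (simp add: nth_tm_def wt_App_iff wt_dflt)
lemma wt_conc: "wt \<Gamma> s (Seq \<sigma>) \<Longrightarrow> wt \<Gamma> t (Seq \<sigma>) \<Longrightarrow> wt \<Gamma> (conc \<sigma> s t) (Seq \<sigma>)"
  by (simp add: conc_def wt_App_iff)
lemma wt_sapp: "wt \<Gamma> s (Seq (\<rho> \<rightarrow> Seq \<tau>)) \<Longrightarrow> wt \<Gamma> t \<rho> \<Longrightarrow> wt \<Gamma> (sapp \<rho> \<tau> s t) (Seq \<tau>)"
  unfolding sapp_def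
  by (auto simp: wt_App_iff intro!: wt_conc wt_App wt_lift[of \<Gamma> t \<rho> "[\<rho> \<rightarrow> Seq \<tau>, Seq \<tau>]" 2, simplified])

lemmas wt_intros = wt_App wt_plus wt_len wt_nth_tm wt_conc wt_sapp wt_dflt wt_lift_Cons

lemma wff_Lt: "wt \<Gamma> s Base \<Longrightarrow> wt \<Gamma> t Base \<Longrightarrow> wff \<Gamma> (Lt s t)"
  by (auto simp: Lt_def intro!: wt_intros)
lemma wff_In: "wt \<Gamma> s \<sigma> \<Longrightarrow> wt \<Gamma> t (Seq \<sigma>) \<Longrightarrow> wff \<Gamma> (In \<sigma> s t)"
  by (auto simp: In_def intro!: wt_intros wff_Lt)
lemma wff_BAll: "wt \<Gamma> s (Seq \<sigma>) \<Longrightarrow> wff (\<sigma> # \<Gamma>) \<Phi> \<Longrightarrow> wff \<Gamma> (BAll \<sigma> s \<Phi>)"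
  by (auto simp: BAll_def intro!: wt_intros wff_In)
lemma wff_BEx: "wt \<Gamma> s (Seq \<sigma>) \<Longrightarrow> wff (\<sigma> # \<Gamma>) \<Phi> \<Longrightarrow> wff \<Gamma> (BEx \<sigma> s \<Phi>)"
  by (auto simp: BEx_def intro!: wt_intros wff_In)

subsection \<open>The axioms are closed under substitution\<close>

lemma sub_beta: "sub e (sub (u ## Var) t) = sub (sub e u ## Var) (sub (up e) t)"
  unfolding sub_sub scons_up
  by (rule arg_cong[where f="\<lambda>e. sub e t"]) (auto split: nat.split)

lemma EHA_fsub: "\<Phi> \<in> EHA \<Gamma> \<Longrightarrow> wtenv \<Gamma>' e \<Gamma> \<Longrightarrow> fsub e \<Phi> \<in> EHA \<Gamma>'"
proof (induction rule: EHA.induct)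
  case (eq_repl s \<sigma> t \<phi>)
  then show ?case using EHA.eq_repl[of \<Gamma>' "sub e s" \<sigma> "sub e t" "fsub (up e) \<phi>"]
    by (simp add: fsub_inst_0 wt_sub lang_int_fsub[OF _ wtenv_up])
next
  case (ext f \<sigma> \<tau> g)
  then show ?case using EHA.ext[of \<Gamma>' "sub e f" \<sigma> \<tau> "sub e g"] by (simp add: lift_sub wt_sub)
next
  case (beta \<sigma> t \<tau> u)
  then show ?case using EHA.beta[of \<sigma> \<Gamma>' "sub (up e) t" \<tau> "sub e u"]
    by (simp add: sub_beta wt_sub[OF _ wtenv_up] wt_sub)
next
  case (ind \<phi>)
  then show ?case using EHA.ind[of "fsub (up e) \<phi>" \<Gamma>']
    by (simp add: fsub_inst_0 fsub_inst_1 lang_int_fsub[OF _ wtenv_up])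
next
  case (seq_cases \<sigma>)
  show ?case using EHA.seq_cases[of \<sigma> \<Gamma>'] by (simp add: up_def numeral_2_eq_2)
qed (auto intro: EHA.intros wt_sub)

lemma EHA_st_fsub: "\<Phi> \<in> EHA_st \<Gamma> \<Longrightarrow> wtenv \<Gamma>' e \<Gamma> \<Longrightarrow> fsub e \<Phi> \<in> EHA_st \<Gamma>'"
proof (induction rule: EHA_st.induct)
  case (st_ind \<Phi>)
  then show ?case using EHA_st.st_ind[of "fsub (up e) \<Phi>" \<Gamma>']
    by (simp add: fsub_inst_0 fsub_inst_1 lang_st_fsub[OF _ wtenv_up])
next
  case (AllSt_def \<Phi> \<sigma>)
  then show ?case using EHA_st.AllSt_def[of "fsub (up e) \<Phi>" \<sigma> \<Gamma>'] by (simp add: lang_st_fsub[OF _ wtenv_up])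
next
  case (ExSt_def \<Phi> \<sigma>)
  then show ?case using EHA_st.ExSt_def[of "fsub (up e) \<Phi>" \<sigma> \<Gamma>'] by (simp add: lang_st_fsub[OF _ wtenv_up])
next
  case (st_closed t \<sigma>)
  then show ?case by (simp add: sub_closed EHA_st.st_closed)
next
  case (base \<phi>)
  then show ?case by (intro EHA_st.base EHA_fsub)
next
  case (st_eq s \<sigma> t)
  then show ?case by (simp add: EHA_st.st_eq wt_sub)
next
  case (st_app f \<sigma> \<tau> t)
  then show ?case by (simp add: EHA_st.st_app wt_sub)
qed

lemma H_fsub: "\<Phi> \<in> H \<Gamma> \<Longrightarrow> wtenv \<Gamma>' e \<Gamma> \<Longrightarrow> fsub e \<Phi> \<in> H \<Gamma>'"
proof (induction rule: H.induct)
  case (EHA_st \<Phi>)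
  then show ?case by (intro H.EHA_st EHA_st_fsub)
next
  case (I \<phi> \<sigma> \<tau>)
  then show ?case using H.I[of "fsub (up (up e)) \<phi>" \<sigma> \<tau> \<Gamma>']
    by (simp add: fsub_inst_3 lang_int_fsub[OF _ wtenv_up[OF wtenv_up]])
next
  case (NCR \<Phi> \<sigma> \<tau>)
  then show ?case using H.NCR[of "fsub (up (up e)) \<Phi>" \<sigma> \<tau> \<Gamma>']
    by (simp add: fsub_inst_3 lang_st_fsub[OF _ wtenv_up[OF wtenv_up]])
next
  case (HAC \<Phi> \<tau> \<sigma>)
  then show ?case using H.HAC[of "fsub (up (up e)) \<Phi>" \<tau> \<sigma> \<Gamma>']
    by (simp add: fsub_inst_3 lang_st_fsub[OF _ wtenv_up[OF wtenv_up]])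
next
  case (HIP \<phi> \<sigma> \<Psi> \<tau>)
  then show ?case using H.HIP[of "fsub (up e) \<phi>" \<sigma> \<Gamma>' "fsub (up e) \<Psi>" \<tau>]
    by (simp add: fsub_inst_2 lang_st_fsub[OF _ wtenv_up] lang_int_fsub[OF _ wtenv_up])
next
  case (HGMP \<phi> \<sigma> \<psi>)
  then show ?case using H.HGMP[of "fsub (up e) \<phi>" \<sigma> \<Gamma>' "fsub e \<psi>"]
    by (simp add: fsub_inst_2 fsub_inst_1_Nil lang_int_fsub[OF _ wtenv_up] lang_int_fsub)
qed

lemma prv_H_fsub:
  "prv lang_st H \<Gamma> \<Delta> \<Phi> \<Longrightarrow> wtenv \<Gamma>' e \<Gamma> \<Longrightarrow> prv lang_st H \<Gamma>' (map (fsub e) \<Delta>) (fsub e \<Phi>)"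
  by (rule prv_fsub[OF lang_st_fsub H_fsub])

section \<open>Kripke completeness\<close>

text \<open>Countability provides the enumeration of formulas in \<open>stage\<close> and the coding
  of a type into a variable number in \<open>tyv\<close>.\<close>

instance ty :: countable by countable_datatype
instance tm :: countable by countable_datatype
instance fm :: countable by countable_datatype

text \<open>All worlds share one infinite context, in which every type occurs infinitely often at
  every level. A world of level \<open>n\<close> only mentions variables of levels below \<open>n\<close>, so that fresh
  variables remain for its extensions.\<close>

definition tyv :: "nat \<Rightarrow> ty" where "tyv i = fst (from_nat i :: ty \<times> nat \<times> nat)"
definition lev :: "nat \<Rightarrow> nat" where "lev i = fst (snd (from_nat i :: ty \<times> nat \<times> nat))"
definition GN :: "nat \<Rightarrow> ty list" where "GN N = map tyv [0..<N]"

text \<open>Absence of variables is expressed by substitution instead of a set of free variables: an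
  expression avoids all levels from \<open>n\<close> on exactly when this substitution leaves it
  unchanged. \<open>Zero\<close> may have the wrong type, which is harmless, as the result is only
  compared with the original.\<close>

definition kap :: "nat \<Rightarrow> nat \<Rightarrow> tm" where "kap n i = (if lev i < n then Var i else Zero)"

definition frm :: "fm \<Rightarrow> bool" where "frm \<Phi> \<longleftrightarrow> (\<exists>N. wff (GN N) \<Phi>)"
definition Form :: "nat \<Rightarrow> fm \<Rightarrow> bool" where "Form n \<Phi> \<longleftrightarrow> frm \<Phi> \<and> fsub (kap n) \<Phi> = \<Phi>"
definition Term :: "nat \<Rightarrow> ty \<Rightarrow> tm \<Rightarrow> bool" where
  "Term n \<sigma> t \<longleftrightarrow> (\<exists>N. wt (GN N) t \<sigma>) \<and> sub (kap n) t = t"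

text \<open>The context is existentially quantified along with the assumptions. A derivation uses
  finitely many of both and either can be enlarged, so \<open>ded\<close> acts as derivability over
  the whole infinite context and is compact.\<close>

definition ded :: "fm set \<Rightarrow> fm \<Rightarrow> bool" where
  "ded T \<Phi> \<longleftrightarrow> (\<exists>N \<Delta>. set \<Delta> \<subseteq> T \<and> prv lang_st H (GN N) \<Delta> \<Phi>)"

lemma length_GN [simp]: "length (GN N) = N" by (simp add: GN_def)
lemma nth_GN [simp]: "i < N \<Longrightarrow> GN N ! i = tyv i" by (simp add: GN_def)

lemma wtenv_GN_mono: "N \<le> M \<Longrightarrow> wtenv (GN M) Var (GN N)"
  by (simp add: wtenv_def)

lemma wt_GN_mono: "wt (GN N) t \<tau> \<Longrightarrow> N \<le> M \<Longrightarrow> wt (GN M) t \<tau>"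
  using wt_sub[of "GN N" t \<tau> "GN M" Var] wtenv_GN_mono[of N M] by simp
lemma wff_GN_mono: "wff (GN N) \<Phi> \<Longrightarrow> N \<le> M \<Longrightarrow> wff (GN M) \<Phi>"
  using wff_fsub[of "GN N" \<Phi> "GN M" Var] wtenv_GN_mono[of N M] by simp
lemma prv_GN_mono: "prv lang_st H (GN N) \<Delta> \<Phi> \<Longrightarrow> N \<le> M \<Longrightarrow> prv lang_st H (GN M) \<Delta> \<Phi>"
  using prv_H_fsub[OF _ wtenv_GN_mono, of N \<Delta> \<Phi> M] by (simp add: map_idI)

section \<open>Derivability from sets of formulas over the shared context\<close>

lemma ded_mono: "ded T \<Phi> \<Longrightarrow> T \<subseteq> T' \<Longrightarrow> ded T' \<Phi>"
  unfolding ded_def by blast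

lemma ded_finite: "ded T \<Phi> \<Longrightarrow> \<exists>F. finite F \<and> F \<subseteq> T \<and> ded F \<Phi>"
  unfolding ded_def by (metis List.finite_set subset_refl)

lemma ded_Hyp: "\<Phi> \<in> T \<Longrightarrow> ded T \<Phi>"
  unfolding ded_def by (rule exI[of _ 0], rule exI[of _ "[\<Phi>]"]) (auto intro: prv.Hyp)

lemma ded_insertE:
  assumes "ded (insert \<Phi> T) C"
  obtains N \<Delta> where "set \<Delta> \<subseteq> T" "prv lang_st H (GN N) (\<Phi> # \<Delta>) C"
proof -
  obtain N \<Delta> where d: "set \<Delta> \<subseteq> insert \<Phi> T" "prv lang_st H (GN N) \<Delta> C"
    using assms unfolding ded_def by blast
  have "prv lang_st H (GN N) (\<Phi> # filter (\<lambda>x. x \<noteq> \<Phi>) \<Delta>) C"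
    by (rule prv_weaken[OF d(2)]) auto
  with d(1) show thesis by (intro that[of "filter (\<lambda>x. x \<noteq> \<Phi>) \<Delta>" N]) auto
qed

text \<open>Derivations over different contexts are moved to a common one, and their lists of
  assumptions are concatenated. The bound \<open>M\<close> lets a caller request a context large
  enough to type a further formula or term.\<close>

lemma ded_join2:
  assumes "ded T \<Phi>" "ded T \<Psi>"
  obtains N \<Delta> where "M \<le> N" "set \<Delta> \<subseteq> T" "prv lang_st H (GN N) \<Delta> \<Phi>" "prv lang_st H (GN N) \<Delta> \<Psi>"
proof -
  obtain N1 \<Delta>1 N2 \<Delta>2 where d: "set \<Delta>1 \<subseteq> T" "prv lang_st H (GN N1) \<Delta>1 \<Phi>" "set \<Delta>2 \<subseteq> T" "prv lang_st H (GN N2) \<Delta>2 \<Psi>"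
    using assms unfolding ded_def by blast
  let ?N = "max M (max N1 N2)"
  have "prv lang_st H (GN ?N) (\<Delta>1 @ \<Delta>2) \<Phi>"
    by (rule prv_weaken[OF prv_GN_mono[OF d(2)]]) auto
  moreover have "prv lang_st H (GN ?N) (\<Delta>1 @ \<Delta>2) \<Psi>"
    by (rule prv_weaken[OF prv_GN_mono[OF d(4)]]) auto
  ultimately show thesis using d(1,3) by (intro that[of ?N "\<Delta>1 @ \<Delta>2"]) auto
qed

lemma ded_AndI: "ded T \<Phi> \<Longrightarrow> ded T \<Psi> \<Longrightarrow> ded T (And \<Phi> \<Psi>)"
proof -
  assume "ded T \<Phi>" "ded T \<Psi>"
  then obtain N \<Delta> where "set \<Delta> \<subseteq> T" "prv lang_st H (GN N) \<Delta> \<Phi>" "prv lang_st H (GN N) \<Delta> \<Psi>"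
    by (rule ded_join2[where M = 0])
  then show ?thesis unfolding ded_def by (intro exI[of _ N] exI[of _ \<Delta>] conjI prv.AndI)
qed

lemma ded_AndE: "ded T (And \<Phi> \<Psi>) \<Longrightarrow> ded T \<Phi> \<and> ded T \<Psi>"
  unfolding ded_def by (blast intro: prv.AndE1 prv.AndE2)

lemma ded_ImpE: "ded T (Imp \<Phi> \<Psi>) \<Longrightarrow> ded T \<Phi> \<Longrightarrow> ded T \<Psi>"
proof -
  assume "ded T (Imp \<Phi> \<Psi>)" "ded T \<Phi>"
  then obtain N \<Delta> where d: "set \<Delta> \<subseteq> T" "prv lang_st H (GN N) \<Delta> (Imp \<Phi> \<Psi>)" "prv lang_st H (GN N) \<Delta> \<Phi>"
    by (rule ded_join2[where M = 0])
  from prv.ImpE[OF d(2,3)] d(1) show ?thesis unfolding ded_def by blast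
qed

lemma ded_ImpI:
  assumes "ded (insert \<Phi> T) \<Psi>" "frm \<Phi>"
  shows "ded T (Imp \<Phi> \<Psi>)"
proof -
  obtain M where M: "wff (GN M) \<Phi>" using assms(2) by (auto simp: frm_def)
  obtain N \<Delta> where d: "set \<Delta> \<subseteq> T" "prv lang_st H (GN N) (\<Phi> # \<Delta>) \<Psi>" using ded_insertE[OF assms(1)] .
  have "prv lang_st H (GN (max M N)) \<Delta> (Imp \<Phi> \<Psi>)"
    by (rule prv.ImpI[OF prv_GN_mono[OF d(2)]]) (auto simp: lang_st_def intro: wff_GN_mono[OF M])
  with d(1) show ?thesis unfolding ded_def by blast
qed

lemma ded_cut: "ded (insert \<Phi> T) \<Psi> \<Longrightarrow> ded T \<Phi> \<Longrightarrow> frm \<Phi> \<Longrightarrow> ded T \<Psi>"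
  using ded_ImpI ded_ImpE by blast

lemma ded_BotE:
  assumes "ded T Bot" "frm \<Phi>"
  shows "ded T \<Phi>"
proof -
  obtain M where M: "wff (GN M) \<Phi>" using assms(2) by (auto simp: frm_def)
  obtain N \<Delta> where d: "M \<le> N" "set \<Delta> \<subseteq> T" "prv lang_st H (GN N) \<Delta> Bot" using ded_join2[OF assms(1) assms(1)] .
  have "prv lang_st H (GN N) \<Delta> \<Phi>"
    by (rule prv.BotE[OF d(3)]) (auto simp: lang_st_def intro: wff_GN_mono[OF M d(1)])
  with d(2) show ?thesis unfolding ded_def by blast
qed

lemma ded_OrI:
  assumes "ded T \<Phi> \<or> ded T \<Psi>" "frm \<Phi>" "frm \<Psi>"
  shows "ded T (Or \<Phi> \<Psi>)"
proof -
  obtain M1 M2 where "wff (GN M1) \<Phi>" "wff (GN M2) \<Psi>" using assms(2,3) by (auto simp: frm_def)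
  then have M: "wff (GN (max M1 M2)) \<Phi>" "wff (GN (max M1 M2)) \<Psi>" by (auto elim: wff_GN_mono)
  from assms(1) show ?thesis
  proof
    assume a: "ded T \<Phi>"
    obtain N \<Delta> where d: "max M1 M2 \<le> N" "set \<Delta> \<subseteq> T" "prv lang_st H (GN N) \<Delta> \<Phi>" using ded_join2[OF a a] .
    have "prv lang_st H (GN N) \<Delta> (Or \<Phi> \<Psi>)"
      by (rule prv.OrI1[OF d(3)]) (auto simp: lang_st_def intro: wff_GN_mono[OF M(2) d(1)])
    with d(2) show ?thesis unfolding ded_def by blast
  next
    assume a: "ded T \<Psi>"
    obtain N \<Delta> where d: "max M1 M2 \<le> N" "set \<Delta> \<subseteq> T" "prv lang_st H (GN N) \<Delta> \<Psi>" using ded_join2[OF a a] .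
    have "prv lang_st H (GN N) \<Delta> (Or \<Phi> \<Psi>)"
      by (rule prv.OrI2[OF d(3)]) (auto simp: lang_st_def intro: wff_GN_mono[OF M(1) d(1)])
    with d(2) show ?thesis unfolding ded_def by blast
  qed
qed

lemma ded_OrE:
  assumes "ded T (Or \<Phi> \<Psi>)" "ded (insert \<Phi> T) C" "ded (insert \<Psi> T) C" "frm \<Phi>" "frm \<Psi>"
  shows "ded T C"
proof -
  have i: "ded T (Imp \<Phi> C)" "ded T (Imp \<Psi> C)" using assms ded_ImpI by auto
  \<comment> \<open>The conjunction only serves to bring the three derivations over one context and
    one list of assumptions.\<close>
  obtain N \<Delta> where d: "set \<Delta> \<subseteq> T" "prv lang_st H (GN N) \<Delta> (And (Or \<Phi> \<Psi>) (And (Imp \<Phi> C) (Imp \<Psi> C)))"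
    using ded_AndI[OF assms(1) ded_AndI[OF i]] unfolding ded_def by blast
  have "prv lang_st H (GN N) (\<Phi> # \<Delta>) C"
  proof (rule prv.ImpE[of _ _ _ _ \<Phi>])
    show "prv lang_st H (GN N) (\<Phi> # \<Delta>) (Imp \<Phi> C)"
      by (rule prv.AndE1, rule prv.AndE2, rule prv_weaken[OF d(2)]) auto
  qed (auto intro: prv.Hyp)
  moreover have "prv lang_st H (GN N) (\<Psi> # \<Delta>) C"
  proof (rule prv.ImpE[of _ _ _ _ \<Psi>])
    show "prv lang_st H (GN N) (\<Psi> # \<Delta>) (Imp \<Psi> C)"
      by (rule prv.AndE2, rule prv.AndE2, rule prv_weaken[OF d(2)]) auto
  qed (auto intro: prv.Hyp)
  ultimately have "prv lang_st H (GN N) \<Delta> C" using prv.OrE[OF prv.AndE1[OF d(2)]] by blast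
  with d(1) show ?thesis unfolding ded_def by blast
qed

lemma ded_AllE:
  assumes "ded T (All \<sigma> \<Phi>)" "wt (GN M) t \<sigma>"
  shows "ded T (inst 0 [t] \<Phi>)"
proof -
  obtain N \<Delta> where d: "M \<le> N" "set \<Delta> \<subseteq> T" "prv lang_st H (GN N) \<Delta> (All \<sigma> \<Phi>)" using ded_join2[OF assms(1) assms(1)] .
  have "prv lang_st H (GN N) \<Delta> (inst 0 [t] \<Phi>)"
    by (rule prv.AllE[OF d(3) wt_GN_mono[OF assms(2) d(1)]])
  with d(2) show ?thesis unfolding ded_def by blast
qed

lemma ded_ExI:
  assumes "ded T (inst 0 [t] \<Phi>)" "wt (GN M) t \<sigma>" "frm (Ex \<sigma> \<Phi>)"
  shows "ded T (Ex \<sigma> \<Phi>)"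
proof -
  obtain K where K: "wff (GN K) (Ex \<sigma> \<Phi>)" using assms(3) by (auto simp: frm_def)
  obtain N \<Delta> where d: "max K M \<le> N" "set \<Delta> \<subseteq> T" "prv lang_st H (GN N) \<Delta> (inst 0 [t] \<Phi>)" using ded_join2[OF assms(1) assms(1)] .
  have "prv lang_st H (GN N) \<Delta> (Ex \<sigma> \<Phi>)"
    by (rule prv.ExI[OF d(3) wt_GN_mono[OF assms(2)]]) (use d(1) wff_GN_mono[OF K, of N] in \<open>auto simp: lang_st_def\<close>)
  with d(2) show ?thesis unfolding ded_def by blast
qed

subsection \<open>Fresh variables\<close>

definition fresh :: "nat \<Rightarrow> fm \<Rightarrow> bool" where "fresh c \<Phi> \<longleftrightarrow> fsub (Var(c := Zero)) \<Phi> = \<Phi>"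

text \<open>Turns the variable \<open>c\<close> of the shared context into the variable of a new
  innermost binder and shifts all others past it. This is how a fresh variable becomes an
  eigenvariable of the de Bruijn rules.\<close>

definition abst :: "nat \<Rightarrow> nat \<Rightarrow> tm" where "abst c i = (if i = c then Var 0 else Var (Suc i))"

lemma wtenv_abst: "wtenv (tyv c # GN M) (abst c) (GN M)"
  by (auto simp: wtenv_def abst_def)

lemma fsub_abst: "fresh c \<Phi> \<Longrightarrow> fsub (abst c) \<Phi> = inst 1 [] \<Phi>"
proof -
  assume f: "fresh c \<Phi>"
  have "fsub (abst c) (fsub (Var(c := Zero)) \<Phi>) = inst 1 [] (fsub (Var(c := Zero)) \<Phi>)"
    unfolding inst_Nil fsub_fsub
    by (rule arg_cong[where f="\<lambda>e. fsub e \<Phi>"]) (auto simp: abst_def)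
  then show ?thesis using f by (simp add: fresh_def)
qed

lemma fsub_abst_inst:
  assumes "fresh c (Ex \<sigma> \<Phi>)"
  shows "fsub (abst c) (inst 0 [Var c] \<Phi>) = \<Phi>"
proof -
  \<comment> \<open>This is \<open>up (Var(c := Zero))\<close> spelled out. Freshness makes
    \<open>\<Phi>\<close> invariant under it, so \<open>\<Phi>\<close> may be replaced by an
    instance in which \<open>c\<close> visibly does not occur.\<close>
  let ?e = "Var 0 ## (\<lambda>i. if i = c then Zero else Var (Suc i))"
  have e: "up (Var(c := Zero)) = ?e"
    by (auto simp: up_def lift_def split: nat.split)
  have f: "fsub ?e \<Phi> = \<Phi>" using assms by (simp add: fresh_def flip: e)
  have "fsub (abst c) (inst 0 [Var c] (fsub ?e \<Phi>)) = fsub ?e \<Phi>"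
    unfolding inst_0_single fsub_fsub
    by (rule arg_cong[where f="\<lambda>e. fsub e \<Phi>"]) (auto simp: abst_def split: nat.split)
  then show ?thesis unfolding f .
qed

text \<open>Existential elimination with a variable of the shared context as eigenvariable:
  \<open>abst c\<close> renames \<open>c\<close> to the bound variable of rule \<open>ExE\<close>,
  and by freshness it acts as a mere weakening on the other assumptions and on the
  conclusion.\<close>

lemma ded_fresh_Ex:
  assumes d: "ded (insert (inst 0 [Var c] \<psi>) T) C" and ex: "ded T (Ex (tyv c) \<psi>)"
    and fr: "\<And>\<chi>. \<chi> \<in> T \<Longrightarrow> fresh c \<chi>" "fresh c C" "fresh c (Ex (tyv c) \<psi>)" and C: "frm C"
  shows "ded T C"
proof -
  obtain K where K: "wff (GN K) C" using C by (auto simp: frm_def)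
  obtain N0 \<Delta>0 where d0: "set \<Delta>0 \<subseteq> T" "prv lang_st H (GN N0) (inst 0 [Var c] \<psi> # \<Delta>0) C"
    using ded_insertE[OF d] .
  obtain N1 \<Delta>1 where d1: "max K N0 \<le> N1" "set \<Delta>1 \<subseteq> T" "prv lang_st H (GN N1) \<Delta>1 (Ex (tyv c) \<psi>)"
    using ded_join2[OF ex ex] .
  let ?D = "\<Delta>0 @ \<Delta>1"
  have 1: "prv lang_st H (GN N1) ?D (Ex (tyv c) \<psi>)" by (rule prv_weaken[OF d1(3)]) auto
  have "prv lang_st H (GN N1) (inst 0 [Var c] \<psi> # ?D) C"
    by (rule prv_weaken[OF prv_GN_mono[OF d0(2)]]) (use d1(1) in auto)
  from prv_H_fsub[OF this wtenv_abst[of c]]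
  have "prv lang_st H (tyv c # GN N1) (fsub (abst c) (inst 0 [Var c] \<psi>) # map (fsub (abst c)) ?D) (fsub (abst c) C)"
    by simp
  moreover have "map (fsub (abst c)) ?D = map (inst 1 []) ?D"
    by (rule map_cong[OF refl], rule fsub_abst) (use fr(1) d0(1) d1(2) in auto)
  ultimately have "prv lang_st H (tyv c # GN N1) (\<psi> # map (inst 1 []) ?D) (inst 1 [] C)"
    using fr(2,3) by (simp only: fsub_abst_inst fsub_abst)
  from prv.ExE[OF 1 this] have "prv lang_st H (GN N1) ?D C"
    using wff_GN_mono[OF K] d1(1) by (simp add: lang_st_def)
  then show ?thesis unfolding ded_def using d0(1) d1(2) by (intro exI[of _ N1] exI[of _ ?D]) auto
qed

lemma ded_fresh_All:
  assumes d: "ded T (inst 0 [Var c] \<psi>)"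
    and fr: "\<And>\<chi>. \<chi> \<in> T \<Longrightarrow> fresh c \<chi>" "fresh c (All (tyv c) \<psi>)"
  shows "ded T (All (tyv c) \<psi>)"
proof -
  obtain N \<Delta> where d0: "set \<Delta> \<subseteq> T" "prv lang_st H (GN N) \<Delta> (inst 0 [Var c] \<psi>)"
    using d unfolding ded_def by blast
  have fr': "fresh c (Ex (tyv c) \<psi>)" using fr(2) by (simp add: fresh_def)
  from prv_H_fsub[OF d0(2) wtenv_abst[of c]]
  have "prv lang_st H (tyv c # GN N) (map (fsub (abst c)) \<Delta>) \<psi>"
    by (simp only: fsub_abst_inst[OF fr'])
  moreover have "map (fsub (abst c)) \<Delta> = map (inst 1 []) \<Delta>"
    by (rule map_cong[OF refl], rule fsub_abst) (use fr(1) d0(1) in auto)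
  ultimately have "prv lang_st H (GN N) \<Delta> (All (tyv c) \<psi>)" using prv.AllI by simp
  then show ?thesis using d0(1) unfolding ded_def by blast
qed

text \<open>Levels give freshness for infinitely many formulas at once, where no bound on the
  indices of their variables need exist.\<close>

lemma fresh_Form: "Form n \<Phi> \<Longrightarrow> n \<le> lev c \<Longrightarrow> fresh c \<Phi>"
proof -
  assume F: "Form n \<Phi>" and c: "n \<le> lev c"
  have "fsub (Var(c := Zero)) (fsub (kap n) \<Phi>) = fsub (kap n) \<Phi>"
    unfolding fsub_fsub by (rule arg_cong[where f="\<lambda>e. fsub e \<Phi>"]) (use c in \<open>auto simp: kap_def\<close>)
  then show ?thesis using F by (simp add: Form_def fresh_def)
qed

lemma fresh_wff: "wff (GN N) \<Phi> \<Longrightarrow> N \<le> c \<Longrightarrow> fresh c \<Phi>"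
  unfolding fresh_def using fsub_cong[of "GN N" \<Phi> "Var(c := Zero)" Var] by simp

text \<open>The third component of the coded triple leaves infinitely many indices for each type and
  level, so one of them is at least \<open>N\<close>.\<close>

lemma ex_var: "\<exists>c. N \<le> c \<and> lev c = n \<and> tyv c = \<sigma>"
proof -
  have "inj (\<lambda>k. to_nat (\<sigma>, n, k::nat))" by (auto simp: inj_def)
  then have "infinite (range (\<lambda>k. to_nat (\<sigma>, n, k::nat)))" by (meson finite_imageD infinite_UNIV_nat)
  then obtain c where "c \<in> range (\<lambda>k. to_nat (\<sigma>, n, k::nat))" "N \<le> c"
    unfolding infinite_nat_iff_unbounded_le by blast
  then obtain k where "c = to_nat (\<sigma>, n, k::nat)" by blast
  then have "lev c = n" "tyv c = \<sigma>" by (simp_all add: lev_def tyv_def)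
  with \<open>N \<le> c\<close> show ?thesis by blast
qed

lemma ex_fresh:
  assumes "finite F" "\<And>\<chi>. \<chi> \<in> F \<Longrightarrow> frm \<chi>"
  shows "\<exists>c. lev c = n \<and> tyv c = \<sigma> \<and> (\<forall>\<chi>\<in>F. fresh c \<chi>)"
proof -
  have "\<exists>N. \<forall>\<chi>\<in>F. wff (GN N) \<chi>"
    using assms
  proof (induction F rule: finite_induct)
    case (insert x F)
    obtain M where "wff (GN M) x" using insert.prems[of x] by (auto simp: frm_def)
    moreover obtain N where "\<forall>\<chi>\<in>F. wff (GN N) \<chi>" using insert.IH insert.prems by auto
    ultimately show ?case by (metis insertE max.cobounded1 max.cobounded2 wff_GN_mono)
  qed auto
  then obtain N where N: "\<forall>\<chi>\<in>F. wff (GN N) \<chi>" by blast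
  obtain c where "N \<le> c" "lev c = n" "tyv c = \<sigma>" using ex_var by blast
  with N show ?thesis using fresh_wff by blast
qed

subsection \<open>Prime theories\<close>

lemma kap_kap: "n \<le> m \<Longrightarrow> sub (kap m) (kap n i) = kap n i"
  by (auto simp: kap_def)

lemma Form_mono: "Form n \<Phi> \<Longrightarrow> n \<le> m \<Longrightarrow> Form m \<Phi>"
proof -
  assume "Form n \<Phi>" "n \<le> m"
  then have "fsub (kap m) (fsub (kap n) \<Phi>) = fsub (kap n) \<Phi>" by (simp add: fsub_fsub kap_kap)
  with \<open>Form n \<Phi>\<close> show ?thesis by (simp add: Form_def)
qed
lemma Term_mono: "Term n \<sigma> t \<Longrightarrow> n \<le> m \<Longrightarrow> Term m \<sigma> t"
proof -
  assume "Term n \<sigma> t" "n \<le> m"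
  then have "sub (kap m) (sub (kap n) t) = sub (kap n) t" by (simp add: sub_sub kap_kap)
  with \<open>Term n \<sigma> t\<close> show ?thesis by (simp add: Term_def)
qed

lemma Term_Var: "lev c < n \<Longrightarrow> Term n (tyv c) (Var c)"
  unfolding Term_def by (auto simp: kap_def intro!: exI[of _ "Suc c"])

lemma Form_inst: "Form n (Ex \<sigma> \<Phi>) \<Longrightarrow> Term n \<sigma> t \<Longrightarrow> Form n (inst 0 [t] \<Phi>)"
proof -
  assume F: "Form n (Ex \<sigma> \<Phi>)" and t: "Term n \<sigma> t"
  obtain N M where "wff (\<sigma> # GN N) \<Phi>" "wt (GN M) t \<sigma>" using F t by (auto simp: Form_def Term_def frm_def)
  moreover then have "wtenv (GN (max M N)) (t ## Var) (\<sigma> # GN N)"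
    by (intro wtenv_scons) (auto elim: wt_GN_mono intro: wtenv_GN_mono)
  ultimately have "frm (inst 0 [t] \<Phi>)" unfolding frm_def inst_0_single using wff_fsub by blast
  moreover have "fsub (kap n) (inst 0 [t] \<Phi>) = inst 0 [t] \<Phi>"
    using F t by (simp add: fsub_inst_0 Form_def Term_def)
  ultimately show ?thesis by (simp add: Form_def)
qed

datatype world = World (lvl: nat) (thry: "fm set")

text \<open>Deductive closure is relative to the formulas of the world's own level. The clauses for
  \<open>Or\<close> and \<open>Ex\<close> are the disjunction and existence properties, which let
  membership in the theory behave like forcing for these two connectives.\<close>

definition world :: "world \<Rightarrow> bool" where
  "world w \<longleftrightarrow> (\<forall>\<Phi>\<in>thry w. Form (lvl w) \<Phi>) \<and> Bot \<notin> thry w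
    \<and> (\<forall>\<Phi>. Form (lvl w) \<Phi> \<longrightarrow> ded (thry w) \<Phi> \<longrightarrow> \<Phi> \<in> thry w)
    \<and> (\<forall>\<Phi> \<Psi>. Or \<Phi> \<Psi> \<in> thry w \<longrightarrow> \<Phi> \<in> thry w \<or> \<Psi> \<in> thry w)
    \<and> (\<forall>\<sigma> \<Phi>. Ex \<sigma> \<Phi> \<in> thry w \<longrightarrow> (\<exists>t. Term (lvl w) \<sigma> t \<and> inst 0 [t] \<Phi> \<in> thry w))"

text \<open>The Henkin witness of an existential formula is a variable of level \<open>n\<close>. It
  is chosen fresh for the finite set \<open>F\<close>, which may contain earlier variables of that
  level; for the initial theory its level suffices.\<close>

primrec witn :: "nat \<Rightarrow> fm set \<Rightarrow> fm \<Rightarrow> fm set" where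
  "witn n F (Ex \<sigma> \<psi>) = {inst 0 [Var (SOME c. lev c = n \<and> tyv c = \<sigma> \<and> (\<forall>\<chi>\<in>F. fresh c \<chi>))] \<psi>}"
| "witn n F (Eq \<sigma> s t) = {}"
| "witn n F Bot = {}"
| "witn n F (St \<sigma> t) = {}"
| "witn n F (And \<phi> \<psi>) = {}"
| "witn n F (Or \<phi> \<psi>) = {}"
| "witn n F (Imp \<phi> \<psi>) = {}"
| "witn n F (All \<sigma> \<psi>) = {}"
| "witn n F (AllSt \<sigma> \<psi>) = {}"
| "witn n F (ExSt \<sigma> \<psi>) = {}"

primrec stage :: "nat \<Rightarrow> fm set \<Rightarrow> fm \<Rightarrow> nat \<Rightarrow> fm set" where
  "stage n T C 0 = {}"
| "stage n T C (Suc k) = (let F = stage n T C k; \<phi> = from_nat k in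
    if Form (Suc n) \<phi> \<and> \<not> ded (insert \<phi> (T \<union> F)) C
    then insert \<phi> F \<union> witn n (insert C (insert \<phi> F)) \<phi> else F)"

lemma stage_step:
  assumes T: "\<And>\<chi>. \<chi> \<in> T \<Longrightarrow> Form n \<chi>" and C: "frm C"
    and F: "finite F" "\<And>\<chi>. \<chi> \<in> F \<Longrightarrow> Form (Suc n) \<chi>"
    and \<phi>: "Form (Suc n) \<phi>" "\<not> ded (insert \<phi> (T \<union> F)) C"
  defines "W \<equiv> witn n (insert C (insert \<phi> F)) \<phi>"
  shows "finite W \<and> (\<forall>\<chi>\<in>W. Form (Suc n) \<chi>) \<and> \<not> ded (T \<union> (insert \<phi> F \<union> W)) C"
proof (cases "\<exists>\<sigma> \<psi>. \<phi> = Ex \<sigma> \<psi>")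
  case True
  then obtain \<sigma> \<psi> where e: "\<phi> = Ex \<sigma> \<psi>" by blast
  define c where "c = (SOME c. lev c = n \<and> tyv c = \<sigma> \<and> (\<forall>\<chi>\<in>insert C (insert \<phi> F). fresh c \<chi>))"
  have "lev c = n \<and> tyv c = \<sigma> \<and> (\<forall>\<chi>\<in>insert C (insert \<phi> F). fresh c \<chi>)"
    unfolding c_def
  proof (rule someI_ex, rule ex_fresh)
    fix \<chi> assume "\<chi> \<in> insert C (insert \<phi> F)"
    then show "frm \<chi>" using C F(2) \<phi>(1) unfolding Form_def by blast
  qed (simp add: F)
  then have c: "lev c = n" "tyv c = \<sigma>" "fresh c C" "fresh c (Ex \<sigma> \<psi>)" "\<And>\<chi>. \<chi> \<in> F \<Longrightarrow> fresh c \<chi>" by (auto simp: e)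
  have W: "W = {inst 0 [Var c] \<psi>}" by (simp add: W_def c_def e)
  have "Form (Suc n) (inst 0 [Var c] \<psi>)"
    using Form_inst[of "Suc n" \<sigma> \<psi> "Var c"] \<phi>(1) Term_Var[of c "Suc n"] c by (simp add: e)
  moreover have "\<not> ded (insert (inst 0 [Var c] \<psi>) (insert \<phi> (T \<union> F))) C"
  proof
    assume d: "ded (insert (inst 0 [Var c] \<psi>) (insert \<phi> (T \<union> F))) C"
    have "ded (insert \<phi> (T \<union> F)) C"
    proof (rule ded_fresh_Ex[OF d _ _ c(3) _ C])
      fix \<chi> assume "\<chi> \<in> insert \<phi> (T \<union> F)"
      then show "fresh c \<chi>" using c(4,5) fresh_Form[OF T, of \<chi> c] c(1) e by auto
    qed (use c e in \<open>auto intro: ded_Hyp\<close>)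
    with \<phi>(2) show False ..
  qed
  ultimately show ?thesis by (simp add: W)
next
  case False
  then have "W = {}" by (cases \<phi>) (auto simp: W_def)
  with \<phi>(2) show ?thesis by simp
qed

text \<open>Admitting every formula that does not make \<open>C\<close> derivable yields primeness:
  were both sides of a disjunction in \<open>U\<close> rejected, \<open>C\<close> would follow from
  each and hence from \<open>U\<close>. The level increases by one to make room for the Henkin
  witnesses.\<close>

lemma prime_extension:
  assumes T: "\<And>\<chi>. \<chi> \<in> T \<Longrightarrow> Form n \<chi>" and C: "frm C" and nd: "\<not> ded T C"
  shows "\<exists>U. world (World (Suc n) U) \<and> T \<subseteq> U \<and> C \<notin> U"
proof -
  let ?S = "stage n T C"
  have inv: "finite (?S k) \<and> (\<forall>\<chi>\<in>?S k. Form (Suc n) \<chi>) \<and> \<not> ded (T \<union> ?S k) C" for k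
  proof (induction k)
    case (Suc k)
    let ?\<phi> = "from_nat k :: fm"
    let ?B = "Form (Suc n) ?\<phi> \<and> \<not> ded (insert ?\<phi> (T \<union> ?S k)) C"
    show ?case
    proof (cases ?B)
      case True
      then have "?S (Suc k) = insert ?\<phi> (?S k) \<union> witn n (insert C (insert ?\<phi> (?S k))) ?\<phi>"
        by (simp only: stage.simps Let_def if_True simp_thms)
      moreover have "finite (?S k)" "\<And>\<chi>. \<chi> \<in> ?S k \<Longrightarrow> Form (Suc n) \<chi>" using Suc by auto
      ultimately show ?thesis using stage_step[OF T C, where F = "?S k" and \<phi> = ?\<phi>] True by auto
    next
      case False
      then have "?S (Suc k) = ?S k"
        by (simp only: stage.simps Let_def if_False)
      then show ?thesis using Suc by simp
    qed
  qed (use nd in simp)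
  have mono: "?S k \<subseteq> ?S l" if "k \<le> l" for k l
  proof (rule lift_Suc_mono_le[OF _ that])
    show "?S j \<subseteq> ?S (Suc j)" for j
      unfolding stage.simps Let_def by (cases "Form (Suc n) (from_nat j) \<and> \<not> ded (insert (from_nat j) (T \<union> ?S j)) C") auto
  qed
  define U where "U = T \<union> (\<Union>k. ?S k)"
  have UF: "Form (Suc n) \<chi>" if "\<chi> \<in> U" for \<chi>
    using that inv T Form_mono[of n \<chi> "Suc n"] unfolding U_def by auto
  have ndU: "\<not> ded U C"
  proof
    assume "ded U C"
    then obtain F where F: "finite F" "F \<subseteq> U" "ded F C" using ded_finite by blast
    have "\<exists>k. F \<subseteq> T \<union> ?S k" using F(1,2)
    proof (induction F rule: finite_induct)
      case (insert x F)
      then obtain k where k: "F \<subseteq> T \<union> ?S k" by auto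
      have "x \<in> U" using insert.prems by simp
      then obtain l where l: "x \<in> T \<union> ?S l" by (auto simp: U_def)
      have "T \<union> ?S k \<subseteq> T \<union> ?S (max k l)" "T \<union> ?S l \<subseteq> T \<union> ?S (max k l)"
        using mono[of k "max k l"] mono[of l "max k l"] by auto
      with k l show ?case by (intro exI[of _ "max k l"]) blast
    qed auto
    then show False using inv ded_mono F(3) by blast
  qed
  \<comment> \<open>At stage \<open>to_nat \<phi>\<close> the formula is tested against a subset of
    \<open>U\<close>, so it passes the test there.\<close>
  have mem: "\<phi> \<in> U" if "Form (Suc n) \<phi>" "\<not> ded (insert \<phi> U) C" for \<phi>
  proof -
    have "\<not> ded (insert \<phi> (T \<union> ?S (to_nat \<phi>))) C"
      using that(2) by (rule contrapos_nn) (erule ded_mono, auto simp: U_def)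
    then have "\<phi> \<in> ?S (Suc (to_nat \<phi>))" using that(1) by (simp add: Let_def)
    then show ?thesis unfolding U_def by blast
  qed
  have closed: "\<phi> \<in> U" if "Form (Suc n) \<phi>" "ded U \<phi>" for \<phi>
    using mem[OF that(1)] ded_cut[OF _ that(2), of C] ndU that(1) by (auto simp: Form_def)
  have "world (World (Suc n) U)"
    unfolding world_def world.sel
  proof (intro conjI allI impI ballI)
    show "Bot \<notin> U" using ndU ded_BotE[OF ded_Hyp C] by blast
  next
    fix \<Phi> \<Psi> assume o: "Or \<Phi> \<Psi> \<in> U"
    have f: "Form (Suc n) \<Phi>" "Form (Suc n) \<Psi>" using UF[OF o] by (auto simp: Form_def frm_def)
    then have "frm \<Phi>" "frm \<Psi>" by (auto simp: Form_def)
    with ndU have "\<not> ded (insert \<Phi> U) C \<or> \<not> ded (insert \<Psi> U) C" using ded_OrE[OF ded_Hyp[OF o]] by blast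
    then show "\<Phi> \<in> U \<or> \<Psi> \<in> U" using mem f by blast
  next
    fix \<sigma> \<psi> assume e: "Ex \<sigma> \<psi> \<in> U"
    let ?k = "to_nat (Ex \<sigma> \<psi>)"
    have F: "Form (Suc n) (Ex \<sigma> \<psi>)" using UF[OF e] .
    \<comment> \<open>An existential formula in \<open>U\<close> also passes the test at its own
      stage, where its witness is added with it.\<close>
    have "insert (Ex \<sigma> \<psi>) U = U" using e by blast
    then have "\<not> ded (insert (Ex \<sigma> \<psi>) U) C" using ndU by simp
    then have nd': "\<not> ded (insert (Ex \<sigma> \<psi>) (T \<union> ?S ?k)) C"
      by (rule contrapos_nn) (erule ded_mono, auto simp: U_def)
    define X where "X = insert C (insert (Ex \<sigma> \<psi>) (?S ?k))"
    define c where "c = (SOME c. lev c = n \<and> tyv c = \<sigma> \<and> (\<forall>\<chi>\<in>X. fresh c \<chi>))"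
    have "lev c = n \<and> tyv c = \<sigma> \<and> (\<forall>\<chi>\<in>X. fresh c \<chi>)"
      unfolding c_def
    proof (rule someI_ex, rule ex_fresh)
      fix \<chi> assume "\<chi> \<in> X"
      then show "frm \<chi>" using C F inv[of ?k] unfolding Form_def X_def by blast
    qed (use inv in \<open>simp add: X_def\<close>)
    then have "Term (Suc n) \<sigma> (Var c)" using Term_Var[of c "Suc n"] by simp
    moreover have "inst 0 [Var c] \<psi> \<in> ?S (Suc ?k)" using F nd' by (simp add: c_def X_def Let_def)
    ultimately show "\<exists>t. Term (Suc n) \<sigma> t \<and> inst 0 [t] \<psi> \<in> U" unfolding U_def by blast
  qed (use UF closed in auto)
  moreover have "C \<notin> U" using ndU ded_Hyp by blast
  ultimately show ?thesis unfolding U_def by blast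
qed

section \<open>Truth in a world\<close>

definition wle :: "world \<Rightarrow> world \<Rightarrow> bool" (infix "\<sqsubseteq>" 50) where
  "w \<sqsubseteq> w' \<longleftrightarrow> world w \<and> world w' \<and> lvl w \<le> lvl w' \<and> thry w \<subseteq> thry w'"

definition tr :: "world \<Rightarrow> fm \<Rightarrow> bool" where "tr w \<Phi> \<longleftrightarrow> \<Phi> \<in> thry w"
definition elt :: "world \<Rightarrow> ty \<Rightarrow> tm \<Rightarrow> bool" where "elt w \<sigma> t \<longleftrightarrow> Term (lvl w) \<sigma> t"

lemma wle_refl [simp]: "world w \<Longrightarrow> w \<sqsubseteq> w" by (simp add: wle_def)
lemma wle_trans: "w \<sqsubseteq> w' \<Longrightarrow> w' \<sqsubseteq> w'' \<Longrightarrow> w \<sqsubseteq> w''" by (auto simp: wle_def)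
lemma wle_world: "w \<sqsubseteq> w' \<Longrightarrow> world w'" by (simp add: wle_def)
lemma tr_mono: "tr w \<Phi> \<Longrightarrow> w \<sqsubseteq> w' \<Longrightarrow> tr w' \<Phi>" by (auto simp: tr_def wle_def)
lemma elt_mono: "elt w \<sigma> t \<Longrightarrow> w \<sqsubseteq> w' \<Longrightarrow> elt w' \<sigma> t" by (auto simp: elt_def wle_def elim: Term_mono)

lemma tr_Form: "world w \<Longrightarrow> tr w \<Phi> \<Longrightarrow> Form (lvl w) \<Phi>"
  by (auto simp: world_def tr_def)

lemma tr_ded: "world w \<Longrightarrow> Form (lvl w) \<Phi> \<Longrightarrow> ded (thry w) \<Phi> \<longleftrightarrow> tr w \<Phi>"
  by (auto simp: world_def tr_def intro: ded_Hyp)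

lemma Form_simps [simp]:
  "Form n (And \<Phi> \<Psi>) \<longleftrightarrow> Form n \<Phi> \<and> Form n \<Psi>"
  "Form n (Or \<Phi> \<Psi>) \<longleftrightarrow> Form n \<Phi> \<and> Form n \<Psi>"
  "Form n (Imp \<Phi> \<Psi>) \<longleftrightarrow> Form n \<Phi> \<and> Form n \<Psi>"
proof -
  have "\<exists>N. wff (GN N) \<Phi> \<and> wff (GN N) \<Psi>" if a: "frm \<Phi>" "frm \<Psi>"
  proof -
    obtain N M where "wff (GN N) \<Phi>" "wff (GN M) \<Psi>" using a by (auto simp: frm_def)
    then have "wff (GN (max N M)) \<Phi> \<and> wff (GN (max N M)) \<Psi>"
      using wff_GN_mono[of N \<Phi> "max N M"] wff_GN_mono[of M \<Psi> "max N M"] by simp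
    then show ?thesis ..
  qed
  then have "frm (And \<Phi> \<Psi>) \<longleftrightarrow> frm \<Phi> \<and> frm \<Psi>" "frm (Or \<Phi> \<Psi>) \<longleftrightarrow> frm \<Phi> \<and> frm \<Psi>"
    "frm (Imp \<Phi> \<Psi>) \<longleftrightarrow> frm \<Phi> \<and> frm \<Psi>"
    unfolding frm_def by auto
  then show "Form n (And \<Phi> \<Psi>) \<longleftrightarrow> Form n \<Phi> \<and> Form n \<Psi>"
    "Form n (Or \<Phi> \<Psi>) \<longleftrightarrow> Form n \<Phi> \<and> Form n \<Psi>"
    "Form n (Imp \<Phi> \<Psi>) \<longleftrightarrow> Form n \<Phi> \<and> Form n \<Psi>"
    by (auto simp: Form_def)
qed

lemma tr_Bot: "world w \<Longrightarrow> \<not> tr w Bot"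
  by (simp add: world_def tr_def)

lemma tr_And: "world w \<Longrightarrow> tr w (And \<Phi> \<Psi>) \<longleftrightarrow> tr w \<Phi> \<and> tr w \<Psi>"
proof
  assume w: "world w" and a: "tr w (And \<Phi> \<Psi>)"
  have "Form (lvl w) \<Phi>" "Form (lvl w) \<Psi>" using tr_Form[OF w a] by simp_all
  moreover have "ded (thry w) (And \<Phi> \<Psi>)" using a by (auto simp: tr_def intro: ded_Hyp)
  ultimately show "tr w \<Phi> \<and> tr w \<Psi>" using tr_ded[OF w] ded_AndE by blast
next
  assume w: "world w" and a: "tr w \<Phi> \<and> tr w \<Psi>"
  have "Form (lvl w) (And \<Phi> \<Psi>)" using tr_Form[OF w] a by simp
  moreover have "ded (thry w) (And \<Phi> \<Psi>)" using ded_AndI[OF ded_Hyp ded_Hyp] a unfolding tr_def by blast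
  ultimately show "tr w (And \<Phi> \<Psi>)" using tr_ded[OF w] by blast
qed

lemma tr_Or:
  assumes "world w" "Form (lvl w) \<Phi>" "Form (lvl w) \<Psi>"
  shows "tr w (Or \<Phi> \<Psi>) \<longleftrightarrow> tr w \<Phi> \<or> tr w \<Psi>"
proof
  assume "tr w (Or \<Phi> \<Psi>)"
  then show "tr w \<Phi> \<or> tr w \<Psi>" using assms by (auto simp: world_def tr_def)
next
  assume "tr w \<Phi> \<or> tr w \<Psi>"
  then have "ded (thry w) (Or \<Phi> \<Psi>)" using assms by (intro ded_OrI) (auto simp: tr_def Form_def intro: ded_Hyp)
  then show "tr w (Or \<Phi> \<Psi>)" using assms tr_ded[of w "Or \<Phi> \<Psi>"] by simp
qed

lemma extension:
  assumes w: "world w" and T: "\<And>\<chi>. \<chi> \<in> T \<Longrightarrow> Form n \<chi>" "thry w \<subseteq> T" "lvl w \<le> n"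
    and C: "frm C" "\<not> ded T C"
  obtains w' where "w \<sqsubseteq> w'" "lvl w' = Suc n" "T \<subseteq> thry w'" "\<not> tr w' C"
proof -
  obtain U where "world (World (Suc n) U)" "T \<subseteq> U" "C \<notin> U"
    using prime_extension[of T n C] T(1) C by blast
  then show thesis using that[of "World (Suc n) U"] w T by (auto simp: wle_def tr_def)
qed

text \<open>If the implication fails, \<open>\<Psi>\<close> is not derivable after adding
  \<open>\<Phi>\<close> to the theory, and \<open>extension\<close> yields a later world that
  separates the two.\<close>

lemma tr_Imp:
  assumes w: "world w" and F: "Form (lvl w) \<Phi>" "Form (lvl w) \<Psi>"
  shows "tr w (Imp \<Phi> \<Psi>) \<longleftrightarrow> (\<forall>w'. w \<sqsubseteq> w' \<longrightarrow> tr w' \<Phi> \<longrightarrow> tr w' \<Psi>)"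
proof (intro iffI allI impI)
  fix w' assume a: "tr w (Imp \<Phi> \<Psi>)" "w \<sqsubseteq> w'" "tr w' \<Phi>"
  have "Form (lvl w') \<Psi>" using F(2) a(2) Form_mono by (auto simp: wle_def)
  moreover have "ded (thry w') \<Psi>"
    using ded_ImpE[OF ded_Hyp ded_Hyp] tr_mono[OF a(1,2)] a(3) unfolding tr_def by blast
  ultimately show "tr w' \<Psi>" using tr_ded wle_world[OF a(2)] by blast
next
  assume a: "\<forall>w'. w \<sqsubseteq> w' \<longrightarrow> tr w' \<Phi> \<longrightarrow> tr w' \<Psi>"
  show "tr w (Imp \<Phi> \<Psi>)"
  proof (rule ccontr)
    assume n: "\<not> tr w (Imp \<Phi> \<Psi>)"
    have "\<not> ded (insert \<Phi> (thry w)) \<Psi>"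
    proof
      assume d: "ded (insert \<Phi> (thry w)) \<Psi>"
      have "ded (thry w) (Imp \<Phi> \<Psi>)" using ded_ImpI[OF d] F(1) by (simp add: Form_def)
      then show False using n tr_ded[OF w, of "Imp \<Phi> \<Psi>"] F by simp
    qed
    moreover have "\<And>\<chi>. \<chi> \<in> insert \<Phi> (thry w) \<Longrightarrow> Form (lvl w) \<chi>" using F tr_Form[OF w] by (auto simp: tr_def)
    moreover have "frm \<Psi>" using F by (simp add: Form_def)
    ultimately obtain w' where "w \<sqsubseteq> w'" "insert \<Phi> (thry w) \<subseteq> thry w'" "\<not> tr w' \<Psi>"
      using extension[OF w, of "insert \<Phi> (thry w)" "lvl w" \<Psi>] by (metis order_refl subset_insertI)
    then show False using a unfolding tr_def by blast
  qed
qed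

lemma tr_All:
  assumes w: "world w" and F: "Form (lvl w) (All \<sigma> \<Phi>)"
  shows "tr w (All \<sigma> \<Phi>) \<longleftrightarrow> (\<forall>w'. w \<sqsubseteq> w' \<longrightarrow> (\<forall>t. elt w' \<sigma> t \<longrightarrow> tr w' (inst 0 [t] \<Phi>)))"
proof (intro iffI allI impI)
  fix w' t assume a: "tr w (All \<sigma> \<Phi>)" "w \<sqsubseteq> w'" "elt w' \<sigma> t"
  have "Form (lvl w') (Ex \<sigma> \<Phi>)"
    using Form_mono[OF F, of "lvl w'"] a(2) by (auto simp: wle_def Form_def frm_def)
  then have "Form (lvl w') (inst 0 [t] \<Phi>)" using a(3) by (intro Form_inst) (auto simp: elt_def)
  moreover obtain M where "wt (GN M) t \<sigma>" using a(3) by (auto simp: elt_def Term_def)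
  then have "ded (thry w') (inst 0 [t] \<Phi>)"
    using ded_AllE[OF ded_Hyp] tr_mono[OF a(1,2)] unfolding tr_def by blast
  ultimately show "tr w' (inst 0 [t] \<Phi>)" using tr_ded wle_world[OF a(2)] by blast
next
  assume a: "\<forall>w'. w \<sqsubseteq> w' \<longrightarrow> (\<forall>t. elt w' \<sigma> t \<longrightarrow> tr w' (inst 0 [t] \<Phi>))"
  let ?n = "lvl w"
  show "tr w (All \<sigma> \<Phi>)"
  proof (rule ccontr)
    assume n: "\<not> tr w (All \<sigma> \<Phi>)"
    obtain c where c: "lev c = ?n" "tyv c = \<sigma>" using ex_var by blast
    have "\<not> ded (thry w) (inst 0 [Var c] \<Phi>)"
    proof
      assume d: "ded (thry w) (inst 0 [Var c] \<Phi>)"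
      have "ded (thry w) (All (tyv c) \<Phi>)"
        using d by (rule ded_fresh_All)
          (use fresh_Form[OF tr_Form[OF w], of _ c] fresh_Form[OF F, of c] c in \<open>auto simp: tr_def\<close>)
      then show False using n tr_ded[OF w F] c by simp
    qed
    moreover have "Form (Suc ?n) (Ex \<sigma> \<Phi>)"
      using Form_mono[OF F, of "Suc ?n"] by (auto simp: Form_def frm_def)
    then have "Form (Suc ?n) (inst 0 [Var c] \<Phi>)" using Form_inst Term_Var[of c "Suc ?n"] c by simp
    then have "frm (inst 0 [Var c] \<Phi>)" by (simp add: Form_def)
    moreover have "\<And>\<chi>. \<chi> \<in> thry w \<Longrightarrow> Form (Suc ?n) \<chi>" using Form_mono[OF tr_Form[OF w]] by (auto simp: tr_def)
    \<comment> \<open>The level grows by two: once for the variable \<open>c\<close>, which is fresh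
      at level \<open>?n\<close>, and once for the witnesses of the extension.\<close>
    ultimately obtain w' where w': "w \<sqsubseteq> w'" "lvl w' = Suc (Suc ?n)" "\<not> tr w' (inst 0 [Var c] \<Phi>)"
      using extension[OF w, of "thry w" "Suc ?n" "inst 0 [Var c] \<Phi>"] by (metis order_refl le_SucI)
    have "elt w' \<sigma> (Var c)" using Term_Var[of c "lvl w'"] w'(2) c by (simp add: elt_def)
    with a w' show False by blast
  qed
qed

text \<open>No later worlds are involved, since a world contains witnesses for its existential
  formulas.\<close>

lemma tr_Ex:
  assumes w: "world w" and F: "Form (lvl w) (Ex \<sigma> \<Phi>)"
  shows "tr w (Ex \<sigma> \<Phi>) \<longleftrightarrow> (\<exists>t. elt w \<sigma> t \<and> tr w (inst 0 [t] \<Phi>))"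
proof
  assume "tr w (Ex \<sigma> \<Phi>)"
  then show "\<exists>t. elt w \<sigma> t \<and> tr w (inst 0 [t] \<Phi>)" using w by (auto simp: world_def tr_def elt_def)
next
  assume "\<exists>t. elt w \<sigma> t \<and> tr w (inst 0 [t] \<Phi>)"
  then obtain t M where "wt (GN M) t \<sigma>" "tr w (inst 0 [t] \<Phi>)" by (auto simp: elt_def Term_def)
  then have "ded (thry w) (Ex \<sigma> \<Phi>)" using F by (intro ded_ExI[OF ded_Hyp]) (auto simp: Form_def tr_def)
  then show "tr w (Ex \<sigma> \<Phi>)" using tr_ded[OF w F] by simp
qed

subsection \<open>Environments\<close>

definition envs :: "world \<Rightarrow> ty list \<Rightarrow> (nat \<Rightarrow> tm) \<Rightarrow> bool" where
  "envs w \<Gamma> e \<longleftrightarrow> (\<forall>i < length \<Gamma>. elt w (\<Gamma> ! i) (e i))"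

text \<open>The context argument only records the types of the environment; it lets the clauses below be
  used as conditional rewrite rules.\<close>

definition fc :: "world \<Rightarrow> ty list \<Rightarrow> (nat \<Rightarrow> tm) \<Rightarrow> fm \<Rightarrow> bool" where
  "fc w \<Gamma> e \<Phi> \<longleftrightarrow> tr w (fsub e \<Phi>)"

abbreviation "std w \<sigma> t \<equiv> tr w (St \<sigma> t)"
abbreviation "eqw w \<sigma> s t \<equiv> tr w (Eq \<sigma> s t)"
abbreviation "mem w \<sigma> t s \<equiv> tr w (In \<sigma> t s)"

lemma envs_Nil [simp]: "envs w [] e" by (simp add: envs_def)
lemma envs_Cons [simp]: "envs w (\<sigma> # \<Gamma>) (t ## e) \<longleftrightarrow> elt w \<sigma> t \<and> envs w \<Gamma> e"
  by (auto simp: envs_def nth_Cons split: nat.split)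
lemma envs_mono: "envs w \<Gamma> e \<Longrightarrow> w \<sqsubseteq> w' \<Longrightarrow> envs w' \<Gamma> e"
  by (auto simp: envs_def elim: elt_mono)
lemma fc_mono: "fc w \<Gamma> e \<Phi> \<Longrightarrow> w \<sqsubseteq> w' \<Longrightarrow> fc w' \<Gamma> e \<Phi>"
  unfolding fc_def by (rule tr_mono)

lemma envs_wtenv: "envs w \<Gamma> e \<Longrightarrow> \<exists>N. wtenv (GN N) e \<Gamma>"
proof (induction \<Gamma> rule: rev_induct)
  case (snoc \<sigma> \<Gamma>)
  have a: "elt w ((\<Gamma> @ [\<sigma>]) ! i) (e i)" if "i < Suc (length \<Gamma>)" for i
    using snoc.prems that by (simp add: envs_def)
  have "elt w (\<Gamma> ! i) (e i)" if "i < length \<Gamma>" for i using a[of i] that by (simp add: nth_append)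
  then have "envs w \<Gamma> e" by (simp add: envs_def)
  moreover have "elt w \<sigma> (e (length \<Gamma>))" using a[of "length \<Gamma>"] by simp
  ultimately obtain N M where "wtenv (GN N) e \<Gamma>" "wt (GN M) (e (length \<Gamma>)) \<sigma>"
    using snoc.IH by (auto simp: elt_def Term_def)
  then have "wtenv (GN (max N M)) e (\<Gamma> @ [\<sigma>])"
    using wt_GN_mono[of N _ _ "max N M"] wt_GN_mono[of M _ _ "max N M"]
    by (auto simp: wtenv_def nth_append less_Suc_eq)
  then show ?case ..
qed (simp add: wtenv_def)

lemma envs_kap: "envs w \<Gamma> e \<Longrightarrow> \<forall>i < length \<Gamma>. sub (kap (lvl w)) (e i) = e i"
  by (auto simp: envs_def elt_def Term_def)

lemma Form_fsub: "wff \<Gamma> \<Phi> \<Longrightarrow> envs w \<Gamma> e \<Longrightarrow> Form (lvl w) (fsub e \<Phi>)"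
  unfolding Form_def frm_def fsub_fsub
  using envs_wtenv[of w \<Gamma> e] wff_fsub[of \<Gamma> \<Phi>] fsub_cong[OF _ envs_kap, of \<Gamma> \<Phi> w e] by auto

lemma elt_sub: "wt \<Gamma> t \<tau> \<Longrightarrow> envs w \<Gamma> e \<Longrightarrow> elt w \<tau> (sub e t)"
  unfolding elt_def Term_def sub_sub
  using envs_wtenv[of w \<Gamma> e] wt_sub[of \<Gamma> t \<tau>] sub_cong[OF _ envs_kap, of \<Gamma> t \<tau> w e] by auto

lemma elt_App: "elt w (\<sigma> \<rightarrow> \<tau>) f \<Longrightarrow> elt w \<sigma> t \<Longrightarrow> elt w \<tau> (f \<cdot> t)"
  using elt_sub[of "[\<sigma> \<rightarrow> \<tau>, \<sigma>]" "Var 0 \<cdot> Var 1" \<tau> w "f ## t ## Var"] by (auto simp: wt_App_iff)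

lemma elt_closed: "wt [] t \<tau> \<Longrightarrow> elt w \<tau> t"
  using elt_sub[of "[]" t \<tau> w Var] by simp

section \<open>Truth conditions of the connectives under an environment\<close>

lemma fc_Bot [simp]: "world w \<Longrightarrow> \<not> fc w \<Gamma> e Bot"
  by (simp add: fc_def tr_Bot)
lemma fc_And [simp]: "world w \<Longrightarrow> fc w \<Gamma> e (And \<Phi> \<Psi>) \<longleftrightarrow> fc w \<Gamma> e \<Phi> \<and> fc w \<Gamma> e \<Psi>"
  by (simp add: fc_def tr_And)
lemma fc_Or [simp]: "world w \<Longrightarrow> wff \<Gamma> \<Phi> \<Longrightarrow> wff \<Gamma> \<Psi> \<Longrightarrow> envs w \<Gamma> e \<Longrightarrow>
    fc w \<Gamma> e (Or \<Phi> \<Psi>) \<longleftrightarrow> fc w \<Gamma> e \<Phi> \<or> fc w \<Gamma> e \<Psi>"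
  by (simp add: fc_def tr_Or Form_fsub)
lemma fc_Imp [simp]: "world w \<Longrightarrow> wff \<Gamma> \<Phi> \<Longrightarrow> wff \<Gamma> \<Psi> \<Longrightarrow> envs w \<Gamma> e \<Longrightarrow>
    fc w \<Gamma> e (Imp \<Phi> \<Psi>) \<longleftrightarrow> (\<forall>w'. w \<sqsubseteq> w' \<longrightarrow> fc w' \<Gamma> e \<Phi> \<longrightarrow> fc w' \<Gamma> e \<Psi>)"
  by (simp add: fc_def tr_Imp Form_fsub)
lemma fc_All [simp]: "world w \<Longrightarrow> wff (\<sigma> # \<Gamma>) \<Phi> \<Longrightarrow> envs w \<Gamma> e \<Longrightarrow>
    fc w \<Gamma> e (All \<sigma> \<Phi>) \<longleftrightarrow> (\<forall>w'. w \<sqsubseteq> w' \<longrightarrow> (\<forall>t. elt w' \<sigma> t \<longrightarrow> fc w' (\<sigma> # \<Gamma>) (t ## e) \<Phi>))"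
  using Form_fsub[of \<Gamma> "All \<sigma> \<Phi>" w e] by (simp add: fc_def tr_All inst_0_fsub_up)
lemma fc_Ex [simp]: "world w \<Longrightarrow> wff (\<sigma> # \<Gamma>) \<Phi> \<Longrightarrow> envs w \<Gamma> e \<Longrightarrow>
    fc w \<Gamma> e (Ex \<sigma> \<Phi>) \<longleftrightarrow> (\<exists>t. elt w \<sigma> t \<and> fc w (\<sigma> # \<Gamma>) (t ## e) \<Phi>)"
  using Form_fsub[of \<Gamma> "Ex \<sigma> \<Phi>" w e] by (simp add: fc_def tr_Ex inst_0_fsub_up)
lemma fc_Eq [simp]: "fc w \<Gamma> e (Eq \<sigma> s t) \<longleftrightarrow> eqw w \<sigma> (sub e s) (sub e t)"
  by (simp add: fc_def)
lemma fc_St [simp]: "fc w \<Gamma> e (St \<sigma> t) \<longleftrightarrow> std w \<sigma> (sub e t)"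
  by (simp add: fc_def)
lemma fc_In [simp]: "fc w \<Gamma> e (In \<sigma> s t) \<longleftrightarrow> mem w \<sigma> (sub e s) (sub e t)"
  by (simp add: fc_def)

text \<open>An environment is a substitution into the shared context, so it carries the derivation
  to one of the instance, and worlds are deductively closed.\<close>

lemma soundness:
  assumes "prv lang_st H \<Gamma> [] \<Phi>" "wff \<Gamma> \<Phi>" "world w" "envs w \<Gamma> e"
  shows "fc w \<Gamma> e \<Phi>"
proof -
  obtain N where N: "wtenv (GN N) e \<Gamma>" using envs_wtenv assms(4) by blast
  have "ded (thry w) (fsub e \<Phi>)"
    using prv_H_fsub[OF assms(1) N] unfolding ded_def by (intro exI[of _ N] exI[of _ "[]"]) simp
  then show ?thesis using tr_ded[OF assms(3) Form_fsub[OF assms(2,4)]] by (simp add: fc_def)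
qed

lemma fc_H: "\<Phi> \<in> H \<Gamma> \<Longrightarrow> wff \<Gamma> \<Phi> \<Longrightarrow> world w \<Longrightarrow> envs w \<Gamma> e \<Longrightarrow> fc w \<Gamma> e \<Phi>"
  by (rule soundness[OF prv.Ax])

lemma fc_EHA: "\<Phi> \<in> EHA \<Gamma> \<Longrightarrow> wff \<Gamma> \<Phi> \<Longrightarrow> world w \<Longrightarrow> envs w \<Gamma> e \<Longrightarrow> fc w \<Gamma> e \<Phi>"
  by (rule fc_H[OF H.EHA_st[OF EHA_st.base]])

lemma fc_EHA_st: "\<Phi> \<in> EHA_st \<Gamma> \<Longrightarrow> wff \<Gamma> \<Phi> \<Longrightarrow> world w \<Longrightarrow> envs w \<Gamma> e \<Longrightarrow> fc w \<Gamma> e \<Phi>"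
  by (rule fc_H[OF H.EHA_st])

text \<open>The variables of \<open>\<Gamma>\<close> are sent to distinct variables of level 0 with
  the same types. If \<open>\<Phi>\<close> were underivable, so would be its image, because
  \<open>s\<close> translates back and fills all other variables with defaults. A prime theory of
  level 1 then omits the image.\<close>

theorem completeness:
  assumes wf: "wff \<Gamma> \<Phi>" and valid: "\<And>w e. world w \<Longrightarrow> envs w \<Gamma> e \<Longrightarrow> fc w \<Gamma> e \<Phi>"
  shows "prv lang_st H \<Gamma> [] \<Phi>"
proof (rule ccontr)
  assume np: "\<not> prv lang_st H \<Gamma> [] \<Phi>"
  define v where "v i = to_nat (\<Gamma> ! i, 0::nat, i)" for i
  have v: "tyv (v i) = \<Gamma> ! i" "lev (v i) = 0" for i by (simp_all add: v_def tyv_def lev_def)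
  have inj: "v i = v j \<longleftrightarrow> i = j" for i j by (auto simp: v_def)
  let ?e = "\<lambda>i. Var (v i)"
  have wt: "wt (GN N) (?e i) (\<Gamma> ! i)" if "v i < N" for i N using that v by simp
  have Term: "Term (Suc n) (\<Gamma> ! i) (?e i)" for i n using Term_Var[of "v i" "Suc n"] v by simp
  have "wtenv (GN (Suc (Max (insert 0 (v ` {..<length \<Gamma>}))))) ?e \<Gamma>"
    unfolding wtenv_def by (intro allI impI wt) (simp add: less_Suc_eq_le)
  then have frm: "frm (fsub ?e \<Phi>)" unfolding frm_def using wff_fsub[OF wf] by blast
  define s where "s j = (if \<exists>i < length \<Gamma>. v i = j then Var (THE i. v i = j) else dflt (tyv j))" for j
  have "\<not> ded {} (fsub ?e \<Phi>)"
  proof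
    assume "ded {} (fsub ?e \<Phi>)"
    then obtain N where d: "prv lang_st H (GN N) [] (fsub ?e \<Phi>)" by (auto simp: ded_def)
    have "wtenv \<Gamma> s (GN N)"
      unfolding wtenv_def by (auto simp: s_def v inj wt_dflt)
    from prv_H_fsub[OF d this] have "prv lang_st H \<Gamma> [] (fsub (\<lambda>i. s (v i)) \<Phi>)" by (simp add: fsub_fsub)
    moreover have "fsub (\<lambda>i. s (v i)) \<Phi> = fsub Var \<Phi>"
      by (rule fsub_cong[OF wf]) (auto simp: s_def inj)
    ultimately show False using np by simp
  qed
  then obtain U where U: "world (World (Suc 0) U)" "fsub ?e \<Phi> \<notin> U"
    using prime_extension[of "{}" 0 "fsub ?e \<Phi>"] frm by blast
  then have "fc (World (Suc 0) U) \<Gamma> ?e \<Phi>" using valid Term by (simp add: envs_def elt_def)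
  with U(2) show False by (simp add: fc_def tr_def)
qed

section \<open>Arithmetic and sequences in a world\<close>

declare wle_world [simp] wle_refl [simp del]
lemma elt_mono' [simp]: "w \<sqsubseteq> w' \<Longrightarrow> elt w \<sigma> t \<Longrightarrow> elt w' \<sigma> t" by (rule elt_mono)
lemma envs_mono' [simp]: "w \<sqsubseteq> w' \<Longrightarrow> envs w \<Gamma> e \<Longrightarrow> envs w' \<Gamma> e" by (rule envs_mono)

lemma eqw_elt: assumes "world w" "eqw w \<sigma> s t" shows "elt w \<sigma> s" "elt w \<sigma> t"
  using tr_Form[OF assms] by (auto simp: Form_def frm_def elt_def Term_def)

lemma std_elt: assumes "world w" "std w \<sigma> t" shows "elt w \<sigma> t"
  using tr_Form[OF assms] by (auto simp: Form_def frm_def elt_def Term_def)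

text \<open>Substituting a default for the new variable undoes the lifting.\<close>

lemma wt_lift_ConsD: "wt (\<sigma> # \<Gamma>) (lift (Suc 0) t) \<tau> \<Longrightarrow> wt \<Gamma> t \<tau>"
  using wt_sub[of "\<sigma> # \<Gamma>" "lift (Suc 0) t" \<tau> \<Gamma> "dflt \<sigma> ## Var"] wtenv_scons[OF wt_dflt wtenv_Var, of \<Gamma> \<sigma>]
  by (simp add: sub_lift)

lemma wff_InD: "wff \<Gamma> (In \<sigma> s t) \<Longrightarrow> wt \<Gamma> s \<sigma> \<and> wt \<Gamma> t (Seq \<sigma>)"
  by (auto simp: In_def nth_tm_def wt_App_iff dest: wt_lift_ConsD)

lemma sub_lift_eqD: "lift (Suc 0) (sub e t) = lift (Suc 0) t \<Longrightarrow> sub e t = t"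
  by (drule arg_cong[where f="sub (Zero ## Var)"]) (simp add: sub_sub)

text \<open>\<open>In\<close> places its arguments, lifted, under a binder. Their types and levels
  can be read off from the formula only after the lifting has been undone.\<close>

lemma mem_elt: assumes "world w" "mem w \<sigma> s t" shows "elt w \<sigma> s" "elt w (Seq \<sigma>) t"
proof -
  have *: "Form (lvl w) (In \<sigma> s t)" using tr_Form[OF assms] .
  then have "In \<sigma> (sub (kap (lvl w)) s) (sub (kap (lvl w)) t) = In \<sigma> s t" by (simp add: Form_def)
  then have "sub (kap (lvl w)) s = s \<and> sub (kap (lvl w)) t = t"
    by (auto simp: In_def nth_tm_def simp del: lift_sub intro: sub_lift_eqD)
  then show "elt w \<sigma> s" "elt w (Seq \<sigma>) t" using * by (auto simp: Form_def frm_def elt_def Term_def dest: wff_InD)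
qed

lemma elt_const [simp]:
  "elt w Base Zero" "elt w (Base \<rightarrow> Base) Succ" "elt w (Seq \<sigma>) (Emp \<sigma>)" "elt w \<sigma> (dflt \<sigma>)"
  by (auto intro!: elt_closed wt_dflt)
lemma elt_Succ [simp]: "elt w Base n \<Longrightarrow> elt w Base (Succ \<cdot> n)"
  by (rule elt_App[OF elt_const(2)])
lemma elt_Prep [simp]: "elt w \<sigma> a \<Longrightarrow> elt w (Seq \<sigma>) s \<Longrightarrow> elt w (Seq \<sigma>) (Prep \<sigma> \<cdot> a \<cdot> s)"
  using elt_sub[of "[\<sigma>, Seq \<sigma>]" "Prep \<sigma> \<cdot> Var 0 \<cdot> Var 1" "Seq \<sigma>" w "a ## s ## Var"] by (auto simp: wt_App_iff)
lemma elt_plus [simp]: "elt w Base s \<Longrightarrow> elt w Base t \<Longrightarrow> elt w Base (plus s t)"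
  using elt_sub[of "[Base, Base]" "plus (Var 0) (Var 1)" Base w "s ## t ## Var"] by (simp add: wt_plus)
lemma elt_len [simp]: "elt w (Seq \<sigma>) s \<Longrightarrow> elt w Base (len \<sigma> s)"
  using elt_sub[of "[Seq \<sigma>]" "len \<sigma> (Var 0)" Base w "s ## Var"] by (simp add: wt_len)
lemma elt_conc [simp]: "elt w (Seq \<sigma>) s \<Longrightarrow> elt w (Seq \<sigma>) t \<Longrightarrow> elt w (Seq \<sigma>) (conc \<sigma> s t)"
  using elt_sub[of "[Seq \<sigma>, Seq \<sigma>]" "conc \<sigma> (Var 0) (Var 1)" "Seq \<sigma>" w "s ## t ## Var"] by (simp add: wt_conc)
lemma elt_sapp [simp]: "elt w (Seq (\<rho> \<rightarrow> Seq \<tau>)) s \<Longrightarrow> elt w \<rho> t \<Longrightarrow> elt w (Seq \<tau>) (sapp \<rho> \<tau> s t)"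
  using elt_sub[of "[Seq (\<rho> \<rightarrow> Seq \<tau>), \<rho>]" "sapp \<rho> \<tau> (Var 0) (Var 1)" "Seq \<tau>" w "s ## t ## Var"]
  by (simp add: wt_sapp)
lemma elt_LRec: "elt w (Seq \<sigma>) s \<Longrightarrow> elt w \<rho> y \<Longrightarrow> elt w (\<rho> \<rightarrow> \<sigma> \<rightarrow> \<rho>) z \<Longrightarrow> elt w \<rho> (LRec \<sigma> \<rho> \<cdot> s \<cdot> y \<cdot> z)"
  by (intro elt_App[of w "\<rho> \<rightarrow> \<sigma> \<rightarrow> \<rho>"] elt_App[of w "\<rho>"] elt_App[of w "Seq \<sigma>"]) (auto intro: elt_closed)
lemma elt_NRec: "elt w Base s \<Longrightarrow> elt w \<rho> y \<Longrightarrow> elt w (\<rho> \<rightarrow> Base \<rightarrow> \<rho>) z \<Longrightarrow> elt w \<rho> (NRec \<rho> \<cdot> s \<cdot> y \<cdot> z)"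
  by (intro elt_App[of w "\<rho> \<rightarrow> Base \<rightarrow> \<rho>"] elt_App[of w "\<rho>"] elt_App[of w "Base"]) (auto intro: elt_closed)

lemma fc_ImpD:
  assumes "world w" "fc w \<Gamma> e (Imp \<Phi> \<Psi>)" "fc w \<Gamma> e \<Phi>"
  shows "fc w \<Gamma> e \<Psi>"
  using assms tr_Form[OF assms(1), of "fsub e (Imp \<Phi> \<Psi>)"] tr_Imp[OF assms(1), of "fsub e \<Phi>" "fsub e \<Psi>"]
    wle_refl[OF assms(1)] unfolding fc_def by simp

text \<open>The later worlds introduced by the quantifier and by the implication merge into one,
  since elements persist.\<close>

lemma fc_All_Imp [simp]:
  assumes "world w" "wff (\<sigma> # \<Gamma>) \<Phi>" "wff (\<sigma> # \<Gamma>) \<Psi>" "envs w \<Gamma> e"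
  shows "fc w \<Gamma> e (All \<sigma> (Imp \<Phi> \<Psi>)) \<longleftrightarrow>
    (\<forall>w'. w \<sqsubseteq> w' \<longrightarrow> (\<forall>t. elt w' \<sigma> t \<longrightarrow> fc w' (\<sigma> # \<Gamma>) (t ## e) \<Phi> \<longrightarrow> fc w' (\<sigma> # \<Gamma>) (t ## e) \<Psi>))"
  (is "?L \<longleftrightarrow> ?R")
proof
  have *: "fc w' (\<sigma> # \<Gamma>) (t ## e) (Imp \<Phi> \<Psi>) \<longleftrightarrow> (\<forall>w''. w' \<sqsubseteq> w'' \<longrightarrow> fc w'' (\<sigma> # \<Gamma>) (t ## e) \<Phi> \<longrightarrow> fc w'' (\<sigma> # \<Gamma>) (t ## e) \<Psi>)"
    if "w \<sqsubseteq> w'" "elt w' \<sigma> t" for w' t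
    using assms that envs_mono[OF assms(4) that(1)] wle_world[OF that(1)] by (intro fc_Imp) auto
  have L: "?L \<longleftrightarrow> (\<forall>w'. w \<sqsubseteq> w' \<longrightarrow> (\<forall>t. elt w' \<sigma> t \<longrightarrow> fc w' (\<sigma> # \<Gamma>) (t ## e) (Imp \<Phi> \<Psi>)))"
    using assms by (intro fc_All) auto
  show ?R if ?L using that * wle_refl[OF wle_world] unfolding L by blast
  show ?L if ?R using that * elt_mono wle_trans unfolding L by blast
qed

lemma fc_All_Iff [simp]:
  assumes "world w" "wff (\<sigma> # \<Gamma>) \<Phi>" "wff (\<sigma> # \<Gamma>) \<Psi>" "envs w \<Gamma> e"
  shows "fc w \<Gamma> e (All \<sigma> (Iff \<Phi> \<Psi>)) \<longleftrightarrow>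
    (\<forall>w'. w \<sqsubseteq> w' \<longrightarrow> (\<forall>t. elt w' \<sigma> t \<longrightarrow> (fc w' (\<sigma> # \<Gamma>) (t ## e) \<Phi> \<longleftrightarrow> fc w' (\<sigma> # \<Gamma>) (t ## e) \<Psi>)))"
proof -
  have "fc w \<Gamma> e (All \<sigma> (Iff \<Phi> \<Psi>)) \<longleftrightarrow> fc w \<Gamma> e (All \<sigma> (Imp \<Phi> \<Psi>)) \<and> fc w \<Gamma> e (All \<sigma> (Imp \<Psi> \<Phi>))"
    using assms fc_And[OF wle_world] by (subst (1 2 3) fc_All) (auto simp del: fc_And fc_Imp)
  then show ?thesis
    unfolding fc_All_Imp[OF assms] fc_All_Imp[OF assms(1,3,2,4)] by blast
qed

lemma fc_Lt [simp]: "fc w \<Gamma> e (Lt s t) \<longleftrightarrow> tr w (Lt (sub e s) (sub e t))"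
  by (simp add: fc_def)
lemma fc_inst_0 [simp]: "fc w \<Gamma> e (inst 0 [t] \<Phi>) \<longleftrightarrow> fc w \<Delta> (sub e t ## e) \<Phi>"
  unfolding fc_def inst_0_single fsub_fsub
  by (rule arg_cong[where f="\<lambda>e. tr w (fsub e \<Phi>)"]) (auto split: nat.split)
lemma wff_inst_0: "wff (\<sigma> # \<Gamma>) \<Phi> \<Longrightarrow> wt \<Gamma> t \<sigma> \<Longrightarrow> wff \<Gamma> (inst 0 [t] \<Phi>)"
  unfolding inst_0_single by (erule wff_fsub) (simp add: wtenv_scons wtenv_Var)
lemma fc_inst_1: "fc w \<Gamma> (x ## e) (inst (Suc 0) [t] \<Phi>) \<longleftrightarrow> fc w \<Delta> (sub (x ## e) t ## e) \<Phi>"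
  unfolding fc_def inst_def fsub_fsub
  by (rule arg_cong[where f="\<lambda>e. tr w (fsub e \<Phi>)"]) (auto split: nat.split)
lemma wff_inst_1: "wff (\<sigma> # \<Gamma>) \<Phi> \<Longrightarrow> wt (\<tau> # \<Gamma>) t \<sigma> \<Longrightarrow> wff (\<tau> # \<Gamma>) (inst (Suc 0) [t] \<Phi>)"
  unfolding inst_def by (erule wff_fsub) (auto simp: wtenv_def nth_Cons split: nat.split)

lemma fc_fsub: "fc w \<Gamma> e (fsub f \<Phi>) \<longleftrightarrow> fc w \<Delta> (\<lambda>i. sub e (f i)) \<Phi>"
  unfolding fc_def fsub_fsub ..

subsection \<open>Equality\<close>

lemma eqw_refl: "world w \<Longrightarrow> elt w \<sigma> t \<Longrightarrow> eqw w \<sigma> t t"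
  using fc_EHA[OF EHA.eq_refl[of "[\<sigma>]" "Var 0" \<sigma>], of w "t ## Var"] by simp

text \<open>The replacement axiom concerns terms of the context, so \<open>s\<close> and
  \<open>t\<close> enter as two additional variables of the environment.\<close>

lemma eq_subst:
  assumes \<phi>: "wff (\<sigma> # \<Gamma>) \<phi>" "internal \<phi>" and w: "world w" "envs w \<Gamma> e"
    and st: "eqw w \<sigma> s t" "fc w (\<sigma> # \<Gamma>) (s ## e) \<phi>"
  shows "fc w (\<sigma> # \<Gamma>) (t ## e) \<phi>"
proof -
  \<comment> \<open>Index 0 remains the place of replacement; the parameters skip the two positions
    taken by \<open>s\<close> and \<open>t\<close>.\<close>
  let ?f = "Var 0 ## (\<lambda>i. Var (i + 3))"
  let ?\<phi> = "fsub ?f \<phi>"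
  have wf: "wff (\<sigma> # \<sigma> # \<sigma> # \<Gamma>) ?\<phi>" by (rule wff_fsub[OF \<phi>(1)]) (auto simp: wtenv_def nth_Cons split: nat.split)
  have inst: "fc w \<Delta> (x ## y ## e) (inst 0 [z] ?\<phi>) \<longleftrightarrow> fc w (\<sigma> # \<Gamma>) (sub (x ## y ## e) z ## e) \<phi>" for \<Delta> x y z
    unfolding fc_inst_0[of _ _ _ _ _ "[]"] fc_fsub[of _ _ _ _ _ "\<sigma> # \<Gamma>"]
    by (rule arg_cong[where f="\<lambda>e. fc w _ e \<phi>"]) (auto simp: numeral_3_eq_3 split: nat.split)
  have "fc w (\<sigma> # \<sigma> # \<Gamma>) (s ## t ## e) (Imp (Eq \<sigma> (Var 0) (Var 1)) (Imp (inst 0 [Var 0] ?\<phi>) (inst 0 [Var 1] ?\<phi>)))"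
    by (rule fc_EHA[OF EHA.eq_repl]) (use wf \<phi> w eqw_elt[OF w(1) st(1)] in \<open>auto simp: lang_int_def wff_inst_0\<close>)
  from fc_ImpD[OF w(1) this] st(1)
  have "fc w (\<sigma> # \<sigma> # \<Gamma>) (s ## t ## e) (Imp (inst 0 [Var 0] ?\<phi>) (inst 0 [Var 1] ?\<phi>))" by simp
  from fc_ImpD[OF w(1) this] st(2) show ?thesis unfolding inst by simp
qed

lemma eq_sym:
  assumes "world w" "eqw w \<sigma> s t"
  shows "eqw w \<sigma> t s"
  using eq_subst[of \<sigma> "[\<sigma>]" "Eq \<sigma> (Var 0) (Var 1)" w "s ## Var" s t] assms eqw_elt[OF assms] eqw_refl by simp

lemma eq_trans [trans]:
  assumes "eqw w \<sigma> s t" "eqw w \<sigma> t u" "world w"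
  shows "eqw w \<sigma> s u"
  using eq_subst[of \<sigma> "[\<sigma>]" "Eq \<sigma> (Var 1) (Var 0)" w "s ## Var" t u] assms eqw_elt[OF assms(3) assms(1)] by simp

lemma eq_App:
  assumes "eqw w (\<sigma> \<rightarrow> \<tau>) f g" "eqw w \<sigma> s t" "world w"
  shows "eqw w \<tau> (f \<cdot> s) (g \<cdot> t)"
proof -
  note e = eqw_elt[OF assms(3) assms(1)] eqw_elt[OF assms(3) assms(2)]
  have "eqw w \<tau> (f \<cdot> s) (f \<cdot> s)" using e assms elt_App eqw_refl by blast
  then have "eqw w \<tau> (f \<cdot> s) (g \<cdot> s)"
    using eq_subst[of "\<sigma> \<rightarrow> \<tau>" "[\<sigma> \<rightarrow> \<tau>, \<sigma>]" "Eq \<tau> (Var 1 \<cdot> Var 2) (Var 0 \<cdot> Var 2)" w "f ## s ## Var" f g] assms e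
    by (auto simp: wt_App_iff)
  then show ?thesis
    using eq_subst[of \<sigma> "[\<sigma> \<rightarrow> \<tau>, \<sigma> \<rightarrow> \<tau>, \<sigma>]" "Eq \<tau> (Var 1 \<cdot> Var 3) (Var 2 \<cdot> Var 0)" w "f ## g ## s ## Var" s t] assms e
    by (auto simp: wt_App_iff)
qed

text \<open>The body \<open>t\<close> is an arbitrary term, so the axiom is used for this very
  redex, over an initial segment of the shared context that types both parts, and not for an open
  instance under an environment.\<close>

lemma eq_beta:
  assumes w: "world w" and e: "elt w (\<sigma> \<rightarrow> \<tau>) (Lam \<sigma> t)" "elt w \<sigma> u"
  shows "eqw w \<tau> (Lam \<sigma> t \<cdot> u) (sub (u ## Var) t)"
proof -
  obtain N where "wt (\<sigma> # GN N) t \<tau>" using e(1) by (auto simp: elt_def Term_def)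
  moreover obtain M where "wt (GN M) u \<sigma>" using e(2) by (auto simp: elt_def Term_def)
  ultimately have wt: "wt (\<sigma> # GN (max N M)) t \<tau>" "wt (GN (max N M)) u \<sigma>"
    using wt_GN_mono[of N "Lam \<sigma> t" "\<sigma> \<rightarrow> \<tau>" "max N M"] wt_GN_mono[of M u \<sigma> "max N M"] by auto
  have "ded (thry w) (Eq \<tau> (Lam \<sigma> t \<cdot> u) (sub (u ## Var) t))"
    unfolding ded_def
    by (intro exI[of _ "max N M"] exI[of _ "[]"])
      (auto intro!: prv.Ax H.EHA_st EHA_st.base EHA.beta wt)
  moreover have "wff (GN (max N M)) (Eq \<tau> (Lam \<sigma> t \<cdot> u) (sub (u ## Var) t))"
    using wt wt_sub[OF wt(1) wtenv_scons[OF wt(2) wtenv_Var]] by (auto simp: wt_App_iff)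
  moreover have "sub (up (kap (lvl w))) t = t" "sub (kap (lvl w)) u = u" using e by (auto simp: elt_def Term_def)
  then have "fsub (kap (lvl w)) (Eq \<tau> (Lam \<sigma> t \<cdot> u) (sub (u ## Var) t)) = Eq \<tau> (Lam \<sigma> t \<cdot> u) (sub (u ## Var) t)"
    by (simp add: sub_beta)
  ultimately show ?thesis
    using tr_ded[OF w, of "Eq \<tau> (Lam \<sigma> t \<cdot> u) (sub (u ## Var) t)"] unfolding Form_def frm_def by blast
qed

lemma eq_beta2:
  assumes w: "world w" and e: "elt w (\<sigma> \<rightarrow> \<tau> \<rightarrow> \<rho>) (Lam \<sigma> (Lam \<tau> t))" "elt w \<sigma> u" "elt w \<tau> v"
  shows "eqw w \<rho> (Lam \<sigma> (Lam \<tau> t) \<cdot> u \<cdot> v) (sub (v ## u ## Var) t)"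
proof -
  have 1: "eqw w (\<tau> \<rightarrow> \<rho>) (Lam \<sigma> (Lam \<tau> t) \<cdot> u) (Lam \<tau> (sub (up (u ## Var)) t))"
    using eq_beta[OF w e(1,2)] by simp
  have "eqw w \<rho> (Lam \<tau> (sub (up (u ## Var)) t) \<cdot> v) (sub (v ## Var) (sub (up (u ## Var)) t))"
    by (rule eq_beta[OF w _ e(3)]) (rule eqw_elt[OF w 1])
  also have "sub (v ## Var) (sub (up (u ## Var)) t) = sub (v ## u ## Var) t"
    unfolding sub_sub scons_up by (rule arg_cong[where f="\<lambda>e. sub e t"]) (auto split: nat.split)
  finally show ?thesis using eq_trans[OF eq_App[OF 1 eqw_refl[OF w e(3)] w]] w by blast
qed

lemma eq_beta3:
  assumes w: "world w" and e: "elt w (\<sigma> \<rightarrow> \<tau> \<rightarrow> \<rho> \<rightarrow> \<pi>) (Lam \<sigma> (Lam \<tau> (Lam \<rho> t)))" "elt w \<sigma> u" "elt w \<tau> v" "elt w \<rho> x"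
  shows "eqw w \<pi> (Lam \<sigma> (Lam \<tau> (Lam \<rho> t)) \<cdot> u \<cdot> v \<cdot> x) (sub (x ## v ## u ## Var) t)"
proof -
  have 1: "eqw w (\<rho> \<rightarrow> \<pi>) (Lam \<sigma> (Lam \<tau> (Lam \<rho> t)) \<cdot> u \<cdot> v) (Lam \<rho> (sub (up (v ## u ## Var)) t))"
    using eq_beta2[OF w e(1-3)] by simp
  have "eqw w \<pi> (Lam \<rho> (sub (up (v ## u ## Var)) t) \<cdot> x) (sub (x ## Var) (sub (up (v ## u ## Var)) t))"
    by (rule eq_beta[OF w _ e(4)]) (rule eqw_elt[OF w 1])
  also have "sub (x ## Var) (sub (up (v ## u ## Var)) t) = sub (x ## v ## u ## Var) t"
    unfolding sub_sub scons_up by (rule arg_cong[where f="\<lambda>e. sub e t"]) (auto split: nat.split)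
  finally show ?thesis using eq_trans[OF eq_App[OF 1 eqw_refl[OF w e(4)] w]] w by blast
qed

lemma eq_ext:
  assumes w: "world w" and fg: "elt w (\<sigma> \<rightarrow> \<tau>) f" "elt w (\<sigma> \<rightarrow> \<tau>) g"
    and eq: "\<And>w' x. w \<sqsubseteq> w' \<Longrightarrow> elt w' \<sigma> x \<Longrightarrow> eqw w' \<tau> (f \<cdot> x) (g \<cdot> x)"
  shows "eqw w (\<sigma> \<rightarrow> \<tau>) f g"
proof -
  have "fc w [\<sigma> \<rightarrow> \<tau>, \<sigma> \<rightarrow> \<tau>] (f ## g ## Var) (Imp (All \<sigma> (Eq \<tau> (lift 1 (Var 0) \<cdot> Var 0) (lift 1 (Var 1) \<cdot> Var 0))) (Eq (\<sigma> \<rightarrow> \<tau>) (Var 0) (Var 1)))"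
    by (rule fc_EHA[OF EHA.ext]) (use w fg in \<open>auto simp: wt_App_iff\<close>)
  from fc_ImpD[OF w this] eq show ?thesis using w fg by (simp add: wt_App_iff)
qed

subsection \<open>Natural numbers\<close>

text \<open>The step is required at all later worlds because the quantified implication in the axiom
  ranges over them.\<close>

lemma nat_induct_w:
  assumes \<phi>: "wff (Base # \<Gamma>) \<phi>" "internal \<phi>" and w: "world w" "envs w \<Gamma> e" and n: "elt w Base n"
    and base: "fc w (Base # \<Gamma>) (Zero ## e) \<phi>"
    and step: "\<And>w' n. w \<sqsubseteq> w' \<Longrightarrow> elt w' Base n \<Longrightarrow> fc w' (Base # \<Gamma>) (n ## e) \<phi> \<Longrightarrow> fc w' (Base # \<Gamma>) (Succ \<cdot> n ## e) \<phi>"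
  shows "fc w (Base # \<Gamma>) (n ## e) \<phi>"
proof -
  have wf: "wff \<Gamma> (inst 0 [Zero] \<phi>)" "wff (Base # \<Gamma>) (inst (Suc 0) [Succ \<cdot> Var 0] \<phi>)"
    using \<phi> by (auto intro!: wff_inst_0 wff_inst_1 simp: wt_App_iff)
  have "fc w \<Gamma> e (Imp (And (inst 0 [Zero] \<phi>) (All Base (Imp \<phi> (inst 1 [Succ \<cdot> Var 0] \<phi>)))) (All Base \<phi>))"
    by (rule fc_EHA[OF EHA.ind]) (use w \<phi> wf in \<open>auto simp: lang_int_def\<close>)
  moreover have "fc w \<Gamma> e (And (inst 0 [Zero] \<phi>) (All Base (Imp \<phi> (inst 1 [Succ \<cdot> Var 0] \<phi>))))"
    using w wf \<phi> base step
    by (auto simp: fc_inst_0[of _ _ _ _ _ "Base # \<Gamma>"] fc_inst_1[of _ _ _ _ _ _ "Base # \<Gamma>"] simp del: fc_inst_0) (meson step wle_trans elt_mono)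
  ultimately have "fc w \<Gamma> e (All Base \<phi>)" by (rule fc_ImpD[OF w(1)])
  then show ?thesis using w \<phi> n wle_refl[OF w(1)] by simp
qed

lemma eq_plus_Zero: "world w \<Longrightarrow> elt w Base t \<Longrightarrow> eqw w Base (plus Zero t) t"
  using fc_EHA[OF EHA.NRec_Zero[of "[Base]" "Var 0" Base "Lam Base (Lam Base (Succ \<cdot> Var 1))"], of w "t ## Var"]
  by (simp add: wt_App_iff plus_def)

lemma eq_NRec_Zero: "world w \<Longrightarrow> elt w \<sigma> y \<Longrightarrow> elt w (\<sigma> \<rightarrow> Base \<rightarrow> \<sigma>) z \<Longrightarrow> eqw w \<sigma> (NRec \<sigma> \<cdot> Zero \<cdot> y \<cdot> z) y"
  using fc_EHA[OF EHA.NRec_Zero[of "[\<sigma>, \<sigma> \<rightarrow> Base \<rightarrow> \<sigma>]" "Var 0" \<sigma> "Var 1"], of w "y ## z ## Var"]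
  by (simp add: wt_App_iff)

lemma eq_NRec_Succ: "world w \<Longrightarrow> elt w Base x \<Longrightarrow> elt w \<sigma> y \<Longrightarrow> elt w (\<sigma> \<rightarrow> Base \<rightarrow> \<sigma>) z \<Longrightarrow>
    eqw w \<sigma> (NRec \<sigma> \<cdot> (Succ \<cdot> x) \<cdot> y \<cdot> z) (z \<cdot> (NRec \<sigma> \<cdot> x \<cdot> y \<cdot> z) \<cdot> x)"
  using fc_EHA[OF EHA.NRec_Succ[of "[Base, \<sigma>, \<sigma> \<rightarrow> Base \<rightarrow> \<sigma>]" "Var 0" "Var 1" \<sigma> "Var 2"], of w "x ## y ## z ## Var"]
  by (simp add: wt_App_iff)

lemma eq_LRec_Emp: "world w \<Longrightarrow> elt w \<rho> y \<Longrightarrow> elt w (\<rho> \<rightarrow> \<sigma> \<rightarrow> \<rho>) z \<Longrightarrow> eqw w \<rho> (LRec \<sigma> \<rho> \<cdot> Emp \<sigma> \<cdot> y \<cdot> z) y"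
  using fc_EHA[OF EHA.LRec_Emp[of "[\<rho>, \<rho> \<rightarrow> \<sigma> \<rightarrow> \<rho>]" "Var 0" \<rho> "Var 1" \<sigma>], of w "y ## z ## Var"]
  by (simp add: wt_App_iff)

lemma eq_LRec_Prep: "world w \<Longrightarrow> elt w \<sigma> a \<Longrightarrow> elt w (Seq \<sigma>) x \<Longrightarrow> elt w \<rho> y \<Longrightarrow> elt w (\<rho> \<rightarrow> \<sigma> \<rightarrow> \<rho>) z \<Longrightarrow>
    eqw w \<rho> (LRec \<sigma> \<rho> \<cdot> (Prep \<sigma> \<cdot> a \<cdot> x) \<cdot> y \<cdot> z) (z \<cdot> (LRec \<sigma> \<rho> \<cdot> x \<cdot> y \<cdot> z) \<cdot> a)"
  using fc_EHA[OF EHA.LRec_Prep[of "[\<sigma>, Seq \<sigma>, \<rho>, \<rho> \<rightarrow> \<sigma> \<rightarrow> \<rho>]" "Var 0" \<sigma> "Var 1" "Var 2" \<rho> "Var 3"], of w "a ## x ## y ## z ## Var"]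
  by (simp add: wt_App_iff)

lemma eq_plus_Succ:
  assumes w: "world w" and e: "elt w Base s" "elt w Base t"
  shows "eqw w Base (plus (Succ \<cdot> s) t) (Succ \<cdot> plus s t)"
proof -
  let ?K = "Lam Base (Lam Base (Succ \<cdot> Var 1))"
  have K: "elt w (Base \<rightarrow> Base \<rightarrow> Base) ?K" by (rule elt_closed) (simp add: wt_App_iff)
  have "eqw w Base (plus (Succ \<cdot> s) t) (?K \<cdot> plus s t \<cdot> s)"
    using eq_NRec_Succ[OF w e(1) e(2) K] by (simp add: plus_def)
  also have "eqw w Base (?K \<cdot> plus s t \<cdot> s) (Succ \<cdot> plus s t)"
    using eq_beta2[OF w K, of "plus s t" s] e by simp
  finally show ?thesis using w by blast
qed

lemma not_Succ_eq_Zero: "world w \<Longrightarrow> \<not> eqw w Base (Succ \<cdot> t) Zero"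
proof
  assume w: "world w" and e: "eqw w Base (Succ \<cdot> t) Zero"
  have "elt w Base (Succ \<cdot> t)" using eqw_elt[OF w e] by blast
  then have t: "elt w Base t" unfolding elt_def Term_def by (auto simp: wt_App_iff)
  have "fc w [Base] (t ## Var) (Imp (Eq Base (Succ \<cdot> Var 0) Zero) Bot)"
    by (rule fc_EHA[OF EHA.Succ_neq_Zero]) (use w t in \<open>auto simp: wt_App_iff\<close>)
  from fc_ImpD[OF w this] e have "fc w [Base] (t ## Var) Bot" by simp
  then show False using fc_Bot[OF w] by blast
qed

lemma Succ_inj:
  assumes "world w" "elt w Base s" "elt w Base t" "eqw w Base (Succ \<cdot> s) (Succ \<cdot> t)"
  shows "eqw w Base s t"
proof -
  have "fc w [Base, Base] (s ## t ## Var) (Imp (Eq Base (Succ \<cdot> Var 0) (Succ \<cdot> Var 1)) (Eq Base (Var 0) (Var 1)))"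
    by (rule fc_EHA[OF EHA.Succ_inj]) (use assms in \<open>auto simp: wt_App_iff\<close>)
  from fc_ImpD[OF assms(1) this] assms show ?thesis by simp
qed

lemma nat_cases_w:
  assumes "world w" "elt w Base n"
  shows "eqw w Base n Zero \<or> (\<exists>m. elt w Base m \<and> eqw w Base n (Succ \<cdot> m))"
proof -
  let ?\<phi> = "Or (Eq Base (Var 0) Zero) (Ex Base (Eq Base (Var 1) (Succ \<cdot> Var 0)))"
  have sem: "fc v [Base] (k ## Var) ?\<phi> \<longleftrightarrow> eqw v Base k Zero \<or> (\<exists>m. elt v Base m \<and> eqw v Base k (Succ \<cdot> m))"
    if "world v" "elt v Base k" for v k
    using that by (simp add: wt_App_iff)
  have "fc w [Base] (n ## Var) ?\<phi>"
  proof (rule nat_induct_w)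
    show "fc w [Base] (Zero ## Var) ?\<phi>" using sem assms eqw_refl by simp
    show "fc v [Base] (Succ \<cdot> k ## Var) ?\<phi>" if "w \<sqsubseteq> v" "elt v Base k" for v k
      using sem[of v "Succ \<cdot> k"] that eqw_refl[of v Base "Succ \<cdot> k"] by auto
  qed (use assms in \<open>auto simp: wt_App_iff\<close>)
  then show ?thesis using assms sem by blast
qed

lemma lt_iff:
  assumes "world w" "elt w Base i" "elt w Base n"
  shows "tr w (Lt i n) \<longleftrightarrow> (\<exists>z. elt w Base z \<and> eqw w Base (plus i (Succ \<cdot> z)) n)"
proof -
  have "tr w (Lt i n) \<longleftrightarrow> fc w [Base, Base] (i ## n ## Var) (Lt (Var 0) (Var 1))" by simp
  also have "\<dots> \<longleftrightarrow> (\<exists>z. elt w Base z \<and> eqw w Base (plus i (Succ \<cdot> z)) n)"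
    unfolding Lt_def using assms by (simp add: wt_App_iff wt_plus)
  finally show ?thesis .
qed

lemma lt_cong:
  assumes w: "world w" and e: "eqw w Base i j" "eqw w Base m n" and l: "tr w (Lt i m)"
  shows "tr w (Lt j n)"
proof -
  note el = eqw_elt[OF w e(1)] eqw_elt[OF w e(2)]
  have "tr w (Lt j m)"
    using eq_subst[of Base "[Base]" "Lt (Var 0) (Var 1)" w "m ## Var" i j] w e l el by (simp add: wff_Lt)
  then show ?thesis
    using eq_subst[of Base "[Base]" "Lt (Var 1) (Var 0)" w "j ## Var" m n] w e l el by (simp add: wff_Lt)
qed

lemma not_lt_Zero:
  assumes w: "world w" and i: "elt w Base i"
  shows "\<not> tr w (Lt i Zero)"
proof
  assume "tr w (Lt i Zero)"
  then obtain z where z: "elt w Base z" "eqw w Base (plus i (Succ \<cdot> z)) Zero" using lt_iff[OF w i] by auto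
  from nat_cases_w[OF w i] show False
  proof (elim disjE exE conjE)
    assume i0: "eqw w Base i Zero"
    have "tr w (Lt Zero Zero)" by (rule lt_cong[OF w i0 eqw_refl[OF w] \<open>tr w (Lt i Zero)\<close>]) simp
    then obtain y where y: "elt w Base y" "eqw w Base (plus Zero (Succ \<cdot> y)) Zero" using lt_iff[OF w] by auto
    have "eqw w Base (Succ \<cdot> y) Zero"
      using eq_trans[OF eq_sym[OF w eq_plus_Zero[OF w elt_Succ[OF y(1)]]] y(2) w] .
    with not_Succ_eq_Zero[OF w] show False by blast
  next
    fix m assume m: "elt w Base m" "eqw w Base i (Succ \<cdot> m)"
    have "tr w (Lt (Succ \<cdot> m) Zero)" by (rule lt_cong[OF w m(2) eqw_refl[OF w] \<open>tr w (Lt i Zero)\<close>]) simp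
    then obtain y where y: "elt w Base y" "eqw w Base (plus (Succ \<cdot> m) (Succ \<cdot> y)) Zero" using lt_iff[OF w elt_Succ[OF m(1)]] by auto
    have "eqw w Base (Succ \<cdot> plus m (Succ \<cdot> y)) Zero"
      using eq_trans[OF eq_sym[OF w eq_plus_Succ[OF w m(1) elt_Succ[OF y(1)]]] y(2) w] .
    with not_Succ_eq_Zero[OF w] show False by blast
  qed
qed

lemma lt_Zero_Succ: "world w \<Longrightarrow> elt w Base n \<Longrightarrow> tr w (Lt Zero (Succ \<cdot> n))"
  by (auto simp: lt_iff eq_plus_Zero)

text \<open>The same difference \<open>z\<close> witnesses both inequalities, because
  \<open>plus\<close> recurses on its left argument.\<close>

lemma lt_Succ_Succ:
  assumes w: "world w" and e: "elt w Base i" "elt w Base n"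
  shows "tr w (Lt (Succ \<cdot> i) (Succ \<cdot> n)) \<longleftrightarrow> tr w (Lt i n)"
proof -
  have "eqw w Base (plus (Succ \<cdot> i) (Succ \<cdot> z)) (Succ \<cdot> n) \<longleftrightarrow> eqw w Base (plus i (Succ \<cdot> z)) n"
    if z: "elt w Base z" for z
  proof
    note p = eq_plus_Succ[OF w e(1) elt_Succ[OF z]]
    assume "eqw w Base (plus (Succ \<cdot> i) (Succ \<cdot> z)) (Succ \<cdot> n)"
    from eq_trans[OF eq_sym[OF w p] this w] show "eqw w Base (plus i (Succ \<cdot> z)) n"
      using Succ_inj[OF w] z e by simp
  next
    assume "eqw w Base (plus i (Succ \<cdot> z)) n"
    from eq_App[OF eqw_refl[OF w elt_const(2)] this w]
    show "eqw w Base (plus (Succ \<cdot> i) (Succ \<cdot> z)) (Succ \<cdot> n)"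
      using eq_trans[OF eq_plus_Succ[OF w e(1) elt_Succ[OF z]] _ w] by blast
  qed
  then show ?thesis using e by (auto simp: lt_iff[OF w])
qed

subsection \<open>Length and entries\<close>

lemma eq_len_Emp: "world w \<Longrightarrow> eqw w Base (len \<sigma> (Emp \<sigma>)) Zero"
  unfolding len_def by (rule eq_LRec_Emp) (auto intro!: elt_closed simp: wt_App_iff)

lemma eq_len_Prep:
  assumes w: "world w" and e: "elt w \<sigma> a" "elt w (Seq \<sigma>) s"
  shows "eqw w Base (len \<sigma> (Prep \<sigma> \<cdot> a \<cdot> s)) (Succ \<cdot> len \<sigma> s)"
proof -
  let ?K = "Lam Base (Lam \<sigma> (Succ \<cdot> Var 1))"
  have K: "elt w (Base \<rightarrow> \<sigma> \<rightarrow> Base) ?K" by (rule elt_closed) (simp add: wt_App_iff)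
  have "eqw w Base (len \<sigma> (Prep \<sigma> \<cdot> a \<cdot> s)) (?K \<cdot> len \<sigma> s \<cdot> a)"
    unfolding len_def by (rule eq_LRec_Prep[OF w e _ K]) simp
  also have "eqw w Base (?K \<cdot> len \<sigma> s \<cdot> a) (Succ \<cdot> len \<sigma> s)"
    using eq_beta2[OF w K, of "len \<sigma> s" a] e by simp
  finally show ?thesis using w by blast
qed

lemma eq_nth_Prep:
  assumes w: "world w" and e: "elt w \<sigma> a" "elt w (Seq \<sigma>) s"
  shows eq_nth_Zero: "eqw w \<sigma> (nth_tm \<sigma> (Prep \<sigma> \<cdot> a \<cdot> s) Zero) a"
    and eq_nth_Succ: "elt w Base i \<Longrightarrow> eqw w \<sigma> (nth_tm \<sigma> (Prep \<sigma> \<cdot> a \<cdot> s) (Succ \<cdot> i)) (nth_tm \<sigma> s i)"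
proof -
  let ?Z = "Lam Base (dflt \<sigma>)"
  let ?B = "\<lambda>r. NRec \<sigma> \<cdot> Var 0 \<cdot> Var 1 \<cdot> Lam \<sigma> (Lam Base (r \<cdot> Var 0))"
  let ?K = "Lam (Base \<rightarrow> \<sigma>) (Lam \<sigma> (Lam Base (?B (Var 4))))"
  let ?r = "LRec \<sigma> (Base \<rightarrow> \<sigma>) \<cdot> s \<cdot> ?Z \<cdot> ?K"
  have K: "elt w ((Base \<rightarrow> \<sigma>) \<rightarrow> \<sigma> \<rightarrow> Base \<rightarrow> \<sigma>) ?K" by (rule elt_closed) (simp add: wt_App_iff)
  have Z: "elt w (Base \<rightarrow> \<sigma>) ?Z" by (rule elt_closed) (simp add: wt_dflt)
  have r: "elt w (Base \<rightarrow> \<sigma>) ?r" by (rule elt_LRec[OF e(2) Z K])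
  \<comment> \<open>The successor case of the number recursion calls the entry function
    \<open>?r\<close> of the tail from under two binders, hence the lifting by 2.\<close>
  let ?N = "Lam \<sigma> (Lam Base (lift 2 ?r \<cdot> Var 0))"
  have N: "elt w (\<sigma> \<rightarrow> Base \<rightarrow> \<sigma>) ?N"
    using elt_sub[of "[Base \<rightarrow> \<sigma>]" "Lam \<sigma> (Lam Base (Var 2 \<cdot> Var 0))" "\<sigma> \<rightarrow> Base \<rightarrow> \<sigma>" w "?r ## Var"] r
    by (simp add: wt_App_iff lift_sub numeral_2_eq_2)
  have step: "eqw w \<sigma> (nth_tm \<sigma> (Prep \<sigma> \<cdot> a \<cdot> s) i) (NRec \<sigma> \<cdot> i \<cdot> a \<cdot> ?N)" if i: "elt w Base i" for i
  proof -
    have "eqw w (Base \<rightarrow> \<sigma>) (LRec \<sigma> (Base \<rightarrow> \<sigma>) \<cdot> (Prep \<sigma> \<cdot> a \<cdot> s) \<cdot> ?Z \<cdot> ?K) (?K \<cdot> ?r \<cdot> a)"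
      by (rule eq_LRec_Prep[OF w e Z K])
    from eq_App[OF this eqw_refl[OF w i] w]
    have "eqw w \<sigma> (nth_tm \<sigma> (Prep \<sigma> \<cdot> a \<cdot> s) i) (?K \<cdot> ?r \<cdot> a \<cdot> i)" by (simp add: nth_tm_def)
    also have "eqw w \<sigma> (?K \<cdot> ?r \<cdot> a \<cdot> i) (sub (i ## a ## ?r ## Var) (?B (Var 4)))"
      by (rule eq_beta3[OF w K r e(1) i])
    also have "sub (i ## a ## ?r ## Var) (?B (Var 4)) = NRec \<sigma> \<cdot> i \<cdot> a \<cdot> ?N"
      by (simp add: numeral_2_eq_2)
    finally show ?thesis using w by blast
  qed
  show "eqw w \<sigma> (nth_tm \<sigma> (Prep \<sigma> \<cdot> a \<cdot> s) Zero) a"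
    using eq_trans[OF step eq_NRec_Zero[OF w e(1) N] w] by simp
  show "eqw w \<sigma> (nth_tm \<sigma> (Prep \<sigma> \<cdot> a \<cdot> s) (Succ \<cdot> i)) (nth_tm \<sigma> s i)" if i: "elt w Base i"
  proof -
    have "eqw w \<sigma> (nth_tm \<sigma> (Prep \<sigma> \<cdot> a \<cdot> s) (Succ \<cdot> i)) (NRec \<sigma> \<cdot> (Succ \<cdot> i) \<cdot> a \<cdot> ?N)" using step i by simp
    also have "eqw w \<sigma> (NRec \<sigma> \<cdot> (Succ \<cdot> i) \<cdot> a \<cdot> ?N) (?N \<cdot> (NRec \<sigma> \<cdot> i \<cdot> a \<cdot> ?N) \<cdot> i)"
      by (rule eq_NRec_Succ[OF w i e(1) N])
    also have "eqw w \<sigma> (?N \<cdot> (NRec \<sigma> \<cdot> i \<cdot> a \<cdot> ?N) \<cdot> i) (sub (i ## (NRec \<sigma> \<cdot> i \<cdot> a \<cdot> ?N) ## Var) (lift 2 ?r \<cdot> Var 0))"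
      by (rule eq_beta2[OF w N elt_NRec[OF i e(1) N] i])
    also have "sub (i ## (NRec \<sigma> \<cdot> i \<cdot> a \<cdot> ?N) ## Var) (lift 2 ?r \<cdot> Var 0) = nth_tm \<sigma> s i"
      by (simp add: nth_tm_def numeral_2_eq_2 del: lift_App)
    finally show ?thesis using w by blast
  qed
qed

subsection \<open>Membership\<close>

lemma mem_iff:
  assumes "world w" "elt w \<sigma> x" "elt w (Seq \<sigma>) s"
  shows "mem w \<sigma> x s \<longleftrightarrow> (\<exists>i. elt w Base i \<and> tr w (Lt i (len \<sigma> s)) \<and> eqw w \<sigma> x (nth_tm \<sigma> s i))"
proof -
  have "mem w \<sigma> x s \<longleftrightarrow> fc w [\<sigma>, Seq \<sigma>] (x ## s ## Var) (In \<sigma> (Var 0) (Var 1))" by simp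
  also have "\<dots> \<longleftrightarrow> (\<exists>i. elt w Base i \<and> tr w (Lt i (len \<sigma> s)) \<and> eqw w \<sigma> x (nth_tm \<sigma> s i))"
    unfolding In_def using assms by (simp add: wff_Lt wt_len wt_nth_tm)
  finally show ?thesis .
qed

lemma mem_cong:
  assumes w: "world w" and e: "eqw w \<sigma> x y" "eqw w (Seq \<sigma>) s t" and m: "mem w \<sigma> x s"
  shows "mem w \<sigma> y t"
proof -
  note el = eqw_elt[OF w e(1)] eqw_elt[OF w e(2)]
  have "mem w \<sigma> y s"
    using eq_subst[of \<sigma> "[Seq \<sigma>]" "In \<sigma> (Var 0) (Var 1)" w "s ## Var" x y] w e m el by (simp add: wff_In)
  then show ?thesis
    using eq_subst[of "Seq \<sigma>" "[\<sigma>]" "In \<sigma> (Var 1) (Var 0)" w "y ## Var" s t] w e m el by (simp add: wff_In)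
qed

lemma mem_cong_iff: "world w \<Longrightarrow> eqw w (Seq \<sigma>) s t \<Longrightarrow> mem w \<sigma> x s \<longleftrightarrow> mem w \<sigma> x t"
  by (meson eq_sym eqw_refl mem_cong mem_elt)

lemma not_mem_Emp: "world w \<Longrightarrow> \<not> mem w \<sigma> x (Emp \<sigma>)"
proof
  assume w: "world w" and m: "mem w \<sigma> x (Emp \<sigma>)"
  then obtain i where i: "elt w Base i" "tr w (Lt i (len \<sigma> (Emp \<sigma>)))"
    using mem_iff[OF w] mem_elt[OF w m] by blast
  have "tr w (Lt i Zero)" by (rule lt_cong[OF w eqw_refl[OF w i(1)] eq_len_Emp[OF w] i(2)])
  then show False using not_lt_Zero[OF w i(1)] by blast
qed

text \<open>Index zero is the head and a successor index points into the tail, where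
  \<open>lt_Succ_Succ\<close> adjusts the bound. By \<open>nat_cases_w\<close> there is no third
  kind of index.\<close>

lemma mem_Prep:
  assumes w: "world w" and e: "elt w \<sigma> a" "elt w (Seq \<sigma>) s"
  shows "mem w \<sigma> x (Prep \<sigma> \<cdot> a \<cdot> s) \<longleftrightarrow> eqw w \<sigma> x a \<or> mem w \<sigma> x s"
proof
  let ?c = "Prep \<sigma> \<cdot> a \<cdot> s"
  have c: "elt w (Seq \<sigma>) ?c" using e by simp
  note l = eq_len_Prep[OF w e]
  {
    assume m: "mem w \<sigma> x ?c"
    note x = mem_elt(1)[OF w m]
    obtain i where i: "elt w Base i" "tr w (Lt i (len \<sigma> ?c))" "eqw w \<sigma> x (nth_tm \<sigma> ?c i)"
      using m mem_iff[OF w x c] by blast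
    have nc: "eqw w \<sigma> x (nth_tm \<sigma> ?c j)" if "eqw w Base i j" for j
      using eq_subst[of Base "[\<sigma>, Seq \<sigma>]" "Eq \<sigma> (Var 1) (nth_tm \<sigma> (Var 2) (Var 0))" w "x ## ?c ## Var" i j] w that i x c
      by (simp add: wt_nth_tm)
    from nat_cases_w[OF w i(1)] show "eqw w \<sigma> x a \<or> mem w \<sigma> x s"
    proof (elim disjE exE conjE)
      assume "eqw w Base i Zero"
      from eq_trans[OF nc[OF this] eq_nth_Zero[OF w e] w] show ?thesis ..
    next
      fix j assume j: "elt w Base j" "eqw w Base i (Succ \<cdot> j)"
      have "tr w (Lt (Succ \<cdot> j) (Succ \<cdot> len \<sigma> s))" by (rule lt_cong[OF w j(2) l i(2)])
      then have "tr w (Lt j (len \<sigma> s))" using lt_Succ_Succ[OF w j(1)] e by simp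
      moreover have "eqw w \<sigma> x (nth_tm \<sigma> s j)" by (rule eq_trans[OF nc[OF j(2)] eq_nth_Succ[OF w e j(1)] w])
      ultimately show ?thesis using mem_iff[OF w x e(2)] j(1) by blast
    qed
  next
    assume "eqw w \<sigma> x a \<or> mem w \<sigma> x s"
    then show "mem w \<sigma> x ?c"
    proof
      assume xa: "eqw w \<sigma> x a"
      have "tr w (Lt Zero (len \<sigma> ?c))"
        by (rule lt_cong[OF w eqw_refl[OF w] eq_sym[OF w l] lt_Zero_Succ[OF w]]) (use e in simp_all)
      moreover have "eqw w \<sigma> x (nth_tm \<sigma> ?c Zero)" by (rule eq_trans[OF xa eq_sym[OF w eq_nth_Zero[OF w e]] w])
      ultimately show ?thesis using mem_iff[OF w eqw_elt(1)[OF w xa] c] elt_const(1) by blast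
    next
      assume m: "mem w \<sigma> x s"
      note x = mem_elt(1)[OF w m]
      obtain i where i: "elt w Base i" "tr w (Lt i (len \<sigma> s))" "eqw w \<sigma> x (nth_tm \<sigma> s i)"
        using m mem_iff[OF w x e(2)] by blast
      have "tr w (Lt (Succ \<cdot> i) (Succ \<cdot> len \<sigma> s))" using lt_Succ_Succ[OF w i(1)] i(2) e by simp
      then have "tr w (Lt (Succ \<cdot> i) (len \<sigma> ?c))"
        by (rule lt_cong[OF w eqw_refl[OF w] eq_sym[OF w l], rotated]) (use i in simp)
      moreover have "eqw w \<sigma> x (nth_tm \<sigma> ?c (Succ \<cdot> i))"
        by (rule eq_trans[OF i(3) eq_sym[OF w eq_nth_Succ[OF w e i(1)]] w])
      ultimately show ?thesis using mem_iff[OF w x c] elt_Succ[OF i(1)] by blast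
    qed
  }
qed

lemma seq_cases_w:
  assumes "world w" "elt w (Seq \<sigma>) s"
  shows "eqw w (Seq \<sigma>) s (Emp \<sigma>) \<or> (\<exists>a t. elt w \<sigma> a \<and> elt w (Seq \<sigma>) t \<and> eqw w (Seq \<sigma>) s (Prep \<sigma> \<cdot> a \<cdot> t))"
proof -
  have "fc w [] Var (All (Seq \<sigma>) (Or (Eq (Seq \<sigma>) (Var 0) (Emp \<sigma>))
      (Ex \<sigma> (Ex (Seq \<sigma>) (Eq (Seq \<sigma>) (Var 2) (Prep \<sigma> \<cdot> Var 1 \<cdot> Var 0))))))"
    by (rule fc_EHA[OF EHA.seq_cases]) (use assms in \<open>auto simp: wt_App_iff\<close>)
  then have "fc w [Seq \<sigma>] (s ## Var) (Or (Eq (Seq \<sigma>) (Var 0) (Emp \<sigma>))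
      (Ex \<sigma> (Ex (Seq \<sigma>) (Eq (Seq \<sigma>) (Var 2) (Prep \<sigma> \<cdot> Var 1 \<cdot> Var 0)))))"
    using assms wle_refl[OF assms(1)] by (subst (asm) fc_All) (auto simp: wt_App_iff simp del: fc_Or fc_Ex)
  then show ?thesis using assms by (simp add: wt_App_iff cong: conj_cong)
qed

text \<open>Sequence induction is not among the axioms; it is obtained by induction on the length.\<close>

lemma seq_induct_w:
  assumes \<phi>: "wff (Seq \<sigma> # \<Gamma>) \<phi>" "internal \<phi>" and w: "world w" "envs w \<Gamma> e" and s: "elt w (Seq \<sigma>) s"
    and base: "fc w (Seq \<sigma> # \<Gamma>) (Emp \<sigma> ## e) \<phi>"
    and step: "\<And>v a s. w \<sqsubseteq> v \<Longrightarrow> elt v \<sigma> a \<Longrightarrow> elt v (Seq \<sigma>) s \<Longrightarrow> fc v (Seq \<sigma> # \<Gamma>) (s ## e) \<phi> \<Longrightarrow>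
      fc v (Seq \<sigma> # \<Gamma>) (Prep \<sigma> \<cdot> a \<cdot> s ## e) \<phi>"
  shows "fc w (Seq \<sigma> # \<Gamma>) (s ## e) \<phi>"
proof -
  let ?f = "Var 0 ## (\<lambda>i. Var (Suc (Suc i)))"
  let ?\<psi> = "All (Seq \<sigma>) (Imp (Eq Base (len \<sigma> (Var 0)) (Var 1)) (fsub ?f \<phi>))"
  have wf: "wff (Seq \<sigma> # Base # \<Gamma>) (fsub ?f \<phi>)"
    by (rule wff_fsub[OF \<phi>(1)]) (auto simp: wtenv_def nth_Cons split: nat.split)
  have ren: "fc v \<Delta> (s ## n ## e) (fsub ?f \<phi>) \<longleftrightarrow> fc v (Seq \<sigma> # \<Gamma>) (s ## e) \<phi>" for v \<Delta> s n
    unfolding fc_fsub[of _ _ _ _ _ "Seq \<sigma> # \<Gamma>"]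
    by (rule arg_cong[where f="\<lambda>e. fc v _ e \<phi>"]) (auto simp: numeral_2_eq_2 split: nat.split)
  have sem: "fc v (Base # \<Gamma>) (n ## e) ?\<psi> \<longleftrightarrow>
      (\<forall>v'. v \<sqsubseteq> v' \<longrightarrow> (\<forall>s. elt v' (Seq \<sigma>) s \<longrightarrow> eqw v' Base (len \<sigma> s) n \<longrightarrow> fc v' (Seq \<sigma> # \<Gamma>) (s ## e) \<phi>))"
    if "w \<sqsubseteq> v" "elt v Base n" for v n
    using wf that w envs_mono[OF w(2) that(1)] wle_world[OF that(1)] by (subst fc_All_Imp) (auto simp: ren wt_len)
  have "fc w (Base # \<Gamma>) (len \<sigma> s ## e) ?\<psi>"
  proof (rule nat_induct_w)
    show "fc w (Base # \<Gamma>) (Zero ## e) ?\<psi>"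
      unfolding sem[OF wle_refl[OF w(1)] elt_const(1)]
    proof (intro allI impI)
      fix v s assume v: "w \<sqsubseteq> v" and s: "elt v (Seq \<sigma>) s" and l: "eqw v Base (len \<sigma> s) Zero"
      note wv = wle_world[OF v]
      from seq_cases_w[OF wv s] show "fc v (Seq \<sigma> # \<Gamma>) (s ## e) \<phi>"
      proof (elim disjE exE conjE)
        assume "eqw v (Seq \<sigma>) s (Emp \<sigma>)"
        from eq_subst[OF \<phi> wv envs_mono[OF w(2) v] eq_sym[OF wv this] fc_mono[OF base v]] show ?thesis .
      next
        fix a t assume a: "elt v \<sigma> a" "elt v (Seq \<sigma>) t" "eqw v (Seq \<sigma>) s (Prep \<sigma> \<cdot> a \<cdot> t)"
        have "eqw v Base (len \<sigma> (Prep \<sigma> \<cdot> a \<cdot> t)) Zero"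
          using eq_subst[of "Seq \<sigma>" "[]" "Eq Base (len \<sigma> (Var 0)) Zero" v Var] wv a l by (simp add: wt_len)
        from eq_trans[OF eq_sym[OF wv eq_len_Prep[OF wv a(1,2)]] this wv] not_Succ_eq_Zero[OF wv] show ?thesis by blast
      qed
    qed
  next
    fix v n assume v: "w \<sqsubseteq> v" and n: "elt v Base n" and ih: "fc v (Base # \<Gamma>) (n ## e) ?\<psi>"
    show "fc v (Base # \<Gamma>) (Succ \<cdot> n ## e) ?\<psi>"
      unfolding sem[OF v elt_Succ[OF n]]
    proof (intro allI impI)
      fix u s assume u: "v \<sqsubseteq> u" and s: "elt u (Seq \<sigma>) s" and l: "eqw u Base (len \<sigma> s) (Succ \<cdot> n)"
      note wu = wle_world[OF u] and vu = wle_trans[OF v u]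
      from seq_cases_w[OF wu s] show "fc u (Seq \<sigma> # \<Gamma>) (s ## e) \<phi>"
      proof (elim disjE exE conjE)
        assume "eqw u (Seq \<sigma>) s (Emp \<sigma>)"
        then have "eqw u Base (len \<sigma> (Emp \<sigma>)) (Succ \<cdot> n)"
          using eq_subst[of "Seq \<sigma>" "[Base]" "Eq Base (len \<sigma> (Var 0)) (Succ \<cdot> Var 1)" u "n ## Var"] wu l elt_mono[OF n u]
          by (simp add: wt_len wt_App_iff)
        from eq_trans[OF eq_sym[OF wu this] eq_len_Emp[OF wu] wu] not_Succ_eq_Zero[OF wu] show ?thesis by blast
      next
        fix a t assume a: "elt u \<sigma> a" "elt u (Seq \<sigma>) t" "eqw u (Seq \<sigma>) s (Prep \<sigma> \<cdot> a \<cdot> t)"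
        have "eqw u Base (len \<sigma> (Prep \<sigma> \<cdot> a \<cdot> t)) (Succ \<cdot> n)"
          using eq_subst[of "Seq \<sigma>" "[Base]" "Eq Base (len \<sigma> (Var 0)) (Succ \<cdot> Var 1)" u "n ## Var"] wu a l elt_mono[OF n u]
          by (simp add: wt_len wt_App_iff)
        from eq_trans[OF eq_sym[OF wu eq_len_Prep[OF wu a(1,2)]] this wu]
        have "eqw u Base (len \<sigma> t) n" using Succ_inj[OF wu] a elt_mono[OF n u] by simp
        then have "fc u (Seq \<sigma> # \<Gamma>) (t ## e) \<phi>" using ih[unfolded sem[OF v n]] u a by blast
        from step[OF vu a(1,2) this]
        show ?thesis using eq_subst[OF \<phi> wu envs_mono[OF w(2) vu] eq_sym[OF wu a(3)]] by blast
      qed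
    qed
  qed (use wf \<phi> w s in \<open>auto simp: wt_len\<close>)
  then show ?thesis
    unfolding sem[OF wle_refl[OF w(1)] elt_len[OF s]] using s eqw_refl[OF w(1) elt_len[OF s]] wle_refl[OF w(1)] by blast
qed

section \<open>Concatenation and recursively formed unions\<close>

lemma eq_conc_Emp: "world w \<Longrightarrow> elt w (Seq \<sigma>) t \<Longrightarrow> eqw w (Seq \<sigma>) (conc \<sigma> (Emp \<sigma>) t) t"
  unfolding conc_def by (rule eq_LRec_Emp) (auto intro!: elt_closed simp: wt_App_iff)

lemma eq_conc_Prep:
  assumes w: "world w" and e: "elt w \<sigma> a" "elt w (Seq \<sigma>) s" "elt w (Seq \<sigma>) t"
  shows "eqw w (Seq \<sigma>) (conc \<sigma> (Prep \<sigma> \<cdot> a \<cdot> s) t) (Prep \<sigma> \<cdot> a \<cdot> conc \<sigma> s t)"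
proof -
  let ?K = "Lam (Seq \<sigma>) (Lam \<sigma> (Prep \<sigma> \<cdot> Var 0 \<cdot> Var 1))"
  have K: "elt w (Seq \<sigma> \<rightarrow> \<sigma> \<rightarrow> Seq \<sigma>) ?K" by (rule elt_closed) (simp add: wt_App_iff)
  have "eqw w (Seq \<sigma>) (conc \<sigma> (Prep \<sigma> \<cdot> a \<cdot> s) t) (?K \<cdot> conc \<sigma> s t \<cdot> a)"
    unfolding conc_def by (rule eq_LRec_Prep[OF w e K])
  also have "eqw w (Seq \<sigma>) (?K \<cdot> conc \<sigma> s t \<cdot> a) (Prep \<sigma> \<cdot> a \<cdot> conc \<sigma> s t)"
    using eq_beta2[OF w K, of "conc \<sigma> s t" a] e by simp
  finally show ?thesis using w by blast
qed

lemma mem_conc: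
  assumes w: "world w" and s: "elt w (Seq \<sigma>) s" and t: "elt w (Seq \<sigma>) t"
  shows "mem w \<sigma> x (conc \<sigma> s t) \<longleftrightarrow> mem w \<sigma> x s \<or> mem w \<sigma> x t"
proof -
  let ?\<phi> = "All \<sigma> (Iff (In \<sigma> (Var 0) (conc \<sigma> (Var 1) (Var 2))) (Or (In \<sigma> (Var 0) (Var 1)) (In \<sigma> (Var 0) (Var 2))))"
  have sem: "fc v [Seq \<sigma>, Seq \<sigma>] (s ## t ## Var) ?\<phi> \<longleftrightarrow>
      (\<forall>v'. v \<sqsubseteq> v' \<longrightarrow> (\<forall>x. elt v' \<sigma> x \<longrightarrow> (mem v' \<sigma> x (conc \<sigma> s t) \<longleftrightarrow> mem v' \<sigma> x s \<or> mem v' \<sigma> x t)))"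
    if "world v" "elt v (Seq \<sigma>) s" "elt v (Seq \<sigma>) t" for v s t
    using that by (subst fc_All_Iff) (auto simp: wff_In wt_conc)
  have "fc w [Seq \<sigma>, Seq \<sigma>] (s ## t ## Var) ?\<phi>"
  proof (rule seq_induct_w)
    show "fc w [Seq \<sigma>, Seq \<sigma>] (Emp \<sigma> ## t ## Var) ?\<phi>"
      unfolding sem[OF w elt_const(3) t]
    proof (intro allI impI)
      fix v x assume v: "w \<sqsubseteq> v"
      show "mem v \<sigma> x (conc \<sigma> (Emp \<sigma>) t) \<longleftrightarrow> mem v \<sigma> x (Emp \<sigma>) \<or> mem v \<sigma> x t"
        using mem_cong_iff[OF wle_world[OF v] eq_conc_Emp[OF wle_world[OF v] elt_mono[OF t v]]]
          not_mem_Emp[OF wle_world[OF v]] by blast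
    qed
  next
    fix v a s assume v: "w \<sqsubseteq> v" and e: "elt v \<sigma> a" "elt v (Seq \<sigma>) s" and ih: "fc v [Seq \<sigma>, Seq \<sigma>] (s ## t ## Var) ?\<phi>"
    note t' = elt_mono[OF t v] and wv = wle_world[OF v]
    show "fc v [Seq \<sigma>, Seq \<sigma>] (Prep \<sigma> \<cdot> a \<cdot> s ## t ## Var) ?\<phi>"
      unfolding sem[OF wv elt_Prep[OF e] t']
    proof (intro allI impI)
      fix u x assume u: "v \<sqsubseteq> u" and x: "elt u \<sigma> x"
      note wu = wle_world[OF u] and e' = elt_mono[OF e(1) u] elt_mono[OF e(2) u] elt_mono[OF t' u]
      show "mem u \<sigma> x (conc \<sigma> (Prep \<sigma> \<cdot> a \<cdot> s) t) \<longleftrightarrow> mem u \<sigma> x (Prep \<sigma> \<cdot> a \<cdot> s) \<or> mem u \<sigma> x t"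
        unfolding mem_cong_iff[OF wu eq_conc_Prep[OF wu e']] mem_Prep[OF wu e'(1) elt_conc[OF e'(2,3)]] mem_Prep[OF wu e'(1,2)]
        using ih[unfolded sem[OF wv e(2) t'], rule_format, OF u x] by blast
    qed
  qed (use assms in \<open>auto simp: wff_In wt_conc\<close>)
  then show ?thesis unfolding sem[OF w s t] using wle_refl[OF w] mem_elt[OF w] by blast
qed

text \<open>Common core of \<open>sapp\<close> and of the bind operation below. Only the members of
  \<open>z \<cdot> r \<cdot> a\<close> matter, so \<open>z\<close> may be any step function that
  joins the members of \<open>f \<cdot> a\<close> to those of \<open>r\<close>.\<close>

lemma mem_LRec:
  assumes w: "world w" and s: "elt w (Seq \<sigma>) s" and z: "elt w (Seq \<tau> \<rightarrow> \<sigma> \<rightarrow> Seq \<tau>) z" and f: "elt w (\<sigma> \<rightarrow> Seq \<tau>) f"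
    and step: "\<And>v r a x. w \<sqsubseteq> v \<Longrightarrow> elt v (Seq \<tau>) r \<Longrightarrow> elt v \<sigma> a \<Longrightarrow> mem v \<tau> x (z \<cdot> r \<cdot> a) \<longleftrightarrow> mem v \<tau> x (f \<cdot> a) \<or> mem v \<tau> x r"
  shows "mem w \<tau> x (LRec \<sigma> (Seq \<tau>) \<cdot> s \<cdot> Emp \<tau> \<cdot> z) \<longleftrightarrow> (\<exists>a. mem w \<sigma> a s \<and> mem w \<tau> x (f \<cdot> a))"
proof -
  let ?R = "\<lambda>s z. LRec \<sigma> (Seq \<tau>) \<cdot> s \<cdot> Emp \<tau> \<cdot> z"
  let ?\<phi> = "All \<tau> (Iff (In \<tau> (Var 0) (?R (Var 1) (Var 2))) (Ex \<sigma> (And (In \<sigma> (Var 0) (Var 2)) (In \<tau> (Var 1) (Var 4 \<cdot> Var 0)))))"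
  let ?\<Gamma> = "[Seq \<sigma>, Seq \<tau> \<rightarrow> \<sigma> \<rightarrow> Seq \<tau>, \<sigma> \<rightarrow> Seq \<tau>]"
  have sem: "fc v ?\<Gamma> (s ## z ## f ## Var) ?\<phi> \<longleftrightarrow>
      (\<forall>v'. v \<sqsubseteq> v' \<longrightarrow> (\<forall>x. elt v' \<tau> x \<longrightarrow> (mem v' \<tau> x (?R s z) \<longleftrightarrow> (\<exists>a. mem v' \<sigma> a s \<and> mem v' \<tau> x (f \<cdot> a)))))"
    if v: "w \<sqsubseteq> v" and s: "elt v (Seq \<sigma>) s" for v s
  proof -
    have "fc v ?\<Gamma> (s ## z ## f ## Var) ?\<phi> \<longleftrightarrow>
      (\<forall>v'. v \<sqsubseteq> v' \<longrightarrow> (\<forall>x. elt v' \<tau> x \<longrightarrow> (mem v' \<tau> x (?R s z) \<longleftrightarrow> (\<exists>a. elt v' \<sigma> a \<and> mem v' \<sigma> a s \<and> mem v' \<tau> x (f \<cdot> a)))))"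
      using s elt_mono[OF z v] elt_mono[OF f v] wle_world[OF v] by (subst fc_All_Iff) (auto simp: wt_App_iff wff_In)
    then show ?thesis using mem_elt(1)[OF wle_world] by blast
  qed
  have "fc w ?\<Gamma> (s ## z ## f ## Var) ?\<phi>"
  proof (rule seq_induct_w)
    show "fc w ?\<Gamma> (Emp \<sigma> ## z ## f ## Var) ?\<phi>"
      unfolding sem[OF wle_refl[OF w] elt_const(3)]
    proof (intro allI impI)
      fix v x assume v: "w \<sqsubseteq> v"
      show "mem v \<tau> x (?R (Emp \<sigma>) z) \<longleftrightarrow> (\<exists>a. mem v \<sigma> a (Emp \<sigma>) \<and> mem v \<tau> x (f \<cdot> a))"
        using mem_cong_iff[OF wle_world[OF v] eq_LRec_Emp[OF wle_world[OF v] elt_const(3) elt_mono[OF z v]]]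
          not_mem_Emp[OF wle_world[OF v]] by blast
    qed
  next
    fix v a s assume v: "w \<sqsubseteq> v" and e: "elt v \<sigma> a" "elt v (Seq \<sigma>) s" and ih: "fc v ?\<Gamma> (s ## z ## f ## Var) ?\<phi>"
    note z' = elt_mono[OF z v] and wv = wle_world[OF v]
    show "fc v ?\<Gamma> (Prep \<sigma> \<cdot> a \<cdot> s ## z ## f ## Var) ?\<phi>"
      unfolding sem[OF v elt_Prep[OF e]]
    proof (intro allI impI)
      fix u x assume u: "v \<sqsubseteq> u" and x: "elt u \<tau> x"
      note wu = wle_world[OF u] and e' = elt_mono[OF e(1) u] elt_mono[OF e(2) u] and z'' = elt_mono[OF z' u]
      have "mem u \<tau> x (?R (Prep \<sigma> \<cdot> a \<cdot> s) z) \<longleftrightarrow> mem u \<tau> x (z \<cdot> ?R s z \<cdot> a)"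
        by (rule mem_cong_iff[OF wu eq_LRec_Prep[OF wu e' elt_const(3) z'']])
      also have "\<dots> \<longleftrightarrow> mem u \<tau> x (f \<cdot> a) \<or> mem u \<tau> x (?R s z)"
        by (rule step[OF wle_trans[OF v u] elt_LRec[OF e'(2) elt_const(3) z''] e'(1)])
      also have "\<dots> \<longleftrightarrow> mem u \<tau> x (f \<cdot> a) \<or> (\<exists>b. mem u \<sigma> b s \<and> mem u \<tau> x (f \<cdot> b))"
        using ih[unfolded sem[OF v e(2)]] u x by blast
      also have "\<dots> \<longleftrightarrow> (\<exists>b. mem u \<sigma> b (Prep \<sigma> \<cdot> a \<cdot> s) \<and> mem u \<tau> x (f \<cdot> b))"
      proof -
        \<comment> \<open>A member of the extended sequence need only be equal to \<open>a\<close>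
          in the sense of the world, so \<open>f\<close> has to respect that equality.\<close>
        have "mem u \<tau> x (f \<cdot> a)" if "eqw u \<sigma> b a" "mem u \<tau> x (f \<cdot> b)" for b
          using mem_cong_iff[OF wu eq_App[OF eqw_refl[OF wu] that(1) wu]] that(2) elt_mono[OF f wle_trans[OF v u]] by blast
        then show ?thesis using mem_Prep[OF wu e'] eqw_refl[OF wu e'(1)] by blast
      qed
      finally show "mem u \<tau> x (?R (Prep \<sigma> \<cdot> a \<cdot> s) z) \<longleftrightarrow> (\<exists>b. mem u \<sigma> b (Prep \<sigma> \<cdot> a \<cdot> s) \<and> mem u \<tau> x (f \<cdot> b))" .
    qed
  qed (use assms in \<open>auto simp: wt_App_iff wff_In\<close>)
  then show ?thesis
    unfolding sem[OF wle_refl[OF w] s] using wle_refl[OF w] mem_elt(1)[OF w] by blast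
qed

subsection \<open>Standard elements\<close>

lemma std_closed: "wt [] t \<sigma> \<Longrightarrow> world w \<Longrightarrow> std w \<sigma> t"
  using fc_EHA_st[OF EHA_st.st_closed[of t \<sigma> "[]"], of w Var] by simp

lemma std_App:
  assumes "world w" "std w (\<sigma> \<rightarrow> \<tau>) f" "std w \<sigma> t"
  shows "std w \<tau> (f \<cdot> t)"
proof -
  have "fc w [\<sigma> \<rightarrow> \<tau>, \<sigma>] (f ## t ## Var) (Imp (And (St (\<sigma> \<rightarrow> \<tau>) (Var 0)) (St \<sigma> (Var 1))) (St \<tau> (Var 0 \<cdot> Var 1)))"
    by (rule fc_EHA_st[OF EHA_st.st_app]) (use assms std_elt[OF assms(1)] in \<open>auto simp: wt_App_iff\<close>)
  from fc_ImpD[OF assms(1) this] show ?thesis using assms by simp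
qed

lemma std_eq:
  assumes "world w" "std w \<sigma> s" "eqw w \<sigma> s t"
  shows "std w \<sigma> t"
proof -
  have "fc w [\<sigma>, \<sigma>] (s ## t ## Var) (Imp (And (St \<sigma> (Var 0)) (Eq \<sigma> (Var 0) (Var 1))) (St \<sigma> (Var 1)))"
    by (rule fc_EHA_st[OF EHA_st.st_eq]) (use assms eqw_elt[OF assms(1,3)] in auto)
  from fc_ImpD[OF assms(1) this] show ?thesis using assms by simp
qed

lemma fc_AllSt [simp]:
  assumes "world w" "wff (\<sigma> # \<Gamma>) \<Phi>" "envs w \<Gamma> e"
  shows "fc w \<Gamma> e (AllSt \<sigma> \<Phi>) \<longleftrightarrow> (\<forall>w'. w \<sqsubseteq> w' \<longrightarrow> (\<forall>t. std w' \<sigma> t \<longrightarrow> fc w' (\<sigma> # \<Gamma>) (t ## e) \<Phi>))"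
proof -
  have ax: "fc w \<Gamma> e (Iff (AllSt \<sigma> \<Phi>) (All \<sigma> (Imp (St \<sigma> (Var 0)) \<Phi>)))"
    by (rule fc_EHA_st[OF EHA_st.AllSt_def]) (use assms in \<open>auto simp: lang_st_def\<close>)
  then have "fc w \<Gamma> e (AllSt \<sigma> \<Phi>) \<longleftrightarrow> fc w \<Gamma> e (All \<sigma> (Imp (St \<sigma> (Var 0)) \<Phi>))"
    using fc_ImpD[OF assms(1)] fc_And[OF assms(1)] by blast
  also have "\<dots> \<longleftrightarrow> (\<forall>w'. w \<sqsubseteq> w' \<longrightarrow> (\<forall>t. elt w' \<sigma> t \<longrightarrow> std w' \<sigma> t \<longrightarrow> fc w' (\<sigma> # \<Gamma>) (t ## e) \<Phi>))"
    using assms by (subst fc_All_Imp) auto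
  finally show ?thesis using std_elt[OF wle_world] by blast
qed

lemma fc_ExSt [simp]:
  assumes "world w" "wff (\<sigma> # \<Gamma>) \<Phi>" "envs w \<Gamma> e"
  shows "fc w \<Gamma> e (ExSt \<sigma> \<Phi>) \<longleftrightarrow> (\<exists>t. std w \<sigma> t \<and> fc w (\<sigma> # \<Gamma>) (t ## e) \<Phi>)"
proof -
  have ax: "fc w \<Gamma> e (Iff (ExSt \<sigma> \<Phi>) (Ex \<sigma> (And (St \<sigma> (Var 0)) \<Phi>)))"
    by (rule fc_EHA_st[OF EHA_st.ExSt_def]) (use assms in \<open>auto simp: lang_st_def\<close>)
  then have "fc w \<Gamma> e (ExSt \<sigma> \<Phi>) \<longleftrightarrow> fc w \<Gamma> e (Ex \<sigma> (And (St \<sigma> (Var 0)) \<Phi>))"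
    using fc_ImpD[OF assms(1)] fc_And[OF assms(1)] by blast
  also have "\<dots> \<longleftrightarrow> (\<exists>t. elt w \<sigma> t \<and> std w \<sigma> t \<and> fc w (\<sigma> # \<Gamma>) (t ## e) \<Phi>)"
    using assms by simp
  finally show ?thesis using std_elt[OF assms(1)] by blast
qed

lemma fc_BAll [simp]:
  assumes "world w" "wff (\<sigma> # \<Gamma>) \<Phi>" "wt \<Gamma> s (Seq \<sigma>)" "envs w \<Gamma> e"
  shows "fc w \<Gamma> e (BAll \<sigma> s \<Phi>) \<longleftrightarrow>
    (\<forall>w'. w \<sqsubseteq> w' \<longrightarrow> (\<forall>t. mem w' \<sigma> t (sub e s) \<longrightarrow> fc w' (\<sigma> # \<Gamma>) (t ## e) \<Phi>))"
proof -
  have "fc w \<Gamma> e (BAll \<sigma> s \<Phi>) \<longleftrightarrow>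
    (\<forall>w'. w \<sqsubseteq> w' \<longrightarrow> (\<forall>t. elt w' \<sigma> t \<longrightarrow> mem w' \<sigma> t (sub e s) \<longrightarrow> fc w' (\<sigma> # \<Gamma>) (t ## e) \<Phi>))"
    unfolding BAll_def using assms wt_lift_Cons[OF assms(3)] by (subst fc_All_Imp) (auto simp: wff_In)
  then show ?thesis using mem_elt(1)[OF wle_world] by blast
qed

lemma fc_BEx [simp]:
  assumes "world w" "wff (\<sigma> # \<Gamma>) \<Phi>" "wt \<Gamma> s (Seq \<sigma>)" "envs w \<Gamma> e"
  shows "fc w \<Gamma> e (BEx \<sigma> s \<Phi>) \<longleftrightarrow> (\<exists>t. mem w \<sigma> t (sub e s) \<and> fc w (\<sigma> # \<Gamma>) (t ## e) \<Phi>)"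
proof -
  have "fc w \<Gamma> e (BEx \<sigma> s \<Phi>) \<longleftrightarrow> (\<exists>t. elt w \<sigma> t \<and> mem w \<sigma> t (sub e s) \<and> fc w (\<sigma> # \<Gamma>) (t ## e) \<Phi>)"
    unfolding BEx_def using assms wt_lift_Cons[OF assms(3)] by (subst fc_Ex) (auto simp: wff_In)
  then show ?thesis using mem_elt(1)[OF assms(1)] by blast
qed

lemma st_induct_w:
  assumes \<phi>: "wff (Base # \<Gamma>) \<phi>" and w: "world w" "envs w \<Gamma> e" and n: "std w Base n"
    and base: "fc w (Base # \<Gamma>) (Zero ## e) \<phi>"
    and step: "\<And>w' n. w \<sqsubseteq> w' \<Longrightarrow> std w' Base n \<Longrightarrow> fc w' (Base # \<Gamma>) (n ## e) \<phi> \<Longrightarrow> fc w' (Base # \<Gamma>) (Succ \<cdot> n ## e) \<phi>"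
  shows "fc w (Base # \<Gamma>) (n ## e) \<phi>"
proof -
  have wf: "wff \<Gamma> (inst 0 [Zero] \<phi>)" "wff (Base # \<Gamma>) (inst (Suc 0) [Succ \<cdot> Var 0] \<phi>)"
    using \<phi> by (auto intro!: wff_inst_0 wff_inst_1 simp: wt_App_iff)
  have "fc w \<Gamma> e (Imp (And (inst 0 [Zero] \<phi>) (AllSt Base (Imp \<phi> (inst 1 [Succ \<cdot> Var 0] \<phi>)))) (AllSt Base \<phi>))"
    by (rule fc_EHA_st[OF EHA_st.st_ind]) (use w \<phi> wf in \<open>auto simp: lang_st_def\<close>)
  moreover have "fc w \<Gamma> e (And (inst 0 [Zero] \<phi>) (AllSt Base (Imp \<phi> (inst 1 [Succ \<cdot> Var 0] \<phi>))))"
  proof -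
    have "fc w' (Base # \<Gamma>) (t ## e) (Imp \<phi> (inst 1 [Succ \<cdot> Var 0] \<phi>))" if t: "w \<sqsubseteq> w'" "std w' Base t" for w' t
    proof -
      have "fc w'' (Base # \<Gamma>) (Succ \<cdot> t ## e) \<phi>" if u: "w' \<sqsubseteq> w''" "fc w'' (Base # \<Gamma>) (t ## e) \<phi>" for w''
        by (rule step[OF wle_trans[OF t(1) u(1)] tr_mono[OF t(2) u(1)] u(2)])
      then show ?thesis
        using wf \<phi> w t std_elt[OF wle_world[OF t(1)] t(2)] by (simp add: fc_inst_1[of _ _ _ _ _ _ "Base # \<Gamma>"])
    qed
    then show ?thesis using w wf \<phi> base by (simp add: fc_inst_0[of _ _ _ _ _ "Base # \<Gamma>"] del: fc_inst_0 fc_Imp)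
  qed
  ultimately have "fc w \<Gamma> e (AllSt Base \<phi>)" by (rule fc_ImpD[OF w(1)])
  then show ?thesis using w \<phi> n wle_refl[OF w(1)] by simp
qed

text \<open>The induction on \<open>n\<close> has to be the external one, since the claim mentions
  standardness. A nonzero number below \<open>Succ \<cdot> m\<close> is the successor of a number
  below \<open>m\<close>.\<close>

lemma std_lt:
  assumes w: "world w" and n: "std w Base n" and i: "elt w Base i" "tr w (Lt i n)"
  shows "std w Base i"
proof -
  let ?\<phi> = "All Base (Imp (Lt (Var 0) (Var 1)) (St Base (Var 0)))"
  have sem: "fc v [Base] (n ## Var) ?\<phi> \<longleftrightarrow> (\<forall>v'. v \<sqsubseteq> v' \<longrightarrow> (\<forall>i. elt v' Base i \<longrightarrow> tr v' (Lt i n) \<longrightarrow> std v' Base i))"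
    if "world v" "std v Base n" for v n
    using that std_elt[OF that] by (subst fc_All_Imp) (auto simp: wff_Lt)
  have "fc w [Base] (n ## Var) ?\<phi>"
  proof (rule st_induct_w)
    show "fc w [Base] (Zero ## Var) ?\<phi>"
      unfolding sem[OF w std_closed[of Zero Base, OF _ w, simplified]] using not_lt_Zero[OF wle_world] by blast
  next
    fix v m assume v: "w \<sqsubseteq> v" and m: "std v Base m" and ih: "fc v [Base] (m ## Var) ?\<phi>"
    note wv = wle_world[OF v]
    have sm: "std v Base (Succ \<cdot> m)" by (rule std_App[OF wv std_closed m]) (use wv in auto)
    show "fc v [Base] (Succ \<cdot> m ## Var) ?\<phi>"
      unfolding sem[OF wv sm]
    proof (intro allI impI)
      fix u j assume u: "v \<sqsubseteq> u" and j: "elt u Base j" "tr u (Lt j (Succ \<cdot> m))"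
      note wu = wle_world[OF u] and m' = tr_mono[OF m u]
      from nat_cases_w[OF wu j(1)] show "std u Base j"
      proof (elim disjE exE conjE)
        assume "eqw u Base j Zero"
        from std_eq[OF wu std_closed eq_sym[OF wu this]] wu show ?thesis by simp
      next
        fix k assume k: "elt u Base k" "eqw u Base j (Succ \<cdot> k)"
        note me = std_elt[OF wu m']
        have "tr u (Lt (Succ \<cdot> k) (Succ \<cdot> m))"
          by (rule lt_cong[OF wu k(2) eqw_refl[OF wu] j(2)]) (simp add: me)
        then have "tr u (Lt k m)" using lt_Succ_Succ[OF wu k(1) me] by blast
        then have "std u Base k" using ih[unfolded sem[OF wv m], rule_format, OF u k(1)] by blast
        then have "std u Base (Succ \<cdot> k)" by (rule std_App[OF wu std_closed, rotated 2]) (use wu in auto)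
        from std_eq[OF wu this eq_sym[OF wu k(2)]] show ?thesis .
      qed
    qed
  qed (use assms in \<open>auto simp: wff_Lt\<close>)
  then show ?thesis unfolding sem[OF w n] using wle_refl[OF w] i by blast
qed

lemma std_LRec: "world w \<Longrightarrow> std w (Seq \<sigma>) s \<Longrightarrow> std w \<rho> y \<Longrightarrow> std w (\<rho> \<rightarrow> \<sigma> \<rightarrow> \<rho>) z \<Longrightarrow> std w \<rho> (LRec \<sigma> \<rho> \<cdot> s \<cdot> y \<cdot> z)"
  by (intro std_App[of w "\<rho> \<rightarrow> \<sigma> \<rightarrow> \<rho>"] std_App[of w "\<rho>"] std_App[of w "Seq \<sigma>"]) (auto intro: std_closed)

lemma std_len: "world w \<Longrightarrow> std w (Seq \<sigma>) s \<Longrightarrow> std w Base (len \<sigma> s)"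
  unfolding len_def by (intro std_LRec) (auto intro!: std_closed simp: wt_App_iff)

lemma std_nth: "world w \<Longrightarrow> std w (Seq \<sigma>) s \<Longrightarrow> std w Base i \<Longrightarrow> std w \<sigma> (nth_tm \<sigma> s i)"
  unfolding nth_tm_def by (intro std_App[of w Base] std_LRec) (auto intro!: std_closed simp: wt_App_iff wt_dflt)

text \<open>The index of an entry lies below the standard length and is therefore standard by
  \<open>std_lt\<close>; the entry is then a closed operation applied to standard arguments. This is
  why a standard finite sequence of challenges contains only standard ones.\<close>

lemma mem_std:
  assumes w: "world w" and s: "std w (Seq \<sigma>) s" and m: "mem w \<sigma> x s"
  shows "std w \<sigma> x"
proof -
  obtain i where i: "elt w Base i" "tr w (Lt i (len \<sigma> s))" "eqw w \<sigma> x (nth_tm \<sigma> s i)"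
    using m mem_iff[OF w mem_elt[OF w m]] by blast
  have "std w Base i" by (rule std_lt[OF w std_len[OF w s] i(1,2)])
  from std_eq[OF w std_nth[OF w s this] eq_sym[OF w i(3)]] show ?thesis .
qed

lemma std_Prep: "world w \<Longrightarrow> std w \<sigma> a \<Longrightarrow> std w (Seq \<sigma>) s \<Longrightarrow> std w (Seq \<sigma>) (Prep \<sigma> \<cdot> a \<cdot> s)"
  by (intro std_App[of w "Seq \<sigma>"] std_App[of w \<sigma>]) (auto intro: std_closed)

lemma std_dflt: "world w \<Longrightarrow> std w \<sigma> (dflt \<sigma>)"
  by (intro std_closed wt_dflt)

text \<open>\<open>sapp\<close> builds \<open>t\<close> into its step function, so the term is not
  literally a closed operation applied to \<open>s\<close> and \<open>t\<close>; by beta reduction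
  it is equal to one.\<close>

lemma std_sapp:
  assumes w: "world w" and s: "std w (Seq (\<rho> \<rightarrow> Seq \<tau>)) s" and t: "std w \<rho> t"
  shows "std w (Seq \<tau>) (sapp \<rho> \<tau> s t)"
proof -
  let ?C = "Lam (Seq (\<rho> \<rightarrow> Seq \<tau>)) (Lam \<rho> (sapp \<rho> \<tau> (Var 1) (Var 0)))"
  have C: "wt [] ?C (Seq (\<rho> \<rightarrow> Seq \<tau>) \<rightarrow> \<rho> \<rightarrow> Seq \<tau>)" by (simp add: wt_sapp)
  have "std w (Seq \<tau>) (?C \<cdot> s \<cdot> t)"
    by (intro std_App[OF w _ t] std_App[OF w _ s] std_closed[OF C w])
  moreover have "eqw w (Seq \<tau>) (?C \<cdot> s \<cdot> t) (sapp \<rho> \<tau> s t)"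
    using eq_beta2[OF w elt_closed[OF C] std_elt[OF w s] std_elt[OF w t]] by simp
  ultimately show ?thesis by (rule std_eq[OF w])
qed

lemma mem_single: "world w \<Longrightarrow> elt w \<sigma> a \<Longrightarrow> mem w \<sigma> x (Prep \<sigma> \<cdot> a \<cdot> Emp \<sigma>) \<longleftrightarrow> eqw w \<sigma> x a"
  using mem_Prep[OF _ _ elt_const(3)] not_mem_Emp by blast

lemma mem_sapp:
  assumes w: "world w" and s: "elt w (Seq (\<rho> \<rightarrow> Seq \<tau>)) s" and t: "elt w \<rho> t"
  shows "mem w \<tau> x (sapp \<rho> \<tau> s t) \<longleftrightarrow> (\<exists>f. mem w (\<rho> \<rightarrow> Seq \<tau>) f s \<and> mem w \<tau> x (f \<cdot> t))"
proof -
  let ?z = "Lam (Seq \<tau>) (Lam (\<rho> \<rightarrow> Seq \<tau>) (conc \<tau> (Var 0 \<cdot> lift 2 t) (Var 1)))"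
  \<comment> \<open>Evaluation at \<open>t\<close>, as a function of the entry of \<open>s\<close>,
    brings the union into the form of \<open>mem_LRec\<close>.\<close>
  let ?f = "Lam (\<rho> \<rightarrow> Seq \<tau>) (Var 0 \<cdot> lift 1 t)"
  have z: "elt v (Seq \<tau> \<rightarrow> (\<rho> \<rightarrow> Seq \<tau>) \<rightarrow> Seq \<tau>) ?z" if "elt v \<rho> t" for v
    using elt_sub[of "[\<rho>]" "Lam (Seq \<tau>) (Lam (\<rho> \<rightarrow> Seq \<tau>) (conc \<tau> (Var 0 \<cdot> Var 2) (Var 1)))" "Seq \<tau> \<rightarrow> (\<rho> \<rightarrow> Seq \<tau>) \<rightarrow> Seq \<tau>" v "t ## Var"] that
    by (simp add: wt_App_iff wt_conc numeral_2_eq_2)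
  have f: "elt v ((\<rho> \<rightarrow> Seq \<tau>) \<rightarrow> Seq \<tau>) ?f" if "elt v \<rho> t" for v
    using elt_sub[of "[\<rho>]" "Lam (\<rho> \<rightarrow> Seq \<tau>) (Var 0 \<cdot> Var 1)" "(\<rho> \<rightarrow> Seq \<tau>) \<rightarrow> Seq \<tau>" v "t ## Var"] that
    by (simp add: wt_App_iff)
  have fb: "mem v \<tau> x (?f \<cdot> a) \<longleftrightarrow> mem v \<tau> x (a \<cdot> t)" if "w \<sqsubseteq> v" "elt v (\<rho> \<rightarrow> Seq \<tau>) a" for v a x
    using mem_cong_iff[OF wle_world[OF that(1)] eq_beta[OF wle_world[OF that(1)] f that(2)]] elt_mono[OF t that(1)] by simp
  have "mem w \<tau> x (sapp \<rho> \<tau> s t) \<longleftrightarrow> (\<exists>a. mem w (\<rho> \<rightarrow> Seq \<tau>) a s \<and> mem w \<tau> x (?f \<cdot> a))"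
    unfolding sapp_def
  proof (rule mem_LRec[OF w s z[OF t] f[OF t]])
    fix v r a x assume v: "w \<sqsubseteq> v" and r: "elt v (Seq \<tau>) r" and a: "elt v (\<rho> \<rightarrow> Seq \<tau>) a"
    note wv = wle_world[OF v] and tv = elt_mono[OF t v]
    have "eqw v (Seq \<tau>) (?z \<cdot> r \<cdot> a) (conc \<tau> (a \<cdot> t) r)"
      using eq_beta2[OF wv z[OF tv] r a] by (simp add: numeral_2_eq_2)
    from mem_cong_iff[OF wv this] show "mem v \<tau> x (?z \<cdot> r \<cdot> a) \<longleftrightarrow> mem v \<tau> x (?f \<cdot> a) \<or> mem v \<tau> x r"
      using mem_conc[OF wv elt_App[OF a tv] r] fb[OF v a] by blast
  qed
  then show ?thesis using fb[OF wle_refl[OF w]] mem_elt(1)[OF w] by blast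
qed

text \<open>The monadic bind of finite sequences: the concatenation of all
  \<open>f \<cdot> a\<close> for \<open>a\<close> in the given sequence. Being a closed term, it
  preserves standardness.\<close>

definition bindC :: "ty \<Rightarrow> ty \<Rightarrow> tm" where
  "bindC \<sigma> \<tau> = Lam (\<sigma> \<rightarrow> Seq \<tau>) (Lam (Seq \<sigma>) (LRec \<sigma> (Seq \<tau>) \<cdot> Var 0 \<cdot> Emp \<tau> \<cdot>
     Lam (Seq \<tau>) (Lam \<sigma> (conc \<tau> (Var 3 \<cdot> Var 0) (Var 1)))))"

lemma wt_bindC: "wt \<Gamma> (bindC \<sigma> \<tau>) ((\<sigma> \<rightarrow> Seq \<tau>) \<rightarrow> Seq \<sigma> \<rightarrow> Seq \<tau>)"
  by (simp add: bindC_def wt_App_iff wt_conc)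

lemma mem_bindC:
  assumes w: "world w" and f: "elt w (\<sigma> \<rightarrow> Seq \<tau>) f" and s: "elt w (Seq \<sigma>) s"
  shows "mem w \<tau> x (bindC \<sigma> \<tau> \<cdot> f \<cdot> s) \<longleftrightarrow> (\<exists>a. mem w \<sigma> a s \<and> mem w \<tau> x (f \<cdot> a))"
proof -
  let ?z = "Lam (Seq \<tau>) (Lam \<sigma> (conc \<tau> (lift 2 f \<cdot> Var 0) (Var 1)))"
  have z: "elt v (Seq \<tau> \<rightarrow> \<sigma> \<rightarrow> Seq \<tau>) ?z" if "elt v (\<sigma> \<rightarrow> Seq \<tau>) f" for v
    using elt_sub[of "[\<sigma> \<rightarrow> Seq \<tau>]" "Lam (Seq \<tau>) (Lam \<sigma> (conc \<tau> (Var 2 \<cdot> Var 0) (Var 1)))" "Seq \<tau> \<rightarrow> \<sigma> \<rightarrow> Seq \<tau>" v "f ## Var"] that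
    by (simp add: wt_App_iff wt_conc numeral_2_eq_2)
  have "eqw w (Seq \<tau>) (bindC \<sigma> \<tau> \<cdot> f \<cdot> s) (LRec \<sigma> (Seq \<tau>) \<cdot> s \<cdot> Emp \<tau> \<cdot> ?z)"
    using eq_beta2[OF w elt_closed[OF wt_bindC[of "[]" \<sigma> \<tau>, unfolded bindC_def]] f s]
    by (simp add: bindC_def numeral_2_eq_2)
  from mem_cong_iff[OF w this]
  have "mem w \<tau> x (bindC \<sigma> \<tau> \<cdot> f \<cdot> s) \<longleftrightarrow> mem w \<tau> x (LRec \<sigma> (Seq \<tau>) \<cdot> s \<cdot> Emp \<tau> \<cdot> ?z)" .
  also have "\<dots> \<longleftrightarrow> (\<exists>a. mem w \<sigma> a s \<and> mem w \<tau> x (f \<cdot> a))"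
  proof (rule mem_LRec[OF w s z[OF f] f])
    fix v r a x assume v: "w \<sqsubseteq> v" and r: "elt v (Seq \<tau>) r" and a: "elt v \<sigma> a"
    note wv = wle_world[OF v] and fv = elt_mono[OF f v]
    have "eqw v (Seq \<tau>) (?z \<cdot> r \<cdot> a) (conc \<tau> (f \<cdot> a) r)"
      using eq_beta2[OF wv z[OF fv] r a] by (simp add: numeral_2_eq_2)
    from mem_cong_iff[OF wv this] show "mem v \<tau> x (?z \<cdot> r \<cdot> a) \<longleftrightarrow> mem v \<tau> x (f \<cdot> a) \<or> mem v \<tau> x r"
      using mem_conc[OF wv elt_App[OF fv a] r] by blast
  qed
  finally show ?thesis .
qed

section \<open>Tuples\<close>

abbreviation els :: "world \<Rightarrow> ty list \<Rightarrow> tm list \<Rightarrow> bool" where "els w \<equiv> list_all2 (elt w)"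
abbreviation stds :: "world \<Rightarrow> ty list \<Rightarrow> tm list \<Rightarrow> bool" where "stds w \<equiv> list_all2 (\<lambda>\<tau> t. std w \<tau> t)"

fun mems :: "world \<Rightarrow> ty list \<Rightarrow> tm list \<Rightarrow> tm list \<Rightarrow> bool" where
  "mems w [] [] [] \<longleftrightarrow> True"
| "mems w (\<tau> # \<tau>s) (x # xs) (s # ss) \<longleftrightarrow> mem w \<tau> x s \<and> mems w \<tau>s xs ss"
| "mems w _ _ _ \<longleftrightarrow> False"

text \<open>Quantification over later worlds makes the relation persistent, as the corresponding
  bounded formula would be.\<close>

definition ssub :: "world \<Rightarrow> ty \<Rightarrow> tm \<Rightarrow> tm \<Rightarrow> bool" where
  "ssub w \<tau> s t \<longleftrightarrow> (\<forall>v. w \<sqsubseteq> v \<longrightarrow> (\<forall>x. mem v \<tau> x s \<longrightarrow> mem v \<tau> x t))"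

fun ssubs :: "world \<Rightarrow> ty list \<Rightarrow> tm list \<Rightarrow> tm list \<Rightarrow> bool" where
  "ssubs w [] [] [] \<longleftrightarrow> True"
| "ssubs w (\<tau> # \<tau>s) (s # ss) (t # ts) \<longleftrightarrow> ssub w \<tau> s t \<and> ssubs w \<tau>s ss ts"
| "ssubs w _ _ _ \<longleftrightarrow> False"

lemma els_mono: "els w \<tau>s ts \<Longrightarrow> w \<sqsubseteq> v \<Longrightarrow> els v \<tau>s ts"
  by (erule list_all2_mono) (auto elim: elt_mono)
lemma stds_mono: "stds w \<tau>s ts \<Longrightarrow> w \<sqsubseteq> v \<Longrightarrow> stds v \<tau>s ts"
  by (erule list_all2_mono) (auto elim: tr_mono)
lemma stds_els: "stds w \<tau>s ts \<Longrightarrow> world w \<Longrightarrow> els w \<tau>s ts"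
  by (erule list_all2_mono) (auto elim: std_elt)
lemma ssub_refl: "ssub w \<tau> s s" by (simp add: ssub_def)
lemma ssubs_refl: "length \<tau>s = length ss \<Longrightarrow> ssubs w \<tau>s ss ss"
  by (induction \<tau>s ss rule: list_induct2) (auto simp: ssub_refl)
lemma ssub_mono: "ssub w \<tau> s t \<Longrightarrow> w \<sqsubseteq> v \<Longrightarrow> ssub v \<tau> s t"
  unfolding ssub_def using wle_trans by blast
lemma ssubs_mono: "ssubs w \<tau>s s t \<Longrightarrow> w \<sqsubseteq> v \<Longrightarrow> ssubs v \<tau>s s t"
  by (induction w \<tau>s s t rule: ssubs.induct) (auto elim: ssub_mono)
lemma mems_els: "mems w \<tau>s xs ss \<Longrightarrow> world w \<Longrightarrow> els w \<tau>s xs"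
  by (induction w \<tau>s xs ss rule: mems.induct) (auto elim: mem_elt)
lemma mems_stds: "mems w \<tau>s xs ss \<Longrightarrow> world w \<Longrightarrow> stds w (map Seq \<tau>s) ss \<Longrightarrow> stds w \<tau>s xs"
  by (induction w \<tau>s xs ss rule: mems.induct) (auto elim: mem_std)
lemma mems_ssubs: "mems w \<tau>s xs ss \<Longrightarrow> ssubs w \<tau>s ss ts \<Longrightarrow> world w \<Longrightarrow> mems w \<tau>s xs ts"
proof (induction w \<tau>s xs ss arbitrary: ts rule: mems.induct)
  case (2 w \<tau> \<tau>s x xs s ss)
  then show ?case using wle_refl by (cases ts) (auto simp: ssub_def)
qed (case_tac ts, auto)+
lemma mems_length: "mems w \<tau>s xs ys \<Longrightarrow> length xs = length \<tau>s \<and> length ys = length \<tau>s"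
  by (induction w \<tau>s xs ys rule: mems.induct) auto

text \<open>The first component is pushed first and ends up with the largest index, in agreement
  with a quantifier block written outermost first. Hence the reversed lists in contexts such as
  \<open>rev \<tau>s @ \<Gamma>\<close>.\<close>

primrec pushes :: "tm list \<Rightarrow> (nat \<Rightarrow> tm) \<Rightarrow> nat \<Rightarrow> tm" where
  "pushes [] e = e"
| "pushes (t # ts) e = pushes ts (t ## e)"

lemma pushes_append: "pushes (xs @ ys) e = pushes ys (pushes xs e)"
  by (induction xs arbitrary: e) auto

lemma pushes_ge: "pushes ts e (i + length ts) = e i"
  by (induction ts arbitrary: e i) (auto, metis add_Suc old.nat.simps(5))

lemma pushes_less: "i < length ts \<Longrightarrow> pushes ts e (length ts - Suc i) = ts ! i"
proof (induction ts arbitrary: e i)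
  case (Cons t ts)
  show ?case
  proof (cases i)
    case 0
    then show ?thesis using pushes_ge[of ts "t ## e" 0] by simp
  next
    case (Suc j)
    then show ?thesis using Cons by simp
  qed
qed simp

lemma pushes_rev: "i < length ts \<Longrightarrow> pushes ts e i = rev ts ! i"
  using pushes_less[of "length ts - Suc i" ts e] by (simp add: rev_nth)

lemma envs_pushes: "els w \<tau>s ts \<Longrightarrow> envs w \<Gamma> e \<Longrightarrow> envs w (rev \<tau>s @ \<Gamma>) (pushes ts e)"
proof (induction \<tau>s ts arbitrary: \<Gamma> e rule: list_all2_induct)
  case (Cons \<tau> \<tau>s t ts)
  then show ?case using Cons.IH[of "\<tau> # \<Gamma>" "t ## e"] by simp
qed simp

lemma wff_AllSts [simp]: "wff \<Gamma> (AllSts \<tau>s \<Phi>) \<longleftrightarrow> wff (rev \<tau>s @ \<Gamma>) \<Phi>"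
  and wff_ExSts [simp]: "wff \<Gamma> (ExSts \<tau>s \<Phi>) \<longleftrightarrow> wff (rev \<tau>s @ \<Gamma>) \<Phi>"
  and wff_Alls [simp]: "wff \<Gamma> (Alls \<tau>s \<Phi>) \<longleftrightarrow> wff (rev \<tau>s @ \<Gamma>) \<Phi>"
  by (induction \<tau>s arbitrary: \<Gamma>) auto

lemma list_all2_Cons1_iff: "(\<forall>ys. list_all2 R (x # xs) ys \<longrightarrow> Q ys) \<longleftrightarrow> (\<forall>y ys. R x y \<longrightarrow> list_all2 R xs ys \<longrightarrow> Q (y # ys))"
  by (auto simp: list_all2_Cons1)

lemma list_all2_Cons1_ex: "(\<exists>ys. list_all2 R (x # xs) ys \<and> Q ys) \<longleftrightarrow> (\<exists>y ys. R x y \<and> list_all2 R xs ys \<and> Q (y # ys))"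
  by (auto simp: list_all2_Cons1)

lemma fc_AllSts:
  "world w \<Longrightarrow> wff (rev \<tau>s @ \<Gamma>) \<Phi> \<Longrightarrow> envs w \<Gamma> e \<Longrightarrow>
    fc w \<Gamma> e (AllSts \<tau>s \<Phi>) \<longleftrightarrow> (\<forall>v. w \<sqsubseteq> v \<longrightarrow> (\<forall>ts. stds v \<tau>s ts \<longrightarrow> fc v (rev \<tau>s @ \<Gamma>) (pushes ts e) \<Phi>))"
proof (induction \<tau>s arbitrary: w \<Gamma> e)
  case Nil
  then show ?case using fc_mono wle_refl by auto
next
  case (Cons \<tau> \<tau>s)
  have "fc w \<Gamma> e (AllSts (\<tau> # \<tau>s) \<Phi>) \<longleftrightarrow> (\<forall>v. w \<sqsubseteq> v \<longrightarrow> (\<forall>t. std v \<tau> t \<longrightarrow> fc v (\<tau> # \<Gamma>) (t ## e) (AllSts \<tau>s \<Phi>)))"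
    using Cons.prems by simp
  also have "\<dots> \<longleftrightarrow> (\<forall>v. w \<sqsubseteq> v \<longrightarrow> (\<forall>t. std v \<tau> t \<longrightarrow>
      (\<forall>u. v \<sqsubseteq> u \<longrightarrow> (\<forall>ts. stds u \<tau>s ts \<longrightarrow> fc u (rev \<tau>s @ \<tau> # \<Gamma>) (pushes ts (t ## e)) \<Phi>))))"
    using Cons.IH[of _ "\<tau> # \<Gamma>" "_ ## e"] Cons.prems std_elt[OF wle_world] envs_mono[OF Cons.prems(3)] wle_world by simp
  \<comment> \<open>The nested later worlds collapse: the last one serves for all variables, as
    standardness persists.\<close>
  also have "\<dots> \<longleftrightarrow> (\<forall>v. w \<sqsubseteq> v \<longrightarrow> (\<forall>t ts. std v \<tau> t \<longrightarrow> stds v \<tau>s ts \<longrightarrow> fc v (rev \<tau>s @ \<tau> # \<Gamma>) (pushes ts (t ## e)) \<Phi>))"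
    using tr_mono wle_trans wle_refl wle_world by meson
  finally show ?case by (simp add: list_all2_Cons1_iff)
qed

lemma fc_Alls:
  "world w \<Longrightarrow> wff (rev \<tau>s @ \<Gamma>) \<Phi> \<Longrightarrow> envs w \<Gamma> e \<Longrightarrow>
    fc w \<Gamma> e (Alls \<tau>s \<Phi>) \<longleftrightarrow> (\<forall>v. w \<sqsubseteq> v \<longrightarrow> (\<forall>ts. els v \<tau>s ts \<longrightarrow> fc v (rev \<tau>s @ \<Gamma>) (pushes ts e) \<Phi>))"
proof (induction \<tau>s arbitrary: w \<Gamma> e)
  case Nil
  then show ?case using fc_mono wle_refl by auto
next
  case (Cons \<tau> \<tau>s)
  have "fc w \<Gamma> e (Alls (\<tau> # \<tau>s) \<Phi>) \<longleftrightarrow> (\<forall>v. w \<sqsubseteq> v \<longrightarrow> (\<forall>t. elt v \<tau> t \<longrightarrow> fc v (\<tau> # \<Gamma>) (t ## e) (Alls \<tau>s \<Phi>)))"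
    using Cons.prems by simp
  also have "\<dots> \<longleftrightarrow> (\<forall>v. w \<sqsubseteq> v \<longrightarrow> (\<forall>t. elt v \<tau> t \<longrightarrow>
      (\<forall>u. v \<sqsubseteq> u \<longrightarrow> (\<forall>ts. els u \<tau>s ts \<longrightarrow> fc u (rev \<tau>s @ \<tau> # \<Gamma>) (pushes ts (t ## e)) \<Phi>))))"
    using Cons.IH[of _ "\<tau> # \<Gamma>" "_ ## e"] Cons.prems envs_mono[OF Cons.prems(3)] wle_world by simp
  also have "\<dots> \<longleftrightarrow> (\<forall>v. w \<sqsubseteq> v \<longrightarrow> (\<forall>t ts. elt v \<tau> t \<longrightarrow> els v \<tau>s ts \<longrightarrow> fc v (rev \<tau>s @ \<tau> # \<Gamma>) (pushes ts (t ## e)) \<Phi>))"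
    using elt_mono wle_trans wle_refl wle_world by meson
  finally show ?case by (simp add: list_all2_Cons1_iff)
qed

lemma fc_ExSts:
  "world w \<Longrightarrow> wff (rev \<tau>s @ \<Gamma>) \<Phi> \<Longrightarrow> envs w \<Gamma> e \<Longrightarrow>
    fc w \<Gamma> e (ExSts \<tau>s \<Phi>) \<longleftrightarrow> (\<exists>ts. stds w \<tau>s ts \<and> fc w (rev \<tau>s @ \<Gamma>) (pushes ts e) \<Phi>)"
proof (induction \<tau>s arbitrary: \<Gamma> e)
  case (Cons \<tau> \<tau>s)
  have "fc w \<Gamma> e (ExSts (\<tau> # \<tau>s) \<Phi>) \<longleftrightarrow> (\<exists>t. std w \<tau> t \<and> fc w (\<tau> # \<Gamma>) (t ## e) (ExSts \<tau>s \<Phi>))"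
    using Cons.prems by simp
  also have "\<dots> \<longleftrightarrow> (\<exists>t. std w \<tau> t \<and> (\<exists>ts. stds w \<tau>s ts \<and> fc w (rev \<tau>s @ \<tau> # \<Gamma>) (pushes ts (t ## e)) \<Phi>))"
    using Cons.IH[of "\<tau> # \<Gamma>" "_ ## e"] Cons.prems std_elt[OF Cons.prems(1)] by (simp cong: conj_cong)
  finally show ?case unfolding list_all2_Cons1_ex by simp
qed simp

lemma mems_Cons: "mems w (\<tau> # \<tau>s) ts (s # ss) \<longleftrightarrow> (\<exists>t ts'. ts = t # ts' \<and> mem w \<tau> t s \<and> mems w \<tau>s ts' ss)"
  by (cases ts) auto

lemma wff_BAlls:
  "length ss = length \<tau>s \<Longrightarrow> list_all2 (\<lambda>s \<tau>. wt \<Gamma> s (Seq \<tau>)) ss \<tau>s \<Longrightarrow> wff (rev \<tau>s @ \<Gamma>) \<Phi> \<Longrightarrow> wff \<Gamma> (BAlls \<tau>s ss \<Phi>)"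
proof (induction \<tau>s arbitrary: \<Gamma> ss)
  case (Cons \<tau> \<tau>s)
  from Cons.prems(1) obtain s ss' where [simp]: "ss = s # ss'" by (cases ss) auto
  have "list_all2 (\<lambda>s \<tau>. wt (\<tau>' # \<Gamma>) s (Seq \<tau>)) (map (lift 1) ss') \<tau>s" for \<tau>'
    using Cons.prems by (auto simp: list_all2_map1 wt_lift_Cons elim: list_all2_mono)
  from Cons.IH[OF _ this] show ?case using Cons.prems by (auto intro!: wff_BAll)
qed simp

lemma fc_BAlls:
  "length ss = length \<tau>s \<Longrightarrow> world w \<Longrightarrow> list_all2 (\<lambda>s \<tau>. wt \<Gamma> s (Seq \<tau>)) ss \<tau>s \<Longrightarrow> wff (rev \<tau>s @ \<Gamma>) \<Phi> \<Longrightarrow> envs w \<Gamma> e \<Longrightarrow>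
    fc w \<Gamma> e (BAlls \<tau>s ss \<Phi>) \<longleftrightarrow>
    (\<forall>v. w \<sqsubseteq> v \<longrightarrow> (\<forall>ts. mems v \<tau>s ts (map (sub e) ss) \<longrightarrow> fc v (rev \<tau>s @ \<Gamma>) (pushes ts e) \<Phi>))"
proof (induction \<tau>s arbitrary: w \<Gamma> e ss)
  case Nil
  have "mems v [] ts [] \<longleftrightarrow> ts = []" for v ts by (cases ts) auto
  then show ?case using fc_mono wle_refl Nil by auto
next
  case (Cons \<tau> \<tau>s)
  from Cons.prems(1) obtain s ss' where [simp]: "ss = s # ss'" by (cases ss) auto
  have wt: "list_all2 (\<lambda>s \<tau>. wt (\<tau>' # \<Gamma>) s (Seq \<tau>)) (map (lift 1) ss') \<tau>s" for \<tau>'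
    using Cons.prems by (auto simp: list_all2_map1 wt_lift_Cons elim: list_all2_mono)
  have wf: "wff (\<tau> # \<Gamma>) (BAlls \<tau>s (map (lift 1) ss') \<Phi>)"
    using wff_BAlls[OF _ wt] Cons.prems by simp
  have m: "(\<forall>ts. mems v (\<tau> # \<tau>s) ts (s' # ss') \<longrightarrow> Q ts) \<longleftrightarrow> (\<forall>t ts. mem v \<tau> t s' \<longrightarrow> mems v \<tau>s ts ss' \<longrightarrow> Q (t # ts))" for v s' ss' Q
    by (simp add: mems_Cons) blast
  have "fc w \<Gamma> e (BAlls (\<tau> # \<tau>s) (s # ss') \<Phi>) \<longleftrightarrow>
      (\<forall>v. w \<sqsubseteq> v \<longrightarrow> (\<forall>t. mem v \<tau> t (sub e s) \<longrightarrow> fc v (\<tau> # \<Gamma>) (t ## e) (BAlls \<tau>s (map (lift 1) ss') \<Phi>)))"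
    using Cons.prems wf by simp
  also have "\<dots> \<longleftrightarrow> (\<forall>v. w \<sqsubseteq> v \<longrightarrow> (\<forall>t. mem v \<tau> t (sub e s) \<longrightarrow>
      (\<forall>u. v \<sqsubseteq> u \<longrightarrow> (\<forall>ts. mems u \<tau>s ts (map (sub e) ss') \<longrightarrow> fc u (rev \<tau>s @ \<tau> # \<Gamma>) (pushes ts (t ## e)) \<Phi>))))"
    using Cons.IH[of "map (lift 1) ss'" _ "\<tau> # \<Gamma>" "_ ## e"] Cons.prems wt envs_mono[OF Cons.prems(5)] wle_world mem_elt(1)[OF wle_world] by (simp add: comp_def)
  also have "\<dots> \<longleftrightarrow> (\<forall>v. w \<sqsubseteq> v \<longrightarrow> (\<forall>t ts. mem v \<tau> t (sub e s) \<longrightarrow> mems v \<tau>s ts (map (sub e) ss') \<longrightarrow>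
      fc v (rev \<tau>s @ \<tau> # \<Gamma>) (pushes ts (t ## e)) \<Phi>))"
    using tr_mono wle_trans wle_refl wle_world by meson
  finally show ?case by (simp add: m)
qed

subsection \<open>Definable predicates\<close>

text \<open>Links predicates on worlds and tuples with the formulas over which the principles are
  schemes. Agreement is demanded at all later worlds, since the quantifiers and implications inside
  the principles reach them; \<open>e\<close> holds the parameters.\<close>

definition defined_by :: "ty list \<Rightarrow> (nat \<Rightarrow> tm) \<Rightarrow> fm \<Rightarrow> world \<Rightarrow> ty list \<Rightarrow> (world \<Rightarrow> tm list \<Rightarrow> bool) \<Rightarrow> bool" where
  "defined_by \<Gamma> e \<phi> w \<sigma>s P \<longleftrightarrow> wff (rev \<sigma>s @ \<Gamma>) \<phi> \<and> envs w \<Gamma> e \<and>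
    (\<forall>v ts. w \<sqsubseteq> v \<longrightarrow> els v \<sigma>s ts \<longrightarrow> (P v ts \<longleftrightarrow> fc v (rev \<sigma>s @ \<Gamma>) (pushes ts e) \<phi>))"

text \<open>The flag demands an internal definition, as required for I and HGMP and for the premise
  of HIP.\<close>

definition dfn :: "bool \<Rightarrow> world \<Rightarrow> ty list \<Rightarrow> (world \<Rightarrow> tm list \<Rightarrow> bool) \<Rightarrow> bool" where
  "dfn b w \<sigma>s P \<longleftrightarrow> (\<exists>\<Gamma> e \<phi>. defined_by \<Gamma> e \<phi> w \<sigma>s P \<and> (b \<longrightarrow> internal \<phi>))"

text \<open>Operations given uniformly by open terms with parameters. The identity is syntactic, so
  such operations can be substituted into a defining formula.\<close>

definition defts :: "world \<Rightarrow> ty list \<Rightarrow> ty list \<Rightarrow> (tm list \<Rightarrow> tm list) \<Rightarrow> bool" where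
  "defts w \<sigma>s \<tau>s F \<longleftrightarrow> (\<exists>\<Gamma> e us. list_all2 (wt (rev \<sigma>s @ \<Gamma>)) us \<tau>s \<and> envs w \<Gamma> e \<and>
    (\<forall>v ts. w \<sqsubseteq> v \<longrightarrow> els v \<sigma>s ts \<longrightarrow> F ts = map (sub (pushes ts e)) us))"

lemma defined_byI:
  "wff (rev \<sigma>s @ \<Gamma>) \<phi> \<Longrightarrow> envs w \<Gamma> e \<Longrightarrow>
   (\<And>v ts. w \<sqsubseteq> v \<Longrightarrow> els v \<sigma>s ts \<Longrightarrow> P v ts \<longleftrightarrow> fc v (rev \<sigma>s @ \<Gamma>) (pushes ts e) \<phi>) \<Longrightarrow> defined_by \<Gamma> e \<phi> w \<sigma>s P"
  by (simp add: defined_by_def)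

lemma defined_by_mono: "defined_by \<Gamma> e \<phi> w \<sigma>s P \<Longrightarrow> w \<sqsubseteq> v \<Longrightarrow> defined_by \<Gamma> e \<phi> v \<sigma>s P"
  unfolding defined_by_def using wle_trans envs_mono by blast
lemma dfn_mono: "dfn b w \<sigma>s P \<Longrightarrow> w \<sqsubseteq> v \<Longrightarrow> dfn b v \<sigma>s P"
  unfolding dfn_def using defined_by_mono by blast
lemma dfn_False: "dfn b w \<sigma>s P \<Longrightarrow> dfn False w \<sigma>s P"
  unfolding dfn_def by blast
lemma dfn_cong: "dfn b w \<sigma>s P \<Longrightarrow> (\<And>v ts. w \<sqsubseteq> v \<Longrightarrow> els v \<sigma>s ts \<Longrightarrow> P v ts \<longleftrightarrow> Q v ts) \<Longrightarrow> dfn b w \<sigma>s Q"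
  unfolding dfn_def defined_by_def by meson
lemma defts_cong: "defts w \<sigma>s \<tau>s F \<Longrightarrow> (\<And>v ts. w \<sqsubseteq> v \<Longrightarrow> els v \<sigma>s ts \<Longrightarrow> F ts = G ts) \<Longrightarrow> defts w \<sigma>s \<tau>s G"
  unfolding defts_def by metis
lemma dfn_persist: "dfn b w \<sigma>s P \<Longrightarrow> w \<sqsubseteq> v \<Longrightarrow> els v \<sigma>s ts \<Longrightarrow> P v ts \<Longrightarrow> v \<sqsubseteq> u \<Longrightarrow> P u ts"
  unfolding dfn_def defined_by_def by (meson els_mono wle_trans fc_mono)
lemma defts_els: "defts w \<sigma>s \<tau>s F \<Longrightarrow> w \<sqsubseteq> v \<Longrightarrow> els v \<sigma>s ts \<Longrightarrow> els v \<tau>s (F ts)"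
proof -
  assume "defts w \<sigma>s \<tau>s F" and v: "w \<sqsubseteq> v" "els v \<sigma>s ts"
  then obtain \<Gamma> e us where d: "list_all2 (wt (rev \<sigma>s @ \<Gamma>)) us \<tau>s" "envs w \<Gamma> e" "F ts = map (sub (pushes ts e)) us"
    unfolding defts_def by blast
  have "envs v (rev \<sigma>s @ \<Gamma>) (pushes ts e)" using envs_pushes v envs_mono d(2) by blast
  with d(1) show ?thesis unfolding d(3) by (auto simp: list_all2_conv_all_nth elt_sub)
qed

subsubsection \<open>Merging parameters\<close>

text \<open>Two definitions come with separate lists of parameters; placing the environments side by
  side allows both to occur in one formula.\<close>

definition eapp :: "nat \<Rightarrow> (nat \<Rightarrow> tm) \<Rightarrow> (nat \<Rightarrow> tm) \<Rightarrow> nat \<Rightarrow> tm" where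
  "eapp n e f i = (if i < n then e i else f (i - n))"

lemma envs_eapp: "envs w \<Gamma> e \<Longrightarrow> envs w \<Delta> f \<Longrightarrow> envs w (\<Gamma> @ \<Delta>) (eapp (length \<Gamma>) e f)"
  by (auto simp: envs_def eapp_def nth_append)

lemma pushes_eapp_cong:
  "length ts = length \<sigma>s \<Longrightarrow> \<forall>i < length (rev \<sigma>s @ \<Gamma>). pushes ts (eapp (length \<Gamma>) e f) i = pushes ts e i"
proof (intro allI impI)
  fix i assume l: "length ts = length \<sigma>s" and i: "i < length (rev \<sigma>s @ \<Gamma>)"
  show "pushes ts (eapp (length \<Gamma>) e f) i = pushes ts e i"
  proof (cases "i < length ts")
    case True
    then show ?thesis by (simp add: pushes_rev)
  next
    case False
    then have "i - length ts < length \<Gamma>" using i l by auto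
    then show ?thesis using pushes_ge[of ts _ "i - length ts"] False by (simp add: eapp_def)
  qed
qed

lemma wt_append: "wt \<Gamma> t \<tau> \<Longrightarrow> wt (\<Gamma> @ \<Delta>) t \<tau>"
  using wt_sub[of \<Gamma> t \<tau> "\<Gamma> @ \<Delta>" Var] by (simp add: wtenv_def nth_append)
lemma wff_append: "wff \<Gamma> \<phi> \<Longrightarrow> wff (\<Gamma> @ \<Delta>) \<phi>"
  using wff_fsub[of \<Gamma> \<phi> "\<Gamma> @ \<Delta>" Var] by (simp add: wtenv_def nth_append)

lemma defined_by_merge_left: "defined_by \<Gamma> e \<phi> w \<sigma>s P \<Longrightarrow> envs w \<Delta> f \<Longrightarrow> defined_by (\<Gamma> @ \<Delta>) (eapp (length \<Gamma>) e f) \<phi> w \<sigma>s P"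
proof (rule defined_byI)
  assume d: "defined_by \<Gamma> e \<phi> w \<sigma>s P" and f: "envs w \<Delta> f"
  show "wff (rev \<sigma>s @ \<Gamma> @ \<Delta>) \<phi>" using d wff_append[of "rev \<sigma>s @ \<Gamma>" \<phi> \<Delta>] by (simp add: defined_by_def)
  show "envs w (\<Gamma> @ \<Delta>) (eapp (length \<Gamma>) e f)" using d f by (simp add: defined_by_def envs_eapp)
  fix v ts assume v: "w \<sqsubseteq> v" "els v \<sigma>s ts"
  have "fsub (pushes ts (eapp (length \<Gamma>) e f)) \<phi> = fsub (pushes ts e) \<phi>"
    using d v by (intro fsub_cong[of "rev \<sigma>s @ \<Gamma>"] pushes_eapp_cong) (auto simp: defined_by_def dest: list_all2_lengthD)
  then show "P v ts \<longleftrightarrow> fc v (rev \<sigma>s @ \<Gamma> @ \<Delta>) (pushes ts (eapp (length \<Gamma>) e f)) \<phi>"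
    using d v by (simp add: defined_by_def fc_def)
qed

text \<open>Companion of \<open>eapp\<close>: the \<open>n\<close> argument variables stay, and the
  parameters move past the \<open>m\<close> parameters placed before them.\<close>

definition skip :: "nat \<Rightarrow> nat \<Rightarrow> nat \<Rightarrow> tm" where "skip n m i = (if i < n then Var i else Var (i + m))"

lemma wtenv_skip: "length \<sigma>s = n \<Longrightarrow> wtenv (\<sigma>s @ \<Gamma> @ \<Delta>) (skip n (length \<Gamma>)) (\<sigma>s @ \<Delta>)"
  by (auto simp: wtenv_def skip_def nth_append)

lemma sub_pushes_skip: "length ts = n \<Longrightarrow> sub (pushes ts (eapp m e f)) (skip n m i) = pushes ts f i"
proof (cases "i < n")
  case True
  assume "length ts = n"
  with True show ?thesis by (simp add: skip_def pushes_rev)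
next
  case False
  assume l: "length ts = n"
  from False obtain k where k: "i = k + n" by (metis add.commute le_Suc_ex not_less)
  have "pushes ts (eapp m e f) (k + m + n) = f k" "pushes ts f (k + n) = f k"
    using pushes_ge[of ts _ "k + m"] pushes_ge[of ts _ k] l by (simp_all add: eapp_def)
  then show ?thesis by (simp add: skip_def k add.assoc add.commute[of m n])
qed

lemma defined_by_merge_right:
  "defined_by \<Delta> f \<phi> w \<sigma>s P \<Longrightarrow> envs w \<Gamma> e \<Longrightarrow>
    defined_by (\<Gamma> @ \<Delta>) (eapp (length \<Gamma>) e f) (fsub (skip (length \<sigma>s) (length \<Gamma>)) \<phi>) w \<sigma>s P"
proof (rule defined_byI)
  assume d: "defined_by \<Delta> f \<phi> w \<sigma>s P" and e: "envs w \<Gamma> e"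
  show "wff (rev \<sigma>s @ \<Gamma> @ \<Delta>) (fsub (skip (length \<sigma>s) (length \<Gamma>)) \<phi>)"
    using d by (intro wff_fsub[OF _ wtenv_skip]) (auto simp: defined_by_def)
  show "envs w (\<Gamma> @ \<Delta>) (eapp (length \<Gamma>) e f)" using d e by (simp add: defined_by_def envs_eapp)
  fix v ts assume v: "w \<sqsubseteq> v" "els v \<sigma>s ts"
  then have "length ts = length \<sigma>s" by (auto dest: list_all2_lengthD)
  then show "P v ts \<longleftrightarrow> fc v (rev \<sigma>s @ \<Gamma> @ \<Delta>) (pushes ts (eapp (length \<Gamma>) e f)) (fsub (skip (length \<sigma>s) (length \<Gamma>)) \<phi>)"
    using d v by (simp add: defined_by_def fc_fsub[of _ _ _ _ _ "rev \<sigma>s @ \<Delta>"] sub_pushes_skip)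
qed

lemma dfn_common:
  assumes "dfn b w \<sigma>s P" "dfn c w \<tau>s Q"
  obtains \<Gamma> e \<phi> \<psi> where "defined_by \<Gamma> e \<phi> w \<sigma>s P" "b \<longrightarrow> internal \<phi>" "defined_by \<Gamma> e \<psi> w \<tau>s Q" "c \<longrightarrow> internal \<psi>"
proof -
  obtain \<Gamma> e \<phi> where 1: "defined_by \<Gamma> e \<phi> w \<sigma>s P" "b \<longrightarrow> internal \<phi>" using assms(1) by (auto simp: dfn_def)
  obtain \<Delta> f \<psi> where 2: "defined_by \<Delta> f \<psi> w \<tau>s Q" "c \<longrightarrow> internal \<psi>" using assms(2) by (auto simp: dfn_def)
  have "envs w \<Gamma> e" "envs w \<Delta> f" using 1 2 by (auto simp: defined_by_def)
  then show thesis
    using that[OF defined_by_merge_left[OF 1(1)] 1(2) defined_by_merge_right[OF 2(1)]] 2(2) by simp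
qed

subsubsection \<open>Closure properties\<close>

lemma dfn_AllSts:
  assumes "dfn b w (\<sigma>s @ \<tau>s) P"
  shows "dfn False w \<sigma>s (\<lambda>v ts. \<forall>u. v \<sqsubseteq> u \<longrightarrow> (\<forall>ys. stds u \<tau>s ys \<longrightarrow> P u (ts @ ys)))"
proof -
  obtain \<Gamma> e \<phi> where d: "defined_by \<Gamma> e \<phi> w (\<sigma>s @ \<tau>s) P" using assms by (auto simp: dfn_def)
  have "defined_by \<Gamma> e (AllSts \<tau>s \<phi>) w \<sigma>s (\<lambda>v ts. \<forall>u. v \<sqsubseteq> u \<longrightarrow> (\<forall>ys. stds u \<tau>s ys \<longrightarrow> P u (ts @ ys)))"
  proof (rule defined_byI)
    fix v ts assume v: "w \<sqsubseteq> v" "els v \<sigma>s ts"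
    have "P u (ts @ ys) \<longleftrightarrow> fc u (rev \<tau>s @ rev \<sigma>s @ \<Gamma>) (pushes ys (pushes ts e)) \<phi>" if "v \<sqsubseteq> u" "stds u \<tau>s ys" for u ys
    proof -
      have "els u (\<sigma>s @ \<tau>s) (ts @ ys)"
        using els_mono[OF v(2) that(1)] stds_els[OF that(2) wle_world[OF that(1)]] by (rule list_all2_appendI)
      then show ?thesis using d wle_trans[OF v(1) that(1)] by (simp add: defined_by_def pushes_append)
    qed
    moreover have "envs v (rev \<sigma>s @ \<Gamma>) (pushes ts e)" using d v by (auto simp: defined_by_def intro: envs_pushes envs_mono)
    ultimately show "(\<forall>u. v \<sqsubseteq> u \<longrightarrow> (\<forall>ys. stds u \<tau>s ys \<longrightarrow> P u (ts @ ys))) \<longleftrightarrow> fc v (rev \<sigma>s @ \<Gamma>) (pushes ts e) (AllSts \<tau>s \<phi>)"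
      using d wle_world[OF v(1)] by (subst fc_AllSts) (auto simp: defined_by_def)
  qed (use d in \<open>auto simp: defined_by_def\<close>)
  then show ?thesis by (auto simp: dfn_def)
qed

lemma dfn_ExSts:
  assumes "dfn b w (\<sigma>s @ \<tau>s) P"
  shows "dfn False w \<sigma>s (\<lambda>v ts. \<exists>ys. stds v \<tau>s ys \<and> P v (ts @ ys))"
proof -
  obtain \<Gamma> e \<phi> where d: "defined_by \<Gamma> e \<phi> w (\<sigma>s @ \<tau>s) P" using assms by (auto simp: dfn_def)
  have "defined_by \<Gamma> e (ExSts \<tau>s \<phi>) w \<sigma>s (\<lambda>v ts. \<exists>ys. stds v \<tau>s ys \<and> P v (ts @ ys))"
  proof (rule defined_byI)
    fix v ts assume v: "w \<sqsubseteq> v" "els v \<sigma>s ts"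
    have "P v (ts @ ys) \<longleftrightarrow> fc v (rev \<tau>s @ rev \<sigma>s @ \<Gamma>) (pushes ys (pushes ts e)) \<phi>" if "stds v \<tau>s ys" for ys
    proof -
      have "els v (\<sigma>s @ \<tau>s) (ts @ ys)"
        using v(2) stds_els[OF that wle_world[OF v(1)]] by (rule list_all2_appendI)
      then show ?thesis using d v(1) by (simp add: defined_by_def pushes_append)
    qed
    moreover have "envs v (rev \<sigma>s @ \<Gamma>) (pushes ts e)" using d v by (auto simp: defined_by_def intro: envs_pushes envs_mono)
    ultimately show "(\<exists>ys. stds v \<tau>s ys \<and> P v (ts @ ys)) \<longleftrightarrow> fc v (rev \<sigma>s @ \<Gamma>) (pushes ts e) (ExSts \<tau>s \<phi>)"
      using d wle_world[OF v(1)] by (subst fc_ExSts) (auto simp: defined_by_def)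
  qed (use d in \<open>auto simp: defined_by_def\<close>)
  then show ?thesis by (auto simp: dfn_def)
qed

text \<open>The bounds may depend on the arguments. This is needed for implications, where the
  bounding sequences of challenges are themselves arguments.\<close>

lemma dfn_BAlls:
  assumes "dfn b w (\<sigma>s @ \<tau>s) P" and S: "defts w \<sigma>s (map Seq \<tau>s) S"
  shows "dfn b w \<sigma>s (\<lambda>v ts. \<forall>u. v \<sqsubseteq> u \<longrightarrow> (\<forall>ys. mems u \<tau>s ys (S ts) \<longrightarrow> P u (ts @ ys)))"
proof -
  obtain \<Gamma> e \<phi> where d0: "defined_by \<Gamma> e \<phi> w (\<sigma>s @ \<tau>s) P" and i: "b \<longrightarrow> internal \<phi>"
    using assms by (auto simp: dfn_def)
  obtain \<Delta> f us where us: "list_all2 (wt (rev \<sigma>s @ \<Delta>)) us (map Seq \<tau>s)" "envs w \<Delta> f"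
    "\<And>v ts. w \<sqsubseteq> v \<Longrightarrow> els v \<sigma>s ts \<Longrightarrow> S ts = map (sub (pushes ts f)) us"
    using S unfolding defts_def by blast
  let ?\<Gamma> = "\<Gamma> @ \<Delta>"
  let ?e = "eapp (length \<Gamma>) e f"
  let ?ss = "map (sub (skip (length \<sigma>s) (length \<Gamma>))) us"
  from defined_by_merge_left[OF d0 us(2)] have d: "defined_by ?\<Gamma> ?e \<phi> w (\<sigma>s @ \<tau>s) P" .
  have "wtenv (rev \<sigma>s @ ?\<Gamma>) (skip (length \<sigma>s) (length \<Gamma>)) (rev \<sigma>s @ \<Delta>)" by (rule wtenv_skip) simp
  from wt_sub[OF _ this] have wt: "list_all2 (\<lambda>s \<tau>. wt (rev \<sigma>s @ ?\<Gamma>) s (Seq \<tau>)) ?ss \<tau>s"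
    using us(1) by (auto simp: list_all2_conv_all_nth)
  have "defined_by ?\<Gamma> ?e (BAlls \<tau>s ?ss \<phi>) w \<sigma>s (\<lambda>v ts. \<forall>u. v \<sqsubseteq> u \<longrightarrow> (\<forall>ys. mems u \<tau>s ys (S ts) \<longrightarrow> P u (ts @ ys)))"
  proof (rule defined_byI)
    show "wff (rev \<sigma>s @ ?\<Gamma>) (BAlls \<tau>s ?ss \<phi>)" using d wt list_all2_lengthD[OF us(1)] by (intro wff_BAlls) (auto simp: defined_by_def)
    show "envs w ?\<Gamma> ?e" using d by (simp add: defined_by_def)
    fix v ts assume v: "w \<sqsubseteq> v" "els v \<sigma>s ts"
    have lt: "length ts = length \<sigma>s" using v by (auto dest: list_all2_lengthD)
    have ev: "envs v (rev \<sigma>s @ ?\<Gamma>) (pushes ts ?e)" using d v by (auto simp: defined_by_def intro: envs_pushes envs_mono)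
    have sv: "map (sub (pushes ts ?e)) ?ss = S ts"
      unfolding us(3)[OF v] by (simp add: sub_sub sub_pushes_skip[OF lt])
    have "P u (ts @ ys) \<longleftrightarrow> fc u (rev \<tau>s @ rev \<sigma>s @ ?\<Gamma>) (pushes ys (pushes ts ?e)) \<phi>" if "v \<sqsubseteq> u" "mems u \<tau>s ys ss" for u ys ss
    proof -
      have "els u (\<sigma>s @ \<tau>s) (ts @ ys)"
        using els_mono[OF v(2) that(1)] mems_els[OF that(2) wle_world[OF that(1)]] by (rule list_all2_appendI)
      then show ?thesis using d wle_trans[OF v(1) that(1)] by (simp add: defined_by_def pushes_append)
    qed
    then show "(\<forall>u. v \<sqsubseteq> u \<longrightarrow> (\<forall>ys. mems u \<tau>s ys (S ts) \<longrightarrow> P u (ts @ ys))) \<longleftrightarrow> fc v (rev \<sigma>s @ ?\<Gamma>) (pushes ts ?e) (BAlls \<tau>s ?ss \<phi>)"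
      using fc_BAlls[of ?ss \<tau>s v "rev \<sigma>s @ ?\<Gamma>" \<phi> "pushes ts ?e"] d wle_world[OF v(1)] wt ev sv list_all2_lengthD[OF us(1)]
      by (auto simp: defined_by_def)
  qed
  moreover have "internal (BAlls \<tau>s ss' \<phi>) = internal \<phi>" for ss'
    by (induction \<tau>s ss' \<phi> rule: BAlls.induct) auto
  ultimately show ?thesis using i by (auto simp: dfn_def)
qed

lemma dfn_And: "dfn b w \<sigma>s P \<Longrightarrow> dfn b w \<sigma>s Q \<Longrightarrow> dfn b w \<sigma>s (\<lambda>v ts. P v ts \<and> Q v ts)"
  and dfn_Or: "dfn b w \<sigma>s P \<Longrightarrow> dfn b w \<sigma>s Q \<Longrightarrow> dfn b w \<sigma>s (\<lambda>v ts. P v ts \<or> Q v ts)"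
  and dfn_Imp: "dfn b w \<sigma>s P \<Longrightarrow> dfn b w \<sigma>s Q \<Longrightarrow> dfn b w \<sigma>s (\<lambda>v ts. \<forall>u. v \<sqsubseteq> u \<longrightarrow> P u ts \<longrightarrow> Q u ts)"
proof -
  assume "dfn b w \<sigma>s P" "dfn b w \<sigma>s Q"
  then obtain \<Gamma> e \<phi> \<psi> where d: "defined_by \<Gamma> e \<phi> w \<sigma>s P" "defined_by \<Gamma> e \<psi> w \<sigma>s Q" and i: "b \<longrightarrow> internal \<phi>" "b \<longrightarrow> internal \<psi>"
    using dfn_common by metis
  have wf: "wff (rev \<sigma>s @ \<Gamma>) \<phi>" "wff (rev \<sigma>s @ \<Gamma>) \<psi>" and e: "envs w \<Gamma> e" using d by (auto simp: defined_by_def)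
  have ev: "world v \<and> envs v (rev \<sigma>s @ \<Gamma>) (pushes ts e)" if "w \<sqsubseteq> v" "els v \<sigma>s ts" for v ts
    using that e by (auto intro: envs_pushes envs_mono)
  have P: "P v ts \<longleftrightarrow> fc v (rev \<sigma>s @ \<Gamma>) (pushes ts e) \<phi>" and Q: "Q v ts \<longleftrightarrow> fc v (rev \<sigma>s @ \<Gamma>) (pushes ts e) \<psi>" if "w \<sqsubseteq> v" "els v \<sigma>s ts" for v ts
    using d that by (auto simp: defined_by_def)
  have "defined_by \<Gamma> e (And \<phi> \<psi>) w \<sigma>s (\<lambda>v ts. P v ts \<and> Q v ts)"
    by (rule defined_byI) (use wf e ev P Q in auto)
  then show "dfn b w \<sigma>s (\<lambda>v ts. P v ts \<and> Q v ts)" unfolding dfn_def using i by (meson internal.simps(4))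
  have "defined_by \<Gamma> e (Or \<phi> \<psi>) w \<sigma>s (\<lambda>v ts. P v ts \<or> Q v ts)"
    by (rule defined_byI) (use wf e ev P Q in auto)
  then show "dfn b w \<sigma>s (\<lambda>v ts. P v ts \<or> Q v ts)" unfolding dfn_def using i by (meson internal.simps(5))
  have "defined_by \<Gamma> e (Imp \<phi> \<psi>) w \<sigma>s (\<lambda>v ts. \<forall>u. v \<sqsubseteq> u \<longrightarrow> P u ts \<longrightarrow> Q u ts)"
  proof (rule defined_byI)
    fix v ts assume v: "w \<sqsubseteq> v" "els v \<sigma>s ts"
    have "P u ts \<longleftrightarrow> fc u (rev \<sigma>s @ \<Gamma>) (pushes ts e) \<phi>" "Q u ts \<longleftrightarrow> fc u (rev \<sigma>s @ \<Gamma>) (pushes ts e) \<psi>" if u: "v \<sqsubseteq> u" for u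
      using P[OF wle_trans[OF v(1) u] els_mono[OF v(2) u]] Q[OF wle_trans[OF v(1) u] els_mono[OF v(2) u]] by auto
    then show "(\<forall>u. v \<sqsubseteq> u \<longrightarrow> P u ts \<longrightarrow> Q u ts) \<longleftrightarrow> fc v (rev \<sigma>s @ \<Gamma>) (pushes ts e) (Imp \<phi> \<psi>)"
      using ev[OF v] wf by simp
  qed (use wf e in auto)
  then show "dfn b w \<sigma>s (\<lambda>v ts. \<forall>u. v \<sqsubseteq> u \<longrightarrow> P u ts \<longrightarrow> Q u ts)" unfolding dfn_def using i by (meson internal.simps(6))
qed

lemma dfn_mem_hd: "elt w (Seq \<sigma>) c \<Longrightarrow> dfn True w (\<sigma> # \<tau>s) (\<lambda>v ts. mem v \<sigma> (ts ! 0) c)"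
  and dfn_eq_hd: "elt w \<sigma> c \<Longrightarrow> dfn True w (\<sigma> # \<tau>s) (\<lambda>v ts. eqw v \<sigma> (ts ! 0) c)"
proof -
  \<comment> \<open>The head is pushed first, so its index is \<open>length \<tau>s\<close>; the
    parameter comes right after it.\<close>
  have p: "pushes ts e (length \<tau>s) = ts ! 0" "pushes ts e (Suc (length \<tau>s)) = e 0" if "els v (\<sigma> # \<tau>s) ts" for v ts e
    using pushes_less[of 0 ts e] pushes_ge[of ts e 0] list_all2_lengthD[OF that, symmetric] by auto
  show "dfn True w (\<sigma> # \<tau>s) (\<lambda>v ts. mem v \<sigma> (ts ! 0) c)" if c: "elt w (Seq \<sigma>) c"
  proof -
    have "defined_by [Seq \<sigma>] (c ## Var) (In \<sigma> (Var (length \<tau>s)) (Var (Suc (length \<tau>s)))) w (\<sigma> # \<tau>s) (\<lambda>v ts. mem v \<sigma> (ts ! 0) c)"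
      by (rule defined_byI) (use c p in \<open>auto simp: nth_append intro!: wff_In\<close>)
    then show ?thesis unfolding dfn_def by (meson internal_In)
  qed
  show "dfn True w (\<sigma> # \<tau>s) (\<lambda>v ts. eqw v \<sigma> (ts ! 0) c)" if c: "elt w \<sigma> c"
  proof -
    have "defined_by [\<sigma>] (c ## Var) (Eq \<sigma> (Var (length \<tau>s)) (Var (Suc (length \<tau>s)))) w (\<sigma> # \<tau>s) (\<lambda>v ts. eqw v \<sigma> (ts ! 0) c)"
      by (rule defined_byI) (use c p in \<open>auto simp: nth_append\<close>)
    then show ?thesis unfolding dfn_def by (meson internal.simps(1))
  qed
qed

lemma dfn_comp:
  assumes P: "dfn b w \<tau>s P" and F: "defts w \<sigma>s \<tau>s F"
  shows "dfn b w \<sigma>s (\<lambda>v ts. P v (F ts))"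
proof -
  obtain \<Gamma> e \<phi> where d: "defined_by \<Gamma> e \<phi> w \<tau>s P" and i: "b \<longrightarrow> internal \<phi>"
    using P by (auto simp: dfn_def)
  obtain \<Delta> f us where us: "list_all2 (wt (rev \<sigma>s @ \<Delta>)) us \<tau>s" "envs w \<Delta> f"
    "\<And>v ts. w \<sqsubseteq> v \<Longrightarrow> els v \<sigma>s ts \<Longrightarrow> F ts = map (sub (pushes ts f)) us"
    using F unfolding defts_def by blast
  have lu: "length us = length \<tau>s" using us by (auto dest: list_all2_lengthD)
  \<comment> \<open>The defining terms replace the arguments in reversed order, matching
    \<open>pushes\<close>; the parameters of \<open>P\<close> are moved behind
    \<open>\<sigma>s\<close> and \<open>\<Delta>\<close>.\<close>
  let ?g = "\<lambda>i. if i < length \<tau>s then rev us ! i else Var (i - length \<tau>s + length \<Delta> + length \<sigma>s)"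
  let ?e = "eapp (length \<Delta>) f e"
  have "defined_by (\<Delta> @ \<Gamma>) ?e (fsub ?g \<phi>) w \<sigma>s (\<lambda>v ts. P v (F ts))"
  proof (rule defined_byI)
    have "wt (rev \<sigma>s @ \<Delta> @ \<Gamma>) (rev us ! i) (rev \<tau>s ! i)" if "i < length \<tau>s" for i
      using us(1) lu that wt_append[of "rev \<sigma>s @ \<Delta>" "rev us ! i" "rev \<tau>s ! i" \<Gamma>]
      by (simp add: list_all2_conv_all_nth rev_nth)
    then have "wtenv (rev \<sigma>s @ \<Delta> @ \<Gamma>) ?g (rev \<tau>s @ \<Gamma>)"
      by (auto simp: wtenv_def nth_append)
    then show "wff (rev \<sigma>s @ \<Delta> @ \<Gamma>) (fsub ?g \<phi>)"
      using d by (auto simp: defined_by_def intro: wff_fsub)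
    show "envs w (\<Delta> @ \<Gamma>) ?e" using d us by (auto simp: defined_by_def intro: envs_eapp)
    fix v ts assume v: "w \<sqsubseteq> v" "els v \<sigma>s ts"
    have lt: "length ts = length \<sigma>s" using v by (auto dest: list_all2_lengthD)
    note F = us(3)[OF v]
    have "sub (pushes ts ?e) (?g i) = pushes (F ts) e i" if "i < length (rev \<tau>s @ \<Gamma>)" for i
    proof (cases "i < length \<tau>s")
      case True
      then have "wt (rev \<sigma>s @ \<Delta>) (rev us ! i) (rev \<tau>s ! i)" using us(1) lu by (simp add: list_all2_conv_all_nth rev_nth)
      from sub_cong[OF this pushes_eapp_cong[OF lt]]
      have "sub (pushes ts ?e) (rev us ! i) = sub (pushes ts f) (rev us ! i)" by simp
      then show ?thesis using True lu by (simp add: F pushes_rev rev_map)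
    next
      case False
      then obtain k where k: "i = k + length \<tau>s" by (metis add.commute le_Suc_ex not_less)
      have "pushes ts ?e (k + length \<Delta> + length \<sigma>s) = e k" "pushes (F ts) e (k + length \<tau>s) = e k"
        using pushes_ge[of ts ?e "k + length \<Delta>"] pushes_ge[of "F ts" e k] by (simp_all add: F lu lt eapp_def)
      then show ?thesis by (simp add: k)
    qed
    then have "fsub (\<lambda>i. sub (pushes ts ?e) (?g i)) \<phi> = fsub (pushes (F ts) e) \<phi>"
      using d by (intro fsub_cong[of "rev \<tau>s @ \<Gamma>"]) (auto simp: defined_by_def)
    moreover have "els v \<tau>s (F ts)" by (rule defts_els[OF assms(2) v])
    ultimately show "P v (F ts) \<longleftrightarrow> fc v (rev \<sigma>s @ \<Delta> @ \<Gamma>) (pushes ts ?e) (fsub ?g \<phi>)"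
      using d v(1) by (simp add: defined_by_def fc_def fsub_fsub)
  qed
  moreover have "b \<longrightarrow> internal (fsub ?g \<phi>)" using i by simp
  ultimately show ?thesis unfolding dfn_def by blast
qed

lemma defts_common:
  assumes "defts w \<sigma>s \<tau>s F" "defts w \<sigma>s \<rho>s G"
  obtains \<Gamma> e us vs where "list_all2 (wt (rev \<sigma>s @ \<Gamma>)) us \<tau>s" "list_all2 (wt (rev \<sigma>s @ \<Gamma>)) vs \<rho>s" "envs w \<Gamma> e"
    "\<And>v ts. w \<sqsubseteq> v \<Longrightarrow> els v \<sigma>s ts \<Longrightarrow> F ts = map (sub (pushes ts e)) us"
    "\<And>v ts. w \<sqsubseteq> v \<Longrightarrow> els v \<sigma>s ts \<Longrightarrow> G ts = map (sub (pushes ts e)) vs"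
proof -
  obtain \<Gamma> e us where us: "list_all2 (wt (rev \<sigma>s @ \<Gamma>)) us \<tau>s" "envs w \<Gamma> e"
    "\<And>v ts. w \<sqsubseteq> v \<Longrightarrow> els v \<sigma>s ts \<Longrightarrow> F ts = map (sub (pushes ts e)) us"
    using assms(1) unfolding defts_def by blast
  obtain \<Delta> f vs where vs: "list_all2 (wt (rev \<sigma>s @ \<Delta>)) vs \<rho>s" "envs w \<Delta> f"
    "\<And>v ts. w \<sqsubseteq> v \<Longrightarrow> els v \<sigma>s ts \<Longrightarrow> G ts = map (sub (pushes ts f)) vs"
    using assms(2) unfolding defts_def by blast
  let ?e = "eapp (length \<Gamma>) e f" and ?s = "sub (skip (length \<sigma>s) (length \<Gamma>))"
  show thesis
  proof (rule that)
    show "list_all2 (wt (rev \<sigma>s @ \<Gamma> @ \<Delta>)) us \<tau>s"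
      using us(1) by (rule list_all2_mono) (use wt_append[of "rev \<sigma>s @ \<Gamma>"] in simp)
    have "wtenv (rev \<sigma>s @ \<Gamma> @ \<Delta>) (skip (length \<sigma>s) (length \<Gamma>)) (rev \<sigma>s @ \<Delta>)" by (rule wtenv_skip) simp
    then show "list_all2 (wt (rev \<sigma>s @ \<Gamma> @ \<Delta>)) (map ?s vs) \<rho>s"
      using vs(1) by (auto simp: list_all2_conv_all_nth intro: wt_sub)
    show "envs w (\<Gamma> @ \<Delta>) ?e" using us vs by (simp add: envs_eapp)
    fix v ts assume v: "w \<sqsubseteq> v" "els v \<sigma>s ts"
    have lt: "length ts = length \<sigma>s" using v by (auto dest: list_all2_lengthD)
    have "sub (pushes ts ?e) (us ! i) = sub (pushes ts e) (us ! i)" if "i < length us" for i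
      using us(1) that sub_cong[OF _ pushes_eapp_cong[OF lt]] by (auto simp: list_all2_conv_all_nth)
    then show "F ts = map (sub (pushes ts ?e)) us"
      unfolding us(3)[OF v] by (auto simp: in_set_conv_nth)
    show "G ts = map (sub (pushes ts ?e)) (map ?s vs)"
      unfolding vs(3)[OF v] by (simp add: sub_sub sub_pushes_skip[OF lt])
  qed
qed

lemma defts_append: "defts w \<sigma>s \<tau>s F \<Longrightarrow> defts w \<sigma>s \<rho>s G \<Longrightarrow> defts w \<sigma>s (\<tau>s @ \<rho>s) (\<lambda>ts. F ts @ G ts)"
proof -
  assume a: "defts w \<sigma>s \<tau>s F" "defts w \<sigma>s \<rho>s G"
  obtain \<Gamma> e us vs where "list_all2 (wt (rev \<sigma>s @ \<Gamma>)) us \<tau>s" "list_all2 (wt (rev \<sigma>s @ \<Gamma>)) vs \<rho>s" "envs w \<Gamma> e"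
    "\<And>v ts. w \<sqsubseteq> v \<Longrightarrow> els v \<sigma>s ts \<Longrightarrow> F ts = map (sub (pushes ts e)) us"
    "\<And>v ts. w \<sqsubseteq> v \<Longrightarrow> els v \<sigma>s ts \<Longrightarrow> G ts = map (sub (pushes ts e)) vs"
    by (rule defts_common[OF a]) (rule that, assumption+)
  then show ?thesis
    unfolding defts_def by (intro exI[of _ \<Gamma>] exI[of _ e] exI[of _ "us @ vs"]) (auto intro: list_all2_appendI)
qed

text \<open>Elements of the world become parameters: they form the environment, and the defining
  terms are the corresponding variables.\<close>

lemma defts_const:
  assumes "els w \<tau>s cs" shows "defts w \<sigma>s \<tau>s (\<lambda>_. cs)"
proof -
  let ?us = "map (\<lambda>j. Var (j + length \<sigma>s)) [0..<length \<tau>s]"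
  have l: "length cs = length \<tau>s" using assms by (auto dest: list_all2_lengthD)
  have "list_all2 (wt (rev \<sigma>s @ \<tau>s)) ?us \<tau>s" by (auto simp: list_all2_conv_all_nth nth_append)
  moreover have "envs w \<tau>s (\<lambda>i. cs ! i)" using assms by (auto simp: envs_def list_all2_conv_all_nth)
  moreover have "cs = map (sub (pushes ts (\<lambda>i. cs ! i))) ?us" if "els v \<sigma>s ts" for v ts
  proof (rule nth_equalityI)
    fix j assume "j < length cs"
    then show "cs ! j = map (sub (pushes ts (\<lambda>i. cs ! i))) ?us ! j"
      using pushes_ge[of ts "\<lambda>i. cs ! i" j] list_all2_lengthD[OF that] by (simp add: l)
  qed (simp add: l)
  ultimately show ?thesis unfolding defts_def by blast
qed

lemma defts_args: "world w \<Longrightarrow> defts w \<sigma>s \<sigma>s (\<lambda>ts. ts)"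
proof -
  let ?us = "map (\<lambda>j. Var (length \<sigma>s - Suc j)) [0..<length \<sigma>s]"
  have "list_all2 (wt (rev \<sigma>s @ [])) ?us \<sigma>s" by (auto simp: list_all2_conv_all_nth rev_nth)
  moreover have "ts = map (sub (pushes ts e)) ?us" if "els v \<sigma>s ts" for v ts e
  proof (rule nth_equalityI)
    fix j assume "j < length ts"
    then show "ts ! j = map (sub (pushes ts e)) ?us ! j"
      using pushes_less[of j ts e] list_all2_lengthD[OF that] by simp
  qed (use list_all2_lengthD[OF that] in simp)
  ultimately show ?thesis unfolding defts_def by (intro exI[of _ "[]"] exI[of _ Var] exI[of _ ?us]) auto
qed

lemma defts_take: "defts w \<sigma>s \<tau>s F \<Longrightarrow> defts w \<sigma>s (take k \<tau>s) (\<lambda>ts. take k (F ts))"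
  and defts_drop: "defts w \<sigma>s \<tau>s F \<Longrightarrow> defts w \<sigma>s (drop k \<tau>s) (\<lambda>ts. drop k (F ts))"
  unfolding defts_def by (metis list_all2_takeI take_map) (metis list_all2_dropI drop_map)

lemma sub_sapps [simp]: "sub e (sapps \<rho>s \<tau> s ts) = sapps \<rho>s \<tau> (sub e s) (map (sub e) ts)"
  by (induction \<rho>s \<tau> s ts rule: sapps.induct) auto

lemma wt_sapps: "wt \<Gamma> s (Seq (fty \<rho>s \<tau>)) \<Longrightarrow> list_all2 (wt \<Gamma>) ts \<rho>s \<Longrightarrow> wt \<Gamma> (sapps \<rho>s \<tau> s ts) (Seq \<tau>)"
  by (induction \<rho>s \<tau> s ts rule: sapps.induct) (auto simp: wt_sapp)

lemma defts_sapps: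
  assumes "defts w \<sigma>s (map (\<lambda>\<tau>. Seq (fty \<rho>s \<tau>)) \<tau>s) F" "defts w \<sigma>s \<rho>s G"
  shows "defts w \<sigma>s (map Seq \<tau>s) (\<lambda>ts. map2 (\<lambda>\<tau> U. sapps \<rho>s \<tau> U (G ts)) \<tau>s (F ts))"
proof -
  obtain \<Gamma> e us vs where d: "list_all2 (wt (rev \<sigma>s @ \<Gamma>)) us (map (\<lambda>\<tau>. Seq (fty \<rho>s \<tau>)) \<tau>s)"
    "list_all2 (wt (rev \<sigma>s @ \<Gamma>)) vs \<rho>s" "envs w \<Gamma> e"
    "\<And>v ts. w \<sqsubseteq> v \<Longrightarrow> els v \<sigma>s ts \<Longrightarrow> F ts = map (sub (pushes ts e)) us"
    "\<And>v ts. w \<sqsubseteq> v \<Longrightarrow> els v \<sigma>s ts \<Longrightarrow> G ts = map (sub (pushes ts e)) vs"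
    by (rule defts_common[OF assms]) (rule that, assumption+)
  let ?us = "map2 (\<lambda>\<tau> u. sapps \<rho>s \<tau> u vs) \<tau>s us"
  have "list_all2 (wt (rev \<sigma>s @ \<Gamma>)) ?us (map Seq \<tau>s)"
    using d(1,2) by (auto simp: list_all2_conv_all_nth intro!: wt_sapps)
  moreover have "map2 (\<lambda>\<tau> U. sapps \<rho>s \<tau> U (G ts)) \<tau>s (F ts) = map (sub (pushes ts e)) ?us"
    if "w \<sqsubseteq> v" "els v \<sigma>s ts" for v ts
    unfolding d(4,5)[OF that] using d(1) by (auto simp: list_all2_conv_all_nth intro: nth_equalityI)
  ultimately show ?thesis unfolding defts_def using d(3) by blast
qed

text \<open>The closed terms \<open>rs\<close> will be the projections decoding a tuple from its code.\<close>

lemma defts_App: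
  assumes F: "defts w \<sigma>s [\<rho>] (\<lambda>ts. [f ts])" and r: "list_all2 (\<lambda>r \<tau>. wt [] r (\<rho> \<rightarrow> \<tau>)) rs \<tau>s"
  shows "defts w \<sigma>s \<tau>s (\<lambda>ts. map (\<lambda>r. r \<cdot> f ts) rs)"
proof -
  obtain \<Gamma> e us where d: "list_all2 (wt (rev \<sigma>s @ \<Gamma>)) us [\<rho>]" "envs w \<Gamma> e"
    "\<And>v ts. w \<sqsubseteq> v \<Longrightarrow> els v \<sigma>s ts \<Longrightarrow> [f ts] = map (sub (pushes ts e)) us"
    using F unfolding defts_def by metis
  then obtain u where u: "us = [u]" "wt (rev \<sigma>s @ \<Gamma>) u \<rho>" by (auto simp: list_all2_Cons2)
  have "list_all2 (wt (rev \<sigma>s @ \<Gamma>)) (map (\<lambda>r. r \<cdot> u) rs) \<tau>s"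
    using r u(2) by (auto simp: list_all2_conv_all_nth intro!: wt_App[OF wt_closed])
  moreover have "map (\<lambda>r. r \<cdot> f ts) rs = map (sub (pushes ts e)) (map (\<lambda>r. r \<cdot> u) rs)" if "w \<sqsubseteq> v" "els v \<sigma>s ts" for v ts
  proof -
    have "sub g r' = r'" if "r' \<in> set rs" for g r'
      using r that by (auto simp: list_all2_conv_all_nth in_set_conv_nth intro: sub_closed)
    then show ?thesis using d(3)[OF that] u(1) by simp
  qed
  ultimately show ?thesis unfolding defts_def using d(2) by blast
qed

subsection \<open>The principles in a world\<close>

lemma fc_inst_3: "fc w \<Gamma> (x ## y ## z ## e) (inst 3 [Var 0, Var (Suc 0)] \<Phi>) \<longleftrightarrow> fc w \<Delta> (x ## y ## e) \<Phi>"
  unfolding fc_def inst_def fsub_fsub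
  by (rule arg_cong[where f="\<lambda>e. tr w (fsub e \<Phi>)"]) (auto simp: less_Suc_eq numeral_3_eq_3 fun_eq_iff split: nat.split)
lemma fc_inst_2: "fc w \<Gamma> (x ## z ## e) (inst 2 [Var 0] \<Phi>) \<longleftrightarrow> fc w \<Delta> (x ## e) \<Phi>"
  unfolding fc_def inst_def fsub_fsub
  by (rule arg_cong[where f="\<lambda>e. tr w (fsub e \<Phi>)"]) (auto simp: numeral_2_eq_2 fun_eq_iff split: nat.split)
lemma fc_inst_1_Nil: "fc w \<Gamma> (z ## e) (inst (Suc 0) [] \<Phi>) \<longleftrightarrow> fc w \<Delta> e \<Phi>"
  unfolding fc_def inst_def fsub_fsub by simp
lemma wff_inst_3: "wff (\<sigma> # \<tau> # \<Gamma>) \<Phi> \<Longrightarrow> wff (\<sigma> # \<tau> # \<rho> # \<Gamma>) (inst 3 [Var 0, Var (Suc 0)] \<Phi>)"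
  unfolding inst_def by (erule wff_fsub) (simp add: wtenv_def All_less_Suc2)
lemma wff_inst_2: "wff (\<sigma> # \<Gamma>) \<Phi> \<Longrightarrow> wff (\<sigma> # \<rho> # \<Gamma>) (inst 2 [Var 0] \<Phi>)"
  unfolding inst_def by (erule wff_fsub) (simp add: wtenv_def All_less_Suc2)
lemma wff_inst_1_Nil: "wff \<Gamma> \<Phi> \<Longrightarrow> wff (\<rho> # \<Gamma>) (inst (Suc 0) [] \<Phi>)"
  unfolding inst_def by (erule wff_fsub) (simp add: wtenv_def)

declare std_elt [simp]

lemma defined_by_2: "defined_by \<Gamma> e \<phi> w [\<sigma>, \<tau>] P \<Longrightarrow>
    wff (\<tau> # \<sigma> # \<Gamma>) \<phi> \<and> envs w \<Gamma> e \<and> (\<forall>v x y. w \<sqsubseteq> v \<longrightarrow> elt v \<sigma> x \<longrightarrow> elt v \<tau> y \<longrightarrow> (fc v (\<tau> # \<sigma> # \<Gamma>) (y ## x ## e) \<phi> \<longleftrightarrow> P v [x, y]))"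
  by (simp add: defined_by_def)
lemma defined_by_1: "defined_by \<Gamma> e \<phi> w [\<sigma>] P \<Longrightarrow>
    wff (\<sigma> # \<Gamma>) \<phi> \<and> envs w \<Gamma> e \<and> (\<forall>v x. w \<sqsubseteq> v \<longrightarrow> elt v \<sigma> x \<longrightarrow> (fc v (\<sigma> # \<Gamma>) (x ## e) \<phi> \<longleftrightarrow> P v [x]))"
  by (simp add: defined_by_def)
lemma defined_by_0: "defined_by \<Gamma> e \<phi> w [] P \<Longrightarrow>
    wff \<Gamma> \<phi> \<and> envs w \<Gamma> e \<and> (\<forall>v. w \<sqsubseteq> v \<longrightarrow> (fc v \<Gamma> e \<phi> \<longleftrightarrow> P v []))"
  by (simp add: defined_by_def)

text \<open>The axiom is taken at a defining formula: \<open>prem\<close> makes its hypothesis true,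
  \<open>fc_ImpD\<close> yields its conclusion, and \<open>sem\<close> translates this back into
  \<open>P\<close>. The other principles follow the same pattern.\<close>

lemma I_w:
  assumes w: "world w" and P: "dfn True w [\<tau>, \<sigma>] P"
    and prem: "\<And>v s. w \<sqsubseteq> v \<Longrightarrow> std v (Seq \<sigma>) s \<Longrightarrow> \<exists>y. elt v \<tau> y \<and> (\<forall>u. v \<sqsubseteq> u \<longrightarrow> (\<forall>x. mem u \<sigma> x s \<longrightarrow> P u [y, x]))"
  shows "\<exists>y. elt w \<tau> y \<and> (\<forall>v. w \<sqsubseteq> v \<longrightarrow> (\<forall>x. std v \<sigma> x \<longrightarrow> P v [y, x]))"
proof -
  obtain \<Gamma> e \<phi> where d: "defined_by \<Gamma> e \<phi> w [\<tau>, \<sigma>] P" and i: "internal \<phi>" using P by (auto simp: dfn_def)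
  from defined_by_2[OF d] have wf: "wff (\<sigma> # \<tau> # \<Gamma>) \<phi>" and e: "envs w \<Gamma> e"
    and sem: "\<And>v x y. w \<sqsubseteq> v \<Longrightarrow> elt v \<tau> y \<Longrightarrow> elt v \<sigma> x \<Longrightarrow> fc v (\<sigma> # \<tau> # \<Gamma>) (x ## y ## e) \<phi> \<longleftrightarrow> P v [y, x]" by auto
  let ?A = "AllSt (Seq \<sigma>) (Ex \<tau> (BAll \<sigma> (Var 1) (inst 3 [Var 0, Var 1] \<phi>)))"
  have ax: "fc w \<Gamma> e (Imp ?A (Ex \<tau> (AllSt \<sigma> \<phi>)))"
    by (rule fc_H[OF H.I]) (use w e wf i in \<open>auto simp: lang_int_def wff_inst_3 intro!: wff_BAll\<close>)
  have "fc v (\<tau> # Seq \<sigma> # \<Gamma>) (y ## s ## e) (BAll \<sigma> (Var 1) (inst 3 [Var 0, Var 1] \<phi>)) \<longleftrightarrow>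
      (\<forall>u. v \<sqsubseteq> u \<longrightarrow> (\<forall>x. mem u \<sigma> x s \<longrightarrow> P u [y, x]))" if v: "w \<sqsubseteq> v" "std v (Seq \<sigma>) s" "elt v \<tau> y" for v s y
  proof -
    have "P u [y, x] \<longleftrightarrow> fc u (\<sigma> # \<tau> # Seq \<sigma> # \<Gamma>) (x ## y ## s ## e) (inst 3 [Var 0, Var (Suc 0)] \<phi>)"
      if "v \<sqsubseteq> u" "mem u \<sigma> x s" for u x
      using sem[OF wle_trans[OF v(1) that(1)] elt_mono[OF v(3) that(1)] mem_elt(1)[OF wle_world[OF that(1)] that(2)]]
      by (simp add: fc_inst_3[of _ _ _ _ _ _ _ "\<sigma> # \<tau> # \<Gamma>"])
    then show ?thesis
      using v e wf envs_mono[OF e v(1)] by (subst fc_BAll) (auto simp: wff_inst_3)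
  qed
  then have "fc w \<Gamma> e ?A"
  proof -
    assume B: "\<And>v s y. w \<sqsubseteq> v \<Longrightarrow> std v (Seq \<sigma>) s \<Longrightarrow> elt v \<tau> y \<Longrightarrow>
      fc v (\<tau> # Seq \<sigma> # \<Gamma>) (y ## s ## e) (BAll \<sigma> (Var 1) (inst 3 [Var 0, Var 1] \<phi>)) \<longleftrightarrow>
      (\<forall>u. v \<sqsubseteq> u \<longrightarrow> (\<forall>x. mem u \<sigma> x s \<longrightarrow> P u [y, x]))"
    have wB: "wff (\<tau> # Seq \<sigma> # \<Gamma>) (BAll \<sigma> (Var 1) (inst 3 [Var 0, Var 1] \<phi>))"
      using wf by (auto intro!: wff_BAll wff_inst_3)
    have "fc v (Seq \<sigma> # \<Gamma>) (s ## e) (Ex \<tau> (BAll \<sigma> (Var 1) (inst 3 [Var 0, Var 1] \<phi>)))"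
      if v: "w \<sqsubseteq> v" "std v (Seq \<sigma>) s" for v s
      using prem[OF v] B[OF v] wB envs_mono[OF e v(1)] wle_world[OF v(1)] v(2) by (subst fc_Ex) auto
    then show ?thesis using w e wB by (simp del: fc_Ex)
  qed
  from fc_ImpD[OF w ax this] obtain y where y: "elt w \<tau> y" "fc w (\<tau> # \<Gamma>) (y ## e) (AllSt \<sigma> \<phi>)" using w e wf by auto
  have "P v [y, x]" if "w \<sqsubseteq> v" "std v \<sigma> x" for v x
    using y that w e wf sem[OF that(1) elt_mono[OF y(1) that(1)], of x] by auto
  then show ?thesis using y(1) by blast
qed

lemma NCR_w:
  assumes w: "world w" and P: "dfn False w [\<tau>, \<sigma>] P"
    and prem: "\<And>v y. w \<sqsubseteq> v \<Longrightarrow> elt v \<tau> y \<Longrightarrow> \<exists>x. std v \<sigma> x \<and> P v [y, x]"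
  shows "\<exists>s. std w (Seq \<sigma>) s \<and> (\<forall>v. w \<sqsubseteq> v \<longrightarrow> (\<forall>y. elt v \<tau> y \<longrightarrow> (\<exists>x. mem v \<sigma> x s \<and> P v [y, x])))"
proof -
  obtain \<Gamma> e \<phi> where d: "defined_by \<Gamma> e \<phi> w [\<tau>, \<sigma>] P" using P by (auto simp: dfn_def)
  from defined_by_2[OF d] have wf: "wff (\<sigma> # \<tau> # \<Gamma>) \<phi>" and e: "envs w \<Gamma> e"
    and sem: "\<And>v x y. w \<sqsubseteq> v \<Longrightarrow> elt v \<tau> y \<Longrightarrow> elt v \<sigma> x \<Longrightarrow> fc v (\<sigma> # \<tau> # \<Gamma>) (x ## y ## e) \<phi> \<longleftrightarrow> P v [y, x]" by auto
  let ?B = "BEx \<sigma> (Var 1) (inst 3 [Var 0, Var 1] \<phi>)"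
  have wB: "wff (\<tau> # Seq \<sigma> # \<Gamma>) ?B" using wf by (auto intro!: wff_BEx wff_inst_3)
  have ax: "fc w \<Gamma> e (Imp (All \<tau> (ExSt \<sigma> \<phi>)) (ExSt (Seq \<sigma>) (All \<tau> ?B)))"
    by (rule fc_H[OF H.NCR]) (use w e wf wB in \<open>auto simp: lang_st_def\<close>)
  have "fc v (\<tau> # \<Gamma>) (y ## e) (ExSt \<sigma> \<phi>)" if "w \<sqsubseteq> v" "elt v \<tau> y" for v y
    using prem[OF that] sem[OF that] that e wf wle_world[OF that(1)] by (subst fc_ExSt) auto
  then have "fc w \<Gamma> e (All \<tau> (ExSt \<sigma> \<phi>))" using w e wf by (simp del: fc_ExSt)
  from fc_ImpD[OF w ax this] obtain s where s: "std w (Seq \<sigma>) s" "fc w (Seq \<sigma> # \<Gamma>) (s ## e) (All \<tau> ?B)"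
    using w e wB by auto
  have "\<exists>x. mem v \<sigma> x s \<and> P v [y, x]" if v: "w \<sqsubseteq> v" "elt v \<tau> y" for v y
  proof -
    have "fc v (\<tau> # Seq \<sigma> # \<Gamma>) (y ## s ## e) ?B" using s w e wB v by (simp del: fc_BEx)
    then obtain x where x: "mem v \<sigma> x s" "fc v (\<sigma> # \<tau> # Seq \<sigma> # \<Gamma>) (x ## y ## s ## e) (inst 3 [Var 0, Var (Suc 0)] \<phi>)"
      using wle_world[OF v(1)] s e v wf tr_mono[OF s(1) v(1)] by (subst (asm) fc_BEx) (auto simp: wff_inst_3)
    then show ?thesis
      using sem[OF v mem_elt(1)[OF wle_world[OF v(1)] x(1)]] by (auto simp: fc_inst_3[of _ _ _ _ _ _ _ "\<sigma> # \<tau> # \<Gamma>"])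
  qed
  then show ?thesis using s(1) by blast
qed

lemma HAC_w:
  assumes w: "world w" and P: "dfn False w [\<sigma>, \<tau>] P"
    and prem: "\<And>v x. w \<sqsubseteq> v \<Longrightarrow> std v \<sigma> x \<Longrightarrow> \<exists>y. std v \<tau> y \<and> P v [x, y]"
  shows "\<exists>F. std w (\<sigma> \<rightarrow> Seq \<tau>) F \<and> (\<forall>v. w \<sqsubseteq> v \<longrightarrow> (\<forall>x. std v \<sigma> x \<longrightarrow> (\<exists>y. mem v \<tau> y (F \<cdot> x) \<and> P v [x, y])))"
proof -
  obtain \<Gamma> e \<phi> where d: "defined_by \<Gamma> e \<phi> w [\<sigma>, \<tau>] P" using P by (auto simp: dfn_def)
  from defined_by_2[OF d] have wf: "wff (\<tau> # \<sigma> # \<Gamma>) \<phi>" and e: "envs w \<Gamma> e"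
    and sem: "\<And>v x y. w \<sqsubseteq> v \<Longrightarrow> elt v \<sigma> x \<Longrightarrow> elt v \<tau> y \<Longrightarrow> fc v (\<tau> # \<sigma> # \<Gamma>) (y ## x ## e) \<phi> \<longleftrightarrow> P v [x, y]" by auto
  let ?B = "BEx \<tau> (Var 1 \<cdot> Var 0) (inst 3 [Var 0, Var 1] \<phi>)"
  have wB: "wff (\<sigma> # (\<sigma> \<rightarrow> Seq \<tau>) # \<Gamma>) ?B" using wf by (auto simp: wt_App_iff intro!: wff_BEx wff_inst_3)
  have ax: "fc w \<Gamma> e (Imp (AllSt \<sigma> (ExSt \<tau> \<phi>)) (ExSt (\<sigma> \<rightarrow> Seq \<tau>) (AllSt \<sigma> ?B)))"
    by (rule fc_H[OF H.HAC]) (use w e wf wB in \<open>auto simp: lang_st_def\<close>)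
  have "fc v (\<sigma> # \<Gamma>) (x ## e) (ExSt \<tau> \<phi>)" if "w \<sqsubseteq> v" "std v \<sigma> x" for v x
    using prem[OF that] sem[OF that(1)] that e wf wle_world[OF that(1)] by (subst fc_ExSt) auto
  then have "fc w \<Gamma> e (AllSt \<sigma> (ExSt \<tau> \<phi>))" using w e wf by (simp del: fc_ExSt)
  from fc_ImpD[OF w ax this] obtain F where F: "std w (\<sigma> \<rightarrow> Seq \<tau>) F" "fc w ((\<sigma> \<rightarrow> Seq \<tau>) # \<Gamma>) (F ## e) (AllSt \<sigma> ?B)"
    using w e wB by auto
  have "\<exists>y. mem v \<tau> y (F \<cdot> x) \<and> P v [x, y]" if v: "w \<sqsubseteq> v" "std v \<sigma> x" for v x
  proof -
    have "fc v (\<sigma> # (\<sigma> \<rightarrow> Seq \<tau>) # \<Gamma>) (x ## F ## e) ?B" using F w e wB v by (simp del: fc_BEx)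
    then obtain y where y: "mem v \<tau> y (F \<cdot> x)" "fc v (\<tau> # \<sigma> # (\<sigma> \<rightarrow> Seq \<tau>) # \<Gamma>) (y ## x ## F ## e) (inst 3 [Var 0, Var (Suc 0)] \<phi>)"
      using wle_world[OF v(1)] F e v wf tr_mono[OF F(1) v(1)] by (subst (asm) fc_BEx) (auto simp: wff_inst_3 wt_App_iff)
    then show ?thesis
      using sem[OF v(1) std_elt[OF wle_world[OF v(1)] v(2)] mem_elt(1)[OF wle_world[OF v(1)] y(1)]]
      by (auto simp: fc_inst_3[of _ _ _ _ _ _ _ "\<tau> # \<sigma> # \<Gamma>"])
  qed
  then show ?thesis using F(1) by blast
qed

lemma HIP_w:
  assumes w: "world w" and P: "dfn True w [\<sigma>] P" and Q: "dfn False w [\<tau>] Q"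
    and prem: "\<And>v. w \<sqsubseteq> v \<Longrightarrow> (\<forall>u. v \<sqsubseteq> u \<longrightarrow> (\<forall>x. std u \<sigma> x \<longrightarrow> P u [x])) \<Longrightarrow> \<exists>y. std v \<tau> y \<and> Q v [y]"
  shows "\<exists>s. std w (Seq \<tau>) s \<and> (\<forall>v. w \<sqsubseteq> v \<longrightarrow> (\<forall>u. v \<sqsubseteq> u \<longrightarrow> (\<forall>x. std u \<sigma> x \<longrightarrow> P u [x])) \<longrightarrow> (\<exists>y. mem v \<tau> y s \<and> Q v [y]))"
proof -
  obtain \<Gamma> e \<phi> \<psi> where d: "defined_by \<Gamma> e \<phi> w [\<sigma>] P" "defined_by \<Gamma> e \<psi> w [\<tau>] Q" and i: "internal \<phi>"
    using dfn_common[OF P Q] by metis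
  from defined_by_1[OF d(1)] have wf: "wff (\<sigma> # \<Gamma>) \<phi>" and e: "envs w \<Gamma> e"
    and semP: "\<And>v x. w \<sqsubseteq> v \<Longrightarrow> elt v \<sigma> x \<Longrightarrow> fc v (\<sigma> # \<Gamma>) (x ## e) \<phi> \<longleftrightarrow> P v [x]" by auto
  from defined_by_1[OF d(2)] have wf': "wff (\<tau> # \<Gamma>) \<psi>"
    and semQ: "\<And>v x. w \<sqsubseteq> v \<Longrightarrow> elt v \<tau> x \<Longrightarrow> fc v (\<tau> # \<Gamma>) (x ## e) \<psi> \<longleftrightarrow> Q v [x]" by auto
  let ?A = "AllSt \<sigma> (inst 2 [Var 0] \<phi>)" and ?B = "BEx \<tau> (Var 0) (inst 2 [Var 0] \<psi>)"
  have wA: "wff (Seq \<tau> # \<Gamma>) ?A" and wB: "wff (Seq \<tau> # \<Gamma>) ?B" using wf wf' by (auto simp: wff_inst_2 intro!: wff_BEx)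
  have ax: "fc w \<Gamma> e (Imp (Imp (AllSt \<sigma> \<phi>) (ExSt \<tau> \<psi>)) (ExSt (Seq \<tau>) (Imp ?A ?B)))"
    by (rule fc_H[OF H.HIP]) (use w e wf wf' i wA wB in \<open>auto simp: lang_st_def lang_int_def\<close>)
  have A: "fc v \<Gamma> e (AllSt \<sigma> \<phi>) \<longleftrightarrow> (\<forall>u. v \<sqsubseteq> u \<longrightarrow> (\<forall>x. std u \<sigma> x \<longrightarrow> P u [x]))" if v: "w \<sqsubseteq> v" for v
    using wle_world[OF v] envs_mono[OF e v] wf semP[OF wle_trans[OF v]] by simp
  have "fc v \<Gamma> e (ExSt \<tau> \<psi>)" if v: "w \<sqsubseteq> v" "fc v \<Gamma> e (AllSt \<sigma> \<phi>)" for v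
    using prem[OF v(1)] A[OF v(1)] v(2) semQ[OF v(1)] wle_world[OF v(1)] envs_mono[OF e v(1)] wf' by auto
  then have "fc w \<Gamma> e (Imp (AllSt \<sigma> \<phi>) (ExSt \<tau> \<psi>))" using w e wf wf' by (simp del: fc_ExSt fc_AllSt)
  from fc_ImpD[OF w ax this] obtain s where s: "std w (Seq \<tau>) s" "fc w (Seq \<tau> # \<Gamma>) (s ## e) (Imp ?A ?B)"
    using w e wA wB by auto
  have "\<exists>y. mem v \<tau> y s \<and> Q v [y]" if v: "w \<sqsubseteq> v" "\<forall>u. v \<sqsubseteq> u \<longrightarrow> (\<forall>x. std u \<sigma> x \<longrightarrow> P u [x])" for v
  proof -
    note wv = wle_world[OF v(1)] and sv = tr_mono[OF s(1) v(1)] and ev = envs_mono[OF e v(1)]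
    have "fc v (Seq \<tau> # \<Gamma>) (s ## e) ?A"
      using v wv sv ev wf semP[OF wle_trans[OF v(1)]] by (simp add: wff_inst_2 fc_inst_2[of _ _ _ _ _ _ "\<sigma> # \<Gamma>"])
    then have "fc v (Seq \<tau> # \<Gamma>) (s ## e) ?B"
      using s(2) w std_elt[OF w s(1)] e wA wB v(1) by (simp del: fc_BEx fc_AllSt)
    then obtain y where y: "mem v \<tau> y s" "fc v (\<tau> # Seq \<tau> # \<Gamma>) (y ## s ## e) (inst 2 [Var 0] \<psi>)"
      using wv sv ev wf' by (subst (asm) fc_BEx) (auto simp: wff_inst_2)
    then show ?thesis
      using semQ[OF v(1) mem_elt(1)[OF wv y(1)]] by (auto simp: fc_inst_2[of _ _ _ _ _ _ "\<tau> # \<Gamma>"])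
  qed
  then show ?thesis using s(1) by blast
qed

lemma HGMP_w:
  assumes w: "world w" and P: "dfn True w [\<sigma>] P" and Q: "dfn True w [] Q"
    and prem: "\<And>v. w \<sqsubseteq> v \<Longrightarrow> (\<forall>u. v \<sqsubseteq> u \<longrightarrow> (\<forall>x. std u \<sigma> x \<longrightarrow> P u [x])) \<Longrightarrow> Q v []"
  shows "\<exists>s. std w (Seq \<sigma>) s \<and> (\<forall>v. w \<sqsubseteq> v \<longrightarrow> (\<forall>u. v \<sqsubseteq> u \<longrightarrow> (\<forall>x. mem u \<sigma> x s \<longrightarrow> P u [x])) \<longrightarrow> Q v [])"
proof -
  obtain \<Gamma> e \<phi> \<psi> where d: "defined_by \<Gamma> e \<phi> w [\<sigma>] P" "defined_by \<Gamma> e \<psi> w [] Q" and i: "internal \<phi>" "internal \<psi>"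
    using dfn_common[OF P Q] by metis
  from defined_by_1[OF d(1)] have wf: "wff (\<sigma> # \<Gamma>) \<phi>" and e: "envs w \<Gamma> e"
    and semP: "\<And>v x. w \<sqsubseteq> v \<Longrightarrow> elt v \<sigma> x \<Longrightarrow> fc v (\<sigma> # \<Gamma>) (x ## e) \<phi> \<longleftrightarrow> P v [x]" by auto
  from defined_by_0[OF d(2)] have wf': "wff \<Gamma> \<psi>"
    and semQ: "\<And>v. w \<sqsubseteq> v \<Longrightarrow> fc v \<Gamma> e \<psi> \<longleftrightarrow> Q v []" by auto
  let ?A = "BAll \<sigma> (Var 0) (inst 2 [Var 0] \<phi>)" and ?B = "inst 1 [] \<psi>"
  have wA: "wff (Seq \<sigma> # \<Gamma>) ?A" and wB: "wff (Seq \<sigma> # \<Gamma>) ?B" using wf wf' by (auto simp: wff_inst_2 wff_inst_1_Nil intro!: wff_BAll)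
  have ax: "fc w \<Gamma> e (Imp (Imp (AllSt \<sigma> \<phi>) \<psi>) (ExSt (Seq \<sigma>) (Imp ?A ?B)))"
    by (rule fc_H[OF H.HGMP]) (use w e wf wf' i wA wB in \<open>auto simp: lang_int_def\<close>)
  have A: "fc v \<Gamma> e (AllSt \<sigma> \<phi>) \<longleftrightarrow> (\<forall>u. v \<sqsubseteq> u \<longrightarrow> (\<forall>x. std u \<sigma> x \<longrightarrow> P u [x]))" if v: "w \<sqsubseteq> v" for v
    using wle_world[OF v] envs_mono[OF e v] wf semP[OF wle_trans[OF v]] by simp
  have "fc w \<Gamma> e (Imp (AllSt \<sigma> \<phi>) \<psi>)" using w e wf wf' A semQ prem by (simp del: fc_AllSt)
  from fc_ImpD[OF w ax this] obtain s where s: "std w (Seq \<sigma>) s" "fc w (Seq \<sigma> # \<Gamma>) (s ## e) (Imp ?A ?B)"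
    using w e wA wB by auto
  have "Q v []" if v: "w \<sqsubseteq> v" "\<forall>u. v \<sqsubseteq> u \<longrightarrow> (\<forall>x. mem u \<sigma> x s \<longrightarrow> P u [x])" for v
  proof -
    note wv = wle_world[OF v(1)] and sv = tr_mono[OF s(1) v(1)] and ev = envs_mono[OF e v(1)]
    have "P u [x] \<longleftrightarrow> fc u (\<sigma> # Seq \<sigma> # \<Gamma>) (x ## s ## e) (inst 2 [Var 0] \<phi>)" if "v \<sqsubseteq> u" "mem u \<sigma> x s" for u x
      using semP[OF wle_trans[OF v(1) that(1)] mem_elt(1)[OF wle_world[OF that(1)] that(2)]]
      by (simp add: fc_inst_2[of _ _ _ _ _ _ "\<sigma> # \<Gamma>"])
    then have "fc v (Seq \<sigma> # \<Gamma>) (s ## e) ?A"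
      using v wv sv ev wf by (subst fc_BAll) (auto simp: wff_inst_2)
    then have "fc v (Seq \<sigma> # \<Gamma>) (s ## e) ?B"
      using s(2) w std_elt[OF w s(1)] e wA wB v(1) by (simp del: fc_BAll)
    then show ?thesis
      using semQ[OF v(1)] by (simp add: fc_inst_1_Nil[of _ _ _ _ _ \<Gamma>])
  qed
  then show ?thesis using s(1) by blast
qed

section \<open>Coding tuples\<close>

fun eqs :: "world \<Rightarrow> ty list \<Rightarrow> tm list \<Rightarrow> tm list \<Rightarrow> bool" where
  "eqs w [] [] [] \<longleftrightarrow> True"
| "eqs w (\<tau> # \<tau>s) (s # ss) (t # ts) \<longleftrightarrow> eqw w \<tau> s t \<and> eqs w \<tau>s ss ts"
| "eqs w _ _ _ \<longleftrightarrow> False"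

lemma eqs_els: "eqs w \<tau>s ss ts \<Longrightarrow> world w \<Longrightarrow> els w \<tau>s ss \<and> els w \<tau>s ts"
  by (induction w \<tau>s ss ts rule: eqs.induct) (auto dest: eqw_elt)

lemma eqs_nth: "eqs w \<tau>s ss ts \<Longrightarrow> length ss = length \<tau>s \<and> length ts = length \<tau>s \<and> (\<forall>i < length \<tau>s. eqw w (\<tau>s ! i) (ss ! i) (ts ! i))"
  by (induction w \<tau>s ss ts rule: eqs.induct) (auto simp: All_less_Suc2)

text \<open>The entries are exchanged one at a time: \<open>?g k\<close> agrees with
  \<open>f\<close> below \<open>k\<close> and with \<open>e\<close> from there on, and a single
  exchange is an instance of \<open>eq_subst\<close>.\<close>

lemma fc_env_eq:
  assumes wf: "wff \<Gamma> \<phi>" "internal \<phi>" and w: "world w" "envs w \<Gamma> e"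
    and eq: "\<And>i. i < length \<Gamma> \<Longrightarrow> eqw w (\<Gamma> ! i) (e i) (f i)" and fc: "fc w \<Gamma> e \<phi>"
  shows "fc w \<Gamma> f \<phi>"
proof -
  let ?g = "\<lambda>k i. if i < k then f i else e i"
  have "fc w \<Gamma> (?g k) \<phi>" if "k \<le> length \<Gamma>" for k
    using that
  proof (induction k)
    case 0
    then show ?case using fc by simp
  next
    case (Suc k)
    then have k: "k < length \<Gamma>" by simp
    let ?h = "\<lambda>i. if i = k then Var 0 else Var (Suc i)"
    have wf': "wff (\<Gamma> ! k # \<Gamma>) (fsub ?h \<phi>)" by (rule wff_fsub[OF wf(1)]) (use k in \<open>auto simp: wtenv_def\<close>)
    have ev: "envs w \<Gamma> (?g k)" using w(2) eqw_elt(2)[OF w(1) eq] by (auto simp: envs_def)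
    have ren: "fc w \<Delta> (t ## ?g k) (fsub ?h \<phi>) \<longleftrightarrow> fc w \<Gamma> ((?g k)(k := t)) \<phi>" for t \<Delta>
      unfolding fc_fsub[of _ _ _ _ _ \<Gamma>] by (rule arg_cong[where f="\<lambda>e. fc w _ e \<phi>"]) auto
    have "fc w (\<Gamma> ! k # \<Gamma>) (e k ## ?g k) (fsub ?h \<phi>)"
      unfolding ren using Suc.IH k by (simp add: fun_upd_idem)
    from eq_subst[OF wf' _ w(1) ev eq[OF k] this] wf(2)
    have "fc w \<Gamma> ((?g k)(k := f k)) \<phi>" unfolding ren by simp
    moreover have "(?g k)(k := f k) = ?g (Suc k)" by auto
    ultimately show ?case by simp
  qed
  from this[of "length \<Gamma>"] have "fc w \<Gamma> (?g (length \<Gamma>)) \<phi>" by simp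
  moreover have "fsub (?g (length \<Gamma>)) \<phi> = fsub f \<phi>" by (rule fsub_cong[OF wf(1)]) simp
  ultimately show ?thesis by (simp add: fc_def)
qed

text \<open>Decoding the code of a tuple yields terms that are equal to the components without being
  identical to them. Replacement in internal formulas suffices, as coding is applied to internal
  predicates only.\<close>

lemma dfn_eqs:
  assumes P: "dfn True w \<sigma>s P" and v: "w \<sqsubseteq> v" and eq: "eqs v \<sigma>s ts us" and t: "P v ts"
  shows "P v us"
proof -
  obtain \<Gamma> e \<phi> where d: "defined_by \<Gamma> e \<phi> w \<sigma>s P" "internal \<phi>" using P by (auto simp: dfn_def)
  note wv = wle_world[OF v] and el = eqs_els[OF eq wle_world[OF v]] and n = eqs_nth[OF eq]
  have wf: "wff (rev \<sigma>s @ \<Gamma>) \<phi>" and e: "envs v \<Gamma> e" using d envs_mono[OF _ v] by (auto simp: defined_by_def)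
  have "fc v (rev \<sigma>s @ \<Gamma>) (pushes us e) \<phi>"
  proof (rule fc_env_eq[OF wf d(2) wv envs_pushes])
    show "fc v (rev \<sigma>s @ \<Gamma>) (pushes ts e) \<phi>" using d t v el by (simp add: defined_by_def)
    fix i assume i: "i < length (rev \<sigma>s @ \<Gamma>)"
    show "eqw v ((rev \<sigma>s @ \<Gamma>) ! i) (pushes ts e i) (pushes us e i)"
    proof (cases "i < length \<sigma>s")
      case True
      then show ?thesis using n by (simp add: pushes_rev nth_append rev_nth)
    next
      case False
      then obtain k where k: "i = k + length \<sigma>s" by (metis add.commute le_Suc_ex not_less)
      then have "elt v (\<Gamma> ! k) (e k)" using e i by (simp add: envs_def)
      then show ?thesis using pushes_ge[of ts e k] pushes_ge[of us e k] n k eqw_refl[OF wv] by (simp add: nth_append)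
    qed
  qed (use el e in auto)
  then show ?thesis using d v el by (simp add: defined_by_def)
qed

subsection \<open>Retracts\<close>

text \<open>A tuple will be stored as a sequence over one type, into which the types of its
  components must embed. Both maps are closed, so they preserve standardness, and \<open>r\<close>
  inverts \<open>i\<close> on all elements of every world, not only on the standard ones.\<close>

definition retraction :: "ty \<Rightarrow> ty \<Rightarrow> tm \<Rightarrow> tm \<Rightarrow> bool" where
  "retraction \<sigma> \<rho> i r \<longleftrightarrow> wt [] i (\<sigma> \<rightarrow> \<rho>) \<and> wt [] r (\<rho> \<rightarrow> \<sigma>) \<and> (\<forall>w x. world w \<longrightarrow> elt w \<sigma> x \<longrightarrow> eqw w \<sigma> (r \<cdot> (i \<cdot> x)) x)"

definition retract :: "ty \<Rightarrow> ty \<Rightarrow> bool" where "retract \<sigma> \<rho> \<longleftrightarrow> (\<exists>i r. retraction \<sigma> \<rho> i r)"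

lemma eq_closed_App: "world w \<Longrightarrow> wt [] f (\<sigma> \<rightarrow> \<tau>) \<Longrightarrow> eqw w \<sigma> s t \<Longrightarrow> eqw w \<tau> (f \<cdot> s) (f \<cdot> t)"
  by (rule eq_App[OF eqw_refl[OF _ elt_closed]])

lemma elt_closed_App: "wt [] f (\<sigma> \<rightarrow> \<tau>) \<Longrightarrow> elt w \<sigma> x \<Longrightarrow> elt w \<tau> (f \<cdot> x)"
  by (rule elt_App[OF elt_closed])

lemma std_closed_App: "world w \<Longrightarrow> wt [] f (\<sigma> \<rightarrow> \<tau>) \<Longrightarrow> std w \<sigma> x \<Longrightarrow> std w \<tau> (f \<cdot> x)"
  by (rule std_App[OF _ std_closed])

lemma eq_beta_closed: "world w \<Longrightarrow> wt [] (Lam \<sigma> t) (\<sigma> \<rightarrow> \<tau>) \<Longrightarrow> elt w \<sigma> u \<Longrightarrow> eqw w \<tau> (Lam \<sigma> t \<cdot> u) (sub (u ## Var) t)"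
  by (rule eq_beta[OF _ elt_closed])

lemma retractionI:
  assumes i: "wt [] i (\<sigma> \<rightarrow> \<rho>)" and r: "wt [] (Lam \<rho> t) (\<rho> \<rightarrow> \<sigma>)"
    and eq: "\<And>w x. world w \<Longrightarrow> elt w \<sigma> x \<Longrightarrow> eqw w \<sigma> (sub (i \<cdot> x ## Var) t) x"
  shows "retraction \<sigma> \<rho> i (Lam \<rho> t)"
  unfolding retraction_def
proof (intro conjI allI impI)
  fix w x assume w: "world w" and x: "elt w \<sigma> x"
  show "eqw w \<sigma> (Lam \<rho> t \<cdot> (i \<cdot> x)) x"
    using eq_trans[OF eq_beta_closed[OF w r elt_closed_App[OF i x]] eq[OF w x] w] .
qed (use i r in auto)

lemma retract_refl: "retract \<sigma> \<sigma>"
proof -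
  have "retraction \<sigma> \<sigma> (Lam \<sigma> (Var 0)) (Lam \<sigma> (Var 0))"
    by (rule retractionI) (use eq_beta_closed[of _ \<sigma> "Var 0" \<sigma>] in auto)
  then show ?thesis by (auto simp: retract_def)
qed

text \<open>Constant functions, decoded by evaluation at the default argument.\<close>

lemma retract_const: "retract \<sigma> (\<tau> \<rightarrow> \<sigma>)"
proof -
  let ?i = "Lam \<sigma> (Lam \<tau> (Var 1))"
  have i: "wt [] ?i (\<sigma> \<rightarrow> \<tau> \<rightarrow> \<sigma>)" by simp
  have "retraction \<sigma> (\<tau> \<rightarrow> \<sigma>) ?i (Lam (\<tau> \<rightarrow> \<sigma>) (Var 0 \<cdot> dflt \<tau>))"
    by (rule retractionI) (use eq_beta2[OF _ elt_closed[OF i], of _ _ "dflt \<tau>"] in \<open>auto simp: wt_App_iff wt_dflt\<close>)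
  then show ?thesis by (auto simp: retract_def)
qed

lemma retract_trans: "retract \<sigma> \<rho> \<Longrightarrow> retract \<rho> \<pi> \<Longrightarrow> retract \<sigma> \<pi>"
proof -
  assume "retract \<sigma> \<rho>" "retract \<rho> \<pi>"
  then obtain i r j s where 1: "retraction \<sigma> \<rho> i r" and 2: "retraction \<rho> \<pi> j s" by (auto simp: retract_def)
  have wt: "wt \<Gamma> i (\<sigma> \<rightarrow> \<rho>)" "wt \<Gamma> r (\<rho> \<rightarrow> \<sigma>)" "wt \<Gamma> j (\<rho> \<rightarrow> \<pi>)" "wt \<Gamma> s (\<pi> \<rightarrow> \<rho>)" for \<Gamma>
    using 1 2 wt_closed by (auto simp: retraction_def)
  note cl [simp] = wt[of "[]", THEN sub_closed]
  let ?i = "Lam \<sigma> (j \<cdot> (i \<cdot> Var 0))"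
  have wi: "wt [] ?i (\<sigma> \<rightarrow> \<pi>)" using wt by (auto simp: wt_App_iff)
  have "retraction \<sigma> \<pi> ?i (Lam \<pi> (r \<cdot> (s \<cdot> Var 0)))"
  proof (rule retractionI[OF wi])
    fix w x assume w: "world w" and x: "elt w \<sigma> x"
    note ix = elt_closed_App[OF wt(1) x]
    have "eqw w \<pi> (?i \<cdot> x) (j \<cdot> (i \<cdot> x))" using eq_beta_closed[OF w wi x] by simp
    from eq_trans[OF eq_closed_App[OF w wt(4) this] _ w, of "i \<cdot> x"]
    have "eqw w \<rho> (s \<cdot> (?i \<cdot> x)) (i \<cdot> x)" using 2 w ix by (auto simp: retraction_def)
    from eq_trans[OF eq_closed_App[OF w wt(2) this] _ w, of x]
    have "eqw w \<sigma> (r \<cdot> (s \<cdot> (?i \<cdot> x))) x" using 1 w x by (auto simp: retraction_def)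
    then show "eqw w \<sigma> (sub (?i \<cdot> x ## Var) (r \<cdot> (s \<cdot> Var 0))) x" by simp
  qed (use wt in \<open>auto simp: wt_App_iff intro!: exI[of _ \<rho>]\<close>)
  then show ?thesis by (auto simp: retract_def)
qed

text \<open>A function \<open>f\<close> is embedded as \<open>j \<circ> f \<circ> r\<close>, and
  \<open>g\<close> on the larger types is decoded as \<open>s \<circ> g \<circ> i\<close>. The
  composites cancel pointwise, and extensionality of the theory turns this into an equation of
  functions.\<close>

lemma retract_Arr: "retract \<sigma> \<sigma>' \<Longrightarrow> retract \<tau> \<tau>' \<Longrightarrow> retract (\<sigma> \<rightarrow> \<tau>) (\<sigma>' \<rightarrow> \<tau>')"
proof -
  assume "retract \<sigma> \<sigma>'" "retract \<tau> \<tau>'"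
  then obtain i r j s where 1: "retraction \<sigma> \<sigma>' i r" and 2: "retraction \<tau> \<tau>' j s" by (auto simp: retract_def)
  have wt: "wt \<Gamma> i (\<sigma> \<rightarrow> \<sigma>')" "wt \<Gamma> r (\<sigma>' \<rightarrow> \<sigma>)" "wt \<Gamma> j (\<tau> \<rightarrow> \<tau>')" "wt \<Gamma> s (\<tau>' \<rightarrow> \<tau>)" for \<Gamma>
    using 1 2 wt_closed by (auto simp: retraction_def)
  note cl [simp] = wt[of "[]", THEN sub_closed]
  let ?i = "Lam (\<sigma> \<rightarrow> \<tau>) (Lam \<sigma>' (j \<cdot> (Var 1 \<cdot> (r \<cdot> Var 0))))"
  let ?r = "Lam (\<sigma>' \<rightarrow> \<tau>') (Lam \<sigma> (s \<cdot> (Var 1 \<cdot> (i \<cdot> Var 0))))"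
  have wi: "wt [] ?i ((\<sigma> \<rightarrow> \<tau>) \<rightarrow> \<sigma>' \<rightarrow> \<tau>')" using wt by (auto simp: wt_App_iff)
  have wr: "wt [] ?r ((\<sigma>' \<rightarrow> \<tau>') \<rightarrow> \<sigma> \<rightarrow> \<tau>)" using wt by (auto simp: wt_App_iff)
  have "retraction (\<sigma> \<rightarrow> \<tau>) (\<sigma>' \<rightarrow> \<tau>') ?i ?r"
    unfolding retraction_def
  proof (intro conjI allI impI)
    fix w f assume w: "world w" and f: "elt w (\<sigma> \<rightarrow> \<tau>) f"
    show "eqw w (\<sigma> \<rightarrow> \<tau>) (?r \<cdot> (?i \<cdot> f)) f"
    proof (rule eq_ext[OF w elt_closed_App[OF wr elt_closed_App[OF wi f]] f])
      fix v x assume v: "w \<sqsubseteq> v" and x: "elt v \<sigma> x"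
      note wv = wle_world[OF v] and fv = elt_mono[OF f v] and ix = elt_closed_App[OF wt(1) x]
      note iff = elt_closed_App[OF wi fv]
      have a: "eqw v \<tau> (?r \<cdot> (?i \<cdot> f) \<cdot> x) (s \<cdot> (?i \<cdot> f \<cdot> (i \<cdot> x)))"
        using eq_beta2[OF wv elt_closed[OF wr] iff x] by simp
      have "eqw v \<tau>' (?i \<cdot> f \<cdot> (i \<cdot> x)) (j \<cdot> (f \<cdot> (r \<cdot> (i \<cdot> x))))"
        using eq_beta2[OF wv elt_closed[OF wi] fv ix] by simp
      also have "eqw v \<tau>' (j \<cdot> (f \<cdot> (r \<cdot> (i \<cdot> x)))) (j \<cdot> (f \<cdot> x))"
        by (rule eq_closed_App[OF wv wt(3)], rule eq_App[OF eqw_refl[OF wv fv] _ wv]) (use 1 wv x in \<open>auto simp: retraction_def\<close>)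
      finally have "eqw v \<tau>' (?i \<cdot> f \<cdot> (i \<cdot> x)) (j \<cdot> (f \<cdot> x))" using wv by blast
      from eq_trans[OF eq_closed_App[OF wv wt(4) this] _ wv, of "f \<cdot> x"]
      have "eqw v \<tau> (s \<cdot> (?i \<cdot> f \<cdot> (i \<cdot> x))) (f \<cdot> x)" using 2 wv elt_App[OF fv x] by (auto simp: retraction_def)
      from eq_trans[OF a this wv] show "eqw v \<tau> (?r \<cdot> (?i \<cdot> f) \<cdot> x) (f \<cdot> x)" .
    qed
  qed (use wi wr in auto)
  then show ?thesis by (auto simp: retract_def)
qed

definition mapC :: "ty \<Rightarrow> ty \<Rightarrow> tm \<Rightarrow> tm" where
  "mapC \<sigma> \<rho> f = Lam (Seq \<sigma>) (LRec \<sigma> (Seq \<rho>) \<cdot> Var 0 \<cdot> Emp \<rho> \<cdot> Lam (Seq \<rho>) (Lam \<sigma> (Prep \<rho> \<cdot> (f \<cdot> Var 0) \<cdot> Var 1)))"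

lemma
  assumes f: "wt [] f (\<sigma> \<rightarrow> \<rho>)"
  shows wt_mapC: "wt [] (mapC \<sigma> \<rho> f) (Seq \<sigma> \<rightarrow> Seq \<rho>)"
    and eq_mapC_Emp: "world w \<Longrightarrow> eqw w (Seq \<rho>) (mapC \<sigma> \<rho> f \<cdot> Emp \<sigma>) (Emp \<rho>)"
    and eq_mapC_Prep: "world w \<Longrightarrow> elt w \<sigma> a \<Longrightarrow> elt w (Seq \<sigma>) s \<Longrightarrow>
      eqw w (Seq \<rho>) (mapC \<sigma> \<rho> f \<cdot> (Prep \<sigma> \<cdot> a \<cdot> s)) (Prep \<rho> \<cdot> (f \<cdot> a) \<cdot> (mapC \<sigma> \<rho> f \<cdot> s))"
proof -
  have wf: "wt \<Gamma> f (\<sigma> \<rightarrow> \<rho>)" for \<Gamma> using wt_closed[OF f] .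
  note cl [simp] = sub_closed[OF f]
  let ?K = "Lam (Seq \<rho>) (Lam \<sigma> (Prep \<rho> \<cdot> (f \<cdot> Var 0) \<cdot> Var 1))"
  have wK: "wt [] ?K (Seq \<rho> \<rightarrow> \<sigma> \<rightarrow> Seq \<rho>)" using wf by (auto simp: wt_App_iff)
  show wm: "wt [] (mapC \<sigma> \<rho> f) (Seq \<sigma> \<rightarrow> Seq \<rho>)" using wf by (auto simp: wt_App_iff mapC_def)
  have m: "eqw w (Seq \<rho>) (mapC \<sigma> \<rho> f \<cdot> s) (LRec \<sigma> (Seq \<rho>) \<cdot> s \<cdot> Emp \<rho> \<cdot> ?K)" if "world w" "elt w (Seq \<sigma>) s" for w s
    using eq_beta_closed[OF that(1) wm[unfolded mapC_def] that(2)] by (simp add: mapC_def)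
  show "eqw w (Seq \<rho>) (mapC \<sigma> \<rho> f \<cdot> Emp \<sigma>) (Emp \<rho>)" if w: "world w"
    using eq_trans[OF m[OF w] eq_LRec_Emp[OF w _ elt_closed[OF wK]] w] by simp
  show "eqw w (Seq \<rho>) (mapC \<sigma> \<rho> f \<cdot> (Prep \<sigma> \<cdot> a \<cdot> s)) (Prep \<rho> \<cdot> (f \<cdot> a) \<cdot> (mapC \<sigma> \<rho> f \<cdot> s))"
    if w: "world w" and e: "elt w \<sigma> a" "elt w (Seq \<sigma>) s"
  proof -
    let ?R = "LRec \<sigma> (Seq \<rho>) \<cdot> s \<cdot> Emp \<rho> \<cdot> ?K"
    note R = elt_LRec[OF e(2) elt_const(3) elt_closed[OF wK]]
    have "eqw w (Seq \<rho>) (mapC \<sigma> \<rho> f \<cdot> (Prep \<sigma> \<cdot> a \<cdot> s)) (?K \<cdot> ?R \<cdot> a)"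
      using eq_trans[OF m[OF w elt_Prep[OF e]] eq_LRec_Prep[OF w e elt_const(3) elt_closed[OF wK]] w] .
    also have "eqw w (Seq \<rho>) (?K \<cdot> ?R \<cdot> a) (Prep \<rho> \<cdot> (f \<cdot> a) \<cdot> ?R)"
      using eq_beta2[OF w elt_closed[OF wK] R e(1)] by simp
    also have "eqw w (Seq \<rho>) (Prep \<rho> \<cdot> (f \<cdot> a) \<cdot> ?R) (Prep \<rho> \<cdot> (f \<cdot> a) \<cdot> (mapC \<sigma> \<rho> f \<cdot> s))"
      by (rule eq_App[OF eqw_refl[OF w] eq_sym[OF w m[OF w e(2)]] w])
        (rule elt_App[of _ \<rho>], auto intro: elt_closed elt_closed_App[OF f] e)
    finally show ?thesis using w by blast
  qed
qed

text \<open>Embedding and decoding act entrywise; sequence induction gives the cancellation.\<close>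

lemma retract_Seq: "retract \<sigma> \<rho> \<Longrightarrow> retract (Seq \<sigma>) (Seq \<rho>)"
proof -
  assume "retract \<sigma> \<rho>"
  then obtain i r where 1: "retraction \<sigma> \<rho> i r" by (auto simp: retract_def)
  then have wt: "wt [] i (\<sigma> \<rightarrow> \<rho>)" "wt [] r (\<rho> \<rightarrow> \<sigma>)" by (auto simp: retraction_def)
  let ?I = "mapC \<sigma> \<rho> i" and ?R = "mapC \<rho> \<sigma> r"
  note wI = wt_mapC[OF wt(1)] and wR = wt_mapC[OF wt(2)]
  note cl [simp] = sub_closed[OF wI] sub_closed[OF wR]
  let ?\<phi> = "Eq (Seq \<sigma>) (?R \<cdot> (?I \<cdot> Var 0)) (Var 0)"
  have "retraction (Seq \<sigma>) (Seq \<rho>) ?I ?R"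
    unfolding retraction_def
  proof (intro conjI allI impI)
    fix w s assume w: "world w" and s: "elt w (Seq \<sigma>) s"
    have "fc w [Seq \<sigma>] (s ## Var) ?\<phi>"
    proof (rule seq_induct_w[OF _ _ w _ s])
      have "eqw w (Seq \<sigma>) (?R \<cdot> (?I \<cdot> Emp \<sigma>)) (?R \<cdot> Emp \<rho>)" by (rule eq_closed_App[OF w wR eq_mapC_Emp[OF wt(1) w]])
      from eq_trans[OF this eq_mapC_Emp[OF wt(2) w] w] show "fc w [Seq \<sigma>] (Emp \<sigma> ## Var) ?\<phi>" by simp
    next
      fix v a s assume v: "w \<sqsubseteq> v" and e: "elt v \<sigma> a" "elt v (Seq \<sigma>) s" and ih: "fc v [Seq \<sigma>] (s ## Var) ?\<phi>"
      note wv = wle_world[OF v] and ia = elt_closed_App[OF wt(1) e(1)] and Is = elt_closed_App[OF wI e(2)]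
      have "eqw v (Seq \<sigma>) (?R \<cdot> (?I \<cdot> (Prep \<sigma> \<cdot> a \<cdot> s))) (?R \<cdot> (Prep \<rho> \<cdot> (i \<cdot> a) \<cdot> (?I \<cdot> s)))"
        by (rule eq_closed_App[OF wv wR eq_mapC_Prep[OF wt(1) wv e]])
      also have "eqw v (Seq \<sigma>) (?R \<cdot> (Prep \<rho> \<cdot> (i \<cdot> a) \<cdot> (?I \<cdot> s))) (Prep \<sigma> \<cdot> (r \<cdot> (i \<cdot> a)) \<cdot> (?R \<cdot> (?I \<cdot> s)))"
        by (rule eq_mapC_Prep[OF wt(2) wv ia Is])
      also have "eqw v (Seq \<sigma>) (Prep \<sigma> \<cdot> (r \<cdot> (i \<cdot> a)) \<cdot> (?R \<cdot> (?I \<cdot> s))) (Prep \<sigma> \<cdot> a \<cdot> s)"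
        using ih 1 wv e(1) by (intro eq_App[OF eq_closed_App[OF wv, of _ \<sigma>]]) (auto simp: retraction_def)
      finally show "fc v [Seq \<sigma>] (Prep \<sigma> \<cdot> a \<cdot> s ## Var) ?\<phi>" using wv by simp
    qed (use wt_closed[OF wI] wt_closed[OF wR] in \<open>auto simp: wt_App_iff\<close>)
    then show "eqw w (Seq \<sigma>) (?R \<cdot> (?I \<cdot> s)) s" by simp
  qed (use wI wR in auto)
  then show ?thesis by (auto simp: retract_def)
qed

text \<open>A number is coded by a sequence of that many default entries and decoded by the
  length.\<close>

lemma retract_Base_Seq: "retract Base (Seq \<tau>)"
proof -
  let ?K = "Lam (Seq \<tau>) (Lam Base (Prep \<tau> \<cdot> dflt \<tau> \<cdot> Var 1))"
  let ?N = "\<lambda>n. NRec (Seq \<tau>) \<cdot> n \<cdot> Emp \<tau> \<cdot> ?K"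
  let ?I = "Lam Base (?N (Var 0))"
  have wK: "wt [] ?K (Seq \<tau> \<rightarrow> Base \<rightarrow> Seq \<tau>)" by (auto simp: wt_App_iff wt_dflt)
  have wI: "wt [] ?I (Base \<rightarrow> Seq \<tau>)" by (auto simp: wt_App_iff wt_dflt)
  have len_cong: "eqw w Base (len \<tau> s) (len \<tau> t)" if "world w" "eqw w (Seq \<tau>) s t" for w s t
    using eq_subst[of "Seq \<tau>" "[Seq \<tau>]" "Eq Base (len \<tau> (Var 1)) (len \<tau> (Var 0))" w "s ## Var" s t] that eqw_elt[OF that] eqw_refl[OF that(1)]
    by (simp add: wt_len)
  have len_N: "eqw w Base (len \<tau> (?N n)) n" if w: "world w" and n: "elt w Base n" for w n
  proof -
    let ?\<phi> = "Eq Base (len \<tau> (?N (Var 0))) (Var 0)"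
    have "fc w [Base] (n ## Var) ?\<phi>"
    proof (rule nat_induct_w[OF _ _ w _ n])
      have "eqw w Base (len \<tau> (?N Zero)) Zero"
        using eq_trans[OF len_cong[OF w eq_NRec_Zero[OF w _ elt_closed[OF wK]]] eq_len_Emp[OF w] w] by simp
      then show "fc w [Base] (Zero ## Var) ?\<phi>" by simp
    next
      fix v m assume v: "w \<sqsubseteq> v" and m: "elt v Base m" and ih: "fc v [Base] (m ## Var) ?\<phi>"
      note wv = wle_world[OF v] and Nm = elt_NRec[OF m elt_const(3) elt_closed[OF wK]]
      have "eqw v (Seq \<tau>) (?N (Succ \<cdot> m)) (?K \<cdot> ?N m \<cdot> m)" by (rule eq_NRec_Succ[OF wv m elt_const(3) elt_closed[OF wK]])
      also have "eqw v (Seq \<tau>) (?K \<cdot> ?N m \<cdot> m) (Prep \<tau> \<cdot> dflt \<tau> \<cdot> ?N m)"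
        using eq_beta2[OF wv elt_closed[OF wK] Nm m] by simp
      finally have "eqw v (Seq \<tau>) (?N (Succ \<cdot> m)) (Prep \<tau> \<cdot> dflt \<tau> \<cdot> ?N m)" using wv by blast
      from eq_trans[OF len_cong[OF wv this] eq_len_Prep[OF wv elt_const(4) Nm] wv]
      have "eqw v Base (len \<tau> (?N (Succ \<cdot> m))) (Succ \<cdot> len \<tau> (?N m))" .
      also have "eqw v Base (Succ \<cdot> len \<tau> (?N m)) (Succ \<cdot> m)"
        by (rule eq_closed_App[OF wv]) (use ih in auto)
      finally show "fc v [Base] (Succ \<cdot> m ## Var) ?\<phi>" using wv by simp
    qed (auto simp: wt_App_iff wt_dflt intro!: wt_len)
    then show ?thesis by simp
  qed
  have "retraction Base (Seq \<tau>) ?I (Lam (Seq \<tau>) (len \<tau> (Var 0)))"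
  proof (rule retractionI[OF wI])
    fix w x assume w: "world w" and x: "elt w Base x"
    have "eqw w (Seq \<tau>) (?I \<cdot> x) (?N x)" using eq_beta_closed[OF w wI x] by simp
    from eq_trans[OF len_cong[OF w this] len_N[OF w x] w]
    show "eqw w Base (sub (?I \<cdot> x ## Var) (len \<tau> (Var 0))) x" by simp
  qed (simp add: wt_len)
  then show ?thesis by (auto simp: retract_def)
qed

lemma retract_Base: "retract Base \<sigma>"
proof (induction \<sigma>)
  case (Arr \<sigma> \<tau>)
  then show ?case using retract_trans retract_const by blast
qed (auto intro: retract_refl retract_Base_Seq)

text \<open>Induction on the total size. \<open>Base\<close> is a retract of every type, and types
  of the same shape are joined componentwise. A sequence type and an arrow type are joined through
  the codomain: the sequence type enters the resulting arrow type by constant functions.\<close>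

lemma retract_join: "\<exists>\<rho>. retract \<sigma> \<rho> \<and> retract \<tau> \<rho>"
proof (induction "size \<sigma> + size \<tau>" arbitrary: \<sigma> \<tau> rule: less_induct)
  case less
  have mixed: "\<exists>\<rho>. retract (Seq \<sigma>1) \<rho> \<and> retract (\<tau>1 \<rightarrow> \<tau>2) \<rho>"
    if "\<exists>\<rho>. retract (Seq \<sigma>1) \<rho> \<and> retract \<tau>2 \<rho>" for \<sigma>1 \<tau>1 \<tau>2
    using that retract_trans[OF _ retract_const] retract_Arr[OF retract_refl] by blast
  show ?case
  proof (cases \<sigma>)
    case Base
    then show ?thesis using retract_Base retract_refl by blast
  next
    case (Arr \<sigma>1 \<sigma>2)
    show ?thesis
    proof (cases \<tau>)
      case Base
      then show ?thesis using retract_Base retract_refl by blast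
    next
      case (Arr \<tau>1 \<tau>2)
      then show ?thesis using less[of \<sigma>1 \<tau>1] less[of \<sigma>2 \<tau>2] \<open>\<sigma> = \<sigma>1 \<rightarrow> \<sigma>2\<close> retract_Arr by fastforce
    next
      case (Seq \<tau>1)
      then show ?thesis using less[of "Seq \<tau>1" \<sigma>2] mixed[of \<tau>1 \<sigma>2 \<sigma>1] Arr by auto
    qed
  next
    case (Seq \<sigma>1)
    show ?thesis
    proof (cases \<tau>)
      case Base
      then show ?thesis using retract_Base retract_refl by blast
    next
      case (Arr \<tau>1 \<tau>2)
      then show ?thesis using less[of "Seq \<sigma>1" \<tau>2] mixed[of \<sigma>1 \<tau>2 \<tau>1] Seq by auto
    next
      case (Seq \<tau>1)
      then show ?thesis using less[of \<sigma>1 \<tau>1] \<open>\<sigma> = Seq \<sigma>1\<close> retract_Seq by fastforce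
    qed
  qed
qed

subsection \<open>Codes\<close>

text \<open>The head and the code of the remaining components are stored as the two entries of a
  sequence over the join \<open>\<pi>\<close> of their types.\<close>

lemma code_exists:
  "\<exists>\<rho> rs. list_all2 (\<lambda>r \<tau>. wt [] r (\<rho> \<rightarrow> \<tau>)) rs \<tau>s \<and>
     (\<forall>w ys. world w \<longrightarrow> stds w \<tau>s ys \<longrightarrow> (\<exists>g. std w \<rho> g \<and> eqs w \<tau>s (map (\<lambda>r. r \<cdot> g) rs) ys))"
proof (induction \<tau>s)
  case Nil
  then show ?case by (intro exI[of _ Base] exI[of _ "[]"]) (auto intro!: exI[of _ Zero] std_closed)
next
  case (Cons \<tau> \<tau>s)
  then obtain \<rho> rs where rs: "list_all2 (\<lambda>r \<tau>. wt [] r (\<rho> \<rightarrow> \<tau>)) rs \<tau>s"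
    and code: "\<And>w ys. world w \<Longrightarrow> stds w \<tau>s ys \<Longrightarrow> \<exists>g. std w \<rho> g \<and> eqs w \<tau>s (map (\<lambda>r. r \<cdot> g) rs) ys" by metis
  obtain \<pi> i r j s where 1: "retraction \<tau> \<pi> i r" and 2: "retraction \<rho> \<pi> j s"
    using retract_join[of \<tau> \<rho>] by (auto simp: retract_def)
  then have wt: "wt [] i (\<tau> \<rightarrow> \<pi>)" "wt [] r (\<pi> \<rightarrow> \<tau>)" "wt [] j (\<rho> \<rightarrow> \<pi>)" "wt [] s (\<pi> \<rightarrow> \<rho>)"
    by (auto simp: retraction_def)
  note cl [simp] = wt[THEN sub_closed] and wt' = wt[THEN wt_closed]
  \<comment> \<open>Entry 0 is decoded to the head and entry 1 to the code of the rest, on which an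
    earlier decoder \<open>q\<close> then acts.\<close>
  let ?A = "Lam (Seq \<pi>) (r \<cdot> nth_tm \<pi> (Var 0) Zero)"
  let ?s = "nth_tm \<pi> (Var 0) (Succ \<cdot> Zero)"
  let ?B = "\<lambda>q. Lam (Seq \<pi>) (q \<cdot> (s \<cdot> ?s))"
  have w0: "wt [] ?A (Seq \<pi> \<rightarrow> \<tau>)" by (auto intro!: wt_App[OF wt'(2)] wt_nth_tm)
  have one: "wt \<Gamma> (Succ \<cdot> Zero) Base" for \<Gamma> by (simp add: wt_App_iff)
  have wq: "wt [] (?B q) (Seq \<pi> \<rightarrow> \<tau>')" if "wt [] q (\<rho> \<rightarrow> \<tau>')" for q \<tau>'
    by (auto intro!: wt_App[OF wt_closed[OF that]] wt_App[OF wt'(4)] wt_nth_tm one)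
  have "\<exists>g. std w (Seq \<pi>) g \<and> eqs w (\<tau> # \<tau>s) (map (\<lambda>r. r \<cdot> g) (?A # map ?B rs)) ys"
    if w: "world w" and ys: "stds w (\<tau> # \<tau>s) ys" for w ys
  proof -
    obtain y ys' where y: "ys = y # ys'" "std w \<tau> y" "stds w \<tau>s ys'" using ys by (auto simp: list_all2_Cons1)
    obtain g where g: "std w \<rho> g" "eqs w \<tau>s (map (\<lambda>r. r \<cdot> g) rs) ys'" using code[OF w y(3)] by blast
    let ?t = "Prep \<pi> \<cdot> (j \<cdot> g) \<cdot> Emp \<pi>"
    let ?g = "Prep \<pi> \<cdot> (i \<cdot> y) \<cdot> ?t"
    have iy: "std w \<pi> (i \<cdot> y)" and jg: "std w \<pi> (j \<cdot> g)" using std_closed_App[OF w] wt y g by auto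
    have st: "std w (Seq \<pi>) ?t" by (rule std_Prep[OF w jg]) (use w in \<open>auto intro: std_closed\<close>)
    have sg: "std w (Seq \<pi>) ?g" by (rule std_Prep[OF w iy st])
    note e = std_elt[OF w iy] std_elt[OF w jg] std_elt[OF w st] std_elt[OF w sg]
    have "eqw w \<tau> (?A \<cdot> ?g) (r \<cdot> nth_tm \<pi> ?g Zero)" using eq_beta_closed[OF w w0 e(4)] by simp
    also have "eqw w \<tau> (r \<cdot> nth_tm \<pi> ?g Zero) (r \<cdot> (i \<cdot> y))" by (rule eq_closed_App[OF w wt(2) eq_nth_Zero[OF w e(1,3)]])
    also have "eqw w \<tau> (r \<cdot> (i \<cdot> y)) y" using 1 w std_elt[OF w y(2)] by (auto simp: retraction_def)
    finally have 3: "eqw w \<tau> (?A \<cdot> ?g) y" using w by blast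
    have "eqw w \<pi> (nth_tm \<pi> ?g (Succ \<cdot> Zero)) (j \<cdot> g)"
      using eq_trans[OF eq_nth_Succ[OF w e(1,3) elt_const(1)] eq_nth_Zero[OF w e(2) elt_const(3)] w] .
    from eq_trans[OF eq_closed_App[OF w wt(4) this] _ w, of g]
    have 4: "eqw w \<rho> (s \<cdot> nth_tm \<pi> ?g (Succ \<cdot> Zero)) g" using 2 w std_elt[OF w g(1)] by (auto simp: retraction_def)
    have 5: "eqw w \<tau>' (?B q \<cdot> ?g) (q \<cdot> g)" if q: "wt [] q (\<rho> \<rightarrow> \<tau>')" for q \<tau>'
    proof -
      have "eqw w \<tau>' (?B q \<cdot> ?g) (q \<cdot> (s \<cdot> nth_tm \<pi> ?g (Succ \<cdot> Zero)))"
        using eq_beta_closed[OF w wq[OF q] e(4)] sub_closed[OF q] by simp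
      from eq_trans[OF this eq_closed_App[OF w q 4] w] show ?thesis .
    qed
    have "eqs w \<tau>s (map (\<lambda>r. r \<cdot> ?g) (map ?B rs)) ys'"
      using rs g(2)
    proof (induction rs \<tau>s arbitrary: ys' rule: list_all2_induct)
      case (Cons q rs \<tau>' \<tau>s)
      then show ?case using 5[OF Cons.hyps(1)] eq_trans[OF _ _ w] by (cases ys') auto
    qed (case_tac ys', auto)
    then show ?thesis using sg 3 y by auto
  qed
  moreover have "list_all2 (\<lambda>r \<tau>. wt [] r (Seq \<pi> \<rightarrow> \<tau>)) (?A # map ?B rs) (\<tau> # \<tau>s)"
    using rs w0 wq by (auto simp: list_all2_map1 simp del: wt_Lam_iff elim!: list_all2_mono)
  ultimately show ?case by blast
qed

text \<open>For the last clause each decoder is mapped over the sequence of codes, giving one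
  sequence per component. Every tuple coded in \<open>G\<close> has its components in these
  sequences, so a statement bounded by \<open>ss\<close> covers the one bounded by
  \<open>G\<close>.\<close>

lemma coding:
  obtains \<rho> rs where "list_all2 (\<lambda>r \<tau>. wt [] r (\<rho> \<rightarrow> \<tau>)) rs \<tau>s"
    and "\<And>w ys. world w \<Longrightarrow> stds w \<tau>s ys \<Longrightarrow> \<exists>g. std w \<rho> g \<and> eqs w \<tau>s (map (\<lambda>r. r \<cdot> g) rs) ys"
    and "\<And>w g. world w \<Longrightarrow> std w \<rho> g \<Longrightarrow> stds w \<tau>s (map (\<lambda>r. r \<cdot> g) rs)"
    and "\<And>w G. world w \<Longrightarrow> std w (Seq \<rho>) G \<Longrightarrow> \<exists>ss. stds w (map Seq \<tau>s) ss \<and>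
      (\<forall>v. w \<sqsubseteq> v \<longrightarrow> (\<forall>g. mem v \<rho> g G \<longrightarrow> mems v \<tau>s (map (\<lambda>r. r \<cdot> g) rs) ss))"
proof -
  obtain \<rho> rs where rs: "list_all2 (\<lambda>r \<tau>. wt [] r (\<rho> \<rightarrow> \<tau>)) rs \<tau>s"
    and code: "\<And>w ys. world w \<Longrightarrow> stds w \<tau>s ys \<Longrightarrow> \<exists>g. std w \<rho> g \<and> eqs w \<tau>s (map (\<lambda>r. r \<cdot> g) rs) ys"
    using code_exists[of \<tau>s] by metis
  have "stds w \<tau>s (map (\<lambda>r. r \<cdot> g) rs)" if "world w" "std w \<rho> g" for w g
    using rs that by (auto simp: list_all2_conv_all_nth intro: std_closed_App)
  moreover have "\<exists>ss. stds w (map Seq \<tau>s) ss \<and>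
      (\<forall>v. w \<sqsubseteq> v \<longrightarrow> (\<forall>g. mem v \<rho> g G \<longrightarrow> mems v \<tau>s (map (\<lambda>r. r \<cdot> g) rs) ss))"
    if w: "world w" and G: "std w (Seq \<rho>) G" for w G
    using rs
  proof (induction rs \<tau>s rule: list_all2_induct)
    case Nil
    then show ?case by (intro exI[of _ "[]"]) auto
  next
    case (Cons r rs \<tau> \<tau>s)
    then obtain ss where ss: "stds w (map Seq \<tau>s) ss"
      "\<And>v g. w \<sqsubseteq> v \<Longrightarrow> mem v \<rho> g G \<Longrightarrow> mems v \<tau>s (map (\<lambda>r. r \<cdot> g) rs) ss" by blast
    let ?f = "Lam \<rho> (Prep \<tau> \<cdot> (r \<cdot> Var 0) \<cdot> Emp \<tau>)"
    let ?s = "bindC \<rho> \<tau> \<cdot> ?f \<cdot> G"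
    note r = Cons.hyps(1) and cl [simp] = sub_closed[OF Cons.hyps(1)]
    have f: "wt [] ?f (\<rho> \<rightarrow> Seq \<tau>)" using wt_closed[OF r] by (auto simp: wt_App_iff)
    have "std w (Seq \<tau>) ?s"
      using std_App[OF w std_App[OF w std_closed[OF wt_bindC w] std_closed[OF f w]] G] .
    moreover have "mem v \<tau> (r \<cdot> g) ?s" if v: "w \<sqsubseteq> v" and g: "mem v \<rho> g G" for v g
    proof -
      note wv = wle_world[OF v] and ge = mem_elt[OF wle_world[OF v] g] and rg = elt_closed_App[OF r mem_elt(1)[OF wle_world[OF v] g]]
      have "eqw v (Seq \<tau>) (?f \<cdot> g) (Prep \<tau> \<cdot> (r \<cdot> g) \<cdot> Emp \<tau>)" using eq_beta_closed[OF wv f ge(1)] by simp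
      from mem_cong_iff[OF wv this] have "mem v \<tau> (r \<cdot> g) (?f \<cdot> g)"
        using mem_single[OF wv rg] eqw_refl[OF wv rg] by blast
      then show ?thesis using mem_bindC[OF wv elt_closed[OF f] ge(2)] g by blast
    qed
    ultimately show ?case using ss by (intro exI[of _ "?s # ss"]) auto
  qed
  ultimately show thesis using that[OF rs code] by blast
qed

section \<open>Monotone tuples\<close>

text \<open>Concatenation of a sequence of sequences. When a principle yields several candidates for
  a witness of sequence type, their flattening is a single witness that includes each of
  them.\<close>

definition flatC :: "ty \<Rightarrow> tm" where
  "flatC \<tau> = Lam (Seq (Seq \<tau>)) (bindC (Seq \<tau>) \<tau> \<cdot> Lam (Seq \<tau>) (Var 0) \<cdot> Var 0)"

lemma wt_flatC: "wt \<Gamma> (flatC \<tau>) (Seq (Seq \<tau>) \<rightarrow> Seq \<tau>)"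
  using wt_bindC[of "Seq (Seq \<tau>) # \<Gamma>" "Seq \<tau>" \<tau>] by (auto simp: flatC_def wt_App_iff)

lemma sub_bindC [simp]: "sub e (bindC \<sigma> \<tau>) = bindC \<sigma> \<tau>" by (rule sub_closed[OF wt_bindC])
lemma sub_flatC [simp]: "sub e (flatC \<tau>) = flatC \<tau>" by (rule sub_closed[OF wt_flatC])

lemma mem_flatC:
  assumes w: "world w" and s: "elt w (Seq (Seq \<tau>)) s"
  shows "mem w \<tau> x (flatC \<tau> \<cdot> s) \<longleftrightarrow> (\<exists>a. mem w (Seq \<tau>) a s \<and> mem w \<tau> x a)"
proof -
  let ?I = "Lam (Seq \<tau>) (Var 0)"
  have I: "wt [] ?I (Seq \<tau> \<rightarrow> Seq \<tau>)" by simp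
  have Ia: "mem w \<tau> x (?I \<cdot> a) \<longleftrightarrow> mem w \<tau> x a" if "elt w (Seq \<tau>) a" for a
    using mem_cong_iff[OF w eq_beta_closed[OF w I that]] by simp
  have "eqw w (Seq \<tau>) (flatC \<tau> \<cdot> s) (bindC (Seq \<tau>) \<tau> \<cdot> ?I \<cdot> s)"
    using eq_beta_closed[OF w wt_flatC[unfolded flatC_def] s] by (simp add: flatC_def)
  from mem_cong_iff[OF w this] mem_bindC[OF w elt_closed[OF I] s]
  have "mem w \<tau> x (flatC \<tau> \<cdot> s) \<longleftrightarrow> (\<exists>a. mem w (Seq \<tau>) a s \<and> mem w \<tau> x (?I \<cdot> a))" by blast
  then show ?thesis using Ia mem_elt(1)[OF w] by blast
qed

lemma std_flatC: "world w \<Longrightarrow> std w (Seq (Seq \<tau>)) s \<Longrightarrow> std w (Seq \<tau>) (flatC \<tau> \<cdot> s)"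
  by (rule std_closed_App[OF _ wt_flatC])

lemma ssub_flatC: "world w \<Longrightarrow> mem w (Seq \<tau>) u s \<Longrightarrow> ssub w \<tau> u (flatC \<tau> \<cdot> s)"
  unfolding ssub_def using mem_flatC mem_elt tr_mono wle_world by metis

text \<open>For witnesses of type \<open>Seq \<tau>\<close> HAC yields a function into
  \<open>Seq (Seq \<tau>)\<close>, whereas the interpretation expects a sequence of functions into
  \<open>Seq \<tau>\<close>. The values are flattened, and the resulting function becomes the only
  entry of a sequence.\<close>

definition liftC :: "ty \<Rightarrow> ty \<Rightarrow> tm" where
  "liftC \<rho> \<tau> = Lam (\<rho> \<rightarrow> Seq (Seq \<tau>)) (Prep (\<rho> \<rightarrow> Seq \<tau>) \<cdot> (Lam \<rho> (flatC \<tau> \<cdot> (Var 1 \<cdot> Var 0))) \<cdot> Emp (\<rho> \<rightarrow> Seq \<tau>))"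

lemma wt_liftC: "wt \<Gamma> (liftC \<rho> \<tau>) ((\<rho> \<rightarrow> Seq (Seq \<tau>)) \<rightarrow> Seq (\<rho> \<rightarrow> Seq \<tau>))"
proof -
  let ?\<Gamma> = "(\<rho> \<rightarrow> Seq (Seq \<tau>)) # \<Gamma>"
  have "wt (\<rho> # ?\<Gamma>) (Var 1 \<cdot> Var 0) (Seq (Seq \<tau>))" by (simp add: wt_App_iff)
  then have L: "wt ?\<Gamma> (Lam \<rho> (flatC \<tau> \<cdot> (Var 1 \<cdot> Var 0))) (\<rho> \<rightarrow> Seq \<tau>)" by (intro wt.intros(2) wt_App[OF wt_flatC])
  have "wt ?\<Gamma> (Prep (\<rho> \<rightarrow> Seq \<tau>) \<cdot> Lam \<rho> (flatC \<tau> \<cdot> (Var 1 \<cdot> Var 0))) (Seq (\<rho> \<rightarrow> Seq \<tau>) \<rightarrow> Seq (\<rho> \<rightarrow> Seq \<tau>))"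
    by (rule wt_App[OF _ L]) simp
  then show ?thesis unfolding liftC_def by (intro wt.intros(2) wt_App[OF _ wt.intros(7)])
qed

lemma mem_liftC:
  assumes w: "world w" and F: "elt w (\<rho> \<rightarrow> Seq (Seq \<tau>)) F" and x: "elt w \<rho> x"
  shows "mem w \<tau> z (sapp \<rho> \<tau> (liftC \<rho> \<tau> \<cdot> F) x) \<longleftrightarrow> mem w \<tau> z (flatC \<tau> \<cdot> (F \<cdot> x))"
proof -
  let ?L = "Lam \<rho> (flatC \<tau> \<cdot> (lift 1 F \<cdot> Var 0))"
  have "wt (\<rho> # [\<rho> \<rightarrow> Seq (Seq \<tau>)]) (Var 1 \<cdot> Var 0) (Seq (Seq \<tau>))" by (simp add: wt_App_iff)
  then have "wt [\<rho> \<rightarrow> Seq (Seq \<tau>)] (Lam \<rho> (flatC \<tau> \<cdot> (Var 1 \<cdot> Var 0))) (\<rho> \<rightarrow> Seq \<tau>)" by (intro wt.intros(2) wt_App[OF wt_flatC])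
  then have L: "elt w (\<rho> \<rightarrow> Seq \<tau>) ?L"
    using elt_sub[of "[\<rho> \<rightarrow> Seq (Seq \<tau>)]" "Lam \<rho> (flatC \<tau> \<cdot> (Var 1 \<cdot> Var 0))" "\<rho> \<rightarrow> Seq \<tau>" w "F ## Var"] F
    by simp
  have "eqw w (Seq (\<rho> \<rightarrow> Seq \<tau>)) (liftC \<rho> \<tau> \<cdot> F) (Prep (\<rho> \<rightarrow> Seq \<tau>) \<cdot> ?L \<cdot> Emp (\<rho> \<rightarrow> Seq \<tau>))"
    using eq_beta_closed[OF w wt_liftC[unfolded liftC_def] F] by (simp add: liftC_def)
  note m = mem_cong_iff[OF w this] mem_single[OF w L]
  have "mem w \<tau> z (sapp \<rho> \<tau> (liftC \<rho> \<tau> \<cdot> F) x) \<longleftrightarrow> (\<exists>f. eqw w (\<rho> \<rightarrow> Seq \<tau>) f ?L \<and> mem w \<tau> z (f \<cdot> x))"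
    using mem_sapp[OF w elt_closed_App[OF wt_liftC F] x] m by simp
  also have "\<dots> \<longleftrightarrow> mem w \<tau> z (?L \<cdot> x)"
    using mem_cong_iff[OF w eq_App[OF _ eqw_refl[OF w x] w]] eqw_refl[OF w L] by blast
  also have "\<dots> \<longleftrightarrow> mem w \<tau> z (flatC \<tau> \<cdot> (F \<cdot> x))"
    using mem_cong_iff[OF w eq_beta[OF w L x]] by simp
  finally show ?thesis .
qed

lemma ssub_sapp:
  assumes w: "world w" and e: "elt w (Seq (\<rho> \<rightarrow> Seq \<tau>)) s" "elt w (Seq (\<rho> \<rightarrow> Seq \<tau>)) t" "elt w \<rho> x"
    and s: "ssub w (\<rho> \<rightarrow> Seq \<tau>) s t"
  shows "ssub w \<tau> (sapp \<rho> \<tau> s x) (sapp \<rho> \<tau> t x)"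
  unfolding ssub_def
proof (intro allI impI)
  fix v z assume v: "w \<sqsubseteq> v" "mem v \<tau> z (sapp \<rho> \<tau> s x)"
  note e' = e[THEN elt_mono, OF v(1)] and wv = wle_world[OF v(1)]
  show "mem v \<tau> z (sapp \<rho> \<tau> t x)"
    using v s unfolding mem_sapp[OF wv e'(1,3)] mem_sapp[OF wv e'(2,3)] ssub_def by blast
qed

lemma ssub_sapps:
  assumes w: "world w"
  shows "elt w (Seq (fty \<rho>s \<tau>)) s \<Longrightarrow> elt w (Seq (fty \<rho>s \<tau>)) t \<Longrightarrow> els w \<rho>s xs \<Longrightarrow> ssub w (fty \<rho>s \<tau>) s t \<Longrightarrow>
    ssub w \<tau> (sapps \<rho>s \<tau> s xs) (sapps \<rho>s \<tau> t xs)"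
proof (induction \<rho>s arbitrary: s t xs)
  case (Cons \<rho> \<rho>s)
  then show ?case using w by (auto simp: list_all2_Cons1 intro!: Cons.IH ssub_sapp)
qed simp

lemma elt_sapps: "elt w (Seq (fty \<rho>s \<tau>)) s \<Longrightarrow> els w \<rho>s xs \<Longrightarrow> elt w (Seq \<tau>) (sapps \<rho>s \<tau> s xs)"
proof (induction \<rho>s arbitrary: s xs)
  case (Cons \<rho> \<rho>s)
  then show ?case by (auto simp: list_all2_Cons1 intro!: Cons.IH)
qed simp

lemma std_sapps: "world w \<Longrightarrow> std w (Seq (fty \<rho>s \<tau>)) s \<Longrightarrow> stds w \<rho>s xs \<Longrightarrow> std w (Seq \<tau>) (sapps \<rho>s \<tau> s xs)"
proof (induction \<rho>s arbitrary: s xs)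
  case (Cons \<rho> \<rho>s)
  then show ?case by (auto simp: list_all2_Cons1 intro!: Cons.IH std_sapp)
qed simp

abbreviation sapp_all :: "ty list \<Rightarrow> ty list \<Rightarrow> tm list \<Rightarrow> tm list \<Rightarrow> tm list" where
  "sapp_all \<rho>s \<tau>s Us xs \<equiv> map2 (\<lambda>\<tau> U. sapps \<rho>s \<tau> U xs) \<tau>s Us"

lemma els_sapp_all: "els w (map (\<lambda>\<tau>. Seq (fty \<rho>s \<tau>)) \<tau>s) Us \<Longrightarrow> els w \<rho>s xs \<Longrightarrow> els w (map Seq \<tau>s) (sapp_all \<rho>s \<tau>s Us xs)"
  by (auto simp: list_all2_conv_all_nth intro!: elt_sapps)

lemma stds_sapp_all: "world w \<Longrightarrow> stds w (map (\<lambda>\<tau>. Seq (fty \<rho>s \<tau>)) \<tau>s) Us \<Longrightarrow> stds w \<rho>s xs \<Longrightarrow>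
    stds w (map Seq \<tau>s) (sapp_all \<rho>s \<tau>s Us xs)"
  by (auto simp: list_all2_conv_all_nth intro!: std_sapps)

lemma ssubs_sapp_all:
  assumes w: "world w" and xs: "els w \<rho>s xs"
  shows "els w (map (\<lambda>\<tau>. Seq (fty \<rho>s \<tau>)) \<tau>s) Us \<Longrightarrow> els w (map (\<lambda>\<tau>. Seq (fty \<rho>s \<tau>)) \<tau>s) Us' \<Longrightarrow>
    ssubs w (map (fty \<rho>s) \<tau>s) Us Us' \<Longrightarrow> ssubs w \<tau>s (sapp_all \<rho>s \<tau>s Us xs) (sapp_all \<rho>s \<tau>s Us' xs)"
proof (induction \<tau>s arbitrary: Us Us')
  case (Cons \<tau> \<tau>s)
  then show ?case by (auto simp: list_all2_Cons1 intro!: ssub_sapps[OF w] xs)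
qed simp

subsection \<open>The principles for tuples\<close>

text \<open>The arguments of types \<open>\<rho>s\<close> stay fixed; only the witnesses, sequences
  over \<open>\<tau>s\<close>, may grow. Under this condition an unknown candidate can be replaced
  by a flattening that includes it.\<close>

definition up_closed :: "world \<Rightarrow> ty list \<Rightarrow> ty list \<Rightarrow> (world \<Rightarrow> tm list \<Rightarrow> bool) \<Rightarrow> bool" where
  "up_closed w \<rho>s \<tau>s P \<longleftrightarrow> (\<forall>v xs us us'. w \<sqsubseteq> v \<longrightarrow> els v \<rho>s xs \<longrightarrow> els v (map Seq \<tau>s) us \<longrightarrow> els v (map Seq \<tau>s) us' \<longrightarrow>
    ssubs v \<tau>s us us' \<longrightarrow> P v (xs @ us) \<longrightarrow> P v (xs @ us'))"

lemma up_closedD: "up_closed w \<rho>s \<tau>s P \<Longrightarrow> w \<sqsubseteq> v \<Longrightarrow> els v \<rho>s xs \<Longrightarrow> els v (map Seq \<tau>s) us \<Longrightarrow> els v (map Seq \<tau>s) us' \<Longrightarrow>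
    ssubs v \<tau>s us us' \<Longrightarrow> P v (xs @ us) \<Longrightarrow> P v (xs @ us')"
  unfolding up_closed_def by blast

lemma defts_nth: "world w \<Longrightarrow> i < length \<sigma>s \<Longrightarrow> defts w \<sigma>s [\<sigma>s ! i] (\<lambda>ts. [ts ! i])"
proof -
  assume w: "world w" and i: "i < length \<sigma>s"
  have "defts w \<sigma>s (take 1 (drop i \<sigma>s)) (\<lambda>ts. take 1 (drop i ts))"
    by (rule defts_take[OF defts_drop[OF defts_args[OF w]]])
  then have "defts w \<sigma>s (take 1 (drop i \<sigma>s)) (\<lambda>ts. [ts ! i])"
    by (rule defts_cong) (use i in \<open>auto dest!: list_all2_lengthD simp: hd_drop_conv_nth take_Suc\<close>)
  then show ?thesis using i by (simp add: hd_drop_conv_nth take_Suc)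
qed

text \<open>I is applied to codes. A finite sequence of codes is bounded by standard sequences of
  components, for which \<open>prem\<close> gives a \<open>y\<close>. Conversely a standard tuple
  has a standard code, and \<open>P\<close> respects the equality between the tuple and its
  decoding.\<close>

lemma I_tuple:
  assumes w: "world w" and P: "dfn True w (\<tau> # \<sigma>s) P"
    and prem: "\<And>v ss. w \<sqsubseteq> v \<Longrightarrow> stds v (map Seq \<sigma>s) ss \<Longrightarrow>
      \<exists>y. elt v \<tau> y \<and> (\<forall>u. v \<sqsubseteq> u \<longrightarrow> (\<forall>xs. mems u \<sigma>s xs ss \<longrightarrow> P u (y # xs)))"
  shows "\<exists>y. elt w \<tau> y \<and> (\<forall>v. w \<sqsubseteq> v \<longrightarrow> (\<forall>xs. stds v \<sigma>s xs \<longrightarrow> P v (y # xs)))"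
proof -
  obtain \<rho> rs where rs: "list_all2 (\<lambda>r \<tau>. wt [] r (\<rho> \<rightarrow> \<tau>)) rs \<sigma>s"
    and code: "\<And>w ys. world w \<Longrightarrow> stds w \<sigma>s ys \<Longrightarrow> \<exists>g. std w \<rho> g \<and> eqs w \<sigma>s (map (\<lambda>r. r \<cdot> g) rs) ys"
    and fin: "\<And>w G. world w \<Longrightarrow> std w (Seq \<rho>) G \<Longrightarrow> \<exists>ss. stds w (map Seq \<sigma>s) ss \<and>
      (\<forall>v. w \<sqsubseteq> v \<longrightarrow> (\<forall>g. mem v \<rho> g G \<longrightarrow> mems v \<sigma>s (map (\<lambda>r. r \<cdot> g) rs) ss))"
    by (rule coding[of \<sigma>s]) blast
  let ?P = "\<lambda>v ts. P v ([ts ! 0] @ map (\<lambda>r. r \<cdot> (ts ! 1)) rs)"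
  have 1: "defts w [\<tau>, \<rho>] [\<tau>] (\<lambda>ts. [ts ! 0])" and 2: "defts w [\<tau>, \<rho>] [\<rho>] (\<lambda>ts. [ts ! 1])"
    using defts_nth[OF w, of 0 "[\<tau>, \<rho>]"] defts_nth[OF w, of 1 "[\<tau>, \<rho>]"] by simp_all
  have "defts w [\<tau>, \<rho>] ([\<tau>] @ \<sigma>s) (\<lambda>ts. [ts ! 0] @ map (\<lambda>r. r \<cdot> (ts ! 1)) rs)"
    by (rule defts_append[OF 1 defts_App[OF 2 rs]])
  from dfn_comp[OF _ this] P have P': "dfn True w [\<tau>, \<rho>] ?P" by simp
  have "\<exists>y. elt w \<tau> y \<and> (\<forall>v. w \<sqsubseteq> v \<longrightarrow> (\<forall>g. std v \<rho> g \<longrightarrow> ?P v [y, g]))"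
  proof (rule I_w[OF w P'])
    fix v G assume v: "w \<sqsubseteq> v" and G: "std v (Seq \<rho>) G"
    obtain ss where ss: "stds v (map Seq \<sigma>s) ss"
      "\<And>u g. v \<sqsubseteq> u \<Longrightarrow> mem u \<rho> g G \<Longrightarrow> mems u \<sigma>s (map (\<lambda>r. r \<cdot> g) rs) ss"
      using fin[OF wle_world[OF v] G] by blast
    show "\<exists>y. elt v \<tau> y \<and> (\<forall>u. v \<sqsubseteq> u \<longrightarrow> (\<forall>g. mem u \<rho> g G \<longrightarrow> ?P u [y, g]))"
      using prem[OF v ss(1)] ss(2) by fastforce
  qed
  then obtain y where y: "elt w \<tau> y" "\<And>v g. w \<sqsubseteq> v \<Longrightarrow> std v \<rho> g \<Longrightarrow> P v (y # map (\<lambda>r. r \<cdot> g) rs)" by auto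
  have "P v (y # xs)" if v: "w \<sqsubseteq> v" and xs: "stds v \<sigma>s xs" for v xs
  proof -
    note wv = wle_world[OF v]
    obtain g where g: "std v \<rho> g" "eqs v \<sigma>s (map (\<lambda>r. r \<cdot> g) rs) xs" using code[OF wv xs] by blast
    have "eqs v (\<tau> # \<sigma>s) (y # map (\<lambda>r. r \<cdot> g) rs) (y # xs)" using g(2) eqw_refl[OF wv elt_mono[OF y(1) v]] by simp
    from dfn_eqs[OF P v this y(2)[OF v g(1)]] show ?thesis .
  qed
  then show ?thesis using y(1) by blast
qed

text \<open>Induction on the number of witnesses. The remaining ones are hidden in an existential
  quantifier while NCR is applied to the first; this quantifier is external, which NCR permits.
  Flattening the candidates fixes the first witness, and by monotonicity the others remain
  valid.\<close>

lemma NCR_tuple: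
  assumes w: "world w"
  shows "dfn False w (\<sigma> # map Seq \<tau>s) P \<Longrightarrow> up_closed w [\<sigma>] \<tau>s P \<Longrightarrow>
    (\<And>v y. w \<sqsubseteq> v \<Longrightarrow> elt v \<sigma> y \<Longrightarrow> \<exists>us. stds v (map Seq \<tau>s) us \<and> P v (y # us)) \<Longrightarrow>
    \<exists>us. stds w (map Seq \<tau>s) us \<and> (\<forall>v. w \<sqsubseteq> v \<longrightarrow> (\<forall>y. elt v \<sigma> y \<longrightarrow> P v (y # us)))"
proof (induction \<tau>s arbitrary: P)
  case Nil
  then show ?case by auto
next
  case (Cons \<tau> \<tau>s)
  let ?Q = "\<lambda>v ts. \<exists>us. stds v (map Seq \<tau>s) us \<and> P v (ts @ us)"
  have Q: "dfn False w [\<sigma>, Seq \<tau>] ?Q" by (rule dfn_ExSts) (use Cons.prems(1) in simp)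
  have "\<exists>s. std w (Seq (Seq \<tau>)) s \<and> (\<forall>v. w \<sqsubseteq> v \<longrightarrow> (\<forall>y. elt v \<sigma> y \<longrightarrow> (\<exists>u. mem v (Seq \<tau>) u s \<and> ?Q v [y, u])))"
    by (rule NCR_w[OF w Q]) (use Cons.prems(3) in \<open>fastforce simp: list_all2_Cons1\<close>)
  then obtain s where s: "std w (Seq (Seq \<tau>)) s"
    "\<And>v y. w \<sqsubseteq> v \<Longrightarrow> elt v \<sigma> y \<Longrightarrow> \<exists>u. mem v (Seq \<tau>) u s \<and> ?Q v [y, u]" by blast
  let ?u = "flatC \<tau> \<cdot> s"
  have u: "std w (Seq \<tau>) ?u" by (rule std_flatC[OF w s(1)])
  let ?F = "\<lambda>ts. [ts ! 0] @ [?u] @ drop 1 ts"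
  let ?P = "\<lambda>v ts. P v (?F ts)"
  have F: "defts w (\<sigma> # map Seq \<tau>s) ([\<sigma>] @ [Seq \<tau>] @ map Seq \<tau>s) ?F"
    using defts_append[OF defts_nth[OF w, of 0] defts_append[OF defts_const defts_drop[OF defts_args[OF w], where k = 1]], of "\<sigma> # map Seq \<tau>s" "[Seq \<tau>]" "[?u]"] std_elt[OF w u]
    by simp
  have P': "dfn False w (\<sigma> # map Seq \<tau>s) ?P" using dfn_comp[OF _ F, of False P] Cons.prems(1) by simp
  have up: "up_closed w [\<sigma>] \<tau>s ?P"
    unfolding up_closed_def
  proof (intro allI impI)
    fix v xs us us' assume v: "w \<sqsubseteq> v" and xs: "els v [\<sigma>] xs" and us: "els v (map Seq \<tau>s) us" "els v (map Seq \<tau>s) us'" "ssubs v \<tau>s us us'" and p: "P v (?F (xs @ us))"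
    obtain x where x: "xs = [x]" using xs by (auto simp: list_all2_Cons1)
    have uv: "elt v (Seq \<tau>) ?u" using std_elt[OF w u] v by (rule elt_mono)
    show "P v (?F (xs @ us'))"
      using up_closedD[OF Cons.prems(2) v xs, of "?u # us" "?u # us'"] us uv p x by (simp add: ssub_refl)
  qed
  have "\<exists>us. stds w (map Seq \<tau>s) us \<and> (\<forall>v. w \<sqsubseteq> v \<longrightarrow> (\<forall>y. elt v \<sigma> y \<longrightarrow> ?P v (y # us)))"
  proof (rule Cons.IH[OF P' up])
    fix v y assume v: "w \<sqsubseteq> v" and y: "elt v \<sigma> y"
    note wv = wle_world[OF v]
    obtain u us where q: "mem v (Seq \<tau>) u s" "stds v (map Seq \<tau>s) us" "P v (y # u # us)" using s(2)[OF v y] by auto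
    have "P v (y # ?u # us)"
      using up_closedD[OF Cons.prems(2) v, of "[y]" "u # us" "?u # us"] y q mem_elt(1)[OF wv q(1)] stds_els[OF q(2) wv]
        elt_mono[OF std_elt[OF w u] v] ssub_flatC[OF wv q(1)] ssubs_refl[of \<tau>s us] list_all2_lengthD[OF q(2)] by simp
    then show "\<exists>us. stds v (map Seq \<tau>s) us \<and> ?P v (y # us)" using q(2) by auto
  qed
  then obtain us where "stds w (map Seq \<tau>s) us" "\<And>v y. w \<sqsubseteq> v \<Longrightarrow> elt v \<sigma> y \<Longrightarrow> P v (y # ?u # us)" by auto
  then show ?case using u by (intro exI[of _ "?u # us"]) auto
qed

text \<open>One argument and several witnesses, on the model of \<open>NCR_tuple\<close>;
  \<open>liftC\<close> now flattens the candidates separately for each value of the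
  argument.\<close>

lemma HAC_1:
  assumes w: "world w"
  shows "dfn False w (\<rho> # map Seq \<tau>s) P \<Longrightarrow> up_closed w [\<rho>] \<tau>s P \<Longrightarrow>
    (\<And>v x. w \<sqsubseteq> v \<Longrightarrow> std v \<rho> x \<Longrightarrow> \<exists>us. stds v (map Seq \<tau>s) us \<and> P v (x # us)) \<Longrightarrow>
    \<exists>Us. stds w (map (\<lambda>\<tau>. Seq (\<rho> \<rightarrow> Seq \<tau>)) \<tau>s) Us \<and>
      (\<forall>v. w \<sqsubseteq> v \<longrightarrow> (\<forall>x. std v \<rho> x \<longrightarrow> P v (x # map2 (\<lambda>\<tau> U. sapp \<rho> \<tau> U x) \<tau>s Us)))"
proof (induction \<tau>s arbitrary: P)
  case Nil
  then show ?case by auto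
next
  case (Cons \<tau> \<tau>s)
  let ?Q = "\<lambda>v ts. \<exists>us. stds v (map Seq \<tau>s) us \<and> P v (ts @ us)"
  have Q: "dfn False w [\<rho>, Seq \<tau>] ?Q" by (rule dfn_ExSts) (use Cons.prems(1) in simp)
  have "\<exists>F. std w (\<rho> \<rightarrow> Seq (Seq \<tau>)) F \<and> (\<forall>v. w \<sqsubseteq> v \<longrightarrow> (\<forall>x. std v \<rho> x \<longrightarrow> (\<exists>u. mem v (Seq \<tau>) u (F \<cdot> x) \<and> ?Q v [x, u])))"
    by (rule HAC_w[OF w Q]) (use Cons.prems(3) in \<open>fastforce simp: list_all2_Cons1\<close>)
  then obtain F where F: "std w (\<rho> \<rightarrow> Seq (Seq \<tau>)) F"
    "\<And>v x. w \<sqsubseteq> v \<Longrightarrow> std v \<rho> x \<Longrightarrow> \<exists>u. mem v (Seq \<tau>) u (F \<cdot> x) \<and> ?Q v [x, u]" by blast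
  let ?U = "liftC \<rho> \<tau> \<cdot> F"
  have U: "std w (Seq (\<rho> \<rightarrow> Seq \<tau>)) ?U" by (rule std_closed_App[OF w wt_liftC F(1)])
  let ?F = "\<lambda>ts. [ts ! 0] @ [sapp \<rho> \<tau> ?U (ts ! 0)] @ drop 1 ts"
  let ?P = "\<lambda>v ts. P v (?F ts)"
  have "defts w (\<rho> # map Seq \<tau>s) [\<rho>] (\<lambda>ts. [ts ! 0])" using defts_nth[OF w, of 0 "\<rho> # map Seq \<tau>s"] by simp
  moreover have "defts w (\<rho> # map Seq \<tau>s) [Seq \<tau>] (\<lambda>ts. [sapp \<rho> \<tau> ?U (ts ! 0)])"
    using defts_sapps[OF defts_const calculation, of "[\<tau>]" "[?U]"] std_elt[OF w U] by simp
  moreover have "defts w (\<rho> # map Seq \<tau>s) (map Seq \<tau>s) (drop 1)"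
    using defts_drop[OF defts_args[OF w], of "\<rho> # map Seq \<tau>s" 1] by simp
  ultimately have "defts w (\<rho> # map Seq \<tau>s) ([\<rho>] @ [Seq \<tau>] @ map Seq \<tau>s) ?F" by (intro defts_append)
  then have P': "dfn False w (\<rho> # map Seq \<tau>s) ?P" using dfn_comp[of False w "\<rho> # Seq \<tau> # map Seq \<tau>s" P] Cons.prems(1) by simp
  have up: "up_closed w [\<rho>] \<tau>s ?P"
    unfolding up_closed_def
  proof (intro allI impI)
    fix v xs us us' assume v: "w \<sqsubseteq> v" and xs: "els v [\<rho>] xs" and us: "els v (map Seq \<tau>s) us" "els v (map Seq \<tau>s) us'" "ssubs v \<tau>s us us'" and p: "P v (?F (xs @ us))"
    obtain x where x: "xs = [x]" "elt v \<rho> x" using xs by (auto simp: list_all2_Cons1)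
    let ?u = "sapp \<rho> \<tau> ?U x"
    have uv: "elt v (Seq \<tau>) ?u" using elt_mono[OF std_elt[OF w U] v] x by simp
    show "P v (?F (xs @ us'))"
      using up_closedD[OF Cons.prems(2) v xs, of "?u # us" "?u # us'"] us uv p x by (simp add: ssub_refl)
  qed
  have "\<exists>Us. stds w (map (\<lambda>\<tau>. Seq (\<rho> \<rightarrow> Seq \<tau>)) \<tau>s) Us \<and>
      (\<forall>v. w \<sqsubseteq> v \<longrightarrow> (\<forall>x. std v \<rho> x \<longrightarrow> ?P v (x # map2 (\<lambda>\<tau> U. sapp \<rho> \<tau> U x) \<tau>s Us)))"
  proof (rule Cons.IH[OF P' up])
    fix v x assume v: "w \<sqsubseteq> v" and x: "std v \<rho> x"
    note wv = wle_world[OF v] and xe = std_elt[OF wle_world[OF v] x] and Uv = elt_mono[OF std_elt[OF w U] v] and Fv = elt_mono[OF std_elt[OF w F(1)] v]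
    obtain u us where q: "mem v (Seq \<tau>) u (F \<cdot> x)" "stds v (map Seq \<tau>s) us" "P v (x # u # us)" using F(2)[OF v x] by auto
    have "ssub v \<tau> u (sapp \<rho> \<tau> ?U x)"
      using ssub_flatC[OF wv q(1)] mem_liftC[OF wle_world elt_mono[OF Fv] elt_mono[OF xe]] unfolding ssub_def by blast
    then have "P v (x # sapp \<rho> \<tau> ?U x # us)"
      using up_closedD[OF Cons.prems(2) v, of "[x]" "u # us" "sapp \<rho> \<tau> ?U x # us"] xe q mem_elt(1)[OF wv q(1)] stds_els[OF q(2) wv]
        Uv ssubs_refl[of \<tau>s us] list_all2_lengthD[OF q(2)] by simp
    then show "\<exists>us. stds v (map Seq \<tau>s) us \<and> ?P v (x # us)" using q(2) by auto
  qed
  then obtain Us where "stds w (map (\<lambda>\<tau>. Seq (\<rho> \<rightarrow> Seq \<tau>)) \<tau>s) Us"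
    "\<And>v x. w \<sqsubseteq> v \<Longrightarrow> std v \<rho> x \<Longrightarrow> P v (x # sapp \<rho> \<tau> ?U x # map2 (\<lambda>\<tau> U. sapp \<rho> \<tau> U x) \<tau>s Us)" by auto
  then show ?case using U by (intro exI[of _ "?U # Us"]) auto
qed

text \<open>Holds because \<open>sapps\<close> consumes its arguments from the left.\<close>

lemma sapp_all_Cons:
  "map2 (\<lambda>\<tau> U. sapps \<rho>s \<tau> U xs) \<tau>s (map2 (\<lambda>\<tau> U. sapp \<rho> \<tau> U x) (map (fty \<rho>s) \<tau>s) Us) = sapp_all (\<rho> # \<rho>s) \<tau>s Us (x # xs)"
  by (induction \<tau>s arbitrary: Us) (simp, case_tac Us, auto)

text \<open>Induction on the arguments. With the first argument fixed, the induction hypothesis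
  supplies functions of the others. These are again tuples of sequences in which the claim is
  monotone, so \<open>HAC_1\<close> makes them depend on the first argument.\<close>

lemma HAC_tuple:
  "world w \<Longrightarrow> dfn False w (\<rho>s @ map Seq \<tau>s) P \<Longrightarrow> up_closed w \<rho>s \<tau>s P \<Longrightarrow>
    (\<And>v xs. w \<sqsubseteq> v \<Longrightarrow> stds v \<rho>s xs \<Longrightarrow> \<exists>us. stds v (map Seq \<tau>s) us \<and> P v (xs @ us)) \<Longrightarrow>
    \<exists>Us. stds w (map (\<lambda>\<tau>. Seq (fty \<rho>s \<tau>)) \<tau>s) Us \<and>
      (\<forall>v. w \<sqsubseteq> v \<longrightarrow> (\<forall>xs. stds v \<rho>s xs \<longrightarrow> P v (xs @ sapp_all \<rho>s \<tau>s Us xs)))"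
proof (induction \<rho>s arbitrary: w P)
  case Nil
  obtain us where us: "stds w (map Seq \<tau>s) us" "P w us" using Nil.prems(4)[of w "[]"] Nil.prems(1) wle_refl by auto
  have "P v us" if "w \<sqsubseteq> v" for v
    using dfn_persist[OF Nil.prems(2) wle_refl[OF Nil.prems(1)] _ _ that] us stds_els[OF us(1) Nil.prems(1)] by simp
  moreover have "map2 (\<lambda>\<tau> U. U) \<tau>s us = us" using list_all2_lengthD[OF us(1)] by (simp add: map2_map_map[symmetric] map_snd_zip case_prod_unfold)
  ultimately show ?case using us(1) by (intro exI[of _ us]) auto
next
  case (Cons \<rho> \<rho>s)
  note w = Cons.prems(1) and P = Cons.prems(2) and up = Cons.prems(3)
  let ?n = "length \<tau>s"
  let ?\<tau>s = "map (fty \<rho>s) \<tau>s"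
  let ?\<sigma>s = "\<rho> # map Seq ?\<tau>s"
  \<comment> \<open>In \<open>ts\<close> the order is first argument, functions, remaining
    arguments; \<open>?F\<close> rearranges this into all arguments followed by the values of the
    functions.\<close>
  let ?F = "\<lambda>ts. [ts ! 0] @ drop (Suc ?n) ts @ sapp_all \<rho>s \<tau>s (take ?n (drop 1 ts)) (drop (Suc ?n) ts)"
  let ?Q = "\<lambda>v ts. \<forall>u. v \<sqsubseteq> u \<longrightarrow> (\<forall>xs. stds u \<rho>s xs \<longrightarrow> P u (?F (ts @ xs)))"
  have "defts w (?\<sigma>s @ \<rho>s) [\<rho>] (\<lambda>ts. [ts ! 0])" using defts_nth[OF w, of 0 "?\<sigma>s @ \<rho>s"] by simp
  moreover have d: "defts w (?\<sigma>s @ \<rho>s) \<rho>s (drop (Suc ?n))" using defts_drop[OF defts_args[OF w], of "?\<sigma>s @ \<rho>s" "Suc ?n"] by simp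
  moreover have "defts w (?\<sigma>s @ \<rho>s) (map Seq \<tau>s) (\<lambda>ts. sapp_all \<rho>s \<tau>s (take ?n (drop 1 ts)) (drop (Suc ?n) ts))"
    using defts_sapps[OF _ d, of \<tau>s "\<lambda>ts. take ?n (drop 1 ts)"] defts_take[OF defts_drop[OF defts_args[OF w]], of "?\<sigma>s @ \<rho>s" ?n 1]
    by (simp add: comp_def)
  ultimately have "defts w (?\<sigma>s @ \<rho>s) ([\<rho>] @ \<rho>s @ map Seq \<tau>s) ?F" by (intro defts_append)
  from dfn_comp[OF _ this, of False P] P have "dfn False w (?\<sigma>s @ \<rho>s) (\<lambda>v ts. P v (?F ts))" by simp
  from dfn_AllSts[OF this] have Q: "dfn False w ?\<sigma>s ?Q" .
  have Qsem: "?Q v (x # Us) \<longleftrightarrow> (\<forall>u. v \<sqsubseteq> u \<longrightarrow> (\<forall>xs. stds u \<rho>s xs \<longrightarrow> P u (x # xs @ sapp_all \<rho>s \<tau>s Us xs)))"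
    if "length Us = ?n" for v x Us using that by simp
  have upQ: "up_closed w [\<rho>] ?\<tau>s ?Q"
    unfolding up_closed_def
  proof (rule allI, rule allI, rule allI, rule allI, rule impI, rule impI, rule impI, rule impI, rule impI, rule impI)
    fix v xs Us Us' assume v: "w \<sqsubseteq> v" and xs: "els v [\<rho>] xs"
      and Us: "els v (map Seq ?\<tau>s) Us" "els v (map Seq ?\<tau>s) Us'" "ssubs v ?\<tau>s Us Us'" and q: "?Q v (xs @ Us)"
    obtain x where x: "xs = [x]" "elt v \<rho> x" using xs by (auto simp: list_all2_Cons1)
    have l: "length Us = ?n" "length Us' = ?n" using list_all2_lengthD[OF Us(1)] list_all2_lengthD[OF Us(2)] by auto
    have "P u (x # ys @ sapp_all \<rho>s \<tau>s Us' ys)" if u: "v \<sqsubseteq> u" and ys: "stds u \<rho>s ys" for u ys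
    proof -
      note wu = wle_world[OF u] and yse = stds_els[OF ys wle_world[OF u]]
      have e: "els u (map (\<lambda>\<tau>. Seq (fty \<rho>s \<tau>)) \<tau>s) Us" "els u (map (\<lambda>\<tau>. Seq (fty \<rho>s \<tau>)) \<tau>s) Us'"
        using els_mono[OF Us(1) u] els_mono[OF Us(2) u] by (simp_all add: comp_def)
      have "P u ((x # ys) @ sapp_all \<rho>s \<tau>s Us ys)" using q Qsem[OF l(1), of v x] x u ys by simp
      then have "P u ((x # ys) @ sapp_all \<rho>s \<tau>s Us' ys)"
        by (rule up_closedD[OF up wle_trans[OF v u] _ els_sapp_all[OF e(1) yse] els_sapp_all[OF e(2) yse]
              ssubs_sapp_all[OF wu yse e ssubs_mono[OF Us(3) u]], rotated])
          (use elt_mono[OF x(2) u] yse in simp)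
      then show ?thesis by simp
    qed
    then show "?Q v (xs @ Us')" using Qsem[OF l(2), of v x] x by simp
  qed
  have "\<exists>Us. stds w (map (\<lambda>\<tau>. Seq (\<rho> \<rightarrow> Seq \<tau>)) ?\<tau>s) Us \<and>
      (\<forall>v. w \<sqsubseteq> v \<longrightarrow> (\<forall>x. std v \<rho> x \<longrightarrow> ?Q v (x # map2 (\<lambda>\<tau> U. sapp \<rho> \<tau> U x) ?\<tau>s Us)))"
  proof (rule HAC_1[OF w Q upQ])
    fix v x assume v: "w \<sqsubseteq> v" and x: "std v \<rho> x"
    note wv = wle_world[OF v] and xe = std_elt[OF wle_world[OF v] x]
    have "defts v (\<rho>s @ map Seq \<tau>s) ([\<rho>] @ (\<rho>s @ map Seq \<tau>s)) (\<lambda>ts. [x] @ ts)"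
      by (rule defts_append[OF defts_const defts_args[OF wv]]) (simp add: xe)
    from dfn_comp[OF _ this, of False P] have P': "dfn False v (\<rho>s @ map Seq \<tau>s) (\<lambda>v ts. P v (x # ts))" using dfn_mono[OF P v] by simp
    have up': "up_closed v \<rho>s \<tau>s (\<lambda>v ts. P v (x # ts))"
      unfolding up_closed_def
    proof (intro allI impI)
      fix u xs us us' assume u: "v \<sqsubseteq> u" "els u \<rho>s xs" "els u (map Seq \<tau>s) us" "els u (map Seq \<tau>s) us'" "ssubs u \<tau>s us us'" "P u (x # xs @ us)"
      show "P u (x # xs @ us')"
        using up_closedD[OF up wle_trans[OF v u(1)], of "x # xs" us us'] u elt_mono[OF xe u(1)] by simp
    qed
    have "\<exists>Us. stds v (map (\<lambda>\<tau>. Seq (fty \<rho>s \<tau>)) \<tau>s) Us \<and>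
      (\<forall>u. v \<sqsubseteq> u \<longrightarrow> (\<forall>xs. stds u \<rho>s xs \<longrightarrow> P u (x # xs @ sapp_all \<rho>s \<tau>s Us xs)))"
    proof (rule Cons.IH[OF wv P' up'])
      fix u xs assume u: "v \<sqsubseteq> u" and xs: "stds u \<rho>s xs"
      show "\<exists>us. stds u (map Seq \<tau>s) us \<and> P u (x # xs @ us)"
        using Cons.prems(4)[OF wle_trans[OF v u], of "x # xs"] xs tr_mono[OF x u] by simp
    qed
    then obtain Us where Us: "stds v (map (\<lambda>\<tau>. Seq (fty \<rho>s \<tau>)) \<tau>s) Us"
      "\<forall>u. v \<sqsubseteq> u \<longrightarrow> (\<forall>xs. stds u \<rho>s xs \<longrightarrow> P u (x # xs @ sapp_all \<rho>s \<tau>s Us xs))" by blast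
    have "length Us = ?n" using list_all2_lengthD[OF Us(1)] by simp
    then have "?Q v (x # Us)" using Qsem Us(2) by blast
    with Us(1) show "\<exists>us. stds v (map Seq ?\<tau>s) us \<and> ?Q v (x # us)" by (auto simp: comp_def)
  qed
  then obtain Us where Us: "stds w (map (\<lambda>\<tau>. Seq (\<rho> \<rightarrow> Seq \<tau>)) ?\<tau>s) Us"
    and q: "\<And>v x. w \<sqsubseteq> v \<Longrightarrow> std v \<rho> x \<Longrightarrow> ?Q v (x # map2 (\<lambda>\<tau> U. sapp \<rho> \<tau> U x) ?\<tau>s Us)" by blast
  have l: "length (map2 (\<lambda>\<tau> U. sapp \<rho> \<tau> U x) ?\<tau>s Us) = ?n" for x using list_all2_lengthD[OF Us] by simp
  have "P v (xs @ sapp_all (\<rho> # \<rho>s) \<tau>s Us xs)" if v: "w \<sqsubseteq> v" and xs: "stds v (\<rho> # \<rho>s) xs" for v xs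
  proof -
    obtain x ys where x: "xs = x # ys" "std v \<rho> x" "stds v \<rho>s ys" using xs by (auto simp: list_all2_Cons1)
    show ?thesis
      using q[OF v x(2)] x(3) wle_refl[OF wle_world[OF v]] unfolding Qsem[OF l] x(1) sapp_all_Cons by auto
  qed
  then show ?case using Us by (intro exI[of _ Us]) (auto simp: comp_def)
qed

text \<open>HIP and HGMP take a premise with a single standard quantifier, so one variable has to
  carry the whole tuple. The last clause is for HGMP, whose finite sequence of codes must be
  replaced by sequences of components.\<close>

lemma coded_premise:
  assumes w: "world w" and P: "dfn True w \<sigma>s P"
  obtains \<rho> P' where "dfn True w [\<rho>] P'"
    and "\<And>v. w \<sqsubseteq> v \<Longrightarrow> (\<forall>u. v \<sqsubseteq> u \<longrightarrow> (\<forall>xs. stds u \<sigma>s xs \<longrightarrow> P u xs)) \<longleftrightarrow> (\<forall>u. v \<sqsubseteq> u \<longrightarrow> (\<forall>g. std u \<rho> g \<longrightarrow> P' u [g]))"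
    and "\<And>G. std w (Seq \<rho>) G \<Longrightarrow> \<exists>ss. stds w (map Seq \<sigma>s) ss \<and> (\<forall>v. w \<sqsubseteq> v \<longrightarrow>
      (\<forall>u. v \<sqsubseteq> u \<longrightarrow> (\<forall>xs. mems u \<sigma>s xs ss \<longrightarrow> P u xs)) \<longrightarrow> (\<forall>u. v \<sqsubseteq> u \<longrightarrow> (\<forall>g. mem u \<rho> g G \<longrightarrow> P' u [g])))"
proof -
  obtain \<rho> rs where rs: "list_all2 (\<lambda>r \<tau>. wt [] r (\<rho> \<rightarrow> \<tau>)) rs \<sigma>s"
    and code: "\<And>w ys. world w \<Longrightarrow> stds w \<sigma>s ys \<Longrightarrow> \<exists>g. std w \<rho> g \<and> eqs w \<sigma>s (map (\<lambda>r. r \<cdot> g) rs) ys"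
    and dec: "\<And>w g. world w \<Longrightarrow> std w \<rho> g \<Longrightarrow> stds w \<sigma>s (map (\<lambda>r. r \<cdot> g) rs)"
    and fin: "\<And>w G. world w \<Longrightarrow> std w (Seq \<rho>) G \<Longrightarrow> \<exists>ss. stds w (map Seq \<sigma>s) ss \<and>
      (\<forall>v. w \<sqsubseteq> v \<longrightarrow> (\<forall>g. mem v \<rho> g G \<longrightarrow> mems v \<sigma>s (map (\<lambda>r. r \<cdot> g) rs) ss))"
    by (rule coding[of \<sigma>s]) blast
  let ?P = "\<lambda>v ts. P v (map (\<lambda>r. r \<cdot> (ts ! 0)) rs)"
  have "defts w [\<rho>] \<sigma>s (\<lambda>ts. map (\<lambda>r. r \<cdot> (ts ! 0)) rs)"
    using defts_App[OF _ rs] defts_nth[OF w, of 0 "[\<rho>]"] by simp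
  from dfn_comp[OF P this] have P': "dfn True w [\<rho>] ?P" .
  show thesis
  proof (rule that[OF P'])
    fix v assume v: "w \<sqsubseteq> v"
    show "(\<forall>u. v \<sqsubseteq> u \<longrightarrow> (\<forall>xs. stds u \<sigma>s xs \<longrightarrow> P u xs)) \<longleftrightarrow> (\<forall>u. v \<sqsubseteq> u \<longrightarrow> (\<forall>g. std u \<rho> g \<longrightarrow> ?P u [g]))"
    proof (intro iffI allI impI)
      fix u g assume "\<forall>u. v \<sqsubseteq> u \<longrightarrow> (\<forall>xs. stds u \<sigma>s xs \<longrightarrow> P u xs)" "v \<sqsubseteq> u" "std u \<rho> g"
      then show "?P u [g]" using dec[OF wle_world] by simp
    next
      fix u xs assume a: "\<forall>u. v \<sqsubseteq> u \<longrightarrow> (\<forall>g. std u \<rho> g \<longrightarrow> ?P u [g])" and u: "v \<sqsubseteq> u" "stds u \<sigma>s xs"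
      obtain g where g: "std u \<rho> g" "eqs u \<sigma>s (map (\<lambda>r. r \<cdot> g) rs) xs" using code[OF wle_world[OF u(1)] u(2)] by blast
      have "P u (map (\<lambda>r. r \<cdot> g) rs)" using a u g by simp
      from dfn_eqs[OF P wle_trans[OF v u(1)] g(2) this] show "P u xs" .
    qed
  next
    fix G assume "std w (Seq \<rho>) G"
    then obtain ss where ss: "stds w (map Seq \<sigma>s) ss"
      "\<And>v g. w \<sqsubseteq> v \<Longrightarrow> mem v \<rho> g G \<Longrightarrow> mems v \<sigma>s (map (\<lambda>r. r \<cdot> g) rs) ss" using fin[OF w] by blast
    then show "\<exists>ss. stds w (map Seq \<sigma>s) ss \<and> (\<forall>v. w \<sqsubseteq> v \<longrightarrow>
      (\<forall>u. v \<sqsubseteq> u \<longrightarrow> (\<forall>xs. mems u \<sigma>s xs ss \<longrightarrow> P u xs)) \<longrightarrow> (\<forall>u. v \<sqsubseteq> u \<longrightarrow> (\<forall>g. mem u \<rho> g G \<longrightarrow> ?P u [g])))"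
      using wle_trans by (intro exI[of _ ss]) fastforce
  qed
qed

text \<open>The argument of \<open>NCR_tuple\<close>, with the premise of HIP in place of the
  universally quantified element.\<close>

lemma HIP_1:
  assumes w: "world w" and P: "dfn True w [\<sigma>] P"
  shows "dfn False w (map Seq \<tau>s) Q \<Longrightarrow> up_closed w [] \<tau>s Q \<Longrightarrow>
    (\<And>v. w \<sqsubseteq> v \<Longrightarrow> (\<forall>u. v \<sqsubseteq> u \<longrightarrow> (\<forall>x. std u \<sigma> x \<longrightarrow> P u [x])) \<Longrightarrow> \<exists>us. stds v (map Seq \<tau>s) us \<and> Q v us) \<Longrightarrow>
    \<exists>us. stds w (map Seq \<tau>s) us \<and> (\<forall>v. w \<sqsubseteq> v \<longrightarrow> (\<forall>u. v \<sqsubseteq> u \<longrightarrow> (\<forall>x. std u \<sigma> x \<longrightarrow> P u [x])) \<longrightarrow> Q v us)"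
proof (induction \<tau>s arbitrary: Q)
  case Nil
  then show ?case by auto
next
  case (Cons \<tau> \<tau>s)
  let ?A = "\<lambda>v. \<forall>u. v \<sqsubseteq> u \<longrightarrow> (\<forall>x. std u \<sigma> x \<longrightarrow> P u [x])"
  let ?R = "\<lambda>v ts. \<exists>us. stds v (map Seq \<tau>s) us \<and> Q v (ts @ us)"
  have R: "dfn False w [Seq \<tau>] ?R" by (rule dfn_ExSts) (use Cons.prems(1) in simp)
  have "\<exists>s. std w (Seq (Seq \<tau>)) s \<and> (\<forall>v. w \<sqsubseteq> v \<longrightarrow> ?A v \<longrightarrow> (\<exists>u. mem v (Seq \<tau>) u s \<and> ?R v [u]))"
    by (rule HIP_w[OF w P R]) (use Cons.prems(3) in \<open>fastforce simp: list_all2_Cons1\<close>)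
  then obtain s where s: "std w (Seq (Seq \<tau>)) s" "\<And>v. w \<sqsubseteq> v \<Longrightarrow> ?A v \<Longrightarrow> \<exists>u. mem v (Seq \<tau>) u s \<and> ?R v [u]" by blast
  let ?u = "flatC \<tau> \<cdot> s"
  have u: "std w (Seq \<tau>) ?u" by (rule std_flatC[OF w s(1)])
  have "defts w (map Seq \<tau>s) ([Seq \<tau>] @ map Seq \<tau>s) (\<lambda>ts. [?u] @ ts)"
    by (rule defts_append[OF defts_const defts_args[OF w]]) (simp add: std_elt[OF w u])
  from dfn_comp[OF _ this, of False Q] have Q': "dfn False w (map Seq \<tau>s) (\<lambda>v ts. Q v (?u # ts))" using Cons.prems(1) by simp
  have up: "up_closed w [] \<tau>s (\<lambda>v ts. Q v (?u # ts))"
    unfolding up_closed_def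
  proof (intro allI impI)
    fix v xs us us' assume v: "w \<sqsubseteq> v" "els v [] xs" "els v (map Seq \<tau>s) us" "els v (map Seq \<tau>s) us'" "ssubs v \<tau>s us us'" "Q v (?u # xs @ us)"
    then show "Q v (?u # xs @ us')"
      using up_closedD[OF Cons.prems(2) v(1), of "[]" "?u # us" "?u # us'"] elt_mono[OF std_elt[OF w u] v(1)] by (simp add: ssub_refl)
  qed
  have "\<exists>us. stds w (map Seq \<tau>s) us \<and> (\<forall>v. w \<sqsubseteq> v \<longrightarrow> ?A v \<longrightarrow> Q v (?u # us))"
  proof (rule Cons.IH[OF Q' up])
    fix v assume v: "w \<sqsubseteq> v" and a: "?A v"
    note wv = wle_world[OF v]
    obtain y us where q: "mem v (Seq \<tau>) y s" "stds v (map Seq \<tau>s) us" "Q v (y # us)" using s(2)[OF v a] by auto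
    have "Q v (?u # us)"
      using up_closedD[OF Cons.prems(2) v, of "[]" "y # us" "?u # us"] q mem_elt(1)[OF wv q(1)] stds_els[OF q(2) wv]
        elt_mono[OF std_elt[OF w u] v] ssub_flatC[OF wv q(1)] ssubs_refl[of \<tau>s us] list_all2_lengthD[OF q(2)] by simp
    then show "\<exists>us. stds v (map Seq \<tau>s) us \<and> Q v (?u # us)" using q(2) by auto
  qed
  then obtain us where "stds w (map Seq \<tau>s) us" "\<And>v. w \<sqsubseteq> v \<Longrightarrow> ?A v \<Longrightarrow> Q v (?u # us)" by auto
  then show ?case using u by (intro exI[of _ "?u # us"]) auto
qed

lemma HIP_tuple:
  assumes w: "world w" and P: "dfn True w \<sigma>s P" and Q: "dfn False w (map Seq \<tau>s) Q" "up_closed w [] \<tau>s Q"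
    and prem: "\<And>v. w \<sqsubseteq> v \<Longrightarrow> (\<forall>u. v \<sqsubseteq> u \<longrightarrow> (\<forall>xs. stds u \<sigma>s xs \<longrightarrow> P u xs)) \<Longrightarrow> \<exists>us. stds v (map Seq \<tau>s) us \<and> Q v us"
  shows "\<exists>us. stds w (map Seq \<tau>s) us \<and> (\<forall>v. w \<sqsubseteq> v \<longrightarrow> (\<forall>u. v \<sqsubseteq> u \<longrightarrow> (\<forall>xs. stds u \<sigma>s xs \<longrightarrow> P u xs)) \<longrightarrow> Q v us)"
proof (rule coded_premise[OF w P])
  fix \<rho> P' assume P': "dfn True w [\<rho>] P'"
    and eq: "\<And>v. w \<sqsubseteq> v \<Longrightarrow> (\<forall>u. v \<sqsubseteq> u \<longrightarrow> (\<forall>xs. stds u \<sigma>s xs \<longrightarrow> P u xs)) \<longleftrightarrow> (\<forall>u. v \<sqsubseteq> u \<longrightarrow> (\<forall>g. std u \<rho> g \<longrightarrow> P' u [g]))"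
  have "\<exists>us. stds w (map Seq \<tau>s) us \<and> (\<forall>v. w \<sqsubseteq> v \<longrightarrow> (\<forall>u. v \<sqsubseteq> u \<longrightarrow> (\<forall>g. std u \<rho> g \<longrightarrow> P' u [g])) \<longrightarrow> Q v us)"
  proof (rule HIP_1[OF w P' Q])
    fix v assume v: "w \<sqsubseteq> v" and a: "\<forall>u. v \<sqsubseteq> u \<longrightarrow> (\<forall>g. std u \<rho> g \<longrightarrow> P' u [g])"
    show "\<exists>us. stds v (map Seq \<tau>s) us \<and> Q v us" by (rule prem[OF v]) (use a eq[OF v] in blast)
  qed
  then obtain us where us: "stds w (map Seq \<tau>s) us"
    "\<And>v. w \<sqsubseteq> v \<Longrightarrow> (\<forall>u. v \<sqsubseteq> u \<longrightarrow> (\<forall>g. std u \<rho> g \<longrightarrow> P' u [g])) \<Longrightarrow> Q v us" by blast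
  show ?thesis
  proof (intro exI[of _ us] conjI allI impI us(1))
    fix v assume v: "w \<sqsubseteq> v" and a: "\<forall>u. v \<sqsubseteq> u \<longrightarrow> (\<forall>xs. stds u \<sigma>s xs \<longrightarrow> P u xs)"
    show "Q v us" by (rule us(2)[OF v]) (use a eq[OF v] in blast)
  qed
qed

lemma HGMP_tuple:
  assumes w: "world w" and P: "dfn True w \<sigma>s P" and Q: "dfn True w [] Q"
    and prem: "\<And>v. w \<sqsubseteq> v \<Longrightarrow> (\<forall>u. v \<sqsubseteq> u \<longrightarrow> (\<forall>xs. stds u \<sigma>s xs \<longrightarrow> P u xs)) \<Longrightarrow> Q v []"
  shows "\<exists>ss. stds w (map Seq \<sigma>s) ss \<and> (\<forall>v. w \<sqsubseteq> v \<longrightarrow> (\<forall>u. v \<sqsubseteq> u \<longrightarrow> (\<forall>xs. mems u \<sigma>s xs ss \<longrightarrow> P u xs)) \<longrightarrow> Q v [])"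
proof (rule coded_premise[OF w P])
  fix \<rho> P' assume P': "dfn True w [\<rho>] P'"
    and eq: "\<And>v. w \<sqsubseteq> v \<Longrightarrow> (\<forall>u. v \<sqsubseteq> u \<longrightarrow> (\<forall>xs. stds u \<sigma>s xs \<longrightarrow> P u xs)) \<longleftrightarrow> (\<forall>u. v \<sqsubseteq> u \<longrightarrow> (\<forall>g. std u \<rho> g \<longrightarrow> P' u [g]))"
    and fin: "\<And>G. std w (Seq \<rho>) G \<Longrightarrow> \<exists>ss. stds w (map Seq \<sigma>s) ss \<and> (\<forall>v. w \<sqsubseteq> v \<longrightarrow>
      (\<forall>u. v \<sqsubseteq> u \<longrightarrow> (\<forall>xs. mems u \<sigma>s xs ss \<longrightarrow> P u xs)) \<longrightarrow> (\<forall>u. v \<sqsubseteq> u \<longrightarrow> (\<forall>g. mem u \<rho> g G \<longrightarrow> P' u [g])))"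
  have "\<exists>G. std w (Seq \<rho>) G \<and> (\<forall>v. w \<sqsubseteq> v \<longrightarrow> (\<forall>u. v \<sqsubseteq> u \<longrightarrow> (\<forall>g. mem u \<rho> g G \<longrightarrow> P' u [g])) \<longrightarrow> Q v [])"
  proof (rule HGMP_w[OF w P' Q])
    fix v assume v: "w \<sqsubseteq> v" and a: "\<forall>u. v \<sqsubseteq> u \<longrightarrow> (\<forall>g. std u \<rho> g \<longrightarrow> P' u [g])"
    show "Q v []" by (rule prem[OF v]) (use a eq[OF v] in blast)
  qed
  then obtain G where G: "std w (Seq \<rho>) G" "\<And>v. w \<sqsubseteq> v \<Longrightarrow> (\<forall>u. v \<sqsubseteq> u \<longrightarrow> (\<forall>g. mem u \<rho> g G \<longrightarrow> P' u [g])) \<Longrightarrow> Q v []" by blast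
  obtain ss where ss: "stds w (map Seq \<sigma>s) ss" "\<And>v. w \<sqsubseteq> v \<Longrightarrow>
      (\<forall>u. v \<sqsubseteq> u \<longrightarrow> (\<forall>xs. mems u \<sigma>s xs ss \<longrightarrow> P u xs)) \<Longrightarrow> (\<forall>u. v \<sqsubseteq> u \<longrightarrow> (\<forall>g. mem u \<rho> g G \<longrightarrow> P' u [g]))"
    using fin[OF G(1)] by blast
  show ?thesis
  proof (intro exI[of _ ss] conjI allI impI ss(1))
    fix v assume v: "w \<sqsubseteq> v" and a: "\<forall>u. v \<sqsubseteq> u \<longrightarrow> (\<forall>xs. mems u \<sigma>s xs ss \<longrightarrow> P u xs)"
    show "Q v []" by (rule G(2)[OF v ss(2)[OF v a]])
  qed
qed

subsection \<open>Bounded quantifiers distribute over disjunctions\<close>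

text \<open>Intuitionistically an arbitrary universal quantifier does not distribute over such a
  disjunction. A quantifier bounded by a finite sequence does, by induction on the sequence: either
  \<open>Q\<close> holds, or \<open>P\<close> holds of every entry met so far.\<close>

lemma finite_disj_1:
  assumes w: "world w" and P: "dfn True w [\<sigma>] P" and Q: "dfn True w [] Q" and s: "elt w (Seq \<sigma>) s"
    and prem: "\<And>v x. w \<sqsubseteq> v \<Longrightarrow> mem v \<sigma> x s \<Longrightarrow> P v [x] \<or> Q v []"
  shows "(\<forall>v. w \<sqsubseteq> v \<longrightarrow> (\<forall>x. mem v \<sigma> x s \<longrightarrow> P v [x])) \<or> Q w []"
proof -
  obtain \<Gamma> e \<phi> \<psi> where d: "defined_by \<Gamma> e \<phi> w [\<sigma>] P" "defined_by \<Gamma> e \<psi> w [] Q" and i: "internal \<phi>" "internal \<psi>"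
    using dfn_common[OF P Q] by metis
  from defined_by_1[OF d(1)] have wf: "wff (\<sigma> # \<Gamma>) \<phi>" and e: "envs w \<Gamma> e"
    and semP: "\<And>v x. w \<sqsubseteq> v \<Longrightarrow> elt v \<sigma> x \<Longrightarrow> fc v (\<sigma> # \<Gamma>) (x ## e) \<phi> \<longleftrightarrow> P v [x]" by auto
  from defined_by_0[OF d(2)] have wf': "wff \<Gamma> \<psi>"
    and semQ: "\<And>v. w \<sqsubseteq> v \<Longrightarrow> fc v \<Gamma> e \<psi> \<longleftrightarrow> Q v []" by auto
  let ?P = "inst 2 [Var 0] \<phi>" and ?Q = "inst 1 [] \<psi>"
  \<comment> \<open>The hypothesis belongs to the induction formula, because the induction varies
    the sequence that bounds it.\<close>
  let ?\<chi> = "Imp (BAll \<sigma> (Var 0) (Or ?P (inst 1 [] ?Q))) (Or (BAll \<sigma> (Var 0) ?P) ?Q)"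
  have wfs: "wff (\<sigma> # Seq \<sigma> # \<Gamma>) ?P" "wff (Seq \<sigma> # \<Gamma>) ?Q" "wff (\<sigma> # Seq \<sigma> # \<Gamma>) (inst 1 [] ?Q)"
    using wf wf' by (auto simp: wff_inst_2 wff_inst_1_Nil)
  have B1: "fc v (Seq \<sigma> # \<Gamma>) (s ## e) (BAll \<sigma> (Var 0) ?P) \<longleftrightarrow> (\<forall>u. v \<sqsubseteq> u \<longrightarrow> (\<forall>x. mem u \<sigma> x s \<longrightarrow> P u [x]))"
    if v: "w \<sqsubseteq> v" "elt v (Seq \<sigma>) s" for v s
  proof -
    have "P u [x] \<longleftrightarrow> fc u (\<sigma> # Seq \<sigma> # \<Gamma>) (x ## s ## e) ?P" if "v \<sqsubseteq> u" "mem u \<sigma> x s" for u x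
      using semP[OF wle_trans[OF v(1) that(1)] mem_elt(1)[OF wle_world[OF that(1)] that(2)]]
      by (simp add: fc_inst_2[of _ _ _ _ _ _ "\<sigma> # \<Gamma>"])
    then show ?thesis using v wfs envs_mono[OF e v(1)] wle_world[OF v(1)] by (subst fc_BAll) auto
  qed
  have B2: "fc v (Seq \<sigma> # \<Gamma>) (s ## e) (BAll \<sigma> (Var 0) (Or ?P (inst 1 [] ?Q))) \<longleftrightarrow> (\<forall>u. v \<sqsubseteq> u \<longrightarrow> (\<forall>x. mem u \<sigma> x s \<longrightarrow> P u [x] \<or> Q u []))"
    if v: "w \<sqsubseteq> v" "elt v (Seq \<sigma>) s" for v s
  proof -
    have "fc u (\<sigma> # Seq \<sigma> # \<Gamma>) (x ## s ## e) (Or ?P (inst 1 [] ?Q)) \<longleftrightarrow> P u [x] \<or> Q u []" if u: "v \<sqsubseteq> u" "mem u \<sigma> x s" for u x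
    proof -
      note wu = wle_world[OF u(1)] and vu = wle_trans[OF v(1) u(1)] and x = mem_elt[OF wle_world[OF u(1)] u(2)]
      have "fc u (\<sigma> # Seq \<sigma> # \<Gamma>) (x ## s ## e) (Or ?P (inst 1 [] ?Q)) \<longleftrightarrow>
          fc u (\<sigma> # Seq \<sigma> # \<Gamma>) (x ## s ## e) ?P \<or> fc u (\<sigma> # Seq \<sigma> # \<Gamma>) (x ## s ## e) (inst 1 [] ?Q)"
        using wu wfs x envs_mono[OF e vu] by (subst fc_Or) auto
      then show ?thesis
        using semP[OF vu x(1)] semQ[OF vu]
        by (simp add: fc_inst_2[of _ _ _ _ _ _ "\<sigma> # \<Gamma>"] fc_inst_1_Nil[of _ _ _ "s ## e" _ "Seq \<sigma> # \<Gamma>"] fc_inst_1_Nil[of _ _ _ e _ \<Gamma>])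
    qed
    then show ?thesis using v wfs envs_mono[OF e v(1)] wle_world[OF v(1)] by (subst fc_BAll) auto
  qed
  have sem: "fc v (Seq \<sigma> # \<Gamma>) (s ## e) ?\<chi> \<longleftrightarrow> (\<forall>u. v \<sqsubseteq> u \<longrightarrow> (\<forall>u'. u \<sqsubseteq> u' \<longrightarrow> (\<forall>x. mem u' \<sigma> x s \<longrightarrow> P u' [x] \<or> Q u' [])) \<longrightarrow>
      (\<forall>u'. u \<sqsubseteq> u' \<longrightarrow> (\<forall>x. mem u' \<sigma> x s \<longrightarrow> P u' [x])) \<or> Q u [])"
    if v: "w \<sqsubseteq> v" "elt v (Seq \<sigma>) s" for v s
  proof -
    have ws: "wff (Seq \<sigma> # \<Gamma>) (BAll \<sigma> (Var 0) (Or ?P (inst 1 [] ?Q)))" "wff (Seq \<sigma> # \<Gamma>) (BAll \<sigma> (Var 0) ?P)"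
      using wfs by (auto intro!: wff_BAll)
    have O: "fc u (Seq \<sigma> # \<Gamma>) (s ## e) (Or (BAll \<sigma> (Var 0) ?P) ?Q) \<longleftrightarrow> (\<forall>u'. u \<sqsubseteq> u' \<longrightarrow> (\<forall>x. mem u' \<sigma> x s \<longrightarrow> P u' [x])) \<or> Q u []"
      if u: "v \<sqsubseteq> u" for u
    proof -
      note vu = wle_trans[OF v(1) u] and wu = wle_world[OF u]
      have "fc u (Seq \<sigma> # \<Gamma>) (s ## e) (Or (BAll \<sigma> (Var 0) ?P) ?Q) \<longleftrightarrow> fc u (Seq \<sigma> # \<Gamma>) (s ## e) (BAll \<sigma> (Var 0) ?P) \<or> fc u (Seq \<sigma> # \<Gamma>) (s ## e) ?Q"
        using wu ws wfs elt_mono[OF v(2) u] envs_mono[OF e vu] by (subst fc_Or) auto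
      then show ?thesis using B1[OF vu elt_mono[OF v(2) u]] semQ[OF vu] by (simp add: fc_inst_1_Nil[of _ _ _ _ _ \<Gamma>])
    qed
    have "fc v (Seq \<sigma> # \<Gamma>) (s ## e) ?\<chi> \<longleftrightarrow> (\<forall>u. v \<sqsubseteq> u \<longrightarrow> fc u (Seq \<sigma> # \<Gamma>) (s ## e) (BAll \<sigma> (Var 0) (Or ?P (inst 1 [] ?Q))) \<longrightarrow>
        fc u (Seq \<sigma> # \<Gamma>) (s ## e) (Or (BAll \<sigma> (Var 0) ?P) ?Q))"
      using wle_world[OF v(1)] ws wfs v envs_mono[OF e v(1)] by (intro fc_Imp) auto
    then show ?thesis using O B2[OF wle_trans[OF v(1)] elt_mono[OF v(2)]] by blast
  qed
  have "fc w (Seq \<sigma> # \<Gamma>) (s ## e) ?\<chi>"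
  proof (rule seq_induct_w[OF _ _ w e s])
    show "fc w (Seq \<sigma> # \<Gamma>) (Emp \<sigma> ## e) ?\<chi>"
      unfolding sem[OF wle_refl[OF w] elt_const(3)] using not_mem_Emp[OF wle_world] by blast
  next
    fix v a s assume v: "w \<sqsubseteq> v" and a: "elt v \<sigma> a" "elt v (Seq \<sigma>) s" and ih: "fc v (Seq \<sigma> # \<Gamma>) (s ## e) ?\<chi>"
    show "fc v (Seq \<sigma> # \<Gamma>) (Prep \<sigma> \<cdot> a \<cdot> s ## e) ?\<chi>"
      unfolding sem[OF v elt_Prep[OF a]]
    proof (intro allI impI)
      fix u assume u: "v \<sqsubseteq> u" and or: "\<forall>u'. u \<sqsubseteq> u' \<longrightarrow> (\<forall>x. mem u' \<sigma> x (Prep \<sigma> \<cdot> a \<cdot> s) \<longrightarrow> P u' [x] \<or> Q u' [])"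
      have mP: "mem u' \<sigma> x (Prep \<sigma> \<cdot> a \<cdot> s) \<longleftrightarrow> eqw u' \<sigma> x a \<or> mem u' \<sigma> x s" if "u \<sqsubseteq> u'" for u' x
        using mem_Prep[OF wle_world[OF that] elt_mono[OF a(1) wle_trans[OF u that]] elt_mono[OF a(2) wle_trans[OF u that]]] .
      have ae: "eqw u \<sigma> a a" using eqw_refl[OF wle_world[OF u] elt_mono[OF a(1) u]] .
      have "(\<forall>u'. u \<sqsubseteq> u' \<longrightarrow> (\<forall>x. mem u' \<sigma> x s \<longrightarrow> P u' [x])) \<or> Q u []"
        using ih[unfolded sem[OF v a(2)], rule_format, OF u] or mP by blast
      moreover have "P u [a] \<or> Q u []" using or mP[OF wle_refl[OF wle_world[OF u]]] ae wle_refl[OF wle_world[OF u]] by blast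
      moreover have "P u' [x]" if "P u [a]" "u \<sqsubseteq> u'" "eqw u' \<sigma> x a" for u' x
      proof -
        have "P u' [a]" using dfn_persist[OF P wle_trans[OF v u], of "[a]" u'] that elt_mono[OF a(1) u] by simp
        moreover have "eqs u' [\<sigma>] [a] [x]" using eq_sym[OF wle_world[OF that(2)] that(3)] by simp
        ultimately show ?thesis using dfn_eqs[OF P wle_trans[OF wle_trans[OF v u] that(2)]] by blast
      qed
      ultimately show "(\<forall>u'. u \<sqsubseteq> u' \<longrightarrow> (\<forall>x. mem u' \<sigma> x (Prep \<sigma> \<cdot> a \<cdot> s) \<longrightarrow> P u' [x])) \<or> Q u []"
        using mP by blast
    qed
  qed (use wfs i in \<open>auto intro!: wff_BAll\<close>)
  then show ?thesis unfolding sem[OF wle_refl[OF w] s] using wle_refl[OF w] prem by blast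
qed

text \<open>For an entry of the first sequence the induction hypothesis, used at a later world,
  decides between \<open>Q\<close> and \<open>P\<close> for all remaining components; then the first
  bounded quantifier is distributed.\<close>

lemma finite_disj:
  "world w \<Longrightarrow> dfn True w \<sigma>s P \<Longrightarrow> dfn True w [] Q \<Longrightarrow> els w (map Seq \<sigma>s) ss \<Longrightarrow>
    (\<And>v xs. w \<sqsubseteq> v \<Longrightarrow> mems v \<sigma>s xs ss \<Longrightarrow> P v xs \<or> Q v []) \<Longrightarrow>
    (\<forall>v. w \<sqsubseteq> v \<longrightarrow> (\<forall>xs. mems v \<sigma>s xs ss \<longrightarrow> P v xs)) \<or> Q w []"
proof (induction \<sigma>s arbitrary: w P ss)
  case Nil
  have "P w [] \<or> Q w []" using Nil.prems(5)[of w "[]"] Nil.prems(1,4) wle_refl by simp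
  moreover have "mems v [] xs ss \<Longrightarrow> xs = []" for v xs using mems_length[of v "[]"] by auto
  ultimately show ?case using dfn_persist[OF Nil.prems(2) wle_refl[OF Nil.prems(1)], of "[]"] by auto
next
  case (Cons \<sigma> \<sigma>s)
  note w = Cons.prems(1)
  obtain s ss' where ss: "ss = s # ss'" "elt w (Seq \<sigma>) s" "els w (map Seq \<sigma>s) ss'" using Cons.prems(4) by (auto simp: list_all2_Cons1)
  let ?P = "\<lambda>v ts. \<forall>u. v \<sqsubseteq> u \<longrightarrow> (\<forall>ys. mems u \<sigma>s ys ss' \<longrightarrow> P u (ts @ ys))"
  have P': "dfn True w [\<sigma>] ?P" by (rule dfn_BAlls[OF _ defts_const[OF ss(3)]]) (use Cons.prems(2) in simp)
  have "(\<forall>v. w \<sqsubseteq> v \<longrightarrow> (\<forall>x. mem v \<sigma> x s \<longrightarrow> ?P v [x])) \<or> Q w []"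
  proof (rule finite_disj_1[OF w P' Cons.prems(3) ss(2)])
    fix v x assume v: "w \<sqsubseteq> v" and x: "mem v \<sigma> x s"
    note wv = wle_world[OF v] and xe = mem_elt(1)[OF wle_world[OF v] x]
    have "defts v \<sigma>s ([\<sigma>] @ \<sigma>s) (\<lambda>ts. [x] @ ts)"
      by (rule defts_append[OF defts_const defts_args[OF wv]]) (simp add: xe)
    from dfn_comp[OF _ this, of True P] have Px: "dfn True v \<sigma>s (\<lambda>v ts. P v (x # ts))" using dfn_mono[OF Cons.prems(2) v] by simp
    have "(\<forall>u. v \<sqsubseteq> u \<longrightarrow> (\<forall>ys. mems u \<sigma>s ys ss' \<longrightarrow> P u (x # ys))) \<or> Q v []"
    proof (rule Cons.IH[OF wv Px dfn_mono[OF Cons.prems(3) v] els_mono[OF ss(3) v]])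
      fix u ys assume u: "v \<sqsubseteq> u" "mems u \<sigma>s ys ss'"
      show "P u (x # ys) \<or> Q u []"
        using Cons.prems(5)[OF wle_trans[OF v u(1)], of "x # ys"] u(2) tr_mono[OF x u(1)] ss(1) by simp
    qed
    then show "?P v [x] \<or> Q v []" by simp
  qed
  then show ?case unfolding ss(1) mems_Cons using wle_refl[OF wle_world] by fastforce
qed

section \<open>The matrix of the interpretation\<close>

text \<open>The \<open>k\<close>-fold iterate of \<open>up\<close> in closed form.\<close>

definition upn :: "nat \<Rightarrow> (nat \<Rightarrow> tm) \<Rightarrow> nat \<Rightarrow> tm" where
  "upn k e i = (if i < k then Var i else lift k (e (i - k)))"

lemma upn_add [simp]: "upn k e (i + k) = lift k (e i)" by (simp add: upn_def)

lemma sub_scons_up: "sub (z ## Var) (up e i) = (z ## e) i"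
  by (cases i) simp_all

lemma upn_0 [simp]: "upn 0 e = e" by (simp add: upn_def fun_eq_iff)
lemma upn_Suc: "upn k (up e) = upn (Suc k) e"
proof
  fix i show "upn k (up e) i = upn (Suc k) e i"
  proof (cases "i < k")
    case False
    then obtain j where "i = j + k" by (metis add.commute le_Suc_ex not_less)
    then show ?thesis by (cases j) (simp_all add: upn_def)
  qed (simp add: upn_def)
qed

lemma sub_upn_lift [simp]: "sub (upn k s) (lift k t) = lift k (sub s t)"
  by (simp add: upn_def lift_sub)

lemma length_vars [simp]: "length (vars k) = k" by (simp add: vars_def)

lemma map_sub_upn_vars [simp]: "map (sub (upn k s)) (vars k) = vars k"
  by (auto simp: vars_def upn_def)

lemma fsub_BAlls: "length ss = length \<tau>s \<Longrightarrow> fsub s (BAlls \<tau>s ss \<Phi>) = BAlls \<tau>s (map (sub s) ss) (fsub (upn (length \<tau>s) s) \<Phi>)"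
proof (induction \<tau>s arbitrary: ss s)
  case (Cons \<tau> \<tau>s)
  then obtain t ts where "ss = t # ts" by (cases ss) auto
  then show ?case using Cons by (simp add: upn_Suc lift_sub comp_def)
qed simp

text \<open>Shared by the clauses for \<open>Ex\<close> and \<open>ExSt\<close>, which have the same
  bounded body under one binder.\<close>

lemma fsub_bounded:
  assumes IH: "\<And>s e xs ys. length xs = length (Dx \<Phi>) \<Longrightarrow> length ys = length (Dy \<Phi>) \<Longrightarrow>
      fsub s (Dm \<Phi> e xs ys) = Dm \<Phi> (\<lambda>i. sub s (e i)) (map (sub s) xs) (map (sub s) ys)"
    and l: "length xs = length (Dx \<Phi>)" "length yss = length (Dy \<Phi>)" "k = length (Dy \<Phi>)"
  shows "fsub (up s) (BAlls (Dy \<Phi>) (map (lift 1) yss) (Dm \<Phi> (\<lambda>i. lift k (up e i)) (map (lift (k + 1)) xs) (vars k)))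
    = BAlls (Dy \<Phi>) (map (lift 1) (map (sub s) yss))
        (Dm \<Phi> (\<lambda>i. lift k (up (\<lambda>i. sub s (e i)) i)) (map (lift (k + 1)) (map (sub s) xs)) (vars k))"
proof -
  have 1: "map (sub (up s)) (map (lift 1) yss) = map (lift 1) (map (sub s) yss)"
    by (simp add: comp_def lift_sub)
  have 2: "sub (upn k (up s)) (lift k (up e i)) = lift k (up (\<lambda>i. sub s (e i)) i)" for i
    using fun_cong[OF up_comp[of s e], of i] by (simp only: sub_upn_lift)
  have 3: "sub (upn k (up s)) (lift (k + 1) t) = lift (k + 1) (sub s t)" for t
  proof -
    have "sub (upn k (up s)) (lift k (lift 1 t)) = lift k (lift 1 (sub s t))"
      unfolding sub_upn_lift sub_up_lift ..
    then show ?thesis by (simp only: lift_lift add.commute[of 1])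
  qed
  have 4: "map (sub (upn k (up s))) (map (lift (k + 1)) xs) = map (lift (k + 1)) (map (sub s) xs)"
    by (simp only: map_map comp_def 3)
  have "fsub (up s) (BAlls (Dy \<Phi>) (map (lift 1) yss) (Dm \<Phi> (\<lambda>i. lift k (up e i)) (map (lift (k + 1)) xs) (vars k)))
    = BAlls (Dy \<Phi>) (map (sub (up s)) (map (lift 1) yss)) (fsub (upn k (up s)) (Dm \<Phi> (\<lambda>i. lift k (up e i)) (map (lift (k + 1)) xs) (vars k)))"
    using l by (subst fsub_BAlls) simp_all
  also have "fsub (upn k (up s)) (Dm \<Phi> (\<lambda>i. lift k (up e i)) (map (lift (k + 1)) xs) (vars k)) =
      Dm \<Phi> (\<lambda>i. lift k (up (\<lambda>i. sub s (e i)) i)) (map (lift (k + 1)) (map (sub s) xs)) (vars k)"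
  proof -
    have "fsub (upn k (up s)) (Dm \<Phi> (\<lambda>i. lift k (up e i)) (map (lift (k + 1)) xs) (vars k)) =
        Dm \<Phi> (\<lambda>i. sub (upn k (up s)) (lift k (up e i))) (map (sub (upn k (up s))) (map (lift (k + 1)) xs)) (map (sub (upn k (up s))) (vars k))"
      by (rule IH) (simp_all add: l)
    then show ?thesis unfolding 2 4 map_sub_upn_vars .
  qed
  finally show ?thesis unfolding 1 .
qed

text \<open>As the matrix takes its variables as arguments, a substitution only acts on the
  environment and on these arguments. The length conditions ensure that the argument lists are split
  at the intended places.\<close>

lemma fsub_Dm:
  "length xs = length (Dx \<Phi>) \<Longrightarrow> length ys = length (Dy \<Phi>) \<Longrightarrow>
    fsub s (Dm \<Phi> e xs ys) = Dm \<Phi> (\<lambda>i. sub s (e i)) (map (sub s) xs) (map (sub s) ys)"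
proof (induction \<Phi> arbitrary: s e xs ys)
  case (Eq \<sigma> t u)
  then show ?case by (simp add: sub_sub)
next
  case (St \<sigma> t)
  then show ?case by (cases xs) (auto simp: sub_sub)
next
  case (And \<Phi> \<Psi>)
  then show ?case by (simp add: Let_def take_map drop_map)
next
  case (Or \<Phi> \<Psi>)
  then show ?case by (simp add: Let_def take_map drop_map)
next
  case (Imp \<Phi> \<Psi>)
  have "map (sub s) (map2 (\<lambda>\<rho> Y. sapps A \<rho> Y us) L Ys) = map2 (\<lambda>\<rho> Y. sapps A \<rho> Y (map (sub s) us)) L (map (sub s) Ys)" for A us L Ys
    by (simp add: zip_map2 case_prod_unfold comp_def)
  moreover have "map (sub s) (take n ys) @ map (sub s) (drop n ys) = map (sub s) ys" for n by (simp flip: map_append)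
  ultimately show ?case using Imp by (simp add: Let_def take_map drop_map fsub_BAlls) (simp add: comp_def lift_sub)
next
  case (All \<sigma> \<Phi>)
  then show ?case by (simp add: comp_def up_comp lift_sub)
next
  case (Ex \<sigma> \<Phi>)
  then have "length xs = length (Dx \<Phi>)" "length ys = length (Dy \<Phi>)" by simp_all
  then show ?case unfolding Dm.simps Let_def fsub.simps by (subst fsub_bounded[OF Ex.IH]) (rule refl | assumption)+
next
  case (AllSt \<sigma> \<Phi>)
  from AllSt.prems(2) obtain z ys' where "ys = z # ys'" by (cases ys) auto
  moreover have "(\<lambda>i. sub s ((z ## e) i)) = sub s z ## (\<lambda>i. sub s (e i))" for z by (auto split: nat.split)
  ultimately show ?case using AllSt by (simp add: zip_map2 case_prod_unfold comp_def Let_def)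
next
  case (ExSt \<sigma> \<Phi>)
  have ne: "xs \<noteq> []" using ExSt.prems(1) by auto
  have "length (butlast xs) = length (Dx \<Phi>)" "length ys = length (Dy \<Phi>)" using ExSt.prems by simp_all
  note fsub_bounded[OF ExSt.IH this refl]
  then show ?case unfolding Dm.simps Let_def by (simp only: fsub_BEx last_map[OF ne] map_butlast)
qed simp

lemma internal_BAlls [simp]: "internal (BAlls \<tau>s ss \<Phi>) = internal \<Phi>"
  by (induction \<tau>s ss \<Phi> rule: BAlls.induct) auto

lemma internal_Dm: "internal (Dm \<Phi> e xs ys)"
  by (induction \<Phi> arbitrary: e xs ys) (simp_all add: Let_def)

lemma wtenv_lift: "wtenv \<Delta> e \<Gamma> \<Longrightarrow> length \<tau>s = k \<Longrightarrow> wtenv (\<tau>s @ \<Delta>) (\<lambda>i. lift k (e i)) \<Gamma>"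
  by (auto simp: wtenv_def intro: wt_lift)

lemma list_all2_wt_lift: "list_all2 (wt \<Delta>) ts \<sigma>s \<Longrightarrow> length \<tau>s = k \<Longrightarrow> list_all2 (wt (\<tau>s @ \<Delta>)) (map (lift k) ts) \<sigma>s"
  by (auto simp: list_all2_conv_all_nth intro: wt_lift)

lemma list_all2_vars: "list_all2 (wt (rev \<tau>s @ \<Delta>)) (vars (length \<tau>s)) \<tau>s"
  by (auto simp: list_all2_conv_all_nth vars_def rev_nth nth_append)

lemma wff_BAlls': "list_all2 (wt \<Gamma>) ss (map Seq \<tau>s) \<Longrightarrow> wff (rev \<tau>s @ \<Gamma>) \<Phi> \<Longrightarrow> wff \<Gamma> (BAlls \<tau>s ss \<Phi>)"
  by (rule wff_BAlls) (auto simp: list_all2_conv_all_nth)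

lemma list_all2_sapps:
  "list_all2 (wt \<Delta>) Us (map (\<lambda>\<tau>. Seq (fty \<rho>s \<tau>)) \<tau>s) \<Longrightarrow> list_all2 (wt \<Delta>) xs \<rho>s \<Longrightarrow> list_all2 (wt \<Delta>) (sapp_all \<rho>s \<tau>s Us xs) (map Seq \<tau>s)"
  by (auto simp: list_all2_conv_all_nth intro!: wt_sapps)

lemma wff_Dm:
  "wff \<Gamma> \<Phi> \<Longrightarrow> wtenv \<Delta> e \<Gamma> \<Longrightarrow> list_all2 (wt \<Delta>) xs (map Seq (Dx \<Phi>)) \<Longrightarrow> list_all2 (wt \<Delta>) ys (Dy \<Phi>) \<Longrightarrow>
    wff \<Delta> (Dm \<Phi> e xs ys)"
proof (induction \<Phi> arbitrary: \<Gamma> \<Delta> e xs ys)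
  case (Eq \<sigma> t u)
  then show ?case by (auto intro: wt_sub)
next
  case (St \<sigma> t)
  then show ?case by (auto simp: list_all2_Cons2 intro!: wff_In intro: wt_sub)
next
  case (And \<Phi> \<Psi>)
  from And.prems(3,4) obtain x1 x2 y1 y2 where "xs = x1 @ x2" "ys = y1 @ y2" "list_all2 (wt \<Delta>) x1 (map Seq (Dx \<Phi>))"
    "list_all2 (wt \<Delta>) x2 (map Seq (Dx \<Psi>))" "list_all2 (wt \<Delta>) y1 (Dy \<Phi>)" "list_all2 (wt \<Delta>) y2 (Dy \<Psi>)"
    by (auto simp: list_all2_append2)
  moreover from this have "length x1 = length (Dx \<Phi>)" "length y1 = length (Dy \<Phi>)" by (auto dest: list_all2_lengthD)
  ultimately show ?case using And.IH(1)[of \<Gamma> \<Delta> e x1 y1] And.IH(2)[of \<Gamma> \<Delta> e x2 y2] And.prems(1,2) by (simp add: Let_def)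
next
  case (Or \<Phi> \<Psi>)
  from Or.prems(3,4) obtain x1 x2 y1 y2 where "xs = x1 @ x2" "ys = y1 @ y2" "list_all2 (wt \<Delta>) x1 (map Seq (Dx \<Phi>))"
    "list_all2 (wt \<Delta>) x2 (map Seq (Dx \<Psi>))" "list_all2 (wt \<Delta>) y1 (Dy \<Phi>)" "list_all2 (wt \<Delta>) y2 (Dy \<Psi>)"
    by (auto simp: list_all2_append2)
  moreover from this have "length x1 = length (Dx \<Phi>)" "length y1 = length (Dy \<Phi>)" by (auto dest: list_all2_lengthD)
  ultimately show ?case using Or.IH(1)[of \<Gamma> \<Delta> e x1 y1] Or.IH(2)[of \<Gamma> \<Delta> e x2 y2] Or.prems(1,2) by (simp add: Let_def)
next
  case (Imp \<Phi> \<Psi>)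
  let ?A = "map Seq (Dx \<Phi>)"
  from Imp.prems(3,4) obtain U Y x v where s: "xs = U @ Y" "ys = x @ v"
    "list_all2 (wt \<Delta>) U (map (\<lambda>\<tau>. Seq (fty ?A \<tau>)) (Dx \<Psi>))"
    "list_all2 (wt \<Delta>) Y (map (\<lambda>\<tau>. Seq (fty (?A @ Dy \<Psi>) \<tau>)) (Dy \<Phi>))" "list_all2 (wt \<Delta>) x ?A" "list_all2 (wt \<Delta>) v (Dy \<Psi>)"
    by (auto simp: list_all2_append2 comp_def)
  have l: "length U = length (Dx \<Psi>)" "length x = length (Dx \<Phi>)" using s by (auto dest: list_all2_lengthD)
  have 1: "wff (rev (Dy \<Phi>) @ \<Delta>) (Dm \<Phi> (\<lambda>i. lift (length (Dy \<Phi>)) (e i)) (map (lift (length (Dy \<Phi>))) x) (vars (length (Dy \<Phi>))))"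
    using Imp.prems(1,2) s(5) by (intro Imp.IH(1)[of \<Gamma>] wtenv_lift list_all2_wt_lift list_all2_vars) auto
  have 2: "wff \<Delta> (BAlls (Dy \<Phi>) (sapp_all (?A @ Dy \<Psi>) (Dy \<Phi>) Y (x @ v)) (Dm \<Phi> (\<lambda>i. lift (length (Dy \<Phi>)) (e i)) (map (lift (length (Dy \<Phi>))) x) (vars (length (Dy \<Phi>)))))"
    using s(4,5,6) by (intro wff_BAlls' 1 list_all2_sapps list_all2_appendI)
  have 3: "wff \<Delta> (Dm \<Psi> e (sapp_all ?A (Dx \<Psi>) U x) v)"
    using Imp.prems(1,2) s(3,5,6) by (intro Imp.IH(2)[of \<Gamma>] list_all2_sapps) auto
  show ?case using 2 3 l by (simp add: s(1,2) Let_def)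
next
  case (All \<sigma> \<Phi>)
  have "list_all2 (wt (\<sigma> # \<Delta>)) (map (lift 1) xs) (map Seq (Dx \<Phi>))" "list_all2 (wt (\<sigma> # \<Delta>)) (map (lift 1) ys) (Dy \<Phi>)"
    using list_all2_wt_lift[of \<Delta> _ _ "[\<sigma>]" 1] All.prems(3,4) by auto
  from All.IH[OF _ wtenv_up[OF All.prems(2)] this] show ?case using All.prems(1) by simp
next
  case (Ex \<sigma> \<Phi>)
  let ?k = "length (Dy \<Phi>)"
  have e: "wtenv (rev (Dy \<Phi>) @ \<sigma> # \<Delta>) (\<lambda>i. lift ?k (up e i)) (\<sigma> # \<Gamma>)" using wtenv_lift[OF wtenv_up[OF Ex.prems(2)]] by simp
  have x: "list_all2 (wt (rev (Dy \<Phi>) @ \<sigma> # \<Delta>)) (map (lift (Suc ?k)) xs) (map Seq (Dx \<Phi>))"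
    using list_all2_wt_lift[OF Ex.prems(3), of "rev (Dy \<Phi>) @ [\<sigma>]" "Suc ?k"] by simp
  have y: "list_all2 (wt (\<sigma> # \<Delta>)) (map (lift 1) ys) (map Seq (Dy \<Phi>))" using list_all2_wt_lift[OF Ex.prems(4), of "[\<sigma>]" 1] by simp
  show ?case using wff_BAlls'[OF y Ex.IH[OF _ e x list_all2_vars]] Ex.prems(1) by (simp add: Let_def)
next
  case (AllSt \<sigma> \<Phi>)
  from AllSt.prems(4) obtain z v where s: "ys = z # v" "wt \<Delta> z \<sigma>" "list_all2 (wt \<Delta>) v (Dy \<Phi>)" by (auto simp: list_all2_Cons2)
  have "list_all2 (wt \<Delta>) (sapp_all [\<sigma>] (Dx \<Phi>) xs [z]) (map Seq (Dx \<Phi>))"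
    using AllSt.prems(3) s(2) by (intro list_all2_sapps) (auto simp: comp_def)
  then show ?case using AllSt.IH[OF _ wtenv_scons[OF s(2) AllSt.prems(2)] _ s(3)] AllSt.prems(1) by (simp add: s(1))
next
  case (ExSt \<sigma> \<Phi>)
  let ?k = "length (Dy \<Phi>)"
  from ExSt.prems(3) obtain x z where s: "xs = x @ [z]" "list_all2 (wt \<Delta>) x (map Seq (Dx \<Phi>))" "wt \<Delta> z (Seq \<sigma>)"
    by (auto simp: list_all2_append2 list_all2_Cons2)
  have e: "wtenv (rev (Dy \<Phi>) @ \<sigma> # \<Delta>) (\<lambda>i. lift ?k (up e i)) (\<sigma> # \<Gamma>)" using wtenv_lift[OF wtenv_up[OF ExSt.prems(2)]] by simp
  have x: "list_all2 (wt (rev (Dy \<Phi>) @ \<sigma> # \<Delta>)) (map (lift (Suc ?k)) x) (map Seq (Dx \<Phi>))"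
    using list_all2_wt_lift[OF s(2), of "rev (Dy \<Phi>) @ [\<sigma>]" "Suc ?k"] by simp
  have y: "list_all2 (wt (\<sigma> # \<Delta>)) (map (lift 1) ys) (map Seq (Dy \<Phi>))" using list_all2_wt_lift[OF ExSt.prems(4), of "[\<sigma>]" 1] by simp
  show ?case using wff_BEx[OF s(3) wff_BAlls'[OF y ExSt.IH[OF _ e x list_all2_vars]]] ExSt.prems(1) by (simp add: Let_def s(1))
qed simp

subsection \<open>Truth of the matrix\<close>

text \<open>The matrix at given elements is an instance of the matrix at variables, under an
  environment that lists the elements and continues with \<open>e\<close>; well-formedness of the
  open version carries over.\<close>

lemma Form_Dm:
  assumes "wff \<Gamma> \<Phi>" "envs w \<Gamma> e" "els w (map Seq (Dx \<Phi>)) xs" "els w (Dy \<Phi>) ys"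
  shows "Form (lvl w) (Dm \<Phi> e xs ys)"
proof -
  let ?m = "length (Dx \<Phi>)" and ?n = "length (Dy \<Phi>)"
  have l: "length xs = ?m" "length ys = ?n" using assms(3,4) by (auto dest: list_all2_lengthD)
  let ?\<Delta> = "map Seq (Dx \<Phi>) @ Dy \<Phi> @ \<Gamma>"
  let ?X = "map Var [0..<?m]" and ?Y = "map (\<lambda>i. Var (i + ?m)) [0..<?n]"
  let ?E = "eapp ?m (\<lambda>i. xs ! i) (eapp ?n (\<lambda>i. ys ! i) e)"
  have "envs w (map Seq (Dx \<Phi>)) (\<lambda>i. xs ! i)" "envs w (Dy \<Phi>) (\<lambda>i. ys ! i)"
    using assms(3,4) by (auto simp: envs_def list_all2_conv_all_nth)
  then have E: "envs w ?\<Delta> ?E" using envs_eapp[OF _ envs_eapp[OF _ assms(2)]] by (metis length_map)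
  have "wff ?\<Delta> (Dm \<Phi> (\<lambda>i. Var (i + (?n + ?m))) ?X ?Y)"
    by (rule wff_Dm[OF assms(1)]) (auto simp: wtenv_def nth_append list_all2_conv_all_nth)
  from Form_fsub[OF this E] have "Form (lvl w) (fsub ?E (Dm \<Phi> (\<lambda>i. Var (i + (?n + ?m))) ?X ?Y))" .
  also have "fsub ?E (Dm \<Phi> (\<lambda>i. Var (i + (?n + ?m))) ?X ?Y) = Dm \<Phi> (\<lambda>i. sub ?E (Var (i + (?n + ?m)))) (map (sub ?E) ?X) (map (sub ?E) ?Y)"
    by (rule fsub_Dm) auto
  also have "map (sub ?E) ?X = xs" by (rule nth_equalityI) (auto simp: l eapp_def)
  also have "map (sub ?E) ?Y = ys" by (rule nth_equalityI) (auto simp: l eapp_def)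
  also have "(\<lambda>i. sub ?E (Var (i + (?n + ?m)))) = e" by (auto simp: eapp_def fun_eq_iff)
  finally show ?thesis .
qed

lemma Form_All_inst: "Form n (All \<sigma> \<Phi>) \<Longrightarrow> Term n \<sigma> t \<Longrightarrow> Form n (inst 0 [t] \<Phi>)"
  by (rule Form_inst) (auto simp: Form_def frm_def)

lemma Form_wle: "Form (lvl w) \<Phi> \<Longrightarrow> w \<sqsubseteq> v \<Longrightarrow> Form (lvl v) \<Phi>"
  unfolding wle_def by (blast intro: Form_mono)

lemma inst_0_In: "inst 0 [x] (In \<sigma> (Var 0) (lift 1 s)) = In \<sigma> x s"
  by (simp add: inst_0_single)

text \<open>A version for formulas already instantiated with terms of the world, where no typing
  context is at hand. The typing conditions are replaced by the condition that the formula belongs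
  to the world's level, and the second part passes this on to the instances.\<close>

lemma tr_BAll:
  assumes w: "world w" and F: "Form (lvl w) (BAll \<sigma> s \<Phi>)"
  shows "tr w (BAll \<sigma> s \<Phi>) \<longleftrightarrow> (\<forall>v. w \<sqsubseteq> v \<longrightarrow> (\<forall>x. mem v \<sigma> x s \<longrightarrow> tr v (inst 0 [x] \<Phi>)))"
    and "w \<sqsubseteq> v \<Longrightarrow> mem v \<sigma> x s \<Longrightarrow> Form (lvl v) (inst 0 [x] \<Phi>)"
proof -
  have eq: "inst 0 [x] (Imp (In \<sigma> (Var 0) (lift 1 s)) \<Phi>) = Imp (In \<sigma> x s) (inst 0 [x] \<Phi>)" for x
    using inst_0_In[of x \<sigma> s] by (simp add: inst_0_single)
  have FF: "Form (lvl v) (In \<sigma> x s)" "Form (lvl v) (inst 0 [x] \<Phi>)" if "w \<sqsubseteq> v" "elt v \<sigma> x" for v x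
    using Form_All_inst[OF Form_wle[OF F that(1), unfolded BAll_def]] that(2) unfolding elt_def eq by auto
  show "Form (lvl v) (inst 0 [x] \<Phi>)" if "w \<sqsubseteq> v" "mem v \<sigma> x s" for v x
    by (rule FF(2)[OF that(1) mem_elt(1)[OF wle_world[OF that(1)] that(2)]])
  have "tr w (BAll \<sigma> s \<Phi>) \<longleftrightarrow> (\<forall>v. w \<sqsubseteq> v \<longrightarrow> (\<forall>x. elt v \<sigma> x \<longrightarrow> tr v (Imp (In \<sigma> x s) (inst 0 [x] \<Phi>))))"
    unfolding BAll_def tr_All[OF w F[unfolded BAll_def]] eq ..
  also have "\<dots> \<longleftrightarrow> (\<forall>v. w \<sqsubseteq> v \<longrightarrow> (\<forall>x. mem v \<sigma> x s \<longrightarrow> tr v (inst 0 [x] \<Phi>)))" (is "?L \<longleftrightarrow> ?R")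
  proof
    assume L: ?L
    show ?R
    proof (intro allI impI)
      fix v x assume v: "w \<sqsubseteq> v" and x: "mem v \<sigma> x s"
      note e = mem_elt(1)[OF wle_world[OF v] x]
      have "tr v (Imp (In \<sigma> x s) (inst 0 [x] \<Phi>))" using L v e by blast
      then show "tr v (inst 0 [x] \<Phi>)"
        using tr_Imp[OF wle_world[OF v] FF[OF v e]] wle_refl[OF wle_world[OF v]] x by blast
    qed
  next
    assume R: ?R
    show ?L
    proof (intro allI impI)
      fix v x assume v: "w \<sqsubseteq> v" and e: "elt v \<sigma> x"
      have "tr u (inst 0 [x] \<Phi>)" if "v \<sqsubseteq> u" "mem u \<sigma> x s" for u
        using R wle_trans[OF v that(1)] that(2) by blast
      then show "tr v (Imp (In \<sigma> x s) (inst 0 [x] \<Phi>))"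
        using tr_Imp[OF wle_world[OF v] FF[OF v e]] by blast
    qed
  qed
  finally show "tr w (BAll \<sigma> s \<Phi>) \<longleftrightarrow> (\<forall>v. w \<sqsubseteq> v \<longrightarrow> (\<forall>x. mem v \<sigma> x s \<longrightarrow> tr v (inst 0 [x] \<Phi>)))" .
qed

lemma pushes_upn: "(\<lambda>i. sub (pushes ts Var) (upn (length ts) (t ## Var) i)) = pushes ts (t ## Var)"
proof
  fix i show "sub (pushes ts Var) (upn (length ts) (t ## Var) i) = pushes ts (t ## Var) i"
  proof (cases "i < length ts")
    case True
    then show ?thesis by (simp add: upn_def pushes_rev)
  next
    case False
    then obtain j where j: "i = j + length ts" by (metis add.commute le_Suc_ex not_less)
    have "(\<lambda>i. pushes ts Var (i + length ts)) = Var" using pushes_ge by (auto simp: fun_eq_iff)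
    then show ?thesis using pushes_ge[of ts "t ## Var" j] by (simp add: upn_def j)
  qed
qed

lemma tr_BAlls:
  "world w \<Longrightarrow> length ss = length \<tau>s \<Longrightarrow> Form (lvl w) (BAlls \<tau>s ss \<Phi>) \<Longrightarrow>
    tr w (BAlls \<tau>s ss \<Phi>) \<longleftrightarrow> (\<forall>v. w \<sqsubseteq> v \<longrightarrow> (\<forall>ys. mems v \<tau>s ys ss \<longrightarrow> tr v (fsub (pushes ys Var) \<Phi>)))"
proof (induction \<tau>s arbitrary: w ss \<Phi>)
  case Nil
  have "mems v [] ys [] \<longleftrightarrow> ys = []" for v ys by (cases ys) auto
  then show ?case using Nil tr_mono wle_refl by auto
next
  case (Cons \<tau> \<tau>s)
  from Cons.prems(2) obtain s ss' where ss: "ss = s # ss'" "length ss' = length \<tau>s" by (cases ss) auto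
  let ?\<Phi> = "\<lambda>x. fsub (upn (length \<tau>s) (x ## Var)) \<Phi>"
  note F = Cons.prems(3)[unfolded ss(1) BAlls.simps]
  have inst: "inst 0 [x] (BAlls \<tau>s (map (lift 1) ss') \<Phi>) = BAlls \<tau>s ss' (?\<Phi> x)" for x
    using ss(2) by (simp add: inst_0_single fsub_BAlls comp_def)
  have ih: "tr v (BAlls \<tau>s ss' (?\<Phi> x)) \<longleftrightarrow> (\<forall>u. v \<sqsubseteq> u \<longrightarrow> (\<forall>ys. mems u \<tau>s ys ss' \<longrightarrow> tr u (fsub (pushes ys (x ## Var)) \<Phi>)))"
    if v: "w \<sqsubseteq> v" "mem v \<tau> x s" for v x
  proof -
    have "fsub (pushes ys Var) (?\<Phi> x) = fsub (pushes ys (x ## Var)) \<Phi>" if "mems u \<tau>s ys ss'" for u ys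
      using pushes_upn[of ys x] mems_length[OF that] by (simp add: fsub_fsub)
    then show ?thesis
      using Cons.IH[OF wle_world[OF v(1)] ss(2) tr_BAll(2)[OF Cons.prems(1) F v, unfolded inst]] by simp
  qed
  have "tr w (BAlls (\<tau> # \<tau>s) ss \<Phi>) \<longleftrightarrow> (\<forall>v. w \<sqsubseteq> v \<longrightarrow> (\<forall>x. mem v \<tau> x s \<longrightarrow> tr v (BAlls \<tau>s ss' (?\<Phi> x))))"
    using tr_BAll(1)[OF Cons.prems(1) F] by (simp only: ss(1) BAlls.simps inst)
  also have "\<dots> \<longleftrightarrow> (\<forall>v. w \<sqsubseteq> v \<longrightarrow> (\<forall>x. mem v \<tau> x s \<longrightarrow> (\<forall>u. v \<sqsubseteq> u \<longrightarrow> (\<forall>ys. mems u \<tau>s ys ss' \<longrightarrow> tr u (fsub (pushes ys (x ## Var)) \<Phi>)))))"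
    using ih by blast
  also have "\<dots> \<longleftrightarrow> (\<forall>v. w \<sqsubseteq> v \<longrightarrow> (\<forall>ys. mems v (\<tau> # \<tau>s) ys ss \<longrightarrow> tr v (fsub (pushes ys Var) \<Phi>)))" (is "?L \<longleftrightarrow> ?R")
  proof
    assume ?L
    then show ?R unfolding ss(1) mems_Cons using wle_refl[OF wle_world] by fastforce
  next
    assume R: ?R
    show ?L
    proof (intro allI impI)
      fix v x u ys assume "w \<sqsubseteq> v" "mem v \<tau> x s" "v \<sqsubseteq> u" "mems u \<tau>s ys ss'"
      then show "tr u (fsub (pushes ys (x ## Var)) \<Phi>)"
        using R[rule_format, of u "x # ys"] wle_trans tr_mono ss(1) by auto
    qed
  qed
  finally show ?case .
qed

lemma map_sub_pushes_vars: "length ys = k \<Longrightarrow> map (sub (pushes ys e)) (vars k) = ys"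
proof (rule nth_equalityI)
  fix i assume l: "length ys = k" and "i < length (map (sub (pushes ys e)) (vars k))"
  then show "map (sub (pushes ys e)) (vars k) ! i = ys ! i"
    using pushes_less[of i ys e] by (simp add: vars_def rev_nth)
qed simp

lemma sub_pushes_lift: "length ys = k \<Longrightarrow> sub (pushes ys e) (lift k t) = sub e t"
proof -
  assume "length ys = k"
  then have "(\<lambda>i. pushes ys e (i + k)) = e" using pushes_ge by (auto simp: fun_eq_iff)
  then show ?thesis by simp
qed

lemma fsub_pushes_Dm:
  "length xs = length (Dx \<Phi>) \<Longrightarrow> length ys = length (Dy \<Phi>) \<Longrightarrow> k = length (Dy \<Phi>) \<Longrightarrow>
    fsub (pushes ys Var) (Dm \<Phi> (\<lambda>i. lift k (e i)) (map (lift k) xs) (vars k)) = Dm \<Phi> e xs ys"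
  by (subst fsub_Dm) (simp_all add: sub_pushes_lift map_sub_pushes_vars comp_def del: sub_lift)

section \<open>Truth conditions for the clauses of the matrix\<close>

lemma dm_And:
  "world w \<Longrightarrow> length xs = length (Dx \<Phi>) \<Longrightarrow> length ys = length (Dy \<Phi>) \<Longrightarrow>
    tr w (Dm (And \<Phi> \<Psi>) e (xs @ us) (ys @ vs)) \<longleftrightarrow> tr w (Dm \<Phi> e xs ys) \<and> tr w (Dm \<Psi> e us vs)"
  by (simp add: Let_def tr_And)

lemma dm_Or:
  "world w \<Longrightarrow> wff \<Gamma> (Or \<Phi> \<Psi>) \<Longrightarrow> envs w \<Gamma> e \<Longrightarrow> els w (map Seq (Dx \<Phi>)) xs \<Longrightarrow> els w (Dy \<Phi>) ys \<Longrightarrow>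
    els w (map Seq (Dx \<Psi>)) us \<Longrightarrow> els w (Dy \<Psi>) vs \<Longrightarrow>
    tr w (Dm (Or \<Phi> \<Psi>) e (xs @ us) (ys @ vs)) \<longleftrightarrow> tr w (Dm \<Phi> e xs ys) \<or> tr w (Dm \<Psi> e us vs)"
  using tr_Or[OF _ Form_Dm[of \<Gamma> \<Phi> w e xs ys] Form_Dm[of \<Gamma> \<Psi> w e us vs]] by (auto simp: Let_def dest!: list_all2_lengthD)

lemma dm_Imp:
  assumes w: "world w" and wf: "wff \<Gamma> (Imp \<Phi> \<Psi>)" and e: "envs w \<Gamma> e"
    and U: "els w (map (\<lambda>\<tau>. Seq (fty (map Seq (Dx \<Phi>)) \<tau>)) (Dx \<Psi>)) Us"
    and Y: "els w (map (\<lambda>\<tau>. Seq (fty (map Seq (Dx \<Phi>) @ Dy \<Psi>) \<tau>)) (Dy \<Phi>)) Ys"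
    and x: "els w (map Seq (Dx \<Phi>)) xs" and v: "els w (Dy \<Psi>) vs"
  shows "tr w (Dm (Imp \<Phi> \<Psi>) e (Us @ Ys) (xs @ vs)) \<longleftrightarrow> (\<forall>v. w \<sqsubseteq> v \<longrightarrow>
      (\<forall>u. v \<sqsubseteq> u \<longrightarrow> (\<forall>ys. mems u (Dy \<Phi>) ys (sapp_all (map Seq (Dx \<Phi>) @ Dy \<Psi>) (Dy \<Phi>) Ys (xs @ vs)) \<longrightarrow> tr u (Dm \<Phi> e xs ys))) \<longrightarrow>
      tr v (Dm \<Psi> e (sapp_all (map Seq (Dx \<Phi>)) (Dx \<Psi>) Us xs) vs))"
proof -
  let ?k = "length (Dy \<Phi>)"
  let ?S = "sapp_all (map Seq (Dx \<Phi>) @ Dy \<Psi>) (Dy \<Phi>) Ys (xs @ vs)"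
  let ?A = "BAlls (Dy \<Phi>) ?S (Dm \<Phi> (\<lambda>i. lift ?k (e i)) (map (lift ?k) xs) (vars ?k))"
  let ?B = "Dm \<Psi> e (sapp_all (map Seq (Dx \<Phi>)) (Dx \<Psi>) Us xs) vs"
  have l: "length Us = length (Dx \<Psi>)" "length Ys = ?k" "length xs = length (Dx \<Phi>)" using U Y x by (auto dest: list_all2_lengthD)
  have eq: "Dm (Imp \<Phi> \<Psi>) e (Us @ Ys) (xs @ vs) = Imp ?A ?B" using l by (simp add: Let_def)
  have "Form (lvl w) (Dm (Imp \<Phi> \<Psi>) e (Us @ Ys) (xs @ vs))"
    using list_all2_appendI[OF U Y] list_all2_appendI[OF x v] by (intro Form_Dm[OF wf e]) (simp_all add: comp_def)
  then have F: "Form (lvl w) ?A" "Form (lvl w) ?B" unfolding eq by auto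
  have "tr u ?A \<longleftrightarrow> (\<forall>u'. u \<sqsubseteq> u' \<longrightarrow> (\<forall>ys. mems u' (Dy \<Phi>) ys ?S \<longrightarrow> tr u' (Dm \<Phi> e xs ys)))" if u: "w \<sqsubseteq> u" for u
  proof -
    have "fsub (pushes ys Var) (Dm \<Phi> (\<lambda>i. lift ?k (e i)) (map (lift ?k) xs) (vars ?k)) = Dm \<Phi> e xs ys" if "mems u' (Dy \<Phi>) ys ?S" for u' ys
      using mems_length[OF that] l by (intro fsub_pushes_Dm) auto
    then show ?thesis using tr_BAlls[OF wle_world[OF u] _ Form_wle[OF F(1) u]] l by simp
  qed
  then show ?thesis unfolding eq using tr_Imp[OF w F] by simp
qed

lemma dm_All:
  assumes w: "world w" and wf: "wff \<Gamma> (All \<sigma> \<Phi>)" and e: "envs w \<Gamma> e"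
    and x: "els w (map Seq (Dx \<Phi>)) xs" and y: "els w (Dy \<Phi>) ys"
  shows "tr w (Dm (All \<sigma> \<Phi>) e xs ys) \<longleftrightarrow> (\<forall>v. w \<sqsubseteq> v \<longrightarrow> (\<forall>z. elt v \<sigma> z \<longrightarrow> tr v (Dm \<Phi> (z ## e) xs ys)))"
proof -
  have l: "length xs = length (Dx \<Phi>)" "length ys = length (Dy \<Phi>)" using x y by (auto dest: list_all2_lengthD)
  have "inst 0 [z] (Dm \<Phi> (up e) (map (lift 1) xs) (map (lift 1) ys)) = Dm \<Phi> (z ## e) xs ys" for z
    unfolding inst_0_single using l scons_up[of z Var e] by (subst fsub_Dm) (simp_all add: comp_def)
  then show ?thesis using tr_All[OF w, of \<sigma>] Form_Dm[OF wf e, of xs ys] x y by simp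
qed

lemma Dm_bounded_inst:
  assumes "length xs = length (Dx \<Phi>)" "length yss = length (Dy \<Phi>)" "k = length (Dy \<Phi>)"
  shows "inst 0 [z] (BAlls (Dy \<Phi>) (map (lift 1) yss) (Dm \<Phi> (\<lambda>i. lift k (up e i)) (map (lift (k + 1)) xs) (vars k)))
    = BAlls (Dy \<Phi>) yss (Dm \<Phi> (\<lambda>i. lift k ((z ## e) i)) (map (lift k) xs) (vars k))"
proof -
  have "sub (upn k (z ## Var)) (lift (k + 1) t) = lift k t" for t
    using sub_upn_lift[of k "z ## Var" "lift 1 t"] by (simp add: add.commute del: sub_upn_lift sub_lift)
       (simp add: lift_sub)
  moreover have "sub (z ## Var) (up e i) = (z ## e) i" for i by (rule sub_scons_up)
  ultimately show ?thesis
    unfolding inst_0_single using assms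
    by (simp add: fsub_BAlls fsub_Dm comp_def del: sub_lift lift_sub) (simp add: comp_def)
qed

lemma dm_bounded:
  assumes w: "world w" and F: "Form (lvl w) (BAlls (Dy \<Phi>) yss (Dm \<Phi> (\<lambda>i. lift k (e i)) (map (lift k) xs) (vars k)))"
    and l: "length xs = length (Dx \<Phi>)" "length yss = length (Dy \<Phi>)" "k = length (Dy \<Phi>)"
  shows "tr w (BAlls (Dy \<Phi>) yss (Dm \<Phi> (\<lambda>i. lift k (e i)) (map (lift k) xs) (vars k))) \<longleftrightarrow>
    (\<forall>v. w \<sqsubseteq> v \<longrightarrow> (\<forall>ys. mems v (Dy \<Phi>) ys yss \<longrightarrow> tr v (Dm \<Phi> e xs ys)))"
proof -
  have "fsub (pushes ys Var) (Dm \<Phi> (\<lambda>i. lift k (e i)) (map (lift k) xs) (vars k)) = Dm \<Phi> e xs ys" if "mems u (Dy \<Phi>) ys yss" for u ys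
    using mems_length[OF that] l by (intro fsub_pushes_Dm) auto
  then show ?thesis using tr_BAlls[OF w l(2) F] by simp
qed

lemma dm_Ex:
  assumes w: "world w" and wf: "wff \<Gamma> (Ex \<sigma> \<Phi>)" and e: "envs w \<Gamma> e"
    and x: "els w (map Seq (Dx \<Phi>)) xs" and y: "els w (map Seq (Dy \<Phi>)) yss"
  shows "tr w (Dm (Ex \<sigma> \<Phi>) e xs yss) \<longleftrightarrow>
    (\<exists>z. elt w \<sigma> z \<and> (\<forall>v. w \<sqsubseteq> v \<longrightarrow> (\<forall>ys. mems v (Dy \<Phi>) ys yss \<longrightarrow> tr v (Dm \<Phi> (z ## e) xs ys))))"
proof -
  let ?k = "length (Dy \<Phi>)"
  let ?A = "BAlls (Dy \<Phi>) (map (lift 1) yss) (Dm \<Phi> (\<lambda>i. lift ?k (up e i)) (map (lift (?k + 1)) xs) (vars ?k))"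
  have l: "length xs = length (Dx \<Phi>)" "length yss = ?k" using x y by (auto dest: list_all2_lengthD)
  have F: "Form (lvl w) (Ex \<sigma> ?A)" using Form_Dm[OF wf e, of xs yss] x y by (simp add: Let_def)
  have "tr w (inst 0 [z] ?A) \<longleftrightarrow> (\<forall>v. w \<sqsubseteq> v \<longrightarrow> (\<forall>ys. mems v (Dy \<Phi>) ys yss \<longrightarrow> tr v (Dm \<Phi> (z ## e) xs ys)))"
    if "elt w \<sigma> z" for z
    using Form_inst[OF F] that unfolding Dm_bounded_inst[OF l refl] elt_def by (intro dm_bounded[OF w _ l refl])
  then show ?thesis using tr_Ex[OF w F] by (auto simp: Let_def)
qed

lemma dm_ExSt:
  assumes w: "world w" and wf: "wff \<Gamma> (ExSt \<sigma> \<Phi>)" and e: "envs w \<Gamma> e"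
    and x: "els w (map Seq (Dx \<Phi>)) xs" and Z: "elt w (Seq \<sigma>) Z" and y: "els w (map Seq (Dy \<Phi>)) yss"
  shows "tr w (Dm (ExSt \<sigma> \<Phi>) e (xs @ [Z]) yss) \<longleftrightarrow>
    (\<exists>z. mem w \<sigma> z Z \<and> (\<forall>v. w \<sqsubseteq> v \<longrightarrow> (\<forall>ys. mems v (Dy \<Phi>) ys yss \<longrightarrow> tr v (Dm \<Phi> (z ## e) xs ys))))"
proof -
  let ?k = "length (Dy \<Phi>)"
  let ?A = "BAlls (Dy \<Phi>) (map (lift 1) yss) (Dm \<Phi> (\<lambda>i. lift ?k (up e i)) (map (lift (?k + 1)) xs) (vars ?k))"
  have l: "length xs = length (Dx \<Phi>)" "length yss = ?k" using x y by (auto dest: list_all2_lengthD)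
  have eq: "Dm (ExSt \<sigma> \<Phi>) e (xs @ [Z]) yss = Ex \<sigma> (And (In \<sigma> (Var 0) (lift 1 Z)) ?A)"
    by (simp add: Let_def BEx_def)
  have F: "Form (lvl w) (Ex \<sigma> (And (In \<sigma> (Var 0) (lift 1 Z)) ?A))"
    unfolding eq[symmetric] using list_all2_appendI[OF x, of "[Seq \<sigma>]" "[Z]"] Z by (intro Form_Dm[OF wf e]) (simp_all add: y)
  have i: "inst 0 [z] (And (In \<sigma> (Var 0) (lift 1 Z)) ?A) = And (In \<sigma> z Z) (inst 0 [z] ?A)" for z
    using inst_0_In[of z \<sigma> Z] by (simp add: inst_0_single)
  have "tr w (inst 0 [z] ?A) \<longleftrightarrow> (\<forall>v. w \<sqsubseteq> v \<longrightarrow> (\<forall>ys. mems v (Dy \<Phi>) ys yss \<longrightarrow> tr v (Dm \<Phi> (z ## e) xs ys)))"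
    if z: "elt w \<sigma> z" for z
  proof -
    have "Form (lvl w) (inst 0 [z] (And (In \<sigma> (Var 0) (lift 1 Z)) ?A))" using Form_inst[OF F] z by (simp only: elt_def)
    then have "Form (lvl w) (inst 0 [z] ?A)" unfolding i by simp
    then show ?thesis unfolding Dm_bounded_inst[OF l refl] by (rule dm_bounded[OF w _ l refl])
  qed
  then show ?thesis unfolding eq using tr_Ex[OF w F] mem_elt(1)[OF w] unfolding i tr_And[OF w] by blast
qed

lemma dm_AllSt: "Dm (AllSt \<sigma> \<Phi>) e Xs (z # ys) = Dm \<Phi> (z ## e) (sapp_all [\<sigma>] (Dx \<Phi>) Xs [z]) ys"
  by simp

section \<open>The characterization theorem\<close>

subsection \<open>Monotonicity and definability of the matrix\<close>

lemma list_all2_append1D: "list_all2 P (ys @ zs) xs \<Longrightarrow> \<exists>us vs. xs = us @ vs \<and> list_all2 P ys us \<and> list_all2 P zs vs"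
  by (auto simp: list_all2_append1)

lemma list_all2_Cons1D: "list_all2 P (y # ys) xs \<Longrightarrow> \<exists>z zs. xs = z # zs \<and> P y z \<and> list_all2 P ys zs"
  by (auto simp: list_all2_Cons1)

lemma ssubs_append:
  "length ss = length \<tau>s \<Longrightarrow> length ss' = length \<tau>s \<Longrightarrow>
    ssubs w (\<tau>s @ \<rho>s) (ss @ us) (ss' @ us') \<longleftrightarrow> ssubs w \<tau>s ss ss' \<and> ssubs w \<rho>s us us'"
proof (induction \<tau>s arbitrary: ss ss')
  case (Cons \<tau> \<tau>s)
  then obtain a as b bs where "ss = a # as" "ss' = b # bs" by (auto simp: length_Suc_conv)
  then show ?case using Cons by simp
qed simp

lemma ssub_mem: "ssub w \<sigma> s t \<Longrightarrow> w \<sqsubseteq> v \<Longrightarrow> mem v \<sigma> x s \<Longrightarrow> mem v \<sigma> x t"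
  unfolding ssub_def by blast

text \<open>Larger witnesses help. For \<open>St\<close> and \<open>ExSt\<close> they offer more
  entries. For an implication, a larger \<open>Y\<close> strengthens the bounded premise by
  admitting more challenges, and a larger \<open>U\<close> gives larger witnesses for the
  conclusion. \<open>sapp\<close> is monotone, which covers \<open>AllSt\<close>.\<close>

lemma Dm_mono:
  "wff \<Gamma> \<Phi> \<Longrightarrow> world w \<Longrightarrow> envs w \<Gamma> e \<Longrightarrow> els w (map Seq (Dx \<Phi>)) xs \<Longrightarrow> els w (map Seq (Dx \<Phi>)) xs' \<Longrightarrow>
    els w (Dy \<Phi>) ys \<Longrightarrow> ssubs w (Dx \<Phi>) xs xs' \<Longrightarrow> tr w (Dm \<Phi> e xs ys) \<Longrightarrow> tr w (Dm \<Phi> e xs' ys)"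
proof (induction \<Phi> arbitrary: \<Gamma> w e xs xs' ys)
  case (St \<sigma> t)
  from St.prems(4) obtain s where "xs = [s]" by (cases xs) auto
  moreover from St.prems(5) obtain s' where "xs' = [s']" by (cases xs') auto
  ultimately show ?case using St.prems(7,8) ssub_mem[OF _ wle_refl[OF St.prems(2)]] by auto
next
  case (And \<Phi> \<Psi>)
  note w = And.prems(2)
  from And.prems(4) obtain x u where x: "xs = x @ u" "els w (map Seq (Dx \<Phi>)) x" "els w (map Seq (Dx \<Psi>)) u"
    by (auto dest!: list_all2_append1D)
  from And.prems(5) obtain x' u' where x': "xs' = x' @ u'" "els w (map Seq (Dx \<Phi>)) x'" "els w (map Seq (Dx \<Psi>)) u'"
    by (auto dest!: list_all2_append1D)
  from And.prems(6) obtain y v where y: "ys = y @ v" "els w (Dy \<Phi>) y" "els w (Dy \<Psi>) v"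
    by (auto dest!: list_all2_append1D)
  note l = list_all2_lengthD[OF x(2), simplified, symmetric] list_all2_lengthD[OF x'(2), simplified, symmetric] list_all2_lengthD[OF y(2), symmetric]
  have s: "ssubs w (Dx \<Phi>) x x'" "ssubs w (Dx \<Psi>) u u'"
    using And.prems(7) unfolding x(1) x'(1) Dx.simps ssubs_append[OF l(1,2)] by simp_all
  have t: "tr w (Dm \<Phi> e x y)" "tr w (Dm \<Psi> e u v)"
    using And.prems(8) unfolding x(1) y(1) dm_And[OF w l(1,3)] by simp_all
  have wf: "wff \<Gamma> \<Phi>" "wff \<Gamma> \<Psi>" using And.prems(1) by simp_all
  show ?case unfolding x'(1) y(1) dm_And[OF w l(2,3)]
    using And.IH(1)[OF wf(1) w And.prems(3) x(2) x'(2) y(2) s(1) t(1)]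
      And.IH(2)[OF wf(2) w And.prems(3) x(3) x'(3) y(3) s(2) t(2)] by simp
next
  case (Or \<Phi> \<Psi>)
  note w = Or.prems(2) and e = Or.prems(3)
  from Or.prems(4) obtain x u where x: "xs = x @ u" "els w (map Seq (Dx \<Phi>)) x" "els w (map Seq (Dx \<Psi>)) u"
    by (auto dest!: list_all2_append1D)
  from Or.prems(5) obtain x' u' where x': "xs' = x' @ u'" "els w (map Seq (Dx \<Phi>)) x'" "els w (map Seq (Dx \<Psi>)) u'"
    by (auto dest!: list_all2_append1D)
  from Or.prems(6) obtain y v where y: "ys = y @ v" "els w (Dy \<Phi>) y" "els w (Dy \<Psi>) v"
    by (auto dest!: list_all2_append1D)
  note l = list_all2_lengthD[OF x(2), simplified, symmetric] list_all2_lengthD[OF x'(2), simplified, symmetric]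
  have s: "ssubs w (Dx \<Phi>) x x'" "ssubs w (Dx \<Psi>) u u'"
    using Or.prems(7) unfolding x(1) x'(1) Dx.simps ssubs_append[OF l] by simp_all
  have wf: "wff \<Gamma> \<Phi>" "wff \<Gamma> \<Psi>" using Or.prems(1) by simp_all
  have "tr w (Dm \<Phi> e x y) \<or> tr w (Dm \<Psi> e u v)"
    using Or.prems(8) unfolding x(1) y(1) dm_Or[OF w Or.prems(1) e x(2) y(2) x(3) y(3)] .
  then show ?case unfolding x'(1) y(1) dm_Or[OF w Or.prems(1) e x'(2) y(2) x'(3) y(3)]
    using Or.IH(1)[OF wf(1) w e x(2) x'(2) y(2) s(1)] Or.IH(2)[OF wf(2) w e x(3) x'(3) y(3) s(2)] by blast
next
  case (Imp \<Phi> \<Psi>)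
  note w = Imp.prems(2) and e = Imp.prems(3)
  let ?A = "map Seq (Dx \<Phi>)" let ?L = "?A @ Dy \<Psi>"
  from Imp.prems(4) obtain U Y where U: "xs = U @ Y" "els w (map (\<lambda>\<tau>. Seq (fty ?A \<tau>)) (Dx \<Psi>)) U"
      "els w (map (\<lambda>\<tau>. Seq (fty ?L \<tau>)) (Dy \<Phi>)) Y"
    by (auto dest!: list_all2_append1D simp: comp_def)
  from Imp.prems(5) obtain U' Y' where U': "xs' = U' @ Y'" "els w (map (\<lambda>\<tau>. Seq (fty ?A \<tau>)) (Dx \<Psi>)) U'"
      "els w (map (\<lambda>\<tau>. Seq (fty ?L \<tau>)) (Dy \<Phi>)) Y'"
    by (auto dest!: list_all2_append1D simp: comp_def)
  from Imp.prems(6) obtain x v where x: "ys = x @ v" "els w ?A x" "els w (Dy \<Psi>) v"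
    by (auto dest!: list_all2_append1D)
  have wf: "wff \<Gamma> \<Psi>" using Imp.prems(1) by simp
  have l: "length U = length (map (fty ?A) (Dx \<Psi>))" "length U' = length (map (fty ?A) (Dx \<Psi>))"
    using U(2) U'(2) by (auto dest: list_all2_lengthD)
  have s: "ssubs w (map (fty ?A) (Dx \<Psi>)) U U'" "ssubs w (map (fty ?L) (Dy \<Phi>)) Y Y'"
    using Imp.prems(7) unfolding U(1) U'(1) Dx.simps ssubs_append[OF l] by simp_all
  show ?case unfolding U'(1) x(1) dm_Imp[OF w Imp.prems(1) e U'(2,3) x(2,3)]
  proof (intro allI impI)
    fix u
    let ?Y = "sapp_all ?L (Dy \<Phi>) Y (x @ v)" and ?Y' = "sapp_all ?L (Dy \<Phi>) Y' (x @ v)"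
    assume u: "w \<sqsubseteq> u" and h: "\<forall>z. u \<sqsubseteq> z \<longrightarrow> (\<forall>ys. mems z (Dy \<Phi>) ys ?Y' \<longrightarrow> tr z (Dm \<Phi> e x ys))"
    have xv: "els w ?L (x @ v)" using x(2,3) by (rule list_all2_appendI)
    have sY: "ssubs w (Dy \<Phi>) ?Y ?Y'" by (rule ssubs_sapp_all[OF w xv U(3) U'(3) s(2)])
    have "\<forall>z. u \<sqsubseteq> z \<longrightarrow> (\<forall>ys. mems z (Dy \<Phi>) ys ?Y \<longrightarrow> tr z (Dm \<Phi> e x ys))"
    proof (intro allI impI)
      fix z ys assume z: "u \<sqsubseteq> z" and m: "mems z (Dy \<Phi>) ys ?Y"
      show "tr z (Dm \<Phi> e x ys)"
        using h z mems_ssubs[OF m ssubs_mono[OF sY wle_trans[OF u z]] wle_world[OF z]] by blast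
    qed
    then have t: "tr u (Dm \<Psi> e (sapp_all ?A (Dx \<Psi>) U x) v)"
      using Imp.prems(8) u unfolding U(1) x(1) dm_Imp[OF w Imp.prems(1) e U(2,3) x(2,3)] by blast
    have sU: "ssubs w (Dx \<Psi>) (sapp_all ?A (Dx \<Psi>) U x) (sapp_all ?A (Dx \<Psi>) U' x)"
      by (rule ssubs_sapp_all[OF w x(2) U(2) U'(2) s(1)])
    show "tr u (Dm \<Psi> e (sapp_all ?A (Dx \<Psi>) U' x) v)"
      by (rule Imp.IH(2)[OF wf wle_world[OF u] envs_mono[OF e u]
            els_mono[OF els_sapp_all[OF U(2) x(2)] u] els_mono[OF els_sapp_all[OF U'(2) x(2)] u]
            els_mono[OF x(3) u] ssubs_mono[OF sU u] t])
  qed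
next
  case (All \<sigma> \<Phi>)
  note w = All.prems(2) and e = All.prems(3)
  have x: "els w (map Seq (Dx \<Phi>)) xs" "els w (map Seq (Dx \<Phi>)) xs'" "els w (Dy \<Phi>) ys" "ssubs w (Dx \<Phi>) xs xs'"
    using All.prems(4-7) by simp_all
  have wf: "wff (\<sigma> # \<Gamma>) \<Phi>" using All.prems(1) by simp
  show ?case unfolding dm_All[OF w All.prems(1) e x(2,3)]
  proof (intro allI impI)
    fix v z assume v: "w \<sqsubseteq> v" and z: "elt v \<sigma> z"
    have "tr v (Dm \<Phi> (z ## e) xs ys)" using All.prems(8) v z unfolding dm_All[OF w All.prems(1) e x(1,3)] by blast
    moreover have "envs v (\<sigma> # \<Gamma>) (z ## e)" using z envs_mono[OF e v] by simp
    ultimately show "tr v (Dm \<Phi> (z ## e) xs' ys)"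
      using All.IH[OF wf wle_world[OF v] _ els_mono[OF x(1) v] els_mono[OF x(2) v] els_mono[OF x(3) v] ssubs_mono[OF x(4) v]] by blast
  qed
next
  case (Ex \<sigma> \<Phi>)
  note w = Ex.prems(2) and e = Ex.prems(3)
  have x: "els w (map Seq (Dx \<Phi>)) xs" "els w (map Seq (Dx \<Phi>)) xs'" "els w (map Seq (Dy \<Phi>)) ys" "ssubs w (Dx \<Phi>) xs xs'"
    using Ex.prems(4-7) by simp_all
  have wf: "wff (\<sigma> # \<Gamma>) \<Phi>" using Ex.prems(1) by simp
  obtain z where z: "elt w \<sigma> z" "\<And>v ys'. w \<sqsubseteq> v \<Longrightarrow> mems v (Dy \<Phi>) ys' ys \<Longrightarrow> tr v (Dm \<Phi> (z ## e) xs ys')"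
    using Ex.prems(8) unfolding dm_Ex[OF w Ex.prems(1) e x(1,3)] by blast
  have "tr v (Dm \<Phi> (z ## e) xs' ys')" if v: "w \<sqsubseteq> v" and m: "mems v (Dy \<Phi>) ys' ys" for v ys'
  proof -
    have "envs v (\<sigma> # \<Gamma>) (z ## e)" using elt_mono[OF z(1) v] envs_mono[OF e v] by simp
    then show ?thesis
      using Ex.IH[OF wf wle_world[OF v] _ els_mono[OF x(1) v] els_mono[OF x(2) v] mems_els[OF m wle_world[OF v]] ssubs_mono[OF x(4) v] z(2)[OF v m]] by blast
  qed
  then show ?case unfolding dm_Ex[OF w Ex.prems(1) e x(2,3)] using z(1) by blast
next
  case (AllSt \<sigma> \<Phi>)
  note w = AllSt.prems(2) and e = AllSt.prems(3)
  from AllSt.prems(6) obtain z y where y: "ys = z # y" "elt w \<sigma> z" "els w (Dy \<Phi>) y" by (auto dest!: list_all2_Cons1D)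
  have X: "els w (map (\<lambda>\<tau>. Seq (fty [\<sigma>] \<tau>)) (Dx \<Phi>)) xs" "els w (map (\<lambda>\<tau>. Seq (fty [\<sigma>] \<tau>)) (Dx \<Phi>)) xs'"
    using AllSt.prems(4,5) by (simp_all add: comp_def)
  have z: "els w [\<sigma>] [z]" using y(2) by simp
  have s: "ssubs w (Dx \<Phi>) (sapp_all [\<sigma>] (Dx \<Phi>) xs [z]) (sapp_all [\<sigma>] (Dx \<Phi>) xs' [z])"
    using AllSt.prems(7) by (intro ssubs_sapp_all[OF w z X]) simp
  have wf: "wff (\<sigma> # \<Gamma>) \<Phi>" and e': "envs w (\<sigma> # \<Gamma>) (z ## e)" using AllSt.prems(1) e y(2) by simp_all
  show ?case using AllSt.prems(8) AllSt.IH[OF wf w e' els_sapp_all[OF X(1) z] els_sapp_all[OF X(2) z] y(3) s]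
    unfolding y(1) dm_AllSt by blast
next
  case (ExSt \<sigma> \<Phi>)
  note w = ExSt.prems(2) and e = ExSt.prems(3)
  have wf: "wff (\<sigma> # \<Gamma>) \<Phi>" using ExSt.prems(1) by simp
  from ExSt.prems(4) obtain x Z where x: "xs = x @ [Z]" "els w (map Seq (Dx \<Phi>)) x" "elt w (Seq \<sigma>) Z"
    by (auto dest!: list_all2_append1D list_all2_Cons1D)
  from ExSt.prems(5) obtain x' Z' where x': "xs' = x' @ [Z']" "els w (map Seq (Dx \<Phi>)) x'" "elt w (Seq \<sigma>) Z'"
    by (auto dest!: list_all2_append1D list_all2_Cons1D)
  have y: "els w (map Seq (Dy \<Phi>)) ys" using ExSt.prems(6) by simp
  have l: "length x = length (Dx \<Phi>)" "length x' = length (Dx \<Phi>)" using x(2) x'(2) by (auto dest: list_all2_lengthD)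
  have s: "ssubs w (Dx \<Phi>) x x'" "ssub w \<sigma> Z Z'"
    using ExSt.prems(7) unfolding x(1) x'(1) Dx.simps ssubs_append[OF l] by simp_all
  obtain z where z: "mem w \<sigma> z Z" "\<And>v ys'. w \<sqsubseteq> v \<Longrightarrow> mems v (Dy \<Phi>) ys' ys \<Longrightarrow> tr v (Dm \<Phi> (z ## e) x ys')"
    using ExSt.prems(8) unfolding x(1) dm_ExSt[OF w ExSt.prems(1) e x(2,3) y] by blast
  have "tr v (Dm \<Phi> (z ## e) x' ys')" if v: "w \<sqsubseteq> v" and m: "mems v (Dy \<Phi>) ys' ys" for v ys'
  proof -
    have "envs v (\<sigma> # \<Gamma>) (z ## e)" using elt_mono[OF mem_elt(1)[OF w z(1)] v] envs_mono[OF e v] by simp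
    then show ?thesis
      using ExSt.IH[OF wf wle_world[OF v] _ els_mono[OF x(2) v] els_mono[OF x'(2) v] mems_els[OF m wle_world[OF v]] ssubs_mono[OF s(1) v] z(2)[OF v m]] by blast
  qed
  then show ?case unfolding x'(1) dm_ExSt[OF w ExSt.prems(1) e x'(2,3) y]
    using ssub_mem[OF s(2) wle_refl[OF w] z(1)] by blast
qed simp_all

text \<open>\<open>Dm\<close> at variables, the body of \<open>D\<close>. It is the formula by which
  the predicates below are shown to be definable.\<close>

definition matrix :: "fm \<Rightarrow> fm" where
  "matrix \<Phi> = (let m = length (Dx \<Phi>); n = length (Dy \<Phi>) in
     Dm \<Phi> (\<lambda>i. Var (i + (m + n))) (map (lift n) (vars m)) (vars n))"

lemma D_eq: "D \<Phi> = ExSts (map Seq (Dx \<Phi>)) (AllSts (Dy \<Phi>) (matrix \<Phi>))"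
  by (simp add: D_def matrix_def Let_def)

lemma wff_matrix:
  assumes "wff \<Gamma> \<Phi>"
  shows "wff (rev (Dy \<Phi>) @ rev (map Seq (Dx \<Phi>)) @ \<Gamma>) (matrix \<Phi>)"
proof -
  let ?m = "length (Dx \<Phi>)" and ?n = "length (Dy \<Phi>)"
  have "wtenv (rev (Dy \<Phi>) @ rev (map Seq (Dx \<Phi>)) @ \<Gamma>) (\<lambda>i. Var (i + (?m + ?n))) \<Gamma>"
    by (auto simp: wtenv_def nth_append)
  moreover have "list_all2 (wt (rev (Dy \<Phi>) @ rev (map Seq (Dx \<Phi>)) @ \<Gamma>)) (map (lift ?n) (vars ?m)) (map Seq (Dx \<Phi>))"
    using list_all2_vars[of "map Seq (Dx \<Phi>)" \<Gamma>] by (intro list_all2_wt_lift) simp_all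
  ultimately show ?thesis
    unfolding matrix_def Let_def using list_all2_vars[of "Dy \<Phi>"] by (intro wff_Dm[OF assms]) auto
qed

lemma fsub_matrix:
  assumes l: "length xs = length (Dx \<Phi>)" "length ys = length (Dy \<Phi>)"
  shows "fsub (pushes ys (pushes xs e)) (matrix \<Phi>) = Dm \<Phi> e xs ys"
proof -
  let ?m = "length (Dx \<Phi>)" and ?n = "length (Dy \<Phi>)"
  have "fsub (pushes ys (pushes xs e)) (matrix \<Phi>) = Dm \<Phi> (\<lambda>i. sub (pushes ys (pushes xs e)) (Var (i + (?m + ?n))))
      (map (sub (pushes ys (pushes xs e))) (map (lift ?n) (vars ?m))) (map (sub (pushes ys (pushes xs e))) (vars ?n))"
    unfolding matrix_def Let_def by (rule fsub_Dm) simp_all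
  also have "map (sub (pushes ys (pushes xs e))) (map (lift ?n) (vars ?m)) = map (sub (pushes xs e)) (vars ?m)"
    by (simp only: map_map comp_def sub_pushes_lift[OF l(2)])
  also have "(\<lambda>i. sub (pushes ys (pushes xs e)) (Var (i + (?m + ?n)))) = e"
  proof
    fix i
    have "pushes ys (pushes xs e) ((i + ?m) + ?n) = e i" using pushes_ge[of ys] pushes_ge[of xs] l by metis
    then show "sub (pushes ys (pushes xs e)) (Var (i + (?m + ?n))) = e i" by (simp add: add.assoc)
  qed
  finally show ?thesis by (simp only: map_sub_pushes_vars l)
qed

text \<open>The first \<open>q\<close> entries of the tuple interpret the innermost free variables
  of \<open>\<Phi>\<close>. The lemma thereby serves both for a formula itself and for the body of a
  quantifier.\<close>

lemma dfn_Dm: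
  assumes wf: "wff (rev \<zeta>s @ \<Gamma>) \<Phi>" and e: "envs w \<Gamma> e" and q: "length \<zeta>s = q" and m: "length (Dx \<Phi>) = m"
  shows "dfn True w (\<zeta>s @ map Seq (Dx \<Phi>) @ Dy \<Phi>)
    (\<lambda>v ts. tr v (Dm \<Phi> (pushes (take q ts) e) (take m (drop q ts)) (drop m (drop q ts))))"
proof -
  have "defined_by \<Gamma> e (matrix \<Phi>) w (\<zeta>s @ map Seq (Dx \<Phi>) @ Dy \<Phi>)
    (\<lambda>v ts. tr v (Dm \<Phi> (pushes (take q ts) e) (take m (drop q ts)) (drop m (drop q ts))))"
  proof (rule defined_byI)
    show "wff (rev (\<zeta>s @ map Seq (Dx \<Phi>) @ Dy \<Phi>) @ \<Gamma>) (matrix \<Phi>)" using wff_matrix[OF wf] by simp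
    fix v ts assume "els v (\<zeta>s @ map Seq (Dx \<Phi>) @ Dy \<Phi>) ts"
    then obtain zs xs ys where ts: "ts = zs @ xs @ ys" "length zs = q" "length xs = m" "length ys = length (Dy \<Phi>)"
      using q m by (auto simp: list_all2_append1 dest: list_all2_lengthD)
    then show "tr v (Dm \<Phi> (pushes (take q ts) e) (take m (drop q ts)) (drop m (drop q ts))) \<longleftrightarrow>
        fc v (rev (\<zeta>s @ map Seq (Dx \<Phi>) @ Dy \<Phi>) @ \<Gamma>) (pushes ts e) (matrix \<Phi>)"
      using m by (simp add: fc_def pushes_append fsub_matrix)
  qed (rule e)
  moreover have "internal (matrix \<Phi>)" by (simp add: matrix_def Let_def internal_Dm)
  ultimately show ?thesis unfolding dfn_def by blast
qed

lemma dfn_Dm_at: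
  assumes wf: "wff (rev \<zeta>s @ \<Gamma>) \<Phi>" and w: "world w" and e: "envs w \<Gamma> e" and q: "length \<zeta>s = q"
    and xs: "els w (map Seq (Dx \<Phi>)) xs"
  shows "dfn True w (\<zeta>s @ Dy \<Phi>) (\<lambda>v ts. tr v (Dm \<Phi> (pushes (take q ts) e) xs (drop q ts)))"
proof -
  have l: "length xs = length (Dx \<Phi>)" using xs by (auto dest: list_all2_lengthD)
  have "defts w (\<zeta>s @ Dy \<Phi>) \<zeta>s (\<lambda>ts. take q ts)" using defts_take[OF defts_args[OF w, of "\<zeta>s @ Dy \<Phi>"], of q] q by simp
  moreover have "defts w (\<zeta>s @ Dy \<Phi>) (Dy \<Phi>) (\<lambda>ts. drop q ts)" using defts_drop[OF defts_args[OF w, of "\<zeta>s @ Dy \<Phi>"], of q] q by simp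
  ultimately have F: "defts w (\<zeta>s @ Dy \<Phi>) (\<zeta>s @ map Seq (Dx \<Phi>) @ Dy \<Phi>) (\<lambda>ts. take q ts @ xs @ drop q ts)"
    by (intro defts_append defts_const[OF xs])
  show ?thesis
  proof (rule dfn_cong[OF dfn_comp[OF dfn_Dm[OF wf e q refl] F]])
    fix v ts assume "els v (\<zeta>s @ Dy \<Phi>) ts"
    then have "length ts = q + length (Dy \<Phi>)" using q by (auto dest: list_all2_lengthD)
    then show "tr v (Dm \<Phi> (pushes (take q (take q ts @ xs @ drop q ts)) e) (take (length (Dx \<Phi>)) (drop q (take q ts @ xs @ drop q ts)))
      (drop (length (Dx \<Phi>)) (drop q (take q ts @ xs @ drop q ts)))) \<longleftrightarrow> tr v (Dm \<Phi> (pushes (take q ts) e) xs (drop q ts))"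
      using l by simp
  qed
qed

definition realizes :: "world \<Rightarrow> fm \<Rightarrow> (nat \<Rightarrow> tm) \<Rightarrow> tm list \<Rightarrow> bool" where
  "realizes w \<Phi> e xs \<longleftrightarrow> (\<forall>v. w \<sqsubseteq> v \<longrightarrow> (\<forall>ys. stds v (Dy \<Phi>) ys \<longrightarrow> tr v (Dm \<Phi> e xs ys)))"

lemma realizesI: "(\<And>v ys. w \<sqsubseteq> v \<Longrightarrow> stds v (Dy \<Phi>) ys \<Longrightarrow> tr v (Dm \<Phi> e xs ys)) \<Longrightarrow> realizes w \<Phi> e xs"
  by (simp add: realizes_def)
lemma realizesD: "realizes w \<Phi> e xs \<Longrightarrow> w \<sqsubseteq> v \<Longrightarrow> stds v (Dy \<Phi>) ys \<Longrightarrow> tr v (Dm \<Phi> e xs ys)"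
  by (simp add: realizes_def)
lemma realizes_mono: "realizes w \<Phi> e xs \<Longrightarrow> w \<sqsubseteq> v \<Longrightarrow> realizes v \<Phi> e xs"
  by (rule realizesI) (rule realizesD[OF _ wle_trans])

lemma realizes_ssubs:
  assumes "wff \<Gamma> \<Phi>" "world w" "envs w \<Gamma> e" "els w (map Seq (Dx \<Phi>)) xs" "els w (map Seq (Dx \<Phi>)) xs'"
    "ssubs w (Dx \<Phi>) xs xs'" "realizes w \<Phi> e xs"
  shows "realizes w \<Phi> e xs'"
proof (rule realizesI)
  fix v ys assume v: "w \<sqsubseteq> v" and y: "stds v (Dy \<Phi>) ys"
  show "tr v (Dm \<Phi> e xs' ys)"
    by (rule Dm_mono[OF assms(1) wle_world[OF v] envs_mono[OF assms(3) v] els_mono[OF assms(4) v] els_mono[OF assms(5) v]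
          stds_els[OF y wle_world[OF v]] ssubs_mono[OF assms(6) v] realizesD[OF assms(7) v y]])
qed

lemma dfn_realizes:
  assumes wf: "wff (rev \<zeta>s @ \<Gamma>) \<Phi>" and e: "envs w \<Gamma> e" and q: "length \<zeta>s = q"
  shows "dfn False w (\<zeta>s @ map Seq (Dx \<Phi>)) (\<lambda>v ts. realizes v \<Phi> (pushes (take q ts) e) (drop q ts))"
proof (rule dfn_cong[OF dfn_AllSts[of True]])
  show "dfn True w ((\<zeta>s @ map Seq (Dx \<Phi>)) @ Dy \<Phi>)
      (\<lambda>v ts. tr v (Dm \<Phi> (pushes (take q ts) e) (take (length (Dx \<Phi>)) (drop q ts)) (drop (length (Dx \<Phi>)) (drop q ts))))"
    using dfn_Dm[OF wf e q refl] by simp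
  fix v ts assume "els v (\<zeta>s @ map Seq (Dx \<Phi>)) ts"
  then have "length ts = q + length (Dx \<Phi>)" using q by (auto dest: list_all2_lengthD)
  then show "(\<forall>u. v \<sqsubseteq> u \<longrightarrow> (\<forall>ys. stds u (Dy \<Phi>) ys \<longrightarrow> tr u (Dm \<Phi> (pushes (take q (ts @ ys)) e)
      (take (length (Dx \<Phi>)) (drop q (ts @ ys))) (drop (length (Dx \<Phi>)) (drop q (ts @ ys)))))) \<longleftrightarrow>
    realizes v \<Phi> (pushes (take q ts) e) (drop q ts)"
    by (simp add: realizes_def)
qed

text \<open>Through this lemma the monotonicity of the matrix enters the principles for
  tuples.\<close>

lemma up_closed_realizes:
  assumes wf: "wff (rev \<zeta>s @ \<Gamma>) \<Phi>" and e: "envs w \<Gamma> e" and q: "length \<zeta>s = q"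
  shows "up_closed w \<zeta>s (Dx \<Phi>) (\<lambda>v ts. realizes v \<Phi> (pushes (take q ts) e) (drop q ts))"
  unfolding up_closed_def
proof (intro allI impI)
  fix v zs us us'
  assume v: "w \<sqsubseteq> v" and z: "els v \<zeta>s zs" and u: "els v (map Seq (Dx \<Phi>)) us" "els v (map Seq (Dx \<Phi>)) us'" "ssubs v (Dx \<Phi>) us us'"
    and r: "realizes v \<Phi> (pushes (take q (zs @ us)) e) (drop q (zs @ us))"
  have l: "length zs = q" using z q by (auto dest: list_all2_lengthD)
  have r': "realizes v \<Phi> (pushes zs e) us" using r l by simp
  have "realizes v \<Phi> (pushes zs e) us'"
    by (rule realizes_ssubs[OF wf wle_world[OF v] envs_pushes[OF z envs_mono[OF e v]] u r'])
  then show "realizes v \<Phi> (pushes (take q (zs @ us')) e) (drop q (zs @ us'))" using l by simp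
qed

subsection \<open>Truth and realizability\<close>

definition realizable :: "world \<Rightarrow> fm \<Rightarrow> (nat \<Rightarrow> tm) \<Rightarrow> bool" where
  "realizable w \<Phi> e \<longleftrightarrow> (\<exists>xs. stds w (map Seq (Dx \<Phi>)) xs \<and> realizes w \<Phi> e xs)"

lemma realizableI: "stds w (map Seq (Dx \<Phi>)) xs \<Longrightarrow> realizes w \<Phi> e xs \<Longrightarrow> realizable w \<Phi> e"
  unfolding realizable_def by blast

lemma realizableE:
  assumes "realizable w \<Phi> e"
  obtains xs where "stds w (map Seq (Dx \<Phi>)) xs" "realizes w \<Phi> e xs"
  using assms unfolding realizable_def by blast

text \<open>Standard fillers for the side of a conjunction or disjunction that is not under
  consideration, as challenges or as witnesses.\<close>

lemma stds_dflt: "world w \<Longrightarrow> stds w \<tau>s (map dflt \<tau>s)"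
  by (induction \<tau>s) (simp_all add: std_dflt)

lemma realizable_And:
  assumes w: "world w"
  shows "realizable w (And \<Phi> \<Psi>) e \<longleftrightarrow> realizable w \<Phi> e \<and> realizable w \<Psi> e"
proof
  assume "realizable w (And \<Phi> \<Psi>) e"
  then obtain xus where xus: "stds w (map Seq (Dx (And \<Phi> \<Psi>))) xus" "realizes w (And \<Phi> \<Psi>) e xus" by (rule realizableE)
  then obtain xs us where x: "xus = xs @ us" "stds w (map Seq (Dx \<Phi>)) xs" "stds w (map Seq (Dx \<Psi>)) us"
    by (auto dest!: list_all2_append1D)
  have l: "length xs = length (Dx \<Phi>)" using x(2) by (auto dest: list_all2_lengthD)
  have *: "tr v (Dm \<Phi> e xs ys) \<and> tr v (Dm \<Psi> e us vs)" if v: "w \<sqsubseteq> v" "stds v (Dy \<Phi>) ys" "stds v (Dy \<Psi>) vs" for v ys vs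
  proof -
    have l': "length ys = length (Dy \<Phi>)" using v(2) by (auto dest: list_all2_lengthD)
    have "stds v (Dy (And \<Phi> \<Psi>)) (ys @ vs)" using v(2,3) by (simp add: list_all2_appendI)
    from realizesD[OF xus(2) v(1) this] show ?thesis unfolding x(1) dm_And[OF wle_world[OF v(1)] l l'] .
  qed
  have "realizes w \<Phi> e xs" by (rule realizesI) (use * stds_dflt wle_world in blast)
  moreover have "realizes w \<Psi> e us" by (rule realizesI) (use * stds_dflt wle_world in blast)
  ultimately show "realizable w \<Phi> e \<and> realizable w \<Psi> e" using x(2,3) by (blast intro: realizableI)
next
  assume "realizable w \<Phi> e \<and> realizable w \<Psi> e"
  then obtain xs us where x: "stds w (map Seq (Dx \<Phi>)) xs" "realizes w \<Phi> e xs" "stds w (map Seq (Dx \<Psi>)) us" "realizes w \<Psi> e us"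
    unfolding realizable_def by blast
  have l: "length xs = length (Dx \<Phi>)" using x(1) by (auto dest: list_all2_lengthD)
  show "realizable w (And \<Phi> \<Psi>) e"
  proof (rule realizableI)
    show "stds w (map Seq (Dx (And \<Phi> \<Psi>))) (xs @ us)" using x(1,3) by (simp add: list_all2_appendI)
    show "realizes w (And \<Phi> \<Psi>) e (xs @ us)"
    proof (rule realizesI)
      fix v yvs assume v: "w \<sqsubseteq> v" and "stds v (Dy (And \<Phi> \<Psi>)) yvs"
      then obtain ys vs where y: "yvs = ys @ vs" "stds v (Dy \<Phi>) ys" "stds v (Dy \<Psi>) vs" by (auto dest!: list_all2_append1D)
      have l': "length ys = length (Dy \<Phi>)" using y(2) by (auto dest: list_all2_lengthD)
      show "tr v (Dm (And \<Phi> \<Psi>) e (xs @ us) yvs)"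
        unfolding y(1) dm_And[OF wle_world[OF v] l l'] using realizesD[OF x(2) v y(2)] realizesD[OF x(4) v y(3)] ..
    qed
  qed
qed

lemma dfn_Dm_const:
  assumes wf: "wff \<Gamma> \<Phi>" and w: "world w" and e: "envs w \<Gamma> e" and xs: "els w (map Seq (Dx \<Phi>)) xs"
  shows "dfn True w (Dy \<Phi>) (\<lambda>v ts. tr v (Dm \<Phi> e xs ts))"
  using dfn_Dm_at[of "[]" \<Gamma> \<Phi> w e 0 xs] assms by simp

lemma dfn_closed: "dfn b w \<sigma>s P \<Longrightarrow> els w \<sigma>s ts \<Longrightarrow> dfn b w [] (\<lambda>v _. P v ts)"
  by (rule dfn_comp[OF _ defts_const])

text \<open>For finitely many challenges to either side the disjunction can be pulled out of the
  bounded quantifiers by \<open>finite_disj\<close>; this is the premise that I requires.\<close>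

lemma realizable_OrD:
  assumes w: "world w" and wf: "wff \<Gamma> (Or \<Phi> \<Psi>)" and e: "envs w \<Gamma> e" and r: "realizable w (Or \<Phi> \<Psi>) e"
  shows "realizable w \<Phi> e \<or> realizable w \<Psi> e"
proof -
  from r obtain xus where xus: "stds w (map Seq (Dx (Or \<Phi> \<Psi>))) xus" "realizes w (Or \<Phi> \<Psi>) e xus" by (rule realizableE)
  then obtain xs us where x: "xus = xs @ us" "stds w (map Seq (Dx \<Phi>)) xs" "stds w (map Seq (Dx \<Psi>)) us"
    by (auto dest!: list_all2_append1D)
  have wf': "wff \<Gamma> \<Phi>" "wff \<Gamma> \<Psi>" using wf by simp_all
  note xe = stds_els[OF x(2) w] stds_els[OF x(3) w]
  have dm: "tr v (Dm \<Phi> e xs ys) \<or> tr v (Dm \<Psi> e us vs)" if v: "w \<sqsubseteq> v" "stds v (Dy \<Phi>) ys" "stds v (Dy \<Psi>) vs" for v ys vs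
  proof -
    note wv = wle_world[OF v(1)]
    have "stds v (Dy (Or \<Phi> \<Psi>)) (ys @ vs)" using v(2,3) by (simp add: list_all2_appendI)
    from realizesD[OF xus(2) v(1) this] show ?thesis
      unfolding x(1) dm_Or[OF wv wf envs_mono[OF e v(1)] els_mono[OF xe(1) v(1)] stds_els[OF v(2) wv] els_mono[OF xe(2) v(1)] stds_els[OF v(3) wv]] .
  qed
  define n where "n = length (Dy \<Phi>)"
  let ?one = "Succ \<cdot> Zero"
  have one: "elt v Base Zero" "elt v Base ?one" for v by (rule elt_closed, simp add: wt_App_iff)+
  \<comment> \<open>The disjunction is rephrased as a statement about a number, 0 for the left side
    and 1 for the right, since I provides an element and does not itself choose a disjunct.\<close>
  let ?P = "\<lambda>v ts. (eqw v Base (ts ! 0) Zero \<and> tr v (Dm \<Phi> e xs (take n (drop 1 ts)))) \<or>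
    (eqw v Base (ts ! 0) ?one \<and> tr v (Dm \<Psi> e us (drop n (drop 1 ts))))"
  let ?L = "Base # Dy \<Phi> @ Dy \<Psi>"
  have "defts w ?L (Dy \<Phi>) (\<lambda>ts. take n (drop 1 ts))"
    using defts_take[OF defts_drop[OF defts_args[OF w, of ?L], of 1], of n] by (simp add: n_def)
  from dfn_comp[OF dfn_Dm_const[OF wf'(1) w e xe(1)] this] have d1: "dfn True w ?L (\<lambda>v ts. tr v (Dm \<Phi> e xs (take n (drop 1 ts))))" .
  have "defts w ?L (Dy \<Psi>) (\<lambda>ts. drop n (drop 1 ts))"
    using defts_drop[OF defts_drop[OF defts_args[OF w, of ?L], of 1], of n] by (simp add: n_def)
  from dfn_comp[OF dfn_Dm_const[OF wf'(2) w e xe(2)] this] have d2: "dfn True w ?L (\<lambda>v ts. tr v (Dm \<Psi> e us (drop n (drop 1 ts))))" .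
  have d: "dfn True w ?L ?P" by (intro dfn_Or dfn_And d1 d2 dfn_eq_hd one)
  have "\<exists>k. elt w Base k \<and> (\<forall>v. w \<sqsubseteq> v \<longrightarrow> (\<forall>ys. stds v (Dy \<Phi> @ Dy \<Psi>) ys \<longrightarrow> ?P v (k # ys)))"
  proof (rule I_tuple[OF w d])
    fix v ss assume v: "w \<sqsubseteq> v" and "stds v (map Seq (Dy \<Phi> @ Dy \<Psi>)) ss"
    then obtain s t where s: "ss = s @ t" "stds v (map Seq (Dy \<Phi>)) s" "stds v (map Seq (Dy \<Psi>)) t" by (auto dest!: list_all2_append1D)
    note wv = wle_world[OF v]
    note se = stds_els[OF s(2) wv] stds_els[OF s(3) wv]
    let ?Q = "\<lambda>u (_ :: tm list). \<forall>u'. u \<sqsubseteq> u' \<longrightarrow> (\<forall>vs. mems u' (Dy \<Psi>) vs t \<longrightarrow> tr u' (Dm \<Psi> e us vs))"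
    have dA: "dfn True v (Dy \<Phi>) (\<lambda>u ts. tr u (Dm \<Phi> e xs ts))" by (rule dfn_Dm_const[OF wf'(1) wv envs_mono[OF e v] els_mono[OF xe(1) v]])
    have dB: "dfn True v (Dy \<Psi>) (\<lambda>u ts. tr u (Dm \<Psi> e us ts))" by (rule dfn_Dm_const[OF wf'(2) wv envs_mono[OF e v] els_mono[OF xe(2) v]])
    have dQ: "dfn True v [] ?Q"
      by (rule dfn_cong[OF dfn_BAlls[where \<sigma>s = "[]" and \<tau>s = "Dy \<Psi>" and S = "\<lambda>_. t" and P = "\<lambda>u ts. tr u (Dm \<Psi> e us ts)"]])
        (use dB defts_const[OF se(2)] in simp_all)
    \<comment> \<open>Two distributions: the outer one over the left challenges and, inside it, with
      a left challenge held fixed, one over the right challenges.\<close>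
    have disj: "(\<forall>u. v \<sqsubseteq> u \<longrightarrow> (\<forall>ys. mems u (Dy \<Phi>) ys s \<longrightarrow> tr u (Dm \<Phi> e xs ys))) \<or> ?Q v []"
    proof (rule finite_disj[OF wv dA dQ se(1)])
      fix u ys assume u: "v \<sqsubseteq> u" and m: "mems u (Dy \<Phi>) ys s"
      note wu = wle_world[OF u]
      have y: "stds u (Dy \<Phi>) ys" by (rule mems_stds[OF m wu stds_mono[OF s(2) u]])
      have "?Q u [] \<or> tr u (Dm \<Phi> e xs ys)"
      proof (rule finite_disj[OF wu dfn_mono[OF dB u] dfn_closed[OF dfn_mono[OF dA u] stds_els[OF y wu]] els_mono[OF se(2) u]])
        fix u' vs assume u': "u \<sqsubseteq> u'" and m': "mems u' (Dy \<Psi>) vs t"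
        have "stds u' (Dy \<Psi>) vs" by (rule mems_stds[OF m' wle_world[OF u'] stds_mono[OF s(3) wle_trans[OF u u']]])
        from dm[OF wle_trans[OF v wle_trans[OF u u']] stds_mono[OF y u'] this]
        show "tr u' (Dm \<Psi> e us vs) \<or> tr u' (Dm \<Phi> e xs ys)" by blast
      qed
      then show "tr u (Dm \<Phi> e xs ys) \<or> ?Q u []" by blast
    qed
    have split: "\<exists>a b. ys = a @ b \<and> length a = n \<and> mems u (Dy \<Phi>) a s \<and> mems u (Dy \<Psi>) b t" if "mems u (Dy \<Phi> @ Dy \<Psi>) ys ss" for u ys
    proof -
      have "mems u (As @ Dy \<Psi>) ys (s' @ t) \<Longrightarrow> length As = length s' \<Longrightarrow>
          \<exists>a b. ys = a @ b \<and> length a = length As \<and> mems u As a s' \<and> mems u (Dy \<Psi>) b t" for As s'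
      proof (induction As arbitrary: s' ys)
        case (Cons \<tau> As)
        from Cons.prems(2) obtain c s'' where s': "s' = c # s''" "length As = length s''" by (cases s') auto
        from Cons.prems(1) s'(1) obtain y ys' where "ys = y # ys'" "mem u \<tau> y c" "mems u (As @ Dy \<Psi>) ys' (s'' @ t)"
          by (auto simp: mems_Cons)
        moreover from Cons.IH[OF this(3) s'(2)] obtain a b where "ys' = a @ b" "length a = length As" "mems u As a s''" "mems u (Dy \<Psi>) b t" by blast
        ultimately show ?case using s'(1) by (intro exI[of _ "y # a"] exI[of _ b]) simp
      qed simp
      from this[of "Dy \<Phi>" s] show ?thesis using that s(1) list_all2_lengthD[OF s(2)] by (simp add: n_def)
    qed
    from disj show "\<exists>k. elt v Base k \<and> (\<forall>u. v \<sqsubseteq> u \<longrightarrow> (\<forall>ys. mems u (Dy \<Phi> @ Dy \<Psi>) ys ss \<longrightarrow> ?P u (k # ys)))"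
    proof
      assume A: "\<forall>u. v \<sqsubseteq> u \<longrightarrow> (\<forall>ys. mems u (Dy \<Phi>) ys s \<longrightarrow> tr u (Dm \<Phi> e xs ys))"
      show ?thesis
      proof (intro exI[of _ Zero] conjI one allI impI)
        fix u ys assume u: "v \<sqsubseteq> u" and "mems u (Dy \<Phi> @ Dy \<Psi>) ys ss"
        then obtain a b where "ys = a @ b" "length a = n" "mems u (Dy \<Phi>) a s" using split by blast
        then show "?P u (Zero # ys)" using A u eqw_refl[OF wle_world[OF u] one(1)] by simp
      qed
    next
      assume B: "?Q v []"
      show ?thesis
      proof (intro exI[of _ ?one] conjI one allI impI)
        fix u ys assume u: "v \<sqsubseteq> u" and "mems u (Dy \<Phi> @ Dy \<Psi>) ys ss"
        then obtain a b where "ys = a @ b" "length a = n" "mems u (Dy \<Psi>) b t" using split by blast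
        then show "?P u (?one # ys)" using B u eqw_refl[OF wle_world[OF u] one(2)] by simp
      qed
    qed
  qed
  then obtain k where k: "elt w Base k" "\<And>v ys. w \<sqsubseteq> v \<Longrightarrow> stds v (Dy \<Phi> @ Dy \<Psi>) ys \<Longrightarrow> ?P v (k # ys)" by blast
  have P: "(eqw v Base k Zero \<and> tr v (Dm \<Phi> e xs ys)) \<or> (eqw v Base k ?one \<and> tr v (Dm \<Psi> e us vs))"
    if "w \<sqsubseteq> v" "stds v (Dy \<Phi>) ys" "stds v (Dy \<Psi>) vs" for v ys vs
    using k(2)[OF that(1) list_all2_appendI[OF that(2,3)]] list_all2_lengthD[OF that(2)] by (simp add: n_def)
  \<comment> \<open>The side is settled at \<open>w\<close> by comparing \<open>k\<close> with zero;
    at every later world the other numeral is then excluded.\<close>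
  from nat_cases_w[OF w k(1)] show ?thesis
  proof
    assume z: "eqw w Base k Zero"
    have "realizes w \<Phi> e xs"
    proof (rule realizesI)
      fix v ys assume v: "w \<sqsubseteq> v" "stds v (Dy \<Phi>) ys"
      note wv = wle_world[OF v(1)]
      have "\<not> eqw v Base k ?one"
        using not_Succ_eq_Zero[OF wv] eq_trans[OF eq_sym[OF wv] tr_mono[OF z v(1)] wv] by blast
      then show "tr v (Dm \<Phi> e xs ys)" using P[OF v stds_dflt[OF wv]] by blast
    qed
    then show ?thesis using realizableI[OF x(2)] by blast
  next
    assume "\<exists>m. elt w Base m \<and> eqw w Base k (Succ \<cdot> m)"
    then obtain m where z: "eqw w Base k (Succ \<cdot> m)" by blast
    have "realizes w \<Psi> e us"
    proof (rule realizesI)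
      fix v vs assume v: "w \<sqsubseteq> v" "stds v (Dy \<Psi>) vs"
      note wv = wle_world[OF v(1)]
      have "\<not> eqw v Base k Zero"
        using not_Succ_eq_Zero[OF wv] eq_trans[OF eq_sym[OF wv tr_mono[OF z v(1)]] _ wv] by blast
      then show "tr v (Dm \<Psi> e us vs)" using P[OF v(1) stds_dflt[OF wv] v(2)] by blast
    qed
    then show ?thesis using realizableI[OF x(3)] by blast
  qed
qed

lemma realizable_Or:
  assumes w: "world w" and wf: "wff \<Gamma> (Or \<Phi> \<Psi>)" and e: "envs w \<Gamma> e"
  shows "realizable w (Or \<Phi> \<Psi>) e \<longleftrightarrow> realizable w \<Phi> e \<or> realizable w \<Psi> e"
proof
  have *: "realizable w (Or \<Phi> \<Psi>) e"
    if x: "stds w (map Seq (Dx \<Phi>)) xs" "stds w (map Seq (Dx \<Psi>)) us" and r: "realizes w \<Phi> e xs \<or> realizes w \<Psi> e us" for xs us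
  proof (rule realizableI)
    show "stds w (map Seq (Dx (Or \<Phi> \<Psi>))) (xs @ us)" using x by (simp add: list_all2_appendI)
    show "realizes w (Or \<Phi> \<Psi>) e (xs @ us)"
    proof (rule realizesI)
      fix v yvs assume v: "w \<sqsubseteq> v" and "stds v (Dy (Or \<Phi> \<Psi>)) yvs"
      then obtain ys vs where y: "yvs = ys @ vs" "stds v (Dy \<Phi>) ys" "stds v (Dy \<Psi>) vs" by (auto dest!: list_all2_append1D)
      note wv = wle_world[OF v]
      show "tr v (Dm (Or \<Phi> \<Psi>) e (xs @ us) yvs)"
        unfolding y(1) dm_Or[OF wv wf envs_mono[OF e v] els_mono[OF stds_els[OF x(1) w] v] stds_els[OF y(2) wv]
            els_mono[OF stds_els[OF x(2) w] v] stds_els[OF y(3) wv]]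
        using r realizesD[OF _ v y(2)] realizesD[OF _ v y(3)] by blast
    qed
  qed
  assume "realizable w \<Phi> e \<or> realizable w \<Psi> e"
  then show "realizable w (Or \<Phi> \<Psi>) e"
    unfolding realizable_def[of w \<Phi>] realizable_def[of w \<Psi>] using * stds_dflt[OF w] by blast
qed (rule realizable_OrD[OF w wf e])

text \<open>\<open>U\<close> applied to \<open>xs\<close> realizes the conclusion. Given a challenge
  \<open>vs\<close>, the sequences \<open>Y\<close> yields are standard, so their entries are
  standard challenges, and these \<open>xs\<close> meets.\<close>

lemma realizable_ImpD:
  assumes w: "world w" and wf: "wff \<Gamma> (Imp \<Phi> \<Psi>)" and e: "envs w \<Gamma> e" and r: "realizable w (Imp \<Phi> \<Psi>) e" and a: "realizable w \<Phi> e"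
  shows "realizable w \<Psi> e"
proof -
  let ?A = "map Seq (Dx \<Phi>)" let ?L = "?A @ Dy \<Psi>"
  from r obtain UY where UY: "stds w (map Seq (Dx (Imp \<Phi> \<Psi>))) UY" "realizes w (Imp \<Phi> \<Psi>) e UY" by (rule realizableE)
  then obtain U Y where U: "UY = U @ Y" "stds w (map (\<lambda>\<tau>. Seq (fty ?A \<tau>)) (Dx \<Psi>)) U"
      "stds w (map (\<lambda>\<tau>. Seq (fty ?L \<tau>)) (Dy \<Phi>)) Y"
    by (auto dest!: list_all2_append1D simp: comp_def)
  from a obtain xs where x: "stds w ?A xs" "realizes w \<Phi> e xs" by (rule realizableE)
  show ?thesis
  proof (rule realizableI[OF stds_sapp_all[OF w U(2) x(1)]], rule realizesI)
    fix v vs assume v: "w \<sqsubseteq> v" and vs: "stds v (Dy \<Psi>) vs"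
    note wv = wle_world[OF v]
    have xv: "stds v ?L (xs @ vs)" using stds_mono[OF x(1) v] vs by (rule list_all2_appendI)
    have Yx: "stds v (map Seq (Dy \<Phi>)) (sapp_all ?L (Dy \<Phi>) Y (xs @ vs))" by (rule stds_sapp_all[OF wv stds_mono[OF U(3) v] xv])
    have "tr v (Dm (Imp \<Phi> \<Psi>) e (U @ Y) (xs @ vs))" using realizesD[OF UY(2) v, of "xs @ vs"] xv U(1) by simp
    moreover have "tr u (Dm \<Phi> e xs ys)" if u: "v \<sqsubseteq> u" and m: "mems u (Dy \<Phi>) ys (sapp_all ?L (Dy \<Phi>) Y (xs @ vs))" for u ys
      by (rule realizesD[OF x(2) wle_trans[OF v u] mems_stds[OF m wle_world[OF u] stds_mono[OF Yx u]]])
    ultimately show "tr v (Dm \<Psi> e (sapp_all ?A (Dx \<Psi>) U xs) vs)"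
      using wle_refl[OF wv]
      unfolding dm_Imp[OF wv wf envs_mono[OF e v] els_mono[OF stds_els[OF U(2) w] v] els_mono[OF stds_els[OF U(3) w] v] els_mono[OF stds_els[OF x(1) w] v] stds_els[OF vs wv]]
      by blast
  qed
qed

text \<open>\<open>U\<close> is obtained from HIP followed by HAC, and then \<open>Y\<close> from
  HGMP followed by HAC. The order is forced: HGMP needs an internal conclusion, and the conclusion
  becomes internal only when \<open>U\<close> and a challenge \<open>vs\<close> are fixed.\<close>

lemma realizable_ImpI:
  assumes w: "world w" and wf: "wff \<Gamma> (Imp \<Phi> \<Psi>)" and e: "envs w \<Gamma> e"
    and imp: "\<And>v. w \<sqsubseteq> v \<Longrightarrow> realizable v \<Phi> e \<Longrightarrow> realizable v \<Psi> e"
  shows "realizable w (Imp \<Phi> \<Psi>) e"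
proof -
  let ?A = "map Seq (Dx \<Phi>)" let ?L = "?A @ Dy \<Psi>"
  define m where "m = length (Dx \<Phi>)"
  define n where "n = length (Dy \<Psi>)"
  have wf': "wff \<Gamma> \<Phi>" "wff \<Gamma> \<Psi>" using wf by simp_all
  have real: "dfn False w (map Seq (Dx \<Theta>)) (\<lambda>v ts. realizes v \<Theta> e ts)" if "wff \<Gamma> \<Theta>" for \<Theta>
    using dfn_realizes[of "[]" \<Gamma> \<Theta> w e 0] that e by simp

  \<comment> \<open>That a fixed \<open>xs\<close> meets every standard challenge is a standard
    universal statement with internal body, the form of premise HIP asks for.\<close>
  have step1: "\<exists>us. stds v (map Seq (Dx \<Psi>)) us \<and> (\<forall>u. v \<sqsubseteq> u \<longrightarrow> realizes u \<Phi> e xs \<longrightarrow> realizes u \<Psi> e us)"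
    if v: "w \<sqsubseteq> v" and xs: "stds v ?A xs" for v xs
  proof -
    note wv = wle_world[OF v]
    have up: "up_closed v [] (Dx \<Psi>) (\<lambda>u ts. realizes u \<Psi> e ts)"
      using up_closed_realizes[of "[]" \<Gamma> \<Psi> v e 0] wf' envs_mono[OF e v] by simp
    show ?thesis unfolding realizes_def[of _ \<Phi>]
    proof (rule HIP_tuple[OF wv dfn_Dm_const[OF wf'(1) wv envs_mono[OF e v] stds_els[OF xs wv]] dfn_mono[OF real[OF wf'(2)] v] up])
      fix u assume u: "v \<sqsubseteq> u" and r: "\<forall>u'. u \<sqsubseteq> u' \<longrightarrow> (\<forall>ys. stds u' (Dy \<Phi>) ys \<longrightarrow> tr u' (Dm \<Phi> e xs ys))"
      have "realizable u \<Phi> e" using r by (intro realizableI[OF stds_mono[OF xs u]]) (simp add: realizes_def)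
      then show "\<exists>us. stds u (map Seq (Dx \<Psi>)) us \<and> realizes u \<Psi> e us" using imp[OF wle_trans[OF v u]] unfolding realizable_def by blast
    qed
  qed

  \<comment> \<open>Enlarging the witnesses of the conclusion keeps this implication true, so HAC
    turns them into functions of \<open>xs\<close>.\<close>
  let ?P = "\<lambda>v ts. \<forall>u. v \<sqsubseteq> u \<longrightarrow> realizes u \<Phi> e (take m ts) \<longrightarrow> realizes u \<Psi> e (drop m ts)"
  obtain U where U: "stds w (map (\<lambda>\<tau>. Seq (fty ?A \<tau>)) (Dx \<Psi>)) U"
    "\<And>v xs. w \<sqsubseteq> v \<Longrightarrow> stds v ?A xs \<Longrightarrow> ?P v (xs @ sapp_all ?A (Dx \<Psi>) U xs)"
  proof -
    let ?M = "?A @ map Seq (Dx \<Psi>)"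
    have "defts w ?M ?A (\<lambda>ts. take m ts)" using defts_take[OF defts_args[OF w, of ?M], of m] by (simp add: m_def)
    from dfn_comp[OF real[OF wf'(1)] this] have d1: "dfn False w ?M (\<lambda>v ts. realizes v \<Phi> e (take m ts))" .
    have "defts w ?M (map Seq (Dx \<Psi>)) (\<lambda>ts. drop m ts)" using defts_drop[OF defts_args[OF w, of ?M], of m] by (simp add: m_def)
    from dfn_comp[OF real[OF wf'(2)] this] have d2: "dfn False w ?M (\<lambda>v ts. realizes v \<Psi> e (drop m ts))" .
    have up: "up_closed w ?A (Dx \<Psi>) ?P"
      unfolding up_closed_def
    proof (intro allI impI)
      fix v xs us us' u
      assume v: "w \<sqsubseteq> v" and x: "els v ?A xs" and us: "els v (map Seq (Dx \<Psi>)) us" "els v (map Seq (Dx \<Psi>)) us'" "ssubs v (Dx \<Psi>) us us'"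
        and P: "?P v (xs @ us)" and u: "v \<sqsubseteq> u" and r: "realizes u \<Phi> e (take m (xs @ us'))"
      have l: "length xs = m" using list_all2_lengthD[OF x] by (simp add: m_def)
      have "realizes u \<Psi> e us" using P u r l by simp
      then show "realizes u \<Psi> e (drop m (xs @ us'))"
        using realizes_ssubs[OF wf'(2) wle_world[OF u] envs_mono[OF e wle_trans[OF v u]] els_mono[OF us(1) u] els_mono[OF us(2) u] ssubs_mono[OF us(3) u]] l by simp
    qed
    have "\<exists>us. stds v (map Seq (Dx \<Psi>)) us \<and> ?P v (xs @ us)" if "w \<sqsubseteq> v" "stds v ?A xs" for v xs
      using step1[OF that] list_all2_lengthD[OF that(2)] by (simp add: m_def)
    from HAC_tuple[OF w dfn_Imp[OF d1 d2] up this] show thesis using that by blast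
  qed
  have U': "realizes u \<Psi> e (sapp_all ?A (Dx \<Psi>) U xs)" if "w \<sqsubseteq> v" "stds v ?A xs" "v \<sqsubseteq> u" "realizes u \<Phi> e xs" for v xs u
    using U(2)[OF that(1,2)] that(3,4) list_all2_lengthD[OF that(2)] by (simp add: m_def)
  have Ue: "els v (map (\<lambda>\<tau>. Seq (fty ?A \<tau>)) (Dx \<Psi>)) U" if "w \<sqsubseteq> v" for v by (rule els_mono[OF stds_els[OF U(1) w] that])

  \<comment> \<open>With \<open>vs\<close> fixed, HGMP reduces the premise to finitely many
    challenges against \<open>xs\<close>.\<close>
  have step3: "\<exists>ss. stds v (map Seq (Dy \<Phi>)) ss \<and> (\<forall>u. v \<sqsubseteq> u \<longrightarrow>
      (\<forall>u'. u \<sqsubseteq> u' \<longrightarrow> (\<forall>ys. mems u' (Dy \<Phi>) ys ss \<longrightarrow> tr u' (Dm \<Phi> e xs ys))) \<longrightarrow> tr u (Dm \<Psi> e (sapp_all ?A (Dx \<Psi>) U xs) vs))"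
    if v: "w \<sqsubseteq> v" and xs: "stds v ?A xs" and vs: "stds v (Dy \<Psi>) vs" for v xs vs
  proof -
    note wv = wle_world[OF v]
    have Q: "dfn True v [] (\<lambda>u _. tr u (Dm \<Psi> e (sapp_all ?A (Dx \<Psi>) U xs) vs))"
      by (rule dfn_closed[OF dfn_Dm_const[OF wf'(2) wv envs_mono[OF e v] els_sapp_all[OF Ue[OF v] stds_els[OF xs wv]]] stds_els[OF vs wv]])
    show ?thesis
    proof (rule HGMP_tuple[OF wv dfn_Dm_const[OF wf'(1) wv envs_mono[OF e v] stds_els[OF xs wv]] Q])
      fix u assume u: "v \<sqsubseteq> u" and "\<forall>u'. u \<sqsubseteq> u' \<longrightarrow> (\<forall>ys. stds u' (Dy \<Phi>) ys \<longrightarrow> tr u' (Dm \<Phi> e xs ys))"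
      then have "realizes u \<Phi> e xs" by (simp add: realizes_def)
      from realizesD[OF U'[OF v xs u this] wle_refl[OF wle_world[OF u]] stds_mono[OF vs u]]
      show "tr u (Dm \<Psi> e (sapp_all ?A (Dx \<Psi>) U xs) vs)" .
    qed
  qed

  \<comment> \<open>The tuple \<open>ts\<close> consists of \<open>xs\<close>, \<open>vs\<close> and
    the sequences of challenges, with \<open>m\<close>, \<open>n\<close> and
    \<open>length (Dy \<Phi>)\<close> entries. More challenges strengthen the premise, so the
    predicate is monotone in these sequences and HAC applies again.\<close>
  let ?R = "\<lambda>v ts. \<forall>u. v \<sqsubseteq> u \<longrightarrow>
    (\<forall>u'. u \<sqsubseteq> u' \<longrightarrow> (\<forall>ys. mems u' (Dy \<Phi>) ys (drop (m + n) ts) \<longrightarrow> tr u' (Dm \<Phi> e (take m ts) ys))) \<longrightarrow>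
    tr u (Dm \<Psi> e (sapp_all ?A (Dx \<Psi>) U (take m ts)) (take n (drop m ts)))"
  obtain Y where Y: "stds w (map (\<lambda>\<tau>. Seq (fty ?L \<tau>)) (Dy \<Phi>)) Y"
    "\<And>v xvs. w \<sqsubseteq> v \<Longrightarrow> stds v ?L xvs \<Longrightarrow> ?R v (xvs @ sapp_all ?L (Dy \<Phi>) Y xvs)"
  proof -
    let ?N = "?L @ map Seq (Dy \<Phi>)"
    have M: "dfn True w (map Seq (Dx \<Theta>) @ Dy \<Theta>) (\<lambda>v ts. tr v (Dm \<Theta> e (take (length (Dx \<Theta>)) ts) (drop (length (Dx \<Theta>)) ts)))" if "wff \<Gamma> \<Theta>" for \<Theta>
      using dfn_Dm[of "[]" \<Gamma> \<Theta> w e 0] that e by simp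
    have x: "defts w (?N @ \<rho>s) ?A (\<lambda>ts. take m ts)" for \<rho>s using defts_take[OF defts_args[OF w, of "?N @ \<rho>s"], of m] by (simp add: m_def)
    have y: "defts w (?N @ Dy \<Phi>) (Dy \<Phi>) (\<lambda>ts. drop (m + n + length (Dy \<Phi>)) ts)"
      using defts_drop[OF defts_args[OF w, of "?N @ Dy \<Phi>"], of "m + n + length (Dy \<Phi>)"] by (simp add: m_def n_def)
    have d0: "dfn True w (?N @ Dy \<Phi>) (\<lambda>v ts. tr v (Dm \<Phi> e (take m ts) (drop (m + n + length (Dy \<Phi>)) ts)))"
    proof (rule dfn_cong[OF dfn_comp[OF M[OF wf'(1)] defts_append[OF x y]]])
      fix v ts assume "els v (?N @ Dy \<Phi>) ts"
      then have "length ts \<ge> m" by (auto simp: m_def dest: list_all2_lengthD)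
      then show "tr v (Dm \<Phi> e (take (length (Dx \<Phi>)) (take m ts @ drop (m + n + length (Dy \<Phi>)) ts)) (drop (length (Dx \<Phi>)) (take m ts @ drop (m + n + length (Dy \<Phi>)) ts))) \<longleftrightarrow>
          tr v (Dm \<Phi> e (take m ts) (drop (m + n + length (Dy \<Phi>)) ts))" by (simp add: m_def)
    qed
    have S: "defts w ?N (map Seq (Dy \<Phi>)) (\<lambda>ts. drop (m + n) ts)"
      using defts_drop[OF defts_args[OF w, of ?N], of "m + n"] by (simp add: m_def n_def)
    have d1: "dfn True w ?N (\<lambda>v ts. \<forall>u. v \<sqsubseteq> u \<longrightarrow> (\<forall>ys. mems u (Dy \<Phi>) ys (drop (m + n) ts) \<longrightarrow> tr u (Dm \<Phi> e (take m ts) ys)))"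
    proof (rule dfn_cong[OF dfn_BAlls[OF d0 S]])
      fix v ts assume "els v ?N ts"
      then have "length ts = m + n + length (Dy \<Phi>)" by (auto simp: m_def n_def dest: list_all2_lengthD)
      then show "(\<forall>u. v \<sqsubseteq> u \<longrightarrow> (\<forall>ys. mems u (Dy \<Phi>) ys (drop (m + n) ts) \<longrightarrow>
            tr u (Dm \<Phi> e (take m (ts @ ys)) (drop (m + n + length (Dy \<Phi>)) (ts @ ys))))) \<longleftrightarrow>
          (\<forall>u. v \<sqsubseteq> u \<longrightarrow> (\<forall>ys. mems u (Dy \<Phi>) ys (drop (m + n) ts) \<longrightarrow> tr u (Dm \<Phi> e (take m ts) ys)))" by simp
    qed
    have x': "defts w ?N ?A (\<lambda>ts. take m ts)" using x[of "[]"] by simp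
    have v': "defts w ?N (Dy \<Psi>) (\<lambda>ts. take n (drop m ts))"
      using defts_take[OF defts_drop[OF defts_args[OF w, of ?N], of m], of n] by (simp add: m_def n_def)
    have Ux: "defts w ?N (map Seq (Dx \<Psi>)) (\<lambda>ts. sapp_all ?A (Dx \<Psi>) U (take m ts))"
      by (rule defts_sapps[OF defts_const[OF Ue[OF wle_refl[OF w]]] x'])
    have d2: "dfn True w ?N (\<lambda>v ts. tr v (Dm \<Psi> e (sapp_all ?A (Dx \<Psi>) U (take m ts)) (take n (drop m ts))))"
      using dfn_comp[OF M[OF wf'(2)] defts_append[OF Ux v']] list_all2_lengthD[OF U(1)] by simp
    have up: "up_closed w ?L (Dy \<Phi>) ?R"
      unfolding up_closed_def
    proof (intro allI impI)
      fix v xs ss ss' u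
      assume v: "w \<sqsubseteq> v" and x: "els v ?L xs" and ss: "ssubs v (Dy \<Phi>) ss ss'" and u: "v \<sqsubseteq> u" and R: "?R v (xs @ ss)"
        and h: "\<forall>u'. u \<sqsubseteq> u' \<longrightarrow> (\<forall>ys. mems u' (Dy \<Phi>) ys (drop (m + n) (xs @ ss')) \<longrightarrow> tr u' (Dm \<Phi> e (take m (xs @ ss')) ys))"
      have l: "length xs = m + n" using list_all2_lengthD[OF x] by (simp add: m_def n_def)
      have "tr u' (Dm \<Phi> e (take m (xs @ ss)) ys)" if u': "u \<sqsubseteq> u'" and my: "mems u' (Dy \<Phi>) ys (drop (m + n) (xs @ ss))" for u' ys
        using h u' mems_ssubs[OF _ ssubs_mono[OF ss wle_trans[OF u u']] wle_world[OF u'], of ys] my l by simp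
      then have "tr u (Dm \<Psi> e (sapp_all ?A (Dx \<Psi>) U (take m (xs @ ss))) (take n (drop m (xs @ ss))))" using R u by blast
      then show "tr u (Dm \<Psi> e (sapp_all ?A (Dx \<Psi>) U (take m (xs @ ss'))) (take n (drop m (xs @ ss'))))" using l by simp
    qed
    have "\<exists>ss. stds v (map Seq (Dy \<Phi>)) ss \<and> ?R v (xvs @ ss)" if v: "w \<sqsubseteq> v" and xvs: "stds v ?L xvs" for v xvs
    proof -
      from xvs obtain xs vs where x: "xvs = xs @ vs" "stds v ?A xs" "stds v (Dy \<Psi>) vs" by (auto dest!: list_all2_append1D)
      have "length xs = m" "length vs = n" using list_all2_lengthD[OF x(2)] list_all2_lengthD[OF x(3)] by (simp_all add: m_def n_def)
      then show ?thesis using step3[OF v x(2,3)] by (simp add: x(1))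
    qed
    from HAC_tuple[OF w dfn_False[OF dfn_Imp[OF d1 d2]] up this] show thesis using that by blast
  qed
  show ?thesis
  proof (rule realizableI)
    show "stds w (map Seq (Dx (Imp \<Phi> \<Psi>))) (U @ Y)" using list_all2_appendI[OF U(1) Y(1)] by (simp add: comp_def)
    show "realizes w (Imp \<Phi> \<Psi>) e (U @ Y)"
    proof (rule realizesI)
      fix v xvs assume v: "w \<sqsubseteq> v" and xvs: "stds v (Dy (Imp \<Phi> \<Psi>)) xvs"
      then obtain xs vs where x: "xvs = xs @ vs" "stds v ?A xs" "stds v (Dy \<Psi>) vs" by (auto dest!: list_all2_append1D)
      note wv = wle_world[OF v]
      have l: "length xs = m" "length vs = n" using list_all2_lengthD[OF x(2)] list_all2_lengthD[OF x(3)] by (simp_all add: m_def n_def)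
      have R: "?R v (xvs @ sapp_all ?L (Dy \<Phi>) Y xvs)" using Y(2)[OF v] xvs by simp
      show "tr v (Dm (Imp \<Phi> \<Psi>) e (U @ Y) xvs)"
        unfolding x(1) dm_Imp[OF wv wf envs_mono[OF e v] Ue[OF v] els_mono[OF stds_els[OF Y(1) w] v] stds_els[OF x(2) wv] stds_els[OF x(3) wv]]
        using R l by (simp add: x(1))
    qed
  qed
qed

text \<open>One tuple has to serve all elements \<open>z\<close>, nonstandard ones included, without
  depending on them. NCR provides this uniformity once its candidates can be merged.\<close>

lemma realizable_All:
  assumes w: "world w" and wf: "wff \<Gamma> (All \<sigma> \<Phi>)" and e: "envs w \<Gamma> e"
  shows "realizable w (All \<sigma> \<Phi>) e \<longleftrightarrow> (\<forall>v. w \<sqsubseteq> v \<longrightarrow> (\<forall>z. elt v \<sigma> z \<longrightarrow> realizable v \<Phi> (z ## e)))"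
proof
  assume "realizable w (All \<sigma> \<Phi>) e"
  then obtain xs where x: "stds w (map Seq (Dx \<Phi>)) xs" "realizes w (All \<sigma> \<Phi>) e xs" unfolding realizable_def by auto
  show "\<forall>v. w \<sqsubseteq> v \<longrightarrow> (\<forall>z. elt v \<sigma> z \<longrightarrow> realizable v \<Phi> (z ## e))"
  proof (intro allI impI)
    fix v z assume v: "w \<sqsubseteq> v" and z: "elt v \<sigma> z"
    show "realizable v \<Phi> (z ## e)"
    proof (rule realizableI[OF stds_mono[OF x(1) v]], rule realizesI)
      fix u ys assume u: "v \<sqsubseteq> u" and y: "stds u (Dy \<Phi>) ys"
      note wu = wle_trans[OF v u] and wu' = wle_world[OF u]
      have "tr u (Dm (All \<sigma> \<Phi>) e xs ys)" using realizesD[OF x(2) wu] y by simp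
      then show "tr u (Dm \<Phi> (z ## e) xs ys)"
        unfolding dm_All[OF wu' wf envs_mono[OF e wu] els_mono[OF stds_els[OF x(1) w] wu] stds_els[OF y wu']]
        using wle_refl[OF wu'] elt_mono[OF z u] by blast
    qed
  qed
next
  assume r: "\<forall>v. w \<sqsubseteq> v \<longrightarrow> (\<forall>z. elt v \<sigma> z \<longrightarrow> realizable v \<Phi> (z ## e))"
  have wf': "wff (rev [\<sigma>] @ \<Gamma>) \<Phi>" using wf by simp
  let ?P = "\<lambda>v ts. realizes v \<Phi> (pushes (take 1 ts) e) (drop 1 ts)"
  have "\<exists>us. stds w (map Seq (Dx \<Phi>)) us \<and> (\<forall>v. w \<sqsubseteq> v \<longrightarrow> (\<forall>z. elt v \<sigma> z \<longrightarrow> ?P v (z # us)))"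
  proof (rule NCR_tuple[OF w])
    show "dfn False w (\<sigma> # map Seq (Dx \<Phi>)) ?P" using dfn_realizes[OF wf' e, of 1] by simp
    show "up_closed w [\<sigma>] (Dx \<Phi>) ?P" by (rule up_closed_realizes[OF wf' e]) simp
    show "\<exists>us. stds v (map Seq (Dx \<Phi>)) us \<and> ?P v (z # us)" if "w \<sqsubseteq> v" "elt v \<sigma> z" for v z
      using r that unfolding realizable_def by simp
  qed
  then obtain us where u: "stds w (map Seq (Dx \<Phi>)) us" "\<And>v z. w \<sqsubseteq> v \<Longrightarrow> elt v \<sigma> z \<Longrightarrow> realizes v \<Phi> (z ## e) us" by auto
  show "realizable w (All \<sigma> \<Phi>) e"
  proof (rule realizableI)
    show "stds w (map Seq (Dx (All \<sigma> \<Phi>))) us" using u(1) by simp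
    show "realizes w (All \<sigma> \<Phi>) e us"
    proof (rule realizesI)
      fix v ys assume v: "w \<sqsubseteq> v" and "stds v (Dy (All \<sigma> \<Phi>)) ys"
      then have y: "stds v (Dy \<Phi>) ys" by simp
      note wv = wle_world[OF v]
      show "tr v (Dm (All \<sigma> \<Phi>) e us ys)"
        unfolding dm_All[OF wv wf envs_mono[OF e v] els_mono[OF stds_els[OF u(1) w] v] stds_els[OF y wv]]
      proof (intro allI impI)
        fix v' z assume v': "v \<sqsubseteq> v'" and z: "elt v' \<sigma> z"
        show "tr v' (Dm \<Phi> (z ## e) us ys)"
          by (rule realizesD[OF u(2)[OF wle_trans[OF v v'] z] wle_refl[OF wle_world[OF v']] stds_mono[OF y v']])
      qed
    qed
  qed
qed

text \<open>For standard \<open>z\<close> the witnesses may depend on \<open>z\<close>; HAC collects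
  them into functions, and \<open>sapp\<close> evaluates these.\<close>

lemma realizable_AllSt:
  assumes w: "world w" and wf: "wff \<Gamma> (AllSt \<sigma> \<Phi>)" and e: "envs w \<Gamma> e"
  shows "realizable w (AllSt \<sigma> \<Phi>) e \<longleftrightarrow> (\<forall>v. w \<sqsubseteq> v \<longrightarrow> (\<forall>z. std v \<sigma> z \<longrightarrow> realizable v \<Phi> (z ## e)))"
proof
  assume "realizable w (AllSt \<sigma> \<Phi>) e"
  then obtain X where X: "stds w (map Seq (Dx (AllSt \<sigma> \<Phi>))) X" "realizes w (AllSt \<sigma> \<Phi>) e X" by (rule realizableE)
  have X': "stds w (map (\<lambda>\<tau>. Seq (fty [\<sigma>] \<tau>)) (Dx \<Phi>)) X" using X(1) by (simp add: comp_def)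
  show "\<forall>v. w \<sqsubseteq> v \<longrightarrow> (\<forall>z. std v \<sigma> z \<longrightarrow> realizable v \<Phi> (z ## e))"
  proof (intro allI impI)
    fix v z assume v: "w \<sqsubseteq> v" and z: "std v \<sigma> z"
    have z': "stds v [\<sigma>] [z]" using z by simp
    show "realizable v \<Phi> (z ## e)"
    proof (rule realizableI[OF stds_sapp_all[OF wle_world[OF v] stds_mono[OF X' v] z']], rule realizesI)
      fix u ys assume u: "v \<sqsubseteq> u" and y: "stds u (Dy \<Phi>) ys"
      have "stds u (Dy (AllSt \<sigma> \<Phi>)) (z # ys)" using y tr_mono[OF z u] by simp
      from realizesD[OF X(2) wle_trans[OF v u] this]
      show "tr u (Dm \<Phi> (z ## e) (sapp_all [\<sigma>] (Dx \<Phi>) X [z]) ys)" unfolding dm_AllSt .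
    qed
  qed
next
  assume r: "\<forall>v. w \<sqsubseteq> v \<longrightarrow> (\<forall>z. std v \<sigma> z \<longrightarrow> realizable v \<Phi> (z ## e))"
  have wf': "wff (rev [\<sigma>] @ \<Gamma>) \<Phi>" using wf by simp
  let ?P = "\<lambda>v ts. realizes v \<Phi> (pushes (take 1 ts) e) (drop 1 ts)"
  have "\<exists>X. stds w (map (\<lambda>\<tau>. Seq (fty [\<sigma>] \<tau>)) (Dx \<Phi>)) X \<and>
    (\<forall>v. w \<sqsubseteq> v \<longrightarrow> (\<forall>zs. stds v [\<sigma>] zs \<longrightarrow> ?P v (zs @ sapp_all [\<sigma>] (Dx \<Phi>) X zs)))"
  proof (rule HAC_tuple[OF w])
    show "dfn False w ([\<sigma>] @ map Seq (Dx \<Phi>)) ?P" by (rule dfn_realizes[OF wf' e]) simp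
    show "up_closed w [\<sigma>] (Dx \<Phi>) ?P" by (rule up_closed_realizes[OF wf' e]) simp
    fix v zs assume v: "w \<sqsubseteq> v" and "stds v [\<sigma>] zs"
    then obtain z where "zs = [z]" "std v \<sigma> z" by (auto dest!: list_all2_Cons1D)
    then show "\<exists>us. stds v (map Seq (Dx \<Phi>)) us \<and> ?P v (zs @ us)" using r v unfolding realizable_def by simp
  qed
  then obtain X where X: "stds w (map (\<lambda>\<tau>. Seq (fty [\<sigma>] \<tau>)) (Dx \<Phi>)) X"
    and X': "\<And>v zs. w \<sqsubseteq> v \<Longrightarrow> stds v [\<sigma>] zs \<Longrightarrow> ?P v (zs @ sapp_all [\<sigma>] (Dx \<Phi>) X zs)"
    by blast
  show "realizable w (AllSt \<sigma> \<Phi>) e"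
  proof (rule realizableI)
    show "stds w (map Seq (Dx (AllSt \<sigma> \<Phi>))) X" using X by (simp add: comp_def)
    show "realizes w (AllSt \<sigma> \<Phi>) e X"
    proof (rule realizesI)
      fix v zys assume v: "w \<sqsubseteq> v" and "stds v (Dy (AllSt \<sigma> \<Phi>)) zys"
      then obtain z ys where z: "zys = z # ys" "std v \<sigma> z" "stds v (Dy \<Phi>) ys" by (auto dest!: list_all2_Cons1D)
      have "realizes v \<Phi> (z ## e) (sapp_all [\<sigma>] (Dx \<Phi>) X [z])" using X'[OF v, of "[z]"] z(2) by simp
      from realizesD[OF this wle_refl[OF wle_world[OF v]] z(3)] show "tr v (Dm (AllSt \<sigma> \<Phi>) e X zys)" unfolding z(1) dm_AllSt .
    qed
  qed
qed

text \<open>The matrix only offers a \<open>z\<close> that meets finitely many challenges at a time;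
  I turns this into a single \<open>z\<close> for all standard challenges. Conversely such a
  \<open>z\<close> meets every standard finite sequence of challenges, whose entries are
  standard.\<close>

lemma realizable_Ex:
  assumes w: "world w" and wf: "wff \<Gamma> (Ex \<sigma> \<Phi>)" and e: "envs w \<Gamma> e"
  shows "realizable w (Ex \<sigma> \<Phi>) e \<longleftrightarrow> (\<exists>z. elt w \<sigma> z \<and> realizable w \<Phi> (z ## e))"
proof
  assume "realizable w (Ex \<sigma> \<Phi>) e"
  then obtain xs where x: "stds w (map Seq (Dx \<Phi>)) xs" "realizes w (Ex \<sigma> \<Phi>) e xs" unfolding realizable_def by auto
  note xe = stds_els[OF x(1) w]
  have wf': "wff (rev [\<sigma>] @ \<Gamma>) \<Phi>" using wf by simp
  let ?P = "\<lambda>v ts. tr v (Dm \<Phi> (pushes (take 1 ts) e) xs (drop 1 ts))"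
  have d: "dfn True w (\<sigma> # Dy \<Phi>) ?P" using dfn_Dm_at[OF wf' w e _ xe, of 1] by simp
  have "\<exists>z. elt w \<sigma> z \<and> (\<forall>v. w \<sqsubseteq> v \<longrightarrow> (\<forall>ys. stds v (Dy \<Phi>) ys \<longrightarrow> ?P v (z # ys)))"
  proof (rule I_tuple[OF w d])
    fix v ss assume v: "w \<sqsubseteq> v" and s: "stds v (map Seq (Dy \<Phi>)) ss"
    note wv = wle_world[OF v]
    have "tr v (Dm (Ex \<sigma> \<Phi>) e xs ss)" using realizesD[OF x(2) v] s by simp
    then show "\<exists>z. elt v \<sigma> z \<and> (\<forall>u. v \<sqsubseteq> u \<longrightarrow> (\<forall>ys. mems u (Dy \<Phi>) ys ss \<longrightarrow> ?P u (z # ys)))"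
      unfolding dm_Ex[OF wv wf envs_mono[OF e v] els_mono[OF xe v] stds_els[OF s wv]] by simp
  qed
  then show "\<exists>z. elt w \<sigma> z \<and> realizable w \<Phi> (z ## e)" using x(1) unfolding realizable_def realizes_def by auto
next
  assume "\<exists>z. elt w \<sigma> z \<and> realizable w \<Phi> (z ## e)"
  then obtain z xs where z: "elt w \<sigma> z" and x: "stds w (map Seq (Dx \<Phi>)) xs" "realizes w \<Phi> (z ## e) xs"
    unfolding realizable_def by blast
  show "realizable w (Ex \<sigma> \<Phi>) e"
  proof (rule realizableI)
    show "stds w (map Seq (Dx (Ex \<sigma> \<Phi>))) xs" using x(1) by simp
    show "realizes w (Ex \<sigma> \<Phi>) e xs"
    proof (rule realizesI)
      fix v ss assume v: "w \<sqsubseteq> v" and "stds v (Dy (Ex \<sigma> \<Phi>)) ss"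
      then have s: "stds v (map Seq (Dy \<Phi>)) ss" by simp
      note wv = wle_world[OF v]
      have "tr u (Dm \<Phi> (z ## e) xs ys)" if u: "v \<sqsubseteq> u" and m: "mems u (Dy \<Phi>) ys ss" for u ys
        by (rule realizesD[OF x(2) wle_trans[OF v u] mems_stds[OF m wle_world[OF u] stds_mono[OF s u]]])
      then show "tr v (Dm (Ex \<sigma> \<Phi>) e xs ss)"
        unfolding dm_Ex[OF wv wf envs_mono[OF e v] els_mono[OF stds_els[OF x(1) w] v] stds_els[OF s wv]]
        using elt_mono[OF z v] by blast
    qed
  qed
qed

lemma realizable_ExSt:
  assumes w: "world w" and wf: "wff \<Gamma> (ExSt \<sigma> \<Phi>)" and e: "envs w \<Gamma> e"
  shows "realizable w (ExSt \<sigma> \<Phi>) e \<longleftrightarrow> (\<exists>z. std w \<sigma> z \<and> realizable w \<Phi> (z ## e))"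
proof
  assume "realizable w (ExSt \<sigma> \<Phi>) e"
  then obtain xZ where xZ: "stds w (map Seq (Dx (ExSt \<sigma> \<Phi>))) xZ" "realizes w (ExSt \<sigma> \<Phi>) e xZ" by (rule realizableE)
  then obtain xs Z where x: "xZ = xs @ [Z]" "stds w (map Seq (Dx \<Phi>)) xs" "std w (Seq \<sigma>) Z"
    by (auto dest!: list_all2_append1D list_all2_Cons1D)
  note xe = stds_els[OF x(2) w]
  have wf': "wff (rev [\<sigma>] @ \<Gamma>) \<Phi>" using wf by simp
  \<comment> \<open>Membership in \<open>Z\<close> is part of the predicate handed to I: the element
    obtained is then an entry of a standard sequence and hence standard.\<close>
  let ?P = "\<lambda>v ts. mem v \<sigma> (ts ! 0) Z \<and> tr v (Dm \<Phi> (pushes (take 1 ts) e) xs (drop 1 ts))"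
  have d: "dfn True w (\<sigma> # Dy \<Phi>) ?P"
    using dfn_Dm_at[OF wf' w e _ xe, of 1] by (intro dfn_And dfn_mem_hd[OF std_elt[OF w x(3)]]) simp
  have "\<exists>z. elt w \<sigma> z \<and> (\<forall>v. w \<sqsubseteq> v \<longrightarrow> (\<forall>ys. stds v (Dy \<Phi>) ys \<longrightarrow> ?P v (z # ys)))"
  proof (rule I_tuple[OF w d])
    fix v ss assume v: "w \<sqsubseteq> v" and s: "stds v (map Seq (Dy \<Phi>)) ss"
    note wv = wle_world[OF v]
    have "tr v (Dm (ExSt \<sigma> \<Phi>) e (xs @ [Z]) ss)" using realizesD[OF xZ(2) v] s x(1) by simp
    then obtain z where z: "mem v \<sigma> z Z" "\<And>u ys. v \<sqsubseteq> u \<Longrightarrow> mems u (Dy \<Phi>) ys ss \<Longrightarrow> tr u (Dm \<Phi> (z ## e) xs ys)"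
      unfolding dm_ExSt[OF wv wf envs_mono[OF e v] els_mono[OF xe v] elt_mono[OF std_elt[OF w x(3)] v] stds_els[OF s wv]] by blast
    show "\<exists>z. elt v \<sigma> z \<and> (\<forall>u. v \<sqsubseteq> u \<longrightarrow> (\<forall>ys. mems u (Dy \<Phi>) ys ss \<longrightarrow> ?P u (z # ys)))"
    proof (intro exI[of _ z] conjI allI impI)
      show "elt v \<sigma> z" by (rule mem_elt(1)[OF wv z(1)])
      fix u ys assume u: "v \<sqsubseteq> u" "mems u (Dy \<Phi>) ys ss"
      show "mem u \<sigma> ((z # ys) ! 0) Z" using tr_mono[OF z(1) u(1)] by simp
      show "tr u (Dm \<Phi> (pushes (take 1 (z # ys)) e) xs (drop 1 (z # ys)))" using z(2)[OF u] by simp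
    qed
  qed
  then obtain z where z: "\<And>v ys. w \<sqsubseteq> v \<Longrightarrow> stds v (Dy \<Phi>) ys \<Longrightarrow> mem v \<sigma> z Z \<and> tr v (Dm \<Phi> (z ## e) xs ys)" by auto
  \<comment> \<open>Membership is available only together with a challenge, so default challenges
    are supplied.\<close>
  have "mem w \<sigma> z Z" using z[OF wle_refl[OF w] stds_dflt[OF w]] by blast
  then have "std w \<sigma> z" by (rule mem_std[OF w x(3)])
  moreover have "realizes w \<Phi> (z ## e) xs" by (rule realizesI) (use z in blast)
  ultimately show "\<exists>z. std w \<sigma> z \<and> realizable w \<Phi> (z ## e)" using realizableI[OF x(2)] by blast
next
  assume "\<exists>z. std w \<sigma> z \<and> realizable w \<Phi> (z ## e)"
  then obtain z xs where z: "std w \<sigma> z" and x: "stds w (map Seq (Dx \<Phi>)) xs" "realizes w \<Phi> (z ## e) xs"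
    unfolding realizable_def by blast
  let ?Z = "Prep \<sigma> \<cdot> z \<cdot> Emp \<sigma>"
  have Z: "std w (Seq \<sigma>) ?Z" using std_Prep[OF w z] std_dflt[OF w, of "Seq \<sigma>"] by simp
  have zZ: "mem w \<sigma> z ?Z" using mem_single[OF w std_elt[OF w z]] eqw_refl[OF w std_elt[OF w z]] by blast
  show "realizable w (ExSt \<sigma> \<Phi>) e"
  proof (rule realizableI)
    show "stds w (map Seq (Dx (ExSt \<sigma> \<Phi>))) (xs @ [?Z])" using list_all2_appendI[OF x(1), of "[Seq \<sigma>]" "[?Z]"] Z by simp
    show "realizes w (ExSt \<sigma> \<Phi>) e (xs @ [?Z])"
    proof (rule realizesI)
      fix v ss assume v: "w \<sqsubseteq> v" and "stds v (Dy (ExSt \<sigma> \<Phi>)) ss"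
      then have s: "stds v (map Seq (Dy \<Phi>)) ss" by simp
      note wv = wle_world[OF v]
      have "tr u (Dm \<Phi> (z ## e) xs ys)" if u: "v \<sqsubseteq> u" and m: "mems u (Dy \<Phi>) ys ss" for u ys
        by (rule realizesD[OF x(2) wle_trans[OF v u] mems_stds[OF m wle_world[OF u] stds_mono[OF s u]]])
      then show "tr v (Dm (ExSt \<sigma> \<Phi>) e (xs @ [?Z]) ss)"
        unfolding dm_ExSt[OF wv wf envs_mono[OF e v] els_mono[OF stds_els[OF x(1) w] v] elt_mono[OF std_elt[OF w Z] v] stds_els[OF s wv]]
        using tr_mono[OF zZ v] by blast
    qed
  qed
qed

text \<open>In one direction entries of a standard sequence are standard; in the other the
  one-element sequence is a witness.\<close>

lemma realizable_St:
  assumes w: "world w" and wf: "wff \<Gamma> (St \<sigma> t)" and e: "envs w \<Gamma> e"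
  shows "realizable w (St \<sigma> t) e \<longleftrightarrow> std w \<sigma> (sub e t)"
proof
  assume "realizable w (St \<sigma> t) e"
  then obtain xs where x: "stds w [Seq \<sigma>] xs" "realizes w (St \<sigma> t) e xs" unfolding realizable_def by auto
  then obtain s where s: "xs = [s]" "std w (Seq \<sigma>) s" by (auto dest!: list_all2_Cons1D)
  have "mem w \<sigma> (sub e t) s" using realizesD[OF x(2) wle_refl[OF w], of "[]"] s(1) by simp
  then show "std w \<sigma> (sub e t)" by (rule mem_std[OF w s(2)])
next
  assume z: "std w \<sigma> (sub e t)"
  let ?Z = "Prep \<sigma> \<cdot> sub e t \<cdot> Emp \<sigma>"
  have Z: "std w (Seq \<sigma>) ?Z" using std_Prep[OF w z] std_dflt[OF w, of "Seq \<sigma>"] by simp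
  have zZ: "mem w \<sigma> (sub e t) ?Z" using mem_single[OF w std_elt[OF w z]] eqw_refl[OF w std_elt[OF w z]] by blast
  show "realizable w (St \<sigma> t) e"
    by (rule realizableI[of _ _ "[?Z]"], use Z in simp, rule realizesI) (use tr_mono[OF zZ] in auto)
qed

theorem fc_iff_realizable:
  "wff \<Gamma> \<Phi> \<Longrightarrow> world w \<Longrightarrow> envs w \<Gamma> e \<Longrightarrow> fc w \<Gamma> e \<Phi> \<longleftrightarrow> realizable w \<Phi> e"
proof (induction \<Phi> arbitrary: \<Gamma> w e)
  case (Eq \<sigma> s t)
  then show ?case using tr_mono wle_refl[OF Eq.prems(2)] unfolding realizable_def realizes_def by simp blast
next
  case Bot
  then show ?case using wle_refl[OF Bot.prems(2)] tr_Bot unfolding realizable_def realizes_def by auto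
next
  case (St \<sigma> t)
  show ?case unfolding fc_St realizable_St[OF St.prems(2,1,3)] ..
next
  case (And \<Phi> \<Psi>)
  then show ?case by (simp add: realizable_And)
next
  case (Or \<Phi> \<Psi>)
  have wf: "wff \<Gamma> \<Phi>" "wff \<Gamma> \<Psi>" using Or.prems(1) by simp_all
  show ?case
    unfolding fc_Or[OF Or.prems(2) wf Or.prems(3)] Or.IH(1)[OF wf(1) Or.prems(2,3)] Or.IH(2)[OF wf(2) Or.prems(2,3)]
      realizable_Or[OF Or.prems(2,1,3)] ..
next
  case (Imp \<Phi> \<Psi>)
  note w = Imp.prems(2) and e = Imp.prems(3)
  have wf: "wff \<Gamma> \<Phi>" "wff \<Gamma> \<Psi>" using Imp.prems(1) by simp_all
  have IH: "fc v \<Gamma> e \<Phi> \<longleftrightarrow> realizable v \<Phi> e" "fc v \<Gamma> e \<Psi> \<longleftrightarrow> realizable v \<Psi> e" if "w \<sqsubseteq> v" for v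
    using Imp.IH(1)[OF wf(1) wle_world[OF that] envs_mono[OF e that]] Imp.IH(2)[OF wf(2) wle_world[OF that] envs_mono[OF e that]] .
  show ?case unfolding fc_Imp[OF w wf e]
  proof
    assume r: "\<forall>v. w \<sqsubseteq> v \<longrightarrow> fc v \<Gamma> e \<Phi> \<longrightarrow> fc v \<Gamma> e \<Psi>"
    show "realizable w (Imp \<Phi> \<Psi>) e" by (rule realizable_ImpI[OF w Imp.prems(1) e]) (use r IH in blast)
  next
    assume "realizable w (Imp \<Phi> \<Psi>) e"
    then obtain xs where x: "stds w (map Seq (Dx (Imp \<Phi> \<Psi>))) xs" "realizes w (Imp \<Phi> \<Psi>) e xs" by (rule realizableE)
    show "\<forall>v. w \<sqsubseteq> v \<longrightarrow> fc v \<Gamma> e \<Phi> \<longrightarrow> fc v \<Gamma> e \<Psi>"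
    proof (intro allI impI)
      fix v assume v: "w \<sqsubseteq> v" and "fc v \<Gamma> e \<Phi>"
      then have "realizable v \<Phi> e" using IH by blast
      then show "fc v \<Gamma> e \<Psi>" unfolding IH(2)[OF v]
        by (rule realizable_ImpD[OF wle_world[OF v] Imp.prems(1) envs_mono[OF e v] realizableI[OF stds_mono[OF x(1) v] realizes_mono[OF x(2) v]]])
    qed
  qed
next
  case (All \<sigma> \<Phi>)
  note w = All.prems(2) and e = All.prems(3)
  have wf: "wff (\<sigma> # \<Gamma>) \<Phi>" using All.prems(1) by simp
  have "fc v (\<sigma> # \<Gamma>) (z ## e) \<Phi> \<longleftrightarrow> realizable v \<Phi> (z ## e)" if "w \<sqsubseteq> v" "elt v \<sigma> z" for v z
    using All.IH[OF wf wle_world[OF that(1)]] envs_mono[OF e that(1)] that(2) by simp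
  then show ?case unfolding fc_All[OF w wf e] realizable_All[OF w All.prems(1) e] by blast
next
  case (Ex \<sigma> \<Phi>)
  note w = Ex.prems(2) and e = Ex.prems(3)
  have wf: "wff (\<sigma> # \<Gamma>) \<Phi>" using Ex.prems(1) by simp
  have "fc w (\<sigma> # \<Gamma>) (z ## e) \<Phi> \<longleftrightarrow> realizable w \<Phi> (z ## e)" if "elt w \<sigma> z" for z
    using Ex.IH[OF wf w] e that by simp
  then show ?case unfolding fc_Ex[OF w wf e] realizable_Ex[OF w Ex.prems(1) e] by blast
next
  case (AllSt \<sigma> \<Phi>)
  note w = AllSt.prems(2) and e = AllSt.prems(3)
  have wf: "wff (\<sigma> # \<Gamma>) \<Phi>" using AllSt.prems(1) by simp
  have "fc v (\<sigma> # \<Gamma>) (z ## e) \<Phi> \<longleftrightarrow> realizable v \<Phi> (z ## e)" if "w \<sqsubseteq> v" "std v \<sigma> z" for v z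
    using AllSt.IH[OF wf wle_world[OF that(1)]] envs_mono[OF e that(1)] std_elt[OF wle_world[OF that(1)] that(2)] by simp
  then show ?case unfolding fc_AllSt[OF w wf e] realizable_AllSt[OF w AllSt.prems(1) e] by blast
next
  case (ExSt \<sigma> \<Phi>)
  note w = ExSt.prems(2) and e = ExSt.prems(3)
  have wf: "wff (\<sigma> # \<Gamma>) \<Phi>" using ExSt.prems(1) by simp
  have "fc w (\<sigma> # \<Gamma>) (z ## e) \<Phi> \<longleftrightarrow> realizable w \<Phi> (z ## e)" if "std w \<sigma> z" for z
    using ExSt.IH[OF wf w] e std_elt[OF w that] by simp
  then show ?case unfolding fc_ExSt[OF w wf e] realizable_ExSt[OF w ExSt.prems(1) e] by blast
qed

section \<open>From the characterization back to derivations\<close>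

lemma wff_D: "wff \<Gamma> \<Phi> \<Longrightarrow> wff \<Gamma> (D \<Phi>)"
  using wff_matrix by (simp add: D_eq)

lemma fc_D:
  assumes wf: "wff \<Gamma> \<Phi>" and w: "world w" and e: "envs w \<Gamma> e"
  shows "fc w \<Gamma> e (D \<Phi>) \<longleftrightarrow> realizable w \<Phi> e"
proof -
  let ?\<Gamma> = "rev (map Seq (Dx \<Phi>)) @ \<Gamma>"
  have "fc w ?\<Gamma> (pushes xs e) (AllSts (Dy \<Phi>) (matrix \<Phi>)) \<longleftrightarrow> realizes w \<Phi> e xs" if x: "stds w (map Seq (Dx \<Phi>)) xs" for xs
  proof -
    have l: "length xs = length (Dx \<Phi>)" using list_all2_lengthD[OF x] by simp
    have "fc v (rev (Dy \<Phi>) @ ?\<Gamma>) (pushes ys (pushes xs e)) (matrix \<Phi>) \<longleftrightarrow> tr v (Dm \<Phi> e xs ys)" if "stds v (Dy \<Phi>) ys" for v ys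
      using fsub_matrix[OF l list_all2_lengthD[OF that, symmetric]] by (simp add: fc_def)
    then show ?thesis
      using fc_AllSts[OF w wff_matrix[OF wf] envs_pushes[OF stds_els[OF x w] e]] unfolding realizes_def by blast
  qed
  moreover have "wff ?\<Gamma> (AllSts (Dy \<Phi>) (matrix \<Phi>))" using wff_matrix[OF wf] by simp
  ultimately show ?thesis unfolding D_eq realizable_def using fc_ExSts[OF w _ e] by blast
qed

text \<open>Both sides are true at the same worlds, namely those at which \<open>\<Phi>\<close> is
  realizable, so completeness applies.\<close>

theorem prv_Iff_D:
  assumes "wff \<Gamma> \<Phi>" shows "prv lang_st H \<Gamma> [] (Iff \<Phi> (D \<Phi>))"
proof (rule completeness)
  show "wff \<Gamma> (Iff \<Phi> (D \<Phi>))" using assms wff_D by simp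
  fix w e assume w: "world w" and e: "envs w \<Gamma> e"
  have "fc v \<Gamma> e \<Phi> \<longleftrightarrow> fc v \<Gamma> e (D \<Phi>)" if v: "w \<sqsubseteq> v" for v
    unfolding fc_D[OF assms wle_world[OF v] envs_mono[OF e v]] by (rule fc_iff_realizable[OF assms wle_world[OF v] envs_mono[OF e v]])
  then show "fc w \<Gamma> e (Iff \<Phi> (D \<Phi>))"
    unfolding fc_And[OF w] fc_Imp[OF w assms wff_D[OF assms] e] fc_Imp[OF w wff_D[OF assms] assms e] by blast
qed

lemma prv_mono:
  assumes "\<And>\<Gamma>. L \<Gamma> \<subseteq> L' \<Gamma>" "\<And>\<Gamma>. A \<Gamma> \<subseteq> A' \<Gamma>"
  shows "prv L A \<Gamma> \<Delta> \<Phi> \<Longrightarrow> prv L' A' \<Gamma> \<Delta> \<Phi>"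
proof (induction rule: prv.induct)
  case (Ax \<Phi> \<Gamma> \<Delta>)
  then show ?case using assms(2) by (intro prv.Ax) blast
next
  case (OrE \<Gamma> \<Delta> \<Phi> \<Psi> \<Theta>)
  show ?case by (rule prv.OrE[OF OrE.IH])
next
  case (ExI \<Gamma> \<Delta> t \<Phi> \<sigma>)
  show ?case using ExI.hyps assms(1) by (intro prv.ExI[OF ExI.IH]) auto
next
  case (ExE \<Gamma> \<Delta> \<sigma> \<Phi> \<Psi>)
  show ?case using ExE.hyps assms(1) by (intro prv.ExE[OF ExE.IH]) auto
qed (use assms in \<open>auto intro: prv.intros\<close>)

lemma prv_Alls_inst:
  "prv L A \<Delta> [] (fsub e (Alls \<sigma>s \<Phi>)) \<Longrightarrow> list_all2 (wt \<Delta>) ts \<sigma>s \<Longrightarrow> prv L A \<Delta> [] (fsub (pushes ts e) \<Phi>)"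
proof (induction \<sigma>s arbitrary: ts e)
  case (Cons \<sigma> \<sigma>s)
  then obtain t ts' where t: "ts = t # ts'" "wt \<Delta> t \<sigma>" "list_all2 (wt \<Delta>) ts' \<sigma>s" by (auto simp: list_all2_Cons2)
  have "prv L A \<Delta> [] (All \<sigma> (fsub (up e) (Alls \<sigma>s \<Phi>)))" using Cons.prems(1) by simp
  from prv.AllE[OF this t(2)] have "prv L A \<Delta> [] (fsub (t ## e) (Alls \<sigma>s \<Phi>))" by (simp only: inst_0_fsub_up)
  from Cons.IH[OF this t(3)] show ?case by (simp add: t(1))
qed simp

text \<open>The closure is instantiated with the variables of \<open>\<Gamma>\<close> themselves;
  pushed in this order they form the identity substitution on \<open>\<Gamma>\<close>.\<close>

lemma prv_closure:
  assumes wf: "wff \<Gamma> \<Phi>" and p: "prv L A \<Gamma> [] (closure \<Gamma> \<Phi>)"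
  shows "prv L A \<Gamma> [] \<Phi>"
proof -
  have "list_all2 (wt \<Gamma>) (vars (length \<Gamma>)) (rev \<Gamma>)" using list_all2_vars[of "rev \<Gamma>" "[]"] by simp
  from prv_Alls_inst[OF _ this, of L A Var \<Phi>] p
  have "prv L A \<Gamma> [] (fsub (pushes (vars (length \<Gamma>)) Var) \<Phi>)" by (simp add: closure_def fsub_Var)
  also have "fsub (pushes (vars (length \<Gamma>)) Var) \<Phi> = fsub Var \<Phi>"
    by (rule fsub_cong[OF wf]) (simp add: pushes_rev vars_def rev_map)
  finally show ?thesis by (simp add: fsub_Var)
qed

text \<open>A derivation in the internal theory is also one in \<open>H\<close>, so the universal
  statement about \<open>ts\<close> is true at every world. Its quantifiers range over all elements,
  and in particular over the standard challenges.\<close>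

lemma realizes_witnesses:
  assumes wf: "wff \<Gamma> \<Phi>" and t: "list_all2 (\<lambda>t \<tau>. wt [] t (Seq \<tau>)) ts (Dx \<Phi>)"
    and p: "prv lang_int EHA \<Gamma> [] (D_witnessed \<Phi> ts)" and w: "world w" and e: "envs w \<Gamma> e"
  shows "realizes w \<Phi> e ts"
proof -
  let ?n = "length (Dy \<Phi>)" and ?\<Gamma> = "rev (Dy \<Phi>) @ \<Gamma>"
  let ?M = "Dm \<Phi> (\<lambda>i. Var (i + ?n)) ts (vars ?n)"
  have W: "D_witnessed \<Phi> ts = Alls (Dy \<Phi>) ?M" by (simp add: D_witnessed_def Let_def)
  have ts: "list_all2 (wt ?\<Gamma>) ts (map Seq (Dx \<Phi>))"
    using t by (auto simp: list_all2_conv_all_nth intro: wt_closed)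
  have "wtenv ?\<Gamma> (\<lambda>i. Var (i + ?n)) \<Gamma>" by (auto simp: wtenv_def nth_append)
  from wff_Dm[OF wf this ts list_all2_vars] have M: "wff ?\<Gamma> ?M" .
  have "prv lang_st H \<Gamma> [] (Alls (Dy \<Phi>) ?M)"
    using p unfolding W by (rule prv_mono[rotated 2]) (auto simp: lang_int_def lang_st_def intro: H.EHA_st EHA_st.base)
  from soundness[OF this _ w e] have "fc w \<Gamma> e (Alls (Dy \<Phi>) ?M)" using M by simp
  then have fc: "fc v ?\<Gamma> (pushes ys e) ?M" if "w \<sqsubseteq> v" "els v (Dy \<Phi>) ys" for v ys
    using fc_Alls[OF w M e] that by blast
  have c: "map (sub f) ts = ts" for f
  proof (rule nth_equalityI)
    fix i assume "i < length (map (sub f) ts)"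
    then have "wt [] (ts ! i) (Seq (Dx \<Phi> ! i))" using t by (simp add: list_all2_conv_all_nth)
    from sub_closed[OF this] show "map (sub f) ts ! i = ts ! i" using \<open>i < _\<close> by simp
  qed simp
  show ?thesis
  proof (rule realizesI)
    fix v ys assume v: "w \<sqsubseteq> v" and y: "stds v (Dy \<Phi>) ys"
    have l: "length ys = ?n" using list_all2_lengthD[OF y] by simp
    have "fsub (pushes ys e) ?M = Dm \<Phi> (\<lambda>i. sub (pushes ys e) (Var (i + ?n))) (map (sub (pushes ys e)) ts) (map (sub (pushes ys e)) (vars ?n))"
      using list_all2_lengthD[OF t] by (intro fsub_Dm) simp_all
    also have "(\<lambda>i. sub (pushes ys e) (Var (i + ?n))) = e" using pushes_ge[of ys e] l by (auto simp: fun_eq_iff)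
    finally show "tr v (Dm \<Phi> e ts ys)"
      using fc[OF v stds_els[OF y wle_world[OF v]]] by (simp add: fc_def c map_sub_pushes_vars l)
  qed
qed

theorem prv_of_witnesses:
  assumes wf: "wff \<Gamma> \<Phi>" and t: "list_all2 (\<lambda>t \<tau>. wt [] t (Seq \<tau>)) ts (Dx \<Phi>)"
    and p: "prv lang_int EHA \<Gamma> [] (D_witnessed \<Phi> ts)"
  shows "prv lang_st H \<Gamma> [] \<Phi>"
proof (rule completeness[OF wf])
  fix w e assume w: "world w" and e: "envs w \<Gamma> e"
  have "stds w (map Seq (Dx \<Phi>)) ts" using t by (auto simp: list_all2_conv_all_nth intro: std_closed[OF _ w])
  then show "fc w \<Gamma> e \<Phi>"
    unfolding fc_iff_realizable[OF wf w e] using realizes_witnesses[OF wf t p w e] by (rule realizableI)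
qed

theorem mainTheorem3:
  shows "(\<forall>\<Gamma> \<Phi>. wff \<Gamma> \<Phi> \<longrightarrow> prv lang_st H \<Gamma> [] (Iff \<Phi> (D \<Phi>)))
    \<and> (\<forall>\<Gamma> \<Psi>. wff \<Gamma> \<Psi> \<longrightarrow>
         (\<forall>\<Gamma>' \<Phi>. wff \<Gamma>' \<Phi> \<longrightarrow> prv lang_st (adjoin H \<Gamma> \<Psi>) \<Gamma>' [] \<Phi> \<longrightarrow>
            (\<exists>ts. list_all2 (\<lambda>t \<tau>. wt [] t (Seq \<tau>)) ts (Dx \<Phi>) \<and>
                  prv lang_int EHA \<Gamma>' [] (D_witnessed \<Phi> ts))) \<longrightarrow>
         prv lang_st H \<Gamma> [] \<Psi>)"
proof (intro conjI allI impI)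
  fix \<Gamma> \<Psi>
  assume wf: "wff \<Gamma> \<Psi>" and h: "\<forall>\<Gamma>' \<Phi>. wff \<Gamma>' \<Phi> \<longrightarrow> prv lang_st (adjoin H \<Gamma> \<Psi>) \<Gamma>' [] \<Phi> \<longrightarrow>
    (\<exists>ts. list_all2 (\<lambda>t \<tau>. wt [] t (Seq \<tau>)) ts (Dx \<Phi>) \<and> prv lang_int EHA \<Gamma>' [] (D_witnessed \<Phi> ts))"
  have "prv lang_st (adjoin H \<Gamma> \<Psi>) \<Gamma> [] \<Psi>"
    by (rule prv_closure[OF wf prv.Ax]) (simp add: adjoin_def)
  then show "prv lang_st H \<Gamma> [] \<Psi>" using h wf prv_of_witnesses by blast
qed (rule prv_Iff_D)

end
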